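(* For every integer $n\ge 4$, there exists a projective completion of $\mathrm{Per}_n(0)$ that has a smooth $\mathbb{Q}$-rational point $f_\star$.
   Context: $\mathcal{M}_2$ denotes the moduli space of quadratic (degree-$2$) rational self-maps of $\mathbb{P}^1$ up to conjugacy by automorphisms of $\mathbb{P}^1$; it is isomorphic to $\mathbb{A}^2$, over $\mathbb{C}$ and over $\mathbb{Q}$. $\mathrm{Per}_n(0)\subsetneq\mathcal{M}_2$ is the one-dimensional $\mathbb{Q}$-subvariety parametrizing conjugacy classes of maps having a critical point that is periodic of exact period $n$. A projective completion of $\mathrm{Per}_n(0)$ means a projective curve over $\mathbb{Q}$ (not assumed irreducible or smooth) containing $\mathrm{Per}_n(0)$ as a Zariski-dense open $\mathbb{Q}$-subvariety. *)

theory Defs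
  imports
    "HOL-Analysis.Analysis"
    "HOL-Library.Poly_Mapping"
    "HOL-Library.Function_Algebras"
begin

text \<open>
  Varieties over the rationals are represented by their sets of complex points: a (reduced)
  \<open>\<rat>\<close>-subvariety of projective space is a locally closed set for the topology whose closed sets are
  the zero loci of forms with rational coefficients, and morphisms over \<open>\<rat>\<close> are given locally by
  such forms.
\<close>

section \<open>Forms and projective space\<close>

type_synonym form = "(nat \<Rightarrow>\<^sub>0 nat) \<Rightarrow>\<^sub>0 complex"
type_synonym point = "(nat \<Rightarrow> complex) set"

definition form_eval :: "form \<Rightarrow> (nat \<Rightarrow> complex) \<Rightarrow> complex" where
  "form_eval p v = (\<Sum>m\<in>Poly_Mapping.keys p. Poly_Mapping.lookup p m *
     (\<Prod>i\<in>Poly_Mapping.keys m. v i ^ Poly_Mapping.lookup m i))"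

definition forms :: "complex set \<Rightarrow> nat \<Rightarrow> nat \<Rightarrow> form set" where
  \<comment> \<open>homogeneous of degree \<open>d\<close> in the variables \<open>0, \<dots>, N\<close>, with coefficients in \<open>K\<close>\<close>
  "forms K N d = {p. \<forall>m\<in>Poly_Mapping.keys p. Poly_Mapping.lookup p m \<in> K \<and>
     Poly_Mapping.keys m \<subseteq> {..N} \<and> (\<Sum>i\<in>Poly_Mapping.keys m. Poly_Mapping.lookup m i) = d}"

definition vec_space :: "nat \<Rightarrow> (nat \<Rightarrow> complex) set" where
  \<comment> \<open>\<open>N + 1\<close> coordinates, padded by zeros\<close>
  "vec_space N = {v. \<forall>i>N. v i = 0}"

definition vec_of :: "complex list \<Rightarrow> nat \<Rightarrow> complex" where
  "vec_of xs = (\<lambda>i. if i < length xs then xs ! i else 0)"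

definition proj_pt :: "(nat \<Rightarrow> complex) \<Rightarrow> point" where
  "proj_pt v = {\<lambda>i. c * v i |c. c \<noteq> 0}"

definition proj_space :: "nat \<Rightarrow> point set" where
  "proj_space N = proj_pt ` (vec_space N - {0})"

definition forms_eval :: "form list \<Rightarrow> (nat \<Rightarrow> complex) \<Rightarrow> nat \<Rightarrow> complex" where
  "forms_eval F v = vec_of (map (\<lambda>p. form_eval p v) F)"


section \<open>Zariski topology, morphisms and curves over the rationals\<close>

definition zero_locus :: "nat \<Rightarrow> form set \<Rightarrow> point set" where
  "zero_locus N S = {P \<in> proj_space N. \<forall>p\<in>S. \<forall>v\<in>P. form_eval p v = 0}"

definition zariski :: "nat \<Rightarrow> point topology" where
  "zariski N = topology (\<lambda>U. \<exists>S \<subseteq> (\<Union>d. forms \<rat> N d). U = proj_space N - zero_locus N S)"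

definition regular_map :: "nat \<Rightarrow> point set \<Rightarrow> nat \<Rightarrow> point set \<Rightarrow> (point \<Rightarrow> point) \<Rightarrow> bool" where
  "regular_map N Y M Z f \<longleftrightarrow> f \<in> Y \<rightarrow> Z \<and>
     (\<forall>P\<in>Y. \<exists>d F. length F = Suc M \<and> set F \<subseteq> forms \<rat> N d \<and>
        (\<forall>v\<in>P. forms_eval F v \<noteq> 0) \<and>
        (\<forall>Q\<in>Y. \<forall>v\<in>Q. forms_eval F v \<noteq> 0 \<longrightarrow> f Q = proj_pt (forms_eval F v)))"

definition isomorphism :: "nat \<Rightarrow> point set \<Rightarrow> nat \<Rightarrow> point set \<Rightarrow> (point \<Rightarrow> point) \<Rightarrow> bool" where
  "isomorphism N Y M Z f \<longleftrightarrow> regular_map N Y M Z f \<and>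
     (\<exists>g. regular_map M Z N Y g \<and> (\<forall>P\<in>Y. g (f P) = P) \<and> (\<forall>Q\<in>Z. f (g Q) = Q))"

definition irreducible_closed :: "'a topology \<Rightarrow> 'a set \<Rightarrow> bool" where
  "irreducible_closed T Z \<longleftrightarrow> closedin T Z \<and> Z \<noteq> {} \<and>
     (\<forall>A B. closedin T A \<longrightarrow> closedin T B \<longrightarrow> Z \<subseteq> A \<union> B \<longrightarrow> Z \<subseteq> A \<or> Z \<subseteq> B)"

definition irreducible_component :: "'a topology \<Rightarrow> 'a set \<Rightarrow> 'a set \<Rightarrow> bool" where
  "irreducible_component T X Z \<longleftrightarrow> irreducible_closed T Z \<and> Z \<subseteq> X \<and>
     (\<forall>Z'. irreducible_closed T Z' \<longrightarrow> Z \<subseteq> Z' \<longrightarrow> Z' \<subseteq> X \<longrightarrow> Z' = Z)"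

definition irreducible_chain :: "'a topology \<Rightarrow> 'a set \<Rightarrow> nat \<Rightarrow> bool" where
  "irreducible_chain T X k \<longleftrightarrow>
     (\<exists>C :: nat \<Rightarrow> 'a set. (\<forall>i\<le>k. irreducible_closed T (C i) \<and> C i \<subseteq> X) \<and> (\<forall>i<k. C i \<subset> C (Suc i)))"

definition has_krull_dim :: "'a topology \<Rightarrow> 'a set \<Rightarrow> nat \<Rightarrow> bool" where
  "has_krull_dim T X k \<longleftrightarrow> irreducible_chain T X k \<and> \<not> irreducible_chain T X (Suc k)"

definition projective_curve :: "nat \<Rightarrow> point set \<Rightarrow> bool" where
  "projective_curve N X \<longleftrightarrow> closedin (zariski N) X \<and>
     (\<forall>Z. irreducible_component (zariski N) X Z \<longrightarrow> has_krull_dim (zariski N) Z 1)"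

definition projective_completion ::
    "nat \<Rightarrow> point set \<Rightarrow> nat \<Rightarrow> point set \<Rightarrow> (point \<Rightarrow> point) \<Rightarrow> bool" where
  "projective_completion M Y N X \<iota> \<longleftrightarrow> projective_curve N X \<and>
     isomorphism M Y N (\<iota> ` Y) \<iota> \<and>
     openin (subtopology (zariski N) X) (\<iota> ` Y) \<and>
     subtopology (zariski N) X closure_of (\<iota> ` Y) = X"

definition rational_point :: "point \<Rightarrow> bool" where
  "rational_point P \<longleftrightarrow> (\<exists>v\<in>P. \<forall>i. v i \<in> \<rat>)"

definition vanishing_forms :: "nat \<Rightarrow> point set \<Rightarrow> form set" where
  "vanishing_forms N X = {p \<in> (\<Union>d. forms \<rat> N d). \<forall>P\<in>X. \<forall>v\<in>P. form_eval p v = 0}"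

definition tangent_cone_space :: "nat \<Rightarrow> point set \<Rightarrow> (nat \<Rightarrow> complex) \<Rightarrow> (nat \<Rightarrow> complex) set" where
  \<comment> \<open>the Zariski tangent space at \<open>v\<close> of the affine cone over \<open>X\<close>, i.e. the kernel of the Jacobian
    matrix of the homogeneous ideal of \<open>X\<close>\<close>
  "tangent_cone_space N X v = {w \<in> vec_space N. \<forall>p\<in>vanishing_forms N X.
     deriv (\<lambda>t. form_eval p (\<lambda>i. v i + t * w i)) 0 = 0}"

definition smooth_point :: "nat \<Rightarrow> point set \<Rightarrow> point \<Rightarrow> bool" where
  \<comment> \<open>Jacobian criterion, for \<open>X\<close> a curve: the cone over it has dimension 2, so the Jacobian matrix of
    size \<open>N + 1\<close> must have rank \<open>N - 1\<close>.\<close>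
  "smooth_point N X P \<longleftrightarrow> P \<in> X \<and>
     (\<forall>v\<in>P. vector_space.dim (\<lambda>(c::complex) w i. c * w i) (tangent_cone_space N X v) = 2)"


section \<open>Quadratic rational maps and their moduli space\<close>

definition represents :: "form list \<Rightarrow> nat \<Rightarrow> (point \<Rightarrow> point) \<Rightarrow> bool" where
  \<comment> \<open>no common zero is allowed, so \<open>\<phi>\<close> has degree exactly \<open>d\<close>\<close>
  "represents F d \<phi> \<longleftrightarrow> length F = 2 \<and> set F \<subseteq> forms UNIV 1 d \<and>
     (\<forall>v \<in> vec_space 1 - {0}. forms_eval F v \<noteq> 0 \<and> \<phi> (proj_pt v) = proj_pt (forms_eval F v))"

definition rational_maps :: "nat \<Rightarrow> (point \<Rightarrow> point) set" where
  "rational_maps d = {\<phi> \<in> extensional (proj_space 1). \<exists>F. represents F d \<phi>}"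

definition conjugacy :: "((point \<Rightarrow> point) \<times> (point \<Rightarrow> point)) set" where
  \<comment> \<open>\<open>rational_maps 1\<close> is the automorphism group of the projective line\<close>
  "conjugacy = {(\<phi>, \<psi>). \<phi> \<in> rational_maps 2 \<and> \<psi> \<in> rational_maps 2 \<and>
     (\<exists>\<mu> \<in> rational_maps 1. \<forall>P \<in> proj_space 1. \<psi> (\<mu> P) = \<mu> (\<phi> P))}"

definition M2 :: "(point \<Rightarrow> point) set set" where
  "M2 = rational_maps 2 // conjugacy"

definition chart :: "point \<Rightarrow> complex \<Rightarrow> point" where
  \<comment> \<open>inverse of the coordinate \<open>z\<close> around a finite point, and of \<open>1 / z\<close> around infinity\<close>
  "chart P z = (if P = proj_pt (vec_of [1, 0]) then proj_pt (vec_of [1, z]) else proj_pt (vec_of [z, 1]))"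

definition local_deriv :: "(point \<Rightarrow> point) \<Rightarrow> point \<Rightarrow> complex" where
  \<comment> \<open>derivative in the above coordinates; for a fixed point this is the multiplier\<close>
  "local_deriv \<phi> P = deriv (inv (chart (\<phi> P)) \<circ> \<phi> \<circ> chart P) (inv (chart P) P)"

definition critical_point :: "(point \<Rightarrow> point) \<Rightarrow> point \<Rightarrow> bool" where
  "critical_point \<phi> P \<longleftrightarrow> P \<in> proj_space 1 \<and> local_deriv \<phi> P = 0"

definition exact_period :: "('a \<Rightarrow> 'a) \<Rightarrow> nat \<Rightarrow> 'a \<Rightarrow> bool" where
  "exact_period \<phi> n P \<longleftrightarrow> n > 0 \<and> (\<phi> ^^ n) P = P \<and> (\<forall>k. 0 < k \<and> k < n \<longrightarrow> (\<phi> ^^ k) P \<noteq> P)"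

definition Per0 :: "nat \<Rightarrow> (point \<Rightarrow> point) set set" where
  "Per0 n = {C \<in> M2. \<exists>\<phi>\<in>C. \<exists>P. critical_point \<phi> P \<and> exact_period \<phi> n P}"

definition fixed_points :: "(point \<Rightarrow> point) \<Rightarrow> point \<Rightarrow> point \<Rightarrow> point \<Rightarrow> bool" where
  \<comment> \<open>\<open>P, Q, R\<close> are the fixed points of the quadratic map \<open>\<phi>\<close>, listed with multiplicity: the cubic
    form \<open>X \<cdot> G - Y \<cdot> F\<close>, where \<open>\<phi> = [F : G]\<close>, is the product of the corresponding linear forms\<close>
  "fixed_points \<phi> P Q R \<longleftrightarrow> (\<exists>F. \<exists>p\<in>P. \<exists>q\<in>Q. \<exists>r\<in>R. represents F 2 \<phi> \<and>
     P \<in> proj_space 1 \<and> Q \<in> proj_space 1 \<and> R \<in> proj_space 1 \<and>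
     (\<forall>x y. x * forms_eval F (vec_of [x, y]) 1 - y * forms_eval F (vec_of [x, y]) 0 =
        (x * p 1 - y * p 0) * (x * q 1 - y * q 0) * (x * r 1 - y * r 0)))"

text \<open>
  The isomorphism from \<open>M2\<close> to the affine plane (Milnor over \<open>\<complex>\<close>, Silverman over \<open>\<int>\<close> and hence over
  \<open>\<rat>\<close>) is given by the first two elementary symmetric functions of the multipliers at the three
  fixed points. It is through these coordinates that \<open>M2\<close> is a variety over \<open>\<rat>\<close>. The affine
  plane is regarded as the standard open subset of the projective plane.
\<close>

definition M2_coords :: "(point \<Rightarrow> point) set \<Rightarrow> point \<Rightarrow> bool" where
  "M2_coords C s \<longleftrightarrow> (\<exists>\<phi>\<in>C. \<exists>P Q R. fixed_points \<phi> P Q R \<and>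
     (let a = local_deriv \<phi> P; b = local_deriv \<phi> Q; c = local_deriv \<phi> R
      in s = proj_pt (vec_of [1, a + b + c, a * b + b * c + c * a])))"

definition Per0_variety :: "nat \<Rightarrow> point set" where
  "Per0_variety n = {s. \<exists>C \<in> Per0 n. M2_coords C s}"


section \<open>The Zariski topology is a topology\<close>

definition monom_eval :: "(nat \<Rightarrow>\<^sub>0 nat) \<Rightarrow> (nat \<Rightarrow> complex) \<Rightarrow> complex" where
  "monom_eval m v = (\<Prod>i\<in>Poly_Mapping.keys m. v i ^ Poly_Mapping.lookup m i)"

lemma monom_eval_superset:
  assumes "finite A" "Poly_Mapping.keys m \<subseteq> A"
  shows "monom_eval m v = (\<Prod>i\<in>A. v i ^ Poly_Mapping.lookup m i)"
  unfolding monom_eval_def using assms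
  by (intro prod.mono_neutral_left) (auto simp: in_keys_iff)

lemma monom_eval_add: "monom_eval (m + m') v = monom_eval m v * monom_eval m' v"
proof -
  let ?A = "Poly_Mapping.keys m \<union> Poly_Mapping.keys m'"
  have "monom_eval (m + m') v = (\<Prod>i\<in>?A. v i ^ Poly_Mapping.lookup (m + m') i)"
    by (rule monom_eval_superset) (auto dest: set_mp[OF Poly_Mapping.keys_add])
  also have "\<dots> = monom_eval m v * monom_eval m' v"
    by (simp add: monom_eval_superset[of ?A] lookup_add power_add prod.distrib)
  finally show ?thesis .
qed

lemma form_eval_superset:
  assumes "finite A" "Poly_Mapping.keys p \<subseteq> A"
  shows "form_eval p v = (\<Sum>m\<in>A. Poly_Mapping.lookup p m * monom_eval m v)"
  unfolding form_eval_def monom_eval_def[symmetric] using assms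
  by (intro sum.mono_neutral_left) (auto simp: in_keys_iff)

lemma form_eval_add: "form_eval (p + q) v = form_eval p v + form_eval q v"
proof -
  let ?A = "Poly_Mapping.keys p \<union> Poly_Mapping.keys q"
  have "form_eval (p + q) v = (\<Sum>m\<in>?A. Poly_Mapping.lookup (p + q) m * monom_eval m v)"
    by (rule form_eval_superset) (auto dest: set_mp[OF Poly_Mapping.keys_add])
  also have "\<dots> = form_eval p v + form_eval q v"
    by (simp add: form_eval_superset[of ?A] lookup_add ring_distribs sum.distrib)
  finally show ?thesis .
qed

lemma form_eval_zero [simp]: "form_eval 0 v = 0"
  by (simp add: form_eval_def)

lemma form_eval_sum: "form_eval (sum f A) v = (\<Sum>a\<in>A. form_eval (f a) v)"
  by (induction A rule: infinite_finite_induct) (auto simp: form_eval_add)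

lemma form_eval_single: "form_eval (Poly_Mapping.single m c) v = c * monom_eval m v"
  by (subst form_eval_superset[of "{m}"]) auto

lemma form_expand:
  "(p :: form) = (\<Sum>m\<in>Poly_Mapping.keys p. Poly_Mapping.single m (Poly_Mapping.lookup p m))"
  by (rule poly_mapping_eqI) (auto simp: lookup_sum lookup_single when_def in_keys_iff)

lemma mult_expand:
  "(p :: form) * q = (\<Sum>m\<in>Poly_Mapping.keys p. \<Sum>m'\<in>Poly_Mapping.keys q.
     Poly_Mapping.single (m + m') (Poly_Mapping.lookup p m * Poly_Mapping.lookup q m'))"
  by (subst form_expand[of p], subst form_expand[of q]) (simp add: sum_product mult_single)

lemma form_eval_mult: "form_eval (p * q) v = form_eval p v * form_eval q v"
  unfolding mult_expand form_eval_sum form_eval_single monom_eval_add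
  by (simp add: form_eval_superset[OF finite_keys order_refl] sum_product mult_ac)

lemma sum_lookup_add:
  fixes m m' :: "nat \<Rightarrow>\<^sub>0 nat"
  shows "(\<Sum>i\<in>Poly_Mapping.keys (m + m'). Poly_Mapping.lookup (m + m') i) =
    (\<Sum>i\<in>Poly_Mapping.keys m. Poly_Mapping.lookup m i) +
    (\<Sum>i\<in>Poly_Mapping.keys m'. Poly_Mapping.lookup m' i)"
  by (rule setsum_keys_plus_distrib) auto

lemma forms_mult:
  assumes "p \<in> forms \<rat> N d" "q \<in> forms \<rat> N e"
  shows "p * q \<in> forms \<rat> N (d + e)"
proof -
  have "Poly_Mapping.lookup (p * q) k \<in> \<rat>" for k
    unfolding mult_expand lookup_sum using assms
    by (intro Rats_sum) (auto simp: lookup_single when_def forms_def)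
  moreover have "Poly_Mapping.keys k \<subseteq> {..N} \<and>
      (\<Sum>i\<in>Poly_Mapping.keys k. Poly_Mapping.lookup k i) = d + e"
    if k: "k \<in> Poly_Mapping.keys (p * q)" for k
  proof -
    obtain m m' where *: "m \<in> Poly_Mapping.keys p" "m' \<in> Poly_Mapping.keys q" "k = m + m'"
      using keys_mult[of p q] k by auto
    then have "Poly_Mapping.keys m \<subseteq> {..N}" "Poly_Mapping.keys m' \<subseteq> {..N}"
      "(\<Sum>i\<in>Poly_Mapping.keys m. Poly_Mapping.lookup m i) = d"
      "(\<Sum>i\<in>Poly_Mapping.keys m'. Poly_Mapping.lookup m' i) = e"
      using assms unfolding forms_def by blast+
    then show ?thesis
      using Poly_Mapping.keys_add[of m m'] unfolding * sum_lookup_add by blast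
  qed
  ultimately show ?thesis
    by (auto simp: forms_def)
qed

lemma form_eval_scale:
  assumes "p \<in> forms K N d"
  shows "form_eval p (\<lambda>i. c * v i) = c ^ d * form_eval p v"
  using assms unfolding form_eval_def sum_distrib_left forms_def
  by (intro sum.cong refl) (auto simp: power_mult_distrib prod.distrib power_sum[symmetric])

lemma zero_on_point_iff:
  assumes "p \<in> forms K N d" "P \<in> proj_space N" "w \<in> P"
  shows "(\<forall>v\<in>P. form_eval p v = 0) \<longleftrightarrow> form_eval p w = 0"
  using assms by (auto simp: proj_space_def proj_pt_def form_eval_scale)

lemma zero_locus_Un:
  assumes S: "S \<subseteq> (\<Union>d. forms \<rat> N d)" and T: "T \<subseteq> (\<Union>d. forms \<rat> N d)"
  shows "zero_locus N S \<union> zero_locus N T = zero_locus N {p * q |p q. p \<in> S \<and> q \<in> T}"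
proof (intro equalityI subsetI)
  fix P assume P: "P \<in> zero_locus N {p * q |p q. p \<in> S \<and> q \<in> T}"
  then have PN: "P \<in> proj_space N"
    by (simp add: zero_locus_def)
  then obtain w where w: "w \<in> P"
    by (force simp: proj_space_def proj_pt_def)
  have *: "P \<in> zero_locus N R \<longleftrightarrow> (\<forall>p\<in>R. form_eval p w = 0)" if "R \<subseteq> (\<Union>d. forms \<rat> N d)" for R
  proof -
    have "(\<forall>v\<in>P. form_eval p v = 0) \<longleftrightarrow> form_eval p w = 0" if "p \<in> R" for p
      using \<open>R \<subseteq> _\<close> that zero_on_point_iff[OF _ PN w] by blast
    then show ?thesis
      using PN by (simp add: zero_locus_def)
  qed
  have "form_eval p w = 0 \<or> form_eval q w = 0" if "p \<in> S" "q \<in> T" for p q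
  proof -
    have "form_eval (p * q) w = 0"
      using P w that unfolding zero_locus_def by blast
    then show ?thesis
      by (simp add: form_eval_mult)
  qed
  then show "P \<in> zero_locus N S \<union> zero_locus N T"
    unfolding Un_iff *[OF S] *[OF T] by blast
qed (auto simp: zero_locus_def form_eval_mult)

lemma istopology_zariski:
  "istopology (\<lambda>U. \<exists>S \<subseteq> (\<Union>d. forms \<rat> N d). U = proj_space N - zero_locus N S)"
  unfolding istopology_def
proof (intro conjI allI impI)
  fix U V
  assume "\<exists>S \<subseteq> (\<Union>d. forms \<rat> N d). U = proj_space N - zero_locus N S"
    and "\<exists>S \<subseteq> (\<Union>d. forms \<rat> N d). V = proj_space N - zero_locus N S"
  then obtain S T where S: "S \<subseteq> (\<Union>d. forms \<rat> N d)" "U = proj_space N - zero_locus N S"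
    and T: "T \<subseteq> (\<Union>d. forms \<rat> N d)" "V = proj_space N - zero_locus N T"
    by blast
  have "{p * q |p q. p \<in> S \<and> q \<in> T} \<subseteq> (\<Union>d. forms \<rat> N d)"
  proof clarify
    fix p q assume "p \<in> S" "q \<in> T"
    then obtain d e where "p \<in> forms \<rat> N d" "q \<in> forms \<rat> N e"
      using S(1) T(1) by blast
    then show "p * q \<in> (\<Union>d. forms \<rat> N d)"
      using forms_mult by blast
  qed
  moreover have "U \<inter> V = proj_space N - zero_locus N {p * q |p q. p \<in> S \<and> q \<in> T}"
    unfolding zero_locus_Un[OF S(1) T(1), symmetric] S(2) T(2) by blast
  ultimately show "\<exists>S \<subseteq> (\<Union>d. forms \<rat> N d). U \<inter> V = proj_space N - zero_locus N S"
    by blast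
next
  fix \<U>
  assume "\<forall>U\<in>\<U>. \<exists>S \<subseteq> (\<Union>d. forms \<rat> N d). U = proj_space N - zero_locus N S"
  then have "\<exists>S. \<forall>U\<in>\<U>. S U \<subseteq> (\<Union>d. forms \<rat> N d) \<and> U = proj_space N - zero_locus N (S U)"
    by (rule bchoice)
  then obtain S where S: "\<And>U. U \<in> \<U> \<Longrightarrow> S U \<subseteq> (\<Union>d. forms \<rat> N d)"
    "\<And>U. U \<in> \<U> \<Longrightarrow> proj_space N - zero_locus N (S U) = U"
    by blast
  have "\<Union>\<U> = (\<Union>U\<in>\<U>. proj_space N - zero_locus N (S U))"
    using S(2) by simp
  also have "\<dots> = proj_space N - zero_locus N (\<Union>U\<in>\<U>. S U)"
    by (auto simp: zero_locus_def)
  finally show "\<exists>S \<subseteq> (\<Union>d. forms \<rat> N d). \<Union>\<U> = proj_space N - zero_locus N S"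
    using S(1) by (intro exI[of _ "\<Union>U\<in>\<U>. S U"] conjI UN_least)
qed

lemma openin_zariski:
  "openin (zariski N) U \<longleftrightarrow> (\<exists>S \<subseteq> (\<Union>d. forms \<rat> N d). U = proj_space N - zero_locus N S)"
  unfolding zariski_def using istopology_zariski by (simp add: topology_inverse')

lemma topspace_zariski: "topspace (zariski N) = proj_space N"
proof -
  have "0 \<in> forms \<rat> N 0" "1 \<in> forms \<rat> N 0"
    by (auto simp: forms_def)
  moreover have "form_eval 1 v = 1" for v
    by (simp add: form_eval_def)
  then have "zero_locus N {1} = {}"
    by (auto simp: zero_locus_def proj_space_def proj_pt_def intro!: exI[of _ 1])
  ultimately have "openin (zariski N) (proj_space N)"
    unfolding openin_zariski by (intro exI[of _ "{1}"]) auto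
  moreover have "topspace (zariski N) \<subseteq> proj_space N"
    using openin_topspace[of "zariski N"] unfolding openin_zariski by blast
  ultimately show ?thesis
    using openin_subset by blast
qed

lemma closedin_zariski:
  "closedin (zariski N) X \<longleftrightarrow> (\<exists>S \<subseteq> (\<Union>d. forms \<rat> N d). X = zero_locus N S)"
proof -
  have "zero_locus N S \<subseteq> proj_space N" for S
    by (auto simp: zero_locus_def)
  then show ?thesis
    unfolding closedin_def topspace_zariski openin_zariski by (metis double_diff order_refl)
qed

lemma vector_space_fun: "vector_space (\<lambda>(c::complex) (w::nat \<Rightarrow> complex) i. c * w i)"
  by unfold_locales (auto simp: fun_eq_iff algebra_simps)

end

theory Submission
  imports Defs "HOL-Complex_Analysis.Complex_Analysis" "HOL-Computational_Algebra.Computational_Algebra"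
    "HOL-Computational_Algebra.Field_as_Ring"
begin

text \<open>
  A quadratic map with a periodic critical point and a marked non-critical fixed point is conjugate to
  \<open>w \<mapsto> t w + B + t / w\<close>, with the periodic critical point at \<open>1\<close>, the other one at \<open>- 1\<close> and the marked fixed
  point at infinity, of multiplier \<open>1 / t\<close>. The curve has a branch \<open>B = - 2 t + t ^ (n - 1) e\<close>, \<open>t \<rightarrow> 0\<close>, on which \<open>1\<close>
  is sent to a neighbourhood of the pole \<open>0\<close>, then close to the repelling fixed point at infinity, and comes
  back along \<open>1 / w\<close> multiplied by \<open>t\<close> at each step; this determines the limit of \<open>e\<close>.

  Let \<open>x, y\<close> be the coordinates of the plane of moduli, normalised such that \<open>x\<close> grows like \<open>1 / t\<close> on the branch,
  and let \<open>h = x ^ (n - 3) (x y + 4)\<close>. The closure of the image of the curve under \<open>[1 : x : y : h : x h]\<close> is a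
  completion, and on the branch this tends to the rational point \<open>[0 : 1 : 0 : 0 : 4]\<close>. The exchange of the two
  critical points is \<open>B \<mapsto> - B\<close>. The product of the equations of periodicity of \<open>1\<close> and of \<open>- 1\<close> is therefore a
  polynomial in \<open>x, y\<close> with rational coefficients, and in the coordinates \<open>1 / x\<close>, \<open>h\<close> it restricts to a multiple of
  \<open>4 - h\<close> on the line at infinity. The zero at \<open>h = 4\<close> being simple, the point is smooth.
\<close>

section \<open>Polynomial functions on the plane with rational coefficients\<close>

text \<open>The passage from (t, B) to (x, y) forgets which fixed point sits at infinity, so
  invariance under B -> - B alone does not make a polynomial in t, B a polynomial in x, y. The
  coordinate z = (w - 1) / (w + 1) removes this obstacle: it puts the critical points at 0 and
  infinity and the map in the form z -> (alpha z^2 + beta) / (gamma z^2 + delta), which refers to no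
  fixed point and is unique up to a common factor and the scaling of z. Polynomials in these four
  coefficients that are bihomogeneous for this two-dimensional torus, of balanced weight, and
  symmetrised under the exchange of the critical points are a power of the determinant 8 t times a
  polynomial in x, y. Exact period is cut out by dividing the equation of period n by those of its
  proper divisors; since the cycle contains a critical point, such a quotient never vanishes
  together with its divisor. Finally, being locally given by one equation in (t, B), the curve has
  no isolated points, which is what makes every component one-dimensional.\<close>

definition eval_hom :: "('a::comm_ring_1 \<Rightarrow> complex) \<Rightarrow> 'a poly \<Rightarrow> complex \<Rightarrow> complex" where
  "eval_hom f p x = poly (map_poly f p) x"

definition is_hom :: "('a::comm_ring_1 \<Rightarrow> complex) \<Rightarrow> bool" where
  "is_hom f \<longleftrightarrow> f 0 = 0 \<and> f 1 = 1 \<and> (\<forall>a b. f (a + b) = f a + f b) \<and> (\<forall>a b. f (a * b) = f a * f b)"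

lemma eval_hom_pCons:
  assumes "is_hom f" shows "eval_hom f (pCons a p) x = f a + x * eval_hom f p x"
  using assms by (simp add: eval_hom_def is_hom_def map_poly_pCons)

lemma eval_hom_0: "eval_hom f 0 x = 0"
  by (simp add: eval_hom_def)

lemma eval_hom_add:
  assumes "is_hom f" shows "eval_hom f (p + q) x = eval_hom f p x + eval_hom f q x"
proof (induction p q rule: poly_induct2)
  case (pCons a p b q)
  then show ?case using assms by (simp add: eval_hom_pCons) (simp add: is_hom_def algebra_simps)
qed (simp add: eval_hom_0)

lemma eval_hom_smult:
  assumes "is_hom f" shows "eval_hom f (smult c p) x = f c * eval_hom f p x"
proof (induction p)
  case (pCons a p)
  then show ?case using assms by (simp add: eval_hom_pCons) (simp add: is_hom_def algebra_simps)
qed (simp add: eval_hom_0)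

lemma eval_hom_mult:
  assumes "is_hom f" shows "eval_hom f (p * q) x = eval_hom f p x * eval_hom f q x"
proof (induction p)
  case (pCons a p)
  then show ?case using assms
    by (simp add: eval_hom_pCons eval_hom_add eval_hom_smult mult_pCons_left)
      (simp add: is_hom_def algebra_simps)
qed (simp add: eval_hom_0)

lemma is_hom_eval_hom: "is_hom f \<Longrightarrow> is_hom (\<lambda>p. eval_hom f p x)"
  unfolding is_hom_def[of "\<lambda>p. eval_hom f p x"]
  using eval_hom_pCons[of f 1 0 x]
  by (simp add: eval_hom_0 eval_hom_add eval_hom_mult) (simp add: is_hom_def one_pCons eval_hom_def)

lemma is_hom_of_rat: "is_hom (of_rat :: rat \<Rightarrow> complex)"
  by (simp add: is_hom_def of_rat_add of_rat_mult)

lemma eval_hom_eq_sum: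
  assumes "is_hom f" "degree p \<le> D"
  shows "eval_hom f p x = (\<Sum>i\<le>D. f (coeff p i) * x ^ i)"
proof -
  have "f 0 = 0" using assms by (simp add: is_hom_def)
  then have "poly (map_poly f p) x = (\<Sum>i\<le>D. coeff (map_poly f p) i * x ^ i)"
  proof -
    have "degree (map_poly f p) \<le> D"
      using assms(2) \<open>f 0 = 0\<close> by (intro degree_le) (auto simp: coeff_map_poly coeff_eq_0)
    then show ?thesis
      unfolding poly_altdef by (intro sum.mono_neutral_left) (auto simp: coeff_eq_0)
  qed
  then show ?thesis using \<open>f 0 = 0\<close> by (simp add: eval_hom_def coeff_map_poly)
qed

definition rpoly :: "rat poly \<Rightarrow> complex \<Rightarrow> complex" where
  "rpoly = eval_hom of_rat"

text \<open>The outer variable is y, the inner one x. Both levels are instances of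
  \<open>eval_hom\<close>, once over \<open>of_rat\<close> and once over evaluation at x, which is
  why its base ring is arbitrary.\<close>

definition rpoly2 :: "rat poly poly \<Rightarrow> complex \<Rightarrow> complex \<Rightarrow> complex" where
  "rpoly2 P x y = eval_hom (\<lambda>p. rpoly p x) P y"

lemma is_hom_rpoly: "is_hom (\<lambda>p. rpoly p x)"
  unfolding rpoly_def by (intro is_hom_eval_hom is_hom_of_rat)

lemma is_hom_rpoly2: "is_hom (\<lambda>P. rpoly2 P x y)"
  unfolding rpoly2_def by (intro is_hom_eval_hom is_hom_rpoly)

lemma rpoly_simps [simp]:
  "rpoly 0 x = 0" "rpoly 1 x = 1" "rpoly (p + q) x = rpoly p x + rpoly q x"
  "rpoly (p * q) x = rpoly p x * rpoly q x"
  "rpoly (pCons a p) x = of_rat a + x * rpoly p x"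
  using is_hom_rpoly[of x] eval_hom_pCons[OF is_hom_of_rat] by (auto simp: is_hom_def rpoly_def)

lemma rpoly2_simps [simp]:
  "rpoly2 0 x y = 0" "rpoly2 1 x y = 1" "rpoly2 (P + Q) x y = rpoly2 P x y + rpoly2 Q x y"
  "rpoly2 (P * Q) x y = rpoly2 P x y * rpoly2 Q x y"
  "rpoly2 (pCons p P) x y = rpoly p x + y * rpoly2 P x y"
  using is_hom_rpoly2[of x y] eval_hom_pCons[OF is_hom_rpoly] by (auto simp: is_hom_def rpoly2_def)

lemma rpoly2_power [simp]: "rpoly2 (P ^ k) x y = rpoly2 P x y ^ k"
  by (induction k) auto

lemma rpoly2_dvd_zero: "P dvd Q \<Longrightarrow> rpoly2 P x y = 0 \<Longrightarrow> rpoly2 Q x y = 0"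
  by (auto elim!: dvdE)

lemma rpoly2_eq_poly: "rpoly2 P x y = poly (map_poly (\<lambda>p. rpoly p x) P) y"
  by (simp add: rpoly2_def eval_hom_def)

lemma rpoly2_eq_sum:
  assumes "degree P \<le> D" "\<And>j. degree (coeff P j) \<le> E"
  shows "rpoly2 P x y = (\<Sum>j\<le>D. \<Sum>i\<le>E. of_rat (coeff (coeff P j) i) * x ^ i * y ^ j)"
  unfolding rpoly2_def eval_hom_eq_sum[OF is_hom_rpoly assms(1)]
  unfolding rpoly_def eval_hom_eq_sum[OF is_hom_of_rat assms(2)]
  by (simp add: sum_distrib_right)

text \<open>Polynomiality is treated as a property of functions, so that closure rules replace
  computations with nested coefficient lists.\<close>

definition rat_polyfun2 :: "(complex \<Rightarrow> complex \<Rightarrow> complex) \<Rightarrow> bool" where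
  "rat_polyfun2 f \<longleftrightarrow> (\<exists>P. \<forall>x y. f x y = rpoly2 P x y)"

named_theorems polyfun_intros

lemma rat_polyfun2_const [polyfun_intros]: "c \<in> \<rat> \<Longrightarrow> rat_polyfun2 (\<lambda>x y. c)"
proof -
  assume "c \<in> \<rat>"
  then obtain r where "c = of_rat r" by (auto elim: Rats_cases)
  then show ?thesis unfolding rat_polyfun2_def by (intro exI[of _ "[:[:r:]:]"]) simp
qed

lemma rat_polyfun2_fst [polyfun_intros]: "rat_polyfun2 (\<lambda>x y. x)"
  unfolding rat_polyfun2_def by (intro exI[of _ "[:[:0, 1:]:]"]) simp

lemma rat_polyfun2_snd [polyfun_intros]: "rat_polyfun2 (\<lambda>x y. y)"
  unfolding rat_polyfun2_def by (intro exI[of _ "[:0, 1:]"]) simp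

lemma rat_polyfun2_add [polyfun_intros]:
  "rat_polyfun2 f \<Longrightarrow> rat_polyfun2 g \<Longrightarrow> rat_polyfun2 (\<lambda>x y. f x y + g x y)"
  unfolding rat_polyfun2_def by (metis rpoly2_simps(3))

lemma rat_polyfun2_mult [polyfun_intros]:
  "rat_polyfun2 f \<Longrightarrow> rat_polyfun2 g \<Longrightarrow> rat_polyfun2 (\<lambda>x y. f x y * g x y)"
  unfolding rat_polyfun2_def by (metis rpoly2_simps(4))

lemma rat_polyfun2_diff [polyfun_intros]:
  assumes "rat_polyfun2 f" "rat_polyfun2 g" shows "rat_polyfun2 (\<lambda>x y. f x y - g x y)"
  using rat_polyfun2_add[OF assms(1) rat_polyfun2_mult[OF rat_polyfun2_const[of "-1"] assms(2)]] by simp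

lemma rat_polyfun2_power [polyfun_intros]: "rat_polyfun2 f \<Longrightarrow> rat_polyfun2 (\<lambda>x y. f x y ^ k)"
  by (induction k) (auto intro!: polyfun_intros)

lemma rat_polyfun2_sum [polyfun_intros]:
  "(\<And>i. i \<in> A \<Longrightarrow> rat_polyfun2 (f i)) \<Longrightarrow> rat_polyfun2 (\<lambda>x y. \<Sum>i\<in>A. f i x y)"
  by (induction A rule: infinite_finite_induct) (auto intro!: polyfun_intros)

lemma rat_polyfun2_prod [polyfun_intros]:
  "(\<And>i. i \<in> A \<Longrightarrow> rat_polyfun2 (f i)) \<Longrightarrow> rat_polyfun2 (\<lambda>x y. \<Prod>i\<in>A. f i x y)"
  by (induction A rule: infinite_finite_induct) (auto intro!: polyfun_intros)

section \<open>Common zeros of two rational plane curves\<close>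

lemma finite_rpoly_roots: "p \<noteq> 0 \<Longrightarrow> finite {x. rpoly p x = 0}"
  unfolding rpoly_def eval_hom_def by (intro poly_roots_finite) (simp add: map_poly_eq_0_iff)

lemma finite_rpoly2_roots:
  "rpoly (coeff P i) x \<noteq> 0 \<Longrightarrow> finite {y. rpoly2 P x y = 0}"
  unfolding rpoly2_eq_poly
  by (intro poly_roots_finite) (auto simp: poly_eq_iff coeff_map_poly intro!: exI[of _ i])

lemma rpoly_root_gcd:
  assumes "rpoly p x = 0" "rpoly q x = 0" shows "rpoly (gcd p q) x = 0"
proof -
  obtain u v where "u * p + v * q = gcd p q"
    using bezout_coefficients_fst_snd[of p q] by blast
  then show ?thesis using assms by (metis add_0 mult_zero_right rpoly_simps(3,4))
qed

lemma rpoly_root_content: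
  assumes "\<And>i. rpoly (coeff P i) x = 0" shows "rpoly (content P) x = 0"
  using assms
proof (induction P)
  case (pCons a P)
  have "content (pCons a P) = gcd a (content P)"
    using pCons.hyps by (simp add: content_def cCons_def)
  moreover have "rpoly a x = 0" using pCons.prems[of 0] by simp
  moreover have "rpoly (content P) x = 0"
    using pCons.IH pCons.prems[of "Suc _"] by (metis coeff_pCons_Suc)
  ultimately show ?case by (metis rpoly_root_gcd)
qed simp

lemma prime_factor_of_pos_degree:
  fixes M :: "rat poly poly"
  assumes "degree M > 0"
  obtains p where "prime_elem p" "degree p > 0" "p dvd M"
proof -
  let ?N = "primitive_part M"
  have M0: "M \<noteq> 0" using assms by auto
  have deg: "degree ?N > 0" using assms by simp
  have "\<not> is_unit ?N"
  proof
    assume "is_unit ?N"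
    then obtain c where "?N = [:c:]" unfolding is_unit_poly_iff by blast
    then have "degree ?N = 0" by (metis degree_pCons_0)
    then show False using deg by linarith
  qed
  moreover have "?N \<noteq> 0" using M0 by simp
  ultimately obtain p where p: "p dvd ?N" "prime p" using prime_divisor_exists by blast
  have "degree p > 0"
  proof (rule ccontr)
    assume "\<not> degree p > 0"
    then obtain c where c: "p = [:c:]" by (meson degree_eq_zeroE gr0I)
    with p have "c dvd content ?N" by (simp add: const_poly_dvd_iff_dvd_content)
    then have "is_unit p" using M0 c by (simp add: is_unit_const_poly_iff)
    then show False using p(2) by (meson not_prime_unit)
  qed
  moreover have "p dvd M" using p(1) by (metis content_times_primitive_part dvd_smult)
  ultimately show ?thesis using that p by auto
qed

text \<open>Elimination of y: an element M of least y-degree in the ideal of A and B divides every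
  element of the ideal up to a nonzero factor in Q[x]. A prime factor of M that involves y would
  then divide both A and B, so M lies in Q[x].\<close>

lemma bezout_irreducible:
  fixes A B :: "rat poly poly"
  assumes irr: "irreducible A" and nd: "\<not> A dvd B"
  obtains U V d where "d \<noteq> 0" "U * A + V * B = [:d:]"
proof -
  define I where "I = (\<lambda>M. M \<noteq> 0 \<and> (\<exists>U V. M = U * A + V * B))"
  have "A = 1 * A + 0 * B" "A \<noteq> 0" using irr by auto
  then have "I A" unfolding I_def by blast
  then obtain M where M: "I M" and min: "\<And>N. I N \<Longrightarrow> degree M \<le> degree N"
    using ex_has_least_nat[of I A degree] by blast
  then obtain U V where UV: "M = U * A + V * B" and M0: "M \<noteq> 0" by (auto simp: I_def)
  \<comment> \<open>Pseudo-division by M: the remainder is again in the ideal and of smaller degree,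
    hence zero.\<close>
  have red: "\<exists>a. a \<noteq> 0 \<and> M dvd smult a C" if C: "C = u * A + v * B" for C u v
  proof -
    obtain a q where a: "a \<noteq> 0" and q: "smult a C = M * q + pseudo_mod C M"
      using pseudo_mod(1)[OF M0] by blast
    have "pseudo_mod C M = smult a C - M * q" using q by simp
    also have "\<dots> = (smult a u - U * q) * A + (smult a v - V * q) * B"
      unfolding C UV by (simp add: algebra_simps smult_add_right)
    finally have "pseudo_mod C M = 0"
      using pseudo_mod(2)[OF M0, of C] min[of "pseudo_mod C M"] unfolding I_def by fastforce
    then show ?thesis using a q by auto
  qed
  have "degree M = 0"
  proof (rule ccontr)
    assume "degree M \<noteq> 0"
    then obtain p where p: "prime_elem p" "degree p > 0" "p dvd M"
      using prime_factor_of_pos_degree by blast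
    have key: "p dvd C" if C: "C = u * A + v * B" for C u v
    proof -
      obtain a where a: "a \<noteq> 0" "M dvd smult a C" using red[OF C] by blast
      then have "p dvd [:a:] * C" using p(3) dvd_trans by auto
      moreover have "\<not> p dvd [:a:]"
      proof
        assume "p dvd [:a:]"
        then have "degree p \<le> degree [:a:]" using a(1) by (intro dvd_imp_degree_le) auto
        then show False using p(2) by simp
      qed
      ultimately show ?thesis using p(1) prime_elem_dvd_multD by blast
    qed
    have "p dvd A" by (rule key[of A 1 0]) simp
    moreover have "p dvd B" by (rule key[of B 0 1]) simp
    moreover from \<open>p dvd A\<close> have "A dvd p"
      using irr p(1) by (metis dvd_refl irreducible_altdef prime_elem_not_unit)
    ultimately show False using nd dvd_trans by blast
  qed
  then obtain d where "M = [:d:]" by (meson degree_eq_zeroE)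
  then show ?thesis using that[of d U V] UV M0 by auto
qed

text \<open>The eliminant d leaves finitely many x. Over each x the fibre is finite unless both
  polynomials vanish identically in y; then x would be a root of the gcd of the contents, which is a
  unit.\<close>

lemma finite_common_zeros:
  assumes irr: "irreducible A" and nd: "\<not> A dvd B"
  shows "finite {(x, y). rpoly2 A x y = 0 \<and> rpoly2 B x y = 0}"
proof -
  obtain U V d where d: "d \<noteq> 0" "U * A + V * B = [:d:]"
    using bezout_irreducible[OF assms] .
  define F where "F = {x. rpoly d x = 0}"
  have "finite F" unfolding F_def using d(1) by (rule finite_rpoly_roots)
  moreover have "finite {y. rpoly2 A x y = 0 \<and> rpoly2 B x y = 0}" for x
  proof -
    let ?c = "gcd (content A) (content B)"
    have "[:?c:] dvd A" "[:?c:] dvd B" by (auto simp: const_poly_dvd_iff_dvd_content)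
    \<comment> \<open>A divisor of the irreducible A is a unit or an associate of A; the latter is
      impossible here because \<open>[:?c:]\<close> also divides B.\<close>
    then have "is_unit [:?c:]" using irr nd by (meson dvd_trans irreducible_altdef)
    then obtain e where e: "?c * e = 1" by (auto simp: is_unit_const_poly_iff elim!: dvdE)
    have "rpoly ?c x \<noteq> 0"
    proof
      assume "rpoly ?c x = 0"
      then have "rpoly (?c * e) x = 0" by (simp only: rpoly_simps) simp
      then show False unfolding e by simp
    qed
    then have "(\<exists>i. rpoly (coeff A i) x \<noteq> 0) \<or> (\<exists>i. rpoly (coeff B i) x \<noteq> 0)"
      using rpoly_root_gcd rpoly_root_content by blast
    then show ?thesis
    proof (elim disjE exE)
      fix i assume "rpoly (coeff A i) x \<noteq> 0"
      from finite_rpoly2_roots[OF this] show ?thesis by (rule finite_subset[rotated]) auto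
    next
      fix i assume "rpoly (coeff B i) x \<noteq> 0"
      from finite_rpoly2_roots[OF this] show ?thesis by (rule finite_subset[rotated]) auto
    qed
  qed
  ultimately have "finite (SIGMA x:F. {y. rpoly2 A x y = 0 \<and> rpoly2 B x y = 0})"
    by (intro finite_SigmaI)
  moreover have "x \<in> F" if "rpoly2 A x y = 0" "rpoly2 B x y = 0" for x y
  proof -
    have "rpoly2 (U * A + V * B) x y = 0" using that by simp
    then show ?thesis unfolding d(2) F_def by simp
  qed
  ultimately show ?thesis by (elim finite_subset[rotated]) auto
qed

text \<open>Either A depends on x alone and its zero set contains a vertical line, or the projection
  to the x-axis misses at most the roots of the leading coefficient.\<close>

lemma infinite_zeros:
  assumes irr: "irreducible A" shows "infinite {(x, y). rpoly2 A x y = 0}"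
proof (cases "degree A = 0")
  case True
  then obtain a where a: "A = [:a:]" by (meson degree_eq_zeroE)
  have "degree a \<noteq> 0"
  proof
    assume "degree a = 0"
    then obtain c where "a = [:c:]" by (meson degree_eq_zeroE)
    then show False using irr a by (auto simp: irreducible_def is_unit_const_poly_iff dvd_field_iff)
  qed
  then have "degree (map_poly (of_rat :: rat \<Rightarrow> complex) a) \<noteq> 0" by (simp add: degree_map_poly)
  then have "\<not> constant (poly (map_poly (of_rat :: rat \<Rightarrow> complex) a))"
    by (simp add: constant_degree)
  then obtain x where "rpoly a x = 0"
    using fundamental_theorem_of_algebra unfolding rpoly_def eval_hom_def by blast
  then have "range (Pair x) \<subseteq> {(x, y). rpoly2 A x y = 0}" by (auto simp: a)
  then show ?thesis
    by (metis finite_imageD finite_subset infinite_UNIV_char_0 injI prod.inject)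
next
  case False
  let ?F = "{x. rpoly (lead_coeff A) x = 0}"
  have "lead_coeff A \<noteq> 0" using False by auto
  then have "finite ?F" by (rule finite_rpoly_roots)
  then have "infinite (- ?F)"
    using finite_compl[of ?F] infinite_UNIV_char_0 by blast
  moreover have "- ?F \<subseteq> fst ` {(x, y). rpoly2 A x y = 0}"
  proof
    fix x assume x: "x \<in> - ?F"
    then have "degree (map_poly (\<lambda>p. rpoly p x) A) = degree A"
      by (intro map_poly_degree_eq) auto
    then obtain y where "rpoly2 A x y = 0"
      using False fundamental_theorem_of_algebra[of "map_poly (\<lambda>p. rpoly p x) A"]
      unfolding rpoly2_eq_poly constant_degree by metis
    then show "x \<in> fst ` {(x, y). rpoly2 A x y = 0}" by force
  qed
  ultimately show ?thesis by (meson finite_imageI finite_subset)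
qed

section \<open>The critical orbit in the fixed-point normal form\<close>

text \<open>Homogeneous coordinates [U : V] of the iterates of 1 under w -> t w + B + t / w. No
  common factor is removed, so that the entries are polynomials in t and B.\<close>

primrec orbit :: "complex \<Rightarrow> complex \<Rightarrow> nat \<Rightarrow> complex \<times> complex" where
  "orbit t B 0 = (1, 1)"
| "orbit t B (Suc k) = (case orbit t B k of (U, V) \<Rightarrow> (t * U\<^sup>2 + B * U * V + t * V\<^sup>2, U * V))"

definition orbit_diff :: "nat \<Rightarrow> complex \<Rightarrow> complex \<Rightarrow> complex" where
  "orbit_diff k t B = fst (orbit t B k) - snd (orbit t B k)"

definition orbit_sum :: "nat \<Rightarrow> complex \<Rightarrow> complex \<Rightarrow> complex" where
  "orbit_sum k t B = fst (orbit t B k) + snd (orbit t B k)"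

definition marked_per :: "nat \<Rightarrow> (complex \<times> complex) set" where
  "marked_per n = {(t, B). t \<noteq> 0 \<and> orbit_diff n t B = 0 \<and> (\<forall>k. 0 < k \<and> k < n \<longrightarrow> orbit_diff k t B \<noteq> 0)}"

text \<open>In terms of the elementary symmetric functions of the three multipliers,
  \<open>coord_x\<close> is sigma1 + 2 and \<open>coord_y\<close> is sigma2 + 2 sigma1 + 3. With
  these shifts the locus B^2 = 4 t^2, where a critical point reaches the fixed point at infinity
  through the pole 0, goes to the curve x y = - 4.\<close>

definition coord_x :: "complex \<Rightarrow> complex \<Rightarrow> complex" where
  "coord_x t B = (1 + 4 * t\<^sup>2 - B\<^sup>2) / t"

definition coord_y :: "complex \<Rightarrow> complex \<Rightarrow> complex" where
  "coord_y t B = - 4 * t + (4 * t\<^sup>2 - B\<^sup>2) * (1 + t)\<^sup>2 / t\<^sup>2"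

definition plane_per :: "nat \<Rightarrow> (complex \<times> complex) set" where
  "plane_per n = (\<lambda>(t, B). (coord_x t B, coord_y t B)) ` marked_per n"

lemma coord_uminus: "coord_x t (- B) = coord_x t B" "coord_y t (- B) = coord_y t B"
  by (simp_all add: coord_x_def coord_y_def)

text \<open>Up to a common factor 1 / 4 these are the coefficients of the map in the coordinate z =
  (w - 1) / (w + 1), namely z -> (alpha z^2 + beta) / (gamma z^2 + delta). The iterates of the
  critical point 0 are \<open>orbit_diff\<close> over \<open>orbit_sum\<close>, and alpha delta -
  beta gamma = 8 t.\<close>

definition alpha :: "complex \<Rightarrow> complex \<Rightarrow> complex" where "alpha t B = 2 * t - B + 1"
definition beta :: "complex \<Rightarrow> complex \<Rightarrow> complex" where "beta t B = 2 * t + B - 1"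
definition gamma :: "complex \<Rightarrow> complex \<Rightarrow> complex" where "gamma t B = 2 * t - B - 1"
definition delta :: "complex \<Rightarrow> complex \<Rightarrow> complex" where "delta t B = 2 * t + B + 1"

lemmas coeff_defs = alpha_def beta_def gamma_def delta_def

lemma orbit_diff_0 [simp]: "orbit_diff 0 t B = 0" and orbit_sum_0 [simp]: "orbit_sum 0 t B = 2"
  by (simp_all add: orbit_diff_def orbit_sum_def)

lemma orbit_diff_Suc:
  "orbit_diff (Suc k) t B = (alpha t B * (orbit_diff k t B)\<^sup>2 + beta t B * (orbit_sum k t B)\<^sup>2) / 4"
proof -
  obtain U V where UV: "orbit t B k = (U, V)" by fastforce
  have "(t * U\<^sup>2 + B * U * V + t * V\<^sup>2 - U * V) * 4 = (2 * t - B + 1) * (U - V)\<^sup>2 + (2 * t + B - 1) * (U + V)\<^sup>2"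
    by algebra
  then show ?thesis unfolding eq_divide_eq by (simp add: orbit_diff_def orbit_sum_def coeff_defs UV)
qed

lemma orbit_sum_Suc:
  "orbit_sum (Suc k) t B = (gamma t B * (orbit_diff k t B)\<^sup>2 + delta t B * (orbit_sum k t B)\<^sup>2) / 4"
proof -
  obtain U V where UV: "orbit t B k = (U, V)" by fastforce
  have "(t * U\<^sup>2 + B * U * V + t * V\<^sup>2 + U * V) * 4 = (2 * t - B - 1) * (U - V)\<^sup>2 + (2 * t + B + 1) * (U + V)\<^sup>2"
    by algebra
  then show ?thesis unfolding eq_divide_eq by (simp add: orbit_diff_def orbit_sum_def coeff_defs UV)
qed

lemma orbit_nonzero:
  assumes "t \<noteq> 0" shows "orbit_diff k t B \<noteq> 0 \<or> orbit_sum k t B \<noteq> 0"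
proof -
  have "fst (orbit t B k) \<noteq> 0 \<or> snd (orbit t B k) \<noteq> 0"
  proof (induction k)
    case (Suc k)
    then show ?case using assms by (cases "orbit t B k") auto
  qed simp
  then show ?thesis unfolding orbit_diff_def orbit_sum_def by auto
qed

subsection \<open>Bihomogeneous expressions in the coefficients\<close>

text \<open>Conjugation by z -> s z multiplies alpha, beta, gamma, delta by s, 1 / s, s^2, 1; this
  gives the weight w, while d is the degree in all four. As functions they satisfy alpha + beta =
  gamma + delta, so the bidegree is not determined by the function; the predicate asserts that some
  bihomogeneous expression for it exists.\<close>

inductive bigraded :: "nat \<Rightarrow> int \<Rightarrow> (complex \<Rightarrow> complex \<Rightarrow> complex) \<Rightarrow> bool" where
  zero: "bigraded d w (\<lambda>t B. 0)"
| add_monom: "bigraded d w f \<Longrightarrow> q \<in> \<rat> \<Longrightarrow> i + j + k + l = d \<Longrightarrow> int i - int j + 2 * int k = w \<Longrightarrow>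
    bigraded d w (\<lambda>t B. f t B + q * (alpha t B ^ i * beta t B ^ j * gamma t B ^ k * delta t B ^ l))"

lemma bigraded_eq:
  assumes "bigraded d w f" "d = d'" "w = w'" "\<And>t B. f t B = g t B"
  shows "bigraded d' w' g"
proof -
  have "f = g" using assms(4) by (intro ext)
  then show ?thesis using assms(1-3) by simp
qed

lemma bigraded_monom:
  "q \<in> \<rat> \<Longrightarrow> i + j + k + l = d \<Longrightarrow> int i - int j + 2 * int k = w \<Longrightarrow>
    bigraded d w (\<lambda>t B. q * (alpha t B ^ i * beta t B ^ j * gamma t B ^ k * delta t B ^ l))"
  using add_monom[OF zero] by simp

lemma bigraded_coeffs:
  "bigraded 1 1 alpha" "bigraded 1 (-1) beta" "bigraded 1 2 gamma" "bigraded 1 0 delta"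
  "c \<in> \<rat> \<Longrightarrow> bigraded 0 0 (\<lambda>t B. c)"
  using bigraded_monom[of 1 1 0 0 0 1 1] bigraded_monom[of 1 0 1 0 0 1 "-1"]
    bigraded_monom[of 1 0 0 1 0 1 2] bigraded_monom[of 1 0 0 0 1 1 0] bigraded_monom[of c 0 0 0 0 0 0]
  by simp_all

lemma bigraded_add:
  assumes "bigraded d w f" "bigraded d w g" shows "bigraded d w (\<lambda>t B. f t B + g t B)"
  using assms
proof (induction rule: bigraded.induct)
  case (add_monom d w f q i j k l)
  then show ?case
    by (intro bigraded_eq[OF bigraded.add_monom[OF add_monom.IH[OF add_monom.prems] add_monom.hyps(2-4)]]) auto
qed simp

lemma bigraded_mult_monom:
  assumes "bigraded d w f" "q \<in> \<rat>" "i + j + k + l = d'" "int i - int j + 2 * int k = w'"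
  shows "bigraded (d + d') (w + w')
    (\<lambda>t B. f t B * (q * (alpha t B ^ i * beta t B ^ j * gamma t B ^ k * delta t B ^ l)))"
  using assms(1)
proof (induction rule: bigraded.induct)
  case (zero d w)
  then show ?case using bigraded.zero by simp
next
  case (add_monom d w f q' i' j' k' l')
  have "bigraded (d + d') (w + w') (\<lambda>t B.
      f t B * (q * (alpha t B ^ i * beta t B ^ j * gamma t B ^ k * delta t B ^ l)) +
      q' * q * (alpha t B ^ (i + i') * beta t B ^ (j + j') * gamma t B ^ (k + k') * delta t B ^ (l + l')))"
    using add_monom.hyps assms by (intro bigraded.add_monom add_monom.IH) auto
  then show ?case
    by (rule bigraded_eq) (auto simp: algebra_simps power_add)
qed

lemma bigraded_mult:
  assumes "bigraded d w f" "bigraded d' w' g"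
  shows "bigraded (d + d') (w + w') (\<lambda>t B. f t B * g t B)"
  using assms(2)
proof (induction rule: bigraded.induct)
  case (zero d w)
  then show ?case using bigraded.zero by simp
next
  case (add_monom d' w' g q i j k l)
  from bigraded_add[OF add_monom.IH bigraded_mult_monom[OF assms(1) add_monom.hyps(2-4)]]
  show ?case by (rule bigraded_eq) (auto simp: algebra_simps)
qed

lemma bigraded_cmult: "c \<in> \<rat> \<Longrightarrow> bigraded d w f \<Longrightarrow> bigraded d w (\<lambda>t B. c * f t B)"
  using bigraded_mult[OF bigraded_coeffs(5)] by simp

lemma bigraded_power: "bigraded d w f \<Longrightarrow> bigraded (d * m) (w * int m) (\<lambda>t B. f t B ^ m)"
proof (induction m)
  case 0
  then show ?case using bigraded_coeffs(5)[of 1] by simp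
next
  case (Suc m)
  from bigraded_mult[OF Suc.prems Suc.IH[OF Suc.prems]] show ?case
    by (rule bigraded_eq) (auto simp: algebra_simps)
qed

lemma coeffs_uminus:
  "alpha t (- B) = delta t B" "beta t (- B) = gamma t B" "gamma t (- B) = beta t B" "delta t (- B) = alpha t B"
  by (simp_all add: coeff_defs)

text \<open>The substitution z -> 1 / z exchanges alpha with delta and beta with gamma and turns
  weight w into d - w. Hence the product of an expression with its swap always has weight equal to
  half its degree.\<close>

lemma bigraded_swap:
  assumes "bigraded d w f" shows "bigraded d (int d - w) (\<lambda>t B. f t (- B))"
  using assms
proof (induction rule: bigraded.induct)
  case (zero d w)
  then show ?case by (rule bigraded.zero)
next
  case (add_monom d w f q i j k l)
  have "bigraded d (int d - w) (\<lambda>t B. f t (- B) +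
      q * (alpha t B ^ l * beta t B ^ k * gamma t B ^ j * delta t B ^ i))"
    using add_monom.hyps by (intro bigraded.add_monom add_monom.IH) auto
  then show ?case by (rule bigraded_eq) (auto simp: coeffs_uminus algebra_simps)
qed

section \<open>Invariants of quadratic maps with unordered critical points\<close>

definition inv_S :: "complex \<Rightarrow> complex \<Rightarrow> complex" where
  "inv_S x y = y / 4 - x / 8 - 3 / 4 - x\<^sup>2 / 32"

lemma alpha_delta:
  assumes "t \<noteq> 0" shows "alpha t B * delta t B = (8 * t) * ((coord_x t B + 4) / 8)"
  using assms by (simp add: coeff_defs coord_x_def field_simps power2_eq_square)

lemma beta_gamma:
  assumes "t \<noteq> 0" shows "beta t B * gamma t B = (8 * t) * ((coord_x t B + 4) / 8 - 1)"
  using assms by (simp add: coeff_defs coord_x_def field_simps power2_eq_square)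

lemma cubic_invariant:
  assumes "t \<noteq> 0"
  shows "alpha t B ^ 3 * beta t B + gamma t B * delta t B ^ 3 = (8 * t)\<^sup>2 * inv_S (coord_x t B) (coord_y t B)"
proof -
  have "t * coord_x t B = 1 + 4 * t\<^sup>2 - B\<^sup>2"
    using assms by (simp add: coord_x_def)
  moreover have "t\<^sup>2 * coord_y t B = - 4 * t ^ 3 + (4 * t\<^sup>2 - B\<^sup>2) * (1 + t)\<^sup>2"
    using assms by (simp add: coord_y_def field_simps power2_eq_square power3_eq_cube)
  moreover have "32 * inv_S (coord_x t B) (coord_y t B) = 8 * coord_y t B - 4 * coord_x t B - 24 - (coord_x t B)\<^sup>2"
    by (simp add: inv_S_def)
  ultimately show ?thesis unfolding coeff_defs by algebra
qed

text \<open>Newton's recurrence for power sums of two quantities: their sum is the cubic invariant,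
  and their product is (alpha delta)^3 (beta gamma), both polynomials in x, y up to powers of 8
  t.\<close>

lemma power_sum_invariant:
  "\<exists>h. rat_polyfun2 h \<and> (\<forall>t B. t \<noteq> 0 \<longrightarrow>
    (alpha t B ^ 3 * beta t B) ^ m + (gamma t B * delta t B ^ 3) ^ m = (8 * t) ^ (2 * m) * h (coord_x t B) (coord_y t B))"
proof (induction m rule: less_induct)
  case (less m)
  consider "m = 0" | "m = 1" | k where "m = Suc (Suc k)" by (metis One_nat_def not0_implies_Suc)
  then show ?case
  proof cases
    case 1
    then show ?thesis by (intro exI[of _ "\<lambda>x y. 2"]) (auto intro!: polyfun_intros)
  next
    case 2
    have "rat_polyfun2 inv_S"
    proof -
      have "rat_polyfun2 (\<lambda>x y. 1 / 4 * y - 1 / 8 * x - 3 / 4 - 1 / 32 * x\<^sup>2)"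
        by (intro polyfun_intros) auto
      then show ?thesis by (rule back_subst[of rat_polyfun2]) (auto simp: inv_S_def fun_eq_iff)
    qed
    then show ?thesis using 2 cubic_invariant by (intro exI[of _ inv_S]) auto
  next
    case 3
    obtain h0 h1 where h: "rat_polyfun2 h0" "rat_polyfun2 h1"
      and h0: "\<And>t B. t \<noteq> 0 \<Longrightarrow> (alpha t B ^ 3 * beta t B) ^ k + (gamma t B * delta t B ^ 3) ^ k =
        (8 * t) ^ (2 * k) * h0 (coord_x t B) (coord_y t B)"
      and h1: "\<And>t B. t \<noteq> 0 \<Longrightarrow> (alpha t B ^ 3 * beta t B) ^ Suc k + (gamma t B * delta t B ^ 3) ^ Suc k =
        (8 * t) ^ (2 * Suc k) * h1 (coord_x t B) (coord_y t B)"
      using less[of k] less[of "Suc k"] 3 by auto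
    let ?a = "\<lambda>x. (x + 4) * (1 / 8)"
    let ?h = "\<lambda>x y. (1 / 4 * y - 1 / 8 * x - 3 / 4 - 1 / 32 * x\<^sup>2) * h1 x y - ?a x ^ 3 * (?a x - 1) * h0 x y"
    have "rat_polyfun2 ?h" by (intro polyfun_intros h) auto
    moreover have "(alpha t B ^ 3 * beta t B) ^ m + (gamma t B * delta t B ^ 3) ^ m =
        (8 * t) ^ (2 * m) * ?h (coord_x t B) (coord_y t B)" if "t \<noteq> 0" for t B
    proof -
      let ?p = "alpha t B ^ 3 * beta t B" and ?q = "gamma t B * delta t B ^ 3"
      let ?x = "coord_x t B" and ?y = "coord_y t B"
      have pq: "?p * ?q = (8 * t) ^ 4 * (?a ?x ^ 3 * (?a ?x - 1))"
      proof -
        have "?p * ?q = (alpha t B * delta t B) ^ 3 * (beta t B * gamma t B)"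
          by (simp add: power_mult_distrib)
        then show ?thesis unfolding alpha_delta[OF that] beta_gamma[OF that]
          by algebra
      qed
      have "?p ^ m + ?q ^ m = (?p + ?q) * (?p ^ Suc k + ?q ^ Suc k) - ?p * ?q * (?p ^ k + ?q ^ k)"
        unfolding 3 by (simp add: algebra_simps)
      also have "\<dots> = (8 * t) ^ (2 * m) * (inv_S ?x ?y * h1 ?x ?y - ?a ?x ^ 3 * (?a ?x - 1) * h0 ?x ?y)"
      proof -
        have *: "(8 * t) ^ (2 * Suc k) = (8 * t)\<^sup>2 * (8 * t) ^ (2 * k)"
          "(8 * t) ^ (2 * m) = (8 * t) ^ 4 * (8 * t) ^ (2 * k)"
          unfolding 3 power_add[symmetric] by (rule arg_cong[where f = "power (8 * t)"], simp)+
        show ?thesis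
          unfolding cubic_invariant[OF that] h0[OF that] h1[OF that] pq * by algebra
      qed
      also have "\<dots> = (8 * t) ^ (2 * m) * ?h ?x ?y"
        by (simp add: inv_S_def)
      finally show ?thesis .
    qed
    ultimately show ?thesis by blast
  qed
qed

text \<open>The two conditions force l - i = 3 (k - j). After powers of alpha delta and beta gamma
  are split off, a power of alpha^3 beta or of gamma delta^3 remains, and the swapped monomial
  supplies the other one.\<close>

lemma monom_invariant:
  assumes "i + j + k + l = 2 * D" "int i - int j + 2 * int k = int D"
  shows "\<exists>h. rat_polyfun2 h \<and> (\<forall>t B. t \<noteq> 0 \<longrightarrow>
    alpha t B ^ i * beta t B ^ j * gamma t B ^ k * delta t B ^ l +
    delta t B ^ i * gamma t B ^ j * beta t B ^ k * alpha t B ^ l = (8 * t) ^ D * h (coord_x t B) (coord_y t B))"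
proof -
  have main: "\<exists>h. rat_polyfun2 h \<and> (\<forall>t B. t \<noteq> 0 \<longrightarrow>
      (alpha t B * delta t B) ^ l * (beta t B * gamma t B) ^ k *
       ((alpha t B ^ 3 * beta t B) ^ m + (gamma t B * delta t B ^ 3) ^ m)
      = (8 * t) ^ (l + k + 2 * m) * h (coord_x t B) (coord_y t B))" for l k m
  proof -
    obtain h where h: "rat_polyfun2 h" and heq: "\<And>t B. t \<noteq> 0 \<Longrightarrow>
      (alpha t B ^ 3 * beta t B) ^ m + (gamma t B * delta t B ^ 3) ^ m =
        (8 * t) ^ (2 * m) * h (coord_x t B) (coord_y t B)"
      using power_sum_invariant[of m] by blast
    let ?h = "\<lambda>x y. ((x + 4) / 8) ^ l * ((x + 4) / 8 - 1) ^ k * h x y"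
    have "rat_polyfun2 (\<lambda>x y. ((x + 4) * (1 / 8)) ^ l * ((x + 4) * (1 / 8) - 1) ^ k * h x y)"
      by (intro polyfun_intros h) auto
    then have "rat_polyfun2 ?h" by simp
    moreover have "(alpha t B * delta t B) ^ l * (beta t B * gamma t B) ^ k *
       ((alpha t B ^ 3 * beta t B) ^ m + (gamma t B * delta t B ^ 3) ^ m)
      = (8 * t) ^ (l + k + 2 * m) * ?h (coord_x t B) (coord_y t B)" if "t \<noteq> 0" for t B
      unfolding alpha_delta[OF that] beta_gamma[OF that] heq[OF that] power_mult_distrib[of "8 * t"] power_add
      by (simp only: mult_ac)
    ultimately show ?thesis by blast
  qed
  show ?thesis
  proof (cases "k \<le> j")
    case True
    then obtain m where m: "j = k + m" using le_Suc_ex by blast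
    have i: "i = l + 3 * m" and D: "D = l + k + 2 * m" using assms m by auto
    have "alpha t B ^ i * beta t B ^ j * gamma t B ^ k * delta t B ^ l +
      delta t B ^ i * gamma t B ^ j * beta t B ^ k * alpha t B ^ l =
      (alpha t B * delta t B) ^ l * (beta t B * gamma t B) ^ k *
       ((alpha t B ^ 3 * beta t B) ^ m + (gamma t B * delta t B ^ 3) ^ m)" for t B
      unfolding m i power_add power_mult power_mult_distrib by (simp only: ring_distribs mult_ac add_ac)
    then show ?thesis using main[of l k m] unfolding D by simp
  next
    case False
    then obtain m where m: "k = j + m" using le_Suc_ex by (metis nat_le_linear)
    have l: "l = i + 3 * m" and D: "D = i + j + 2 * m" using assms m by auto
    have "alpha t B ^ i * beta t B ^ j * gamma t B ^ k * delta t B ^ l +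
      delta t B ^ i * gamma t B ^ j * beta t B ^ k * alpha t B ^ l =
      (alpha t B * delta t B) ^ i * (beta t B * gamma t B) ^ j *
       ((alpha t B ^ 3 * beta t B) ^ m + (gamma t B * delta t B ^ 3) ^ m)" for t B
      unfolding m l power_add power_mult power_mult_distrib by (simp only: ring_distribs mult_ac add_ac)
    then show ?thesis using main[of i j m] unfolding D by simp
  qed
qed

text \<open>The determinant 8 t has degree 2 and weight 1, so its D-th power accounts for the
  bidegree (2 D, D). The quotient then depends on the conjugacy class only and no longer on the
  marked fixed point.\<close>

lemma bigraded_invariant:
  assumes "bigraded d w f" "d = 2 * D" "w = int D"
  shows "\<exists>h. rat_polyfun2 h \<and> (\<forall>t B. t \<noteq> 0 \<longrightarrow>
    f t B + f t (- B) = (8 * t) ^ D * h (coord_x t B) (coord_y t B))"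
  using assms
proof (induction rule: bigraded.induct)
  case (zero d w)
  then show ?case by (intro exI[of _ "\<lambda>x y. 0"]) (auto intro!: polyfun_intros)
next
  case (add_monom d w f q i j k l)
  obtain h1 where h1: "rat_polyfun2 h1" "\<And>t B. t \<noteq> 0 \<Longrightarrow>
    f t B + f t (- B) = (8 * t) ^ D * h1 (coord_x t B) (coord_y t B)" using add_monom by blast
  obtain h2 where h2: "rat_polyfun2 h2" "\<And>t B. t \<noteq> 0 \<Longrightarrow>
    alpha t B ^ i * beta t B ^ j * gamma t B ^ k * delta t B ^ l +
    delta t B ^ i * gamma t B ^ j * beta t B ^ k * alpha t B ^ l = (8 * t) ^ D * h2 (coord_x t B) (coord_y t B)"
    using monom_invariant[of i j k l D] add_monom.hyps add_monom.prems by auto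
  have "rat_polyfun2 (\<lambda>x y. h1 x y + q * h2 x y)"
    using h1 h2 add_monom.hyps by (intro polyfun_intros)
  moreover have "(f t B + q * (alpha t B ^ i * beta t B ^ j * gamma t B ^ k * delta t B ^ l)) +
     (f t (- B) + q * (alpha t (- B) ^ i * beta t (- B) ^ j * gamma t (- B) ^ k * delta t (- B) ^ l)) =
     (8 * t) ^ D * (h1 (coord_x t B) (coord_y t B) + q * h2 (coord_x t B) (coord_y t B))" if "t \<noteq> 0" for t B
  proof -
    let ?m = "alpha t B ^ i * beta t B ^ j * gamma t B ^ k * delta t B ^ l"
    let ?m' = "delta t B ^ i * gamma t B ^ j * beta t B ^ k * alpha t B ^ l"
    have "(f t B + q * ?m) + (f t (- B) + q * ?m') = (f t B + f t (- B)) + q * (?m + ?m')"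
      by (simp only: ring_distribs add_ac)
    also have "\<dots> = (8 * t) ^ D * (h1 (coord_x t B) (coord_y t B) + q * h2 (coord_x t B) (coord_y t B))"
      unfolding h1(2)[OF that] h2(2)[OF that] by (simp only: ring_distribs mult_ac)
    finally show ?thesis unfolding coeffs_uminus .
  qed
  ultimately show ?case
    by (intro exI[of _ "\<lambda>x y. h1 x y + q * h2 x y"] conjI allI impI)
qed

subsection \<open>The marked curve and its image are closed\<close>

text \<open>The coordinate z itself is multiplied by 1 / s under the scaling, which gives its
  numerator weight -1 relative to its denominator.\<close>

lemma bigraded_orbit:
  "bigraded (2 ^ Suc k - 1) (-1) (orbit_diff (Suc k)) \<and> bigraded (2 ^ Suc k - 1) 0 (orbit_sum (Suc k))"
proof (induction k)
  case 0
  have "beta = orbit_diff (Suc 0)" "delta = orbit_sum (Suc 0)"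
    by (simp_all add: fun_eq_iff orbit_diff_Suc orbit_sum_Suc)
  then show ?case using bigraded_coeffs(2,4) by simp
next
  case (Suc k)
  let ?d = "2 ^ Suc k - 1 :: nat"
  let ?u = "orbit_diff (Suc k)" and ?v = "orbit_sum (Suc k)"
  have d: "1 + ?d * 2 = 2 ^ Suc (Suc k) - 1"
    using one_le_power[of "2::nat" k] unfolding power_Suc by linarith
  note u = bigraded_power[of _ _ ?u 2, OF Suc.IH[THEN conjunct1]]
  note v = bigraded_power[of _ _ ?v 2, OF Suc.IH[THEN conjunct2]]
  have "bigraded (1 + ?d * 2) (-1) (\<lambda>t B. 1 / 4 * (alpha t B * ?u t B ^ 2 + beta t B * ?v t B ^ 2))"
    using bigraded_mult[OF bigraded_coeffs(1) u] bigraded_mult[OF bigraded_coeffs(2) v]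
    by (intro bigraded_cmult bigraded_add) auto
  moreover have "bigraded (1 + ?d * 2) 0 (\<lambda>t B. 1 / 4 * (gamma t B * ?u t B ^ 2 + delta t B * ?v t B ^ 2))"
    using bigraded_mult[OF bigraded_coeffs(3) u] bigraded_mult[OF bigraded_coeffs(4) v]
    by (intro bigraded_cmult bigraded_add) auto
  ultimately show ?case unfolding d
    by (auto elim!: bigraded_eq simp: orbit_diff_Suc[of "Suc k"] orbit_sum_Suc[of "Suc k"])
qed

lemma bigraded_orbit_diff: "k > 0 \<Longrightarrow> bigraded (2 ^ k - 1) (-1) (orbit_diff k)"
  and bigraded_orbit_sum: "k > 0 \<Longrightarrow> bigraded (2 ^ k - 1) 0 (orbit_sum k)"
  using bigraded_orbit[of "k - 1"] by auto

text \<open>As 0 is critical, j further steps from (u, v) depend only on u^2 and v^2. Setting u = 0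
  leaves the orbit of the start (0, 2), rescaled by v / 2 in degree 2^j; the difference is divisible
  by u^2.\<close>

lemma orbit_shift:
  assumes "k > 0" "j > 0"
  shows "\<exists>e E D. e + 2 ^ (k + 1) = 2 ^ (k + j) + 1 \<and> bigraded e 1 E \<and> bigraded e 2 D \<and>
    (\<forall>t B. orbit_diff (k + j) t B = orbit_diff j t B * (orbit_sum k t B / 2) ^ 2 ^ j + (orbit_diff k t B)\<^sup>2 * E t B \<and>
      orbit_sum (k + j) t B = orbit_sum j t B * (orbit_sum k t B / 2) ^ 2 ^ j + (orbit_diff k t B)\<^sup>2 * D t B)"
  using \<open>j > 0\<close>
proof (induction j rule: nat_induct_non_zero)
  case 1
  let ?E = "\<lambda>t B. 1 / 4 * alpha t B" and ?D = "\<lambda>t B. 1 / 4 * gamma t B"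
  have "bigraded 1 1 ?E" "bigraded 1 2 ?D"
    by (intro bigraded_cmult bigraded_coeffs; simp)+
  moreover have "orbit_diff (k + 1) t B = orbit_diff 1 t B * (orbit_sum k t B / 2) ^ 2 ^ 1 + (orbit_diff k t B)\<^sup>2 * ?E t B"
    "orbit_sum (k + 1) t B = orbit_sum 1 t B * (orbit_sum k t B / 2) ^ 2 ^ 1 + (orbit_diff k t B)\<^sup>2 * ?D t B" for t B
    by (simp_all add: orbit_diff_Suc orbit_sum_Suc power_divide add_divide_distrib)
  ultimately show ?case by (intro exI[of _ 1] exI[of _ ?E] exI[of _ ?D]) auto
next
  case (Suc j)
  then obtain e E D where e: "e + 2 ^ (k + 1) = 2 ^ (k + j) + 1"
    and E: "bigraded e 1 E" and D: "bigraded e 2 D"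
    and u: "\<And>t B. orbit_diff (k + j) t B = orbit_diff j t B * (orbit_sum k t B / 2) ^ 2 ^ j + (orbit_diff k t B)\<^sup>2 * E t B"
    and v: "\<And>t B. orbit_sum (k + j) t B = orbit_sum j t B * (orbit_sum k t B / 2) ^ 2 ^ j + (orbit_diff k t B)\<^sup>2 * D t B"
    by blast
  let ?c = "\<lambda>t B. (1 / 2 * orbit_sum k t B) ^ 2 ^ j"
  let ?dk = "2 ^ k - 1 :: nat" and ?dj = "2 ^ j - 1 :: nat"
  let ?E1 = "\<lambda>t B. 2 * (orbit_diff j t B * (?c t B * E t B)) + (orbit_diff k t B) ^ 2 * E t B ^ 2"
  let ?D1 = "\<lambda>t B. 2 * (orbit_sum j t B * (?c t B * D t B)) + (orbit_diff k t B) ^ 2 * D t B ^ 2"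
  let ?E' = "\<lambda>t B. 1 / 4 * (alpha t B * ?E1 t B + beta t B * ?D1 t B)"
  let ?D' = "\<lambda>t B. 1 / 4 * (gamma t B * ?E1 t B + delta t B * ?D1 t B)"
  let ?e = "?dj + (?dk * 2 ^ j + e)"
  have one: "1 \<le> (2::nat) ^ k" "1 \<le> (2::nat) ^ j" by simp_all
  have kj: "?dk * 2 ^ j + 2 ^ j = 2 ^ (k + j)"
    using one by (simp add: algebra_simps power_add)
  have e1: "?e = ?dk * 2 + e * 2" using e kj one unfolding power_add power_one_right by linarith
  have e2: "1 + ?e + 2 ^ (k + 1) = 2 ^ (k + Suc j) + 1" using e kj one by simp
  have c: "bigraded (?dk * 2 ^ j) 0 ?c"
    using bigraded_power[OF bigraded_cmult[OF _ bigraded_orbit_sum[OF \<open>k > 0\<close>]], of "1 / 2" "2 ^ j"] by simp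
  have sq: "bigraded (?dk * 2) (-2) (\<lambda>t B. (orbit_diff k t B) ^ 2)"
    using bigraded_power[OF bigraded_orbit_diff[OF \<open>k > 0\<close>], of 2] by simp
  have E1: "bigraded ?e 0 ?E1"
  proof (intro bigraded_add bigraded_cmult)
    show "bigraded ?e 0 (\<lambda>t B. orbit_diff j t B * (?c t B * E t B))"
      using bigraded_mult[OF bigraded_orbit_diff[OF \<open>j > 0\<close>] bigraded_mult[OF c E]] by simp
    show "bigraded ?e 0 (\<lambda>t B. (orbit_diff k t B) ^ 2 * E t B ^ 2)"
      unfolding e1 using bigraded_mult[OF sq bigraded_power[OF E, of 2]] by simp
  qed simp
  have D1: "bigraded ?e 2 ?D1"
  proof (intro bigraded_add bigraded_cmult)
    show "bigraded ?e 2 (\<lambda>t B. orbit_sum j t B * (?c t B * D t B))"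
      using bigraded_mult[OF bigraded_orbit_sum[OF \<open>j > 0\<close>] bigraded_mult[OF c D]] by simp
    show "bigraded ?e 2 (\<lambda>t B. (orbit_diff k t B) ^ 2 * D t B ^ 2)"
      unfolding e1 using bigraded_mult[OF sq bigraded_power[OF D, of 2]] by simp
  qed simp
  have "bigraded (1 + ?e) 1 ?E'"
    using bigraded_mult[OF bigraded_coeffs(1) E1] bigraded_mult[OF bigraded_coeffs(2) D1]
    by (intro bigraded_cmult bigraded_add) auto
  moreover have "bigraded (1 + ?e) 2 ?D'"
    using bigraded_mult[OF bigraded_coeffs(3) E1] bigraded_mult[OF bigraded_coeffs(4) D1]
    by (intro bigraded_cmult bigraded_add) auto
  moreover have "orbit_diff (k + Suc j) t B =
      orbit_diff (Suc j) t B * (orbit_sum k t B / 2) ^ 2 ^ Suc j + (orbit_diff k t B)\<^sup>2 * ?E' t B"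
    "orbit_sum (k + Suc j) t B =
      orbit_sum (Suc j) t B * (orbit_sum k t B / 2) ^ 2 ^ Suc j + (orbit_diff k t B)\<^sup>2 * ?D' t B" for t B
  proof -
    have sq: "(orbit_sum k t B / 2) ^ 2 ^ Suc j = ((orbit_sum k t B / 2) ^ 2 ^ j)\<^sup>2"
      by (simp add: power_mult[symmetric] mult.commute)
    have c: "?c t B = (orbit_sum k t B / 2) ^ 2 ^ j" by simp
    have *: "(a * (p * c + w\<^sup>2 * x)\<^sup>2 + b * (q * c + w\<^sup>2 * z)\<^sup>2) / 4 = (a * p\<^sup>2 + b * q\<^sup>2) / 4 * c\<^sup>2 +
       w\<^sup>2 * (1 / 4 * (a * (2 * (p * (c * x)) + w\<^sup>2 * x\<^sup>2) + b * (2 * (q * (c * z)) + w\<^sup>2 * z\<^sup>2)))"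
      for a b c p q w x z :: complex
      by (simp add: field_simps power2_eq_square)
    show "orbit_diff (k + Suc j) t B =
      orbit_diff (Suc j) t B * (orbit_sum k t B / 2) ^ 2 ^ Suc j + (orbit_diff k t B)\<^sup>2 * ?E' t B"
     "orbit_sum (k + Suc j) t B =
      orbit_sum (Suc j) t B * (orbit_sum k t B / 2) ^ 2 ^ Suc j + (orbit_diff k t B)\<^sup>2 * ?D' t B"
      unfolding add_Suc_right orbit_diff_Suc orbit_sum_Suc sq c u v by (rule *)+
  qed
  ultimately show ?case using e2 by (intro exI[of _ "1 + ?e"] exI[of _ ?E'] exI[of _ ?D']) blast
qed

text \<open>Since the error in \<open>orbit_shift\<close> is quadratic in u, the quotient of the two
  equations is a power of v / 2 wherever the divisor vanishes, hence nonzero for t /= 0: a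
  superattracting cycle does not bifurcate. Vanishing of the cofactor therefore implies that k is
  not a period.\<close>

lemma orbit_cofactor:
  assumes "k > 0" "m > 0"
  shows "\<exists>R. bigraded (2 ^ (m * k) - 2 ^ k) 0 R \<and> (\<forall>t B. orbit_diff (m * k) t B = orbit_diff k t B * R t B) \<and>
    (\<forall>t B. orbit_diff k t B = 0 \<longrightarrow> (\<exists>N. R t B = (orbit_sum k t B / 2) ^ N))"
  using \<open>m > 0\<close>
proof (induction m rule: nat_induct_non_zero)
  case 1
  then show ?case using bigraded_coeffs(5)[of 1]
    by (intro exI[of _ "\<lambda>t B. 1"]) (auto intro: exI[of _ 0])
next
  case (Suc m)
  then obtain R where R: "bigraded (2 ^ (m * k) - 2 ^ k) 0 R"
    and RR: "\<And>t B. orbit_diff (m * k) t B = orbit_diff k t B * R t B"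
    and R0: "\<And>t B. orbit_diff k t B = 0 \<Longrightarrow> \<exists>N. R t B = (orbit_sum k t B / 2) ^ N" by blast
  have mk: "m * k > 0" using Suc.hyps \<open>k > 0\<close> by simp
  obtain e E where e: "e + 2 ^ (k + 1) = 2 ^ (k + m * k) + 1" and E: "bigraded e 1 E"
    and u: "\<And>t B. orbit_diff (k + m * k) t B =
      orbit_diff (m * k) t B * (orbit_sum k t B / 2) ^ 2 ^ (m * k) + (orbit_diff k t B)\<^sup>2 * E t B"
    using orbit_shift[OF \<open>k > 0\<close> mk] by blast
  let ?c = "\<lambda>t B. (1 / 2 * orbit_sum k t B) ^ 2 ^ (m * k)"
  let ?R = "\<lambda>t B. R t B * ?c t B + orbit_diff k t B * E t B"
  let ?dk = "2 ^ k - 1 :: nat"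
  have c: "bigraded (?dk * 2 ^ (m * k)) 0 ?c"
    using bigraded_power[OF bigraded_cmult[OF _ bigraded_orbit_sum[OF \<open>k > 0\<close>]], of "1 / 2" "2 ^ (m * k)"] by simp
  have "(2::nat) ^ k \<le> 2 ^ (m * k)" using Suc.hyps by simp
  moreover have "1 \<le> (2::nat) ^ k" by simp
  moreover have "?dk * 2 ^ (m * k) + 2 ^ (m * k) = 2 ^ (k + m * k)"
    by (simp add: algebra_simps power_add)
  ultimately have d: "2 ^ (m * k) - 2 ^ k + ?dk * 2 ^ (m * k) = 2 ^ (Suc m * k) - 2 ^ k"
    "?dk + e = 2 ^ (Suc m * k) - 2 ^ k"
    using e by simp_all
  have "bigraded (2 ^ (Suc m * k) - 2 ^ k) 0 ?R"
  proof (rule bigraded_add)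
    show "bigraded (2 ^ (Suc m * k) - 2 ^ k) 0 (\<lambda>t B. R t B * ?c t B)"
      using bigraded_mult[OF R c] unfolding d by simp
    show "bigraded (2 ^ (Suc m * k) - 2 ^ k) 0 (\<lambda>t B. orbit_diff k t B * E t B)"
      using bigraded_mult[OF bigraded_orbit_diff[OF \<open>k > 0\<close>] E] unfolding d by simp
  qed
  moreover have "orbit_diff (Suc m * k) t B = orbit_diff k t B * ?R t B" for t B
    using u[of t B] RR[of t B] by (simp add: algebra_simps power2_eq_square)
  moreover have "\<exists>N. ?R t B = (orbit_sum k t B / 2) ^ N" if z: "orbit_diff k t B = 0" for t B
  proof -
    obtain N where "R t B = (orbit_sum k t B / 2) ^ N" using R0[OF z] by blast
    then show ?thesis using z by (intro exI[of _ "N + 2 ^ (m * k)"]) (simp add: power_add)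
  qed
  ultimately show ?case by (intro exI[of _ ?R]) blast
qed

lemma orbit_zero_multiple:
  assumes "t \<noteq> 0" "p > 0" "orbit_diff p t B = 0" "\<And>k. 0 < k \<Longrightarrow> k < p \<Longrightarrow> orbit_diff k t B \<noteq> 0"
    and "orbit_diff m t B = 0"
  shows "p dvd m"
  using assms(5)
proof (induction m rule: less_induct)
  case (less m)
  show ?case
  proof (cases "m \<le> p")
    case True
    then show ?thesis using less.prems assms(4)[of m] by (cases "m = 0 \<or> m = p") auto
  next
    case False
    then have "m - p > 0" by simp
    from orbit_shift[OF \<open>p > 0\<close> this] False assms(3)
    have "orbit_diff m t B = orbit_diff (m - p) t B * (orbit_sum p t B / 2) ^ 2 ^ (m - p)" by auto
    moreover have "orbit_sum p t B \<noteq> 0" using orbit_nonzero[OF assms(1)] assms(3) by blast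
    ultimately have "orbit_diff (m - p) t B = 0" using less.prems by simp
    then have "p dvd m - p" using less.IH[of "m - p"] False assms(2) by simp
    then show ?thesis using False by (simp add: dvd_diff_nat dvd_minus_self)
  qed
qed

text \<open>The number 1 / t has to be the multiplier of a fixed point. Up to sign the cubic is the
  reversal of s^3 - sigma1 s^2 + sigma2 s - sigma3, with sigma3 = sigma1 - 2; its constant term
  keeps t away from 0.\<close>

lemma coords_surj: "\<exists>t B. t \<noteq> 0 \<and> coord_x t B = x \<and> coord_y t B = y"
proof -
  let ?p = "[:-1, x - 2, 2 * x - 1 - y, x - 4:]"
  have "degree ?p \<noteq> 0" by (auto simp: degree_pCons_eq_if)
  then obtain t where "poly ?p t = 0"
    using fundamental_theorem_of_algebra[of ?p] by (auto simp: constant_degree)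
  then have t: "(x - 4) * t ^ 3 + (2 * x - 1 - y) * t\<^sup>2 + (x - 2) * t - 1 = 0"
    by (simp add: algebra_simps power2_eq_square power3_eq_cube)
  then have "t \<noteq> 0" by auto
  define B where "B = csqrt (1 + 4 * t\<^sup>2 - x * t)"
  have B: "B\<^sup>2 = 1 + 4 * t\<^sup>2 - x * t" by (simp add: B_def)
  have "coord_x t B = x" using \<open>t \<noteq> 0\<close> by (simp add: coord_x_def B)
  moreover have "t\<^sup>2 * y = t\<^sup>2 * (- 4 * t) + (4 * t\<^sup>2 - B\<^sup>2) * (1 + t)\<^sup>2"
    unfolding B using t by algebra
  then have "coord_y t B = y"
    using \<open>t \<noteq> 0\<close> by (simp add: coord_y_def field_simps)
  ultimately show ?thesis using \<open>t \<noteq> 0\<close> by blast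
qed

text \<open>Several pairs (t, B) lie over one point (x, y). The symmetrised products of cofactors
  are functions of (x, y), so any single pair decides membership, up to the sign of B.\<close>

theorem plane_per_closed:
  assumes n: "n \<ge> 2"
  obtains F where "\<And>f. f \<in> F \<Longrightarrow> rat_polyfun2 f"
    "\<And>x y. (x, y) \<in> plane_per n \<longleftrightarrow> (\<forall>f\<in>F. f x y = 0)"
proof -
  define K where "K = {k. 0 < k \<and> k < n \<and> k dvd n}"
  have "finite K" unfolding K_def by (rule finite_subset[of _ "{..<n}"]) auto
  have "\<forall>k\<in>K. \<exists>R. bigraded (2 ^ n - 2 ^ k) 0 R \<and> (\<forall>t B. orbit_diff n t B = orbit_diff k t B * R t B) \<and>
    (\<forall>t B. orbit_diff k t B = 0 \<longrightarrow> (\<exists>N. R t B = (orbit_sum k t B / 2) ^ N))"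
  proof
    fix k assume "k \<in> K"
    then obtain m where "n = m * k" "k > 0" "m > 0" unfolding K_def by (auto elim!: dvdE)
    then show "\<exists>R. bigraded (2 ^ n - 2 ^ k) 0 R \<and> (\<forall>t B. orbit_diff n t B = orbit_diff k t B * R t B) \<and>
      (\<forall>t B. orbit_diff k t B = 0 \<longrightarrow> (\<exists>N. R t B = (orbit_sum k t B / 2) ^ N))"
      using orbit_cofactor[of k m] by blast
  qed
  then obtain R where R: "\<And>k. k \<in> K \<Longrightarrow> bigraded (2 ^ n - 2 ^ k) 0 (R k)"
    and RR: "\<And>k t B. k \<in> K \<Longrightarrow> orbit_diff n t B = orbit_diff k t B * R k t B"
    and R0: "\<And>k t B. k \<in> K \<Longrightarrow> orbit_diff k t B = 0 \<Longrightarrow> \<exists>N. R k t B = (orbit_sum k t B / 2) ^ N"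
    by metis
  \<comment> \<open>If all cofactors vanish but some smaller period occurs, the least one divides n
    and its own cofactor is a nonzero power of \<open>orbit_sum\<close>, a contradiction.\<close>
  have marked: "(t, B) \<in> marked_per n \<longleftrightarrow> (\<forall>k\<in>K. R k t B = 0)" if t: "t \<noteq> 0" for t B
  proof
    assume "(t, B) \<in> marked_per n"
    then have "orbit_diff n t B = 0" "\<And>k. k \<in> K \<Longrightarrow> orbit_diff k t B \<noteq> 0"
      by (auto simp: marked_per_def K_def)
    then show "\<forall>k\<in>K. R k t B = 0" using RR by (metis mult_eq_0_iff)
  next
    assume z: "\<forall>k\<in>K. R k t B = 0"
    have "1 \<in> K" using n by (simp add: K_def)
    then have n0: "orbit_diff n t B = 0" using RR z by simp
    have False if k: "0 < k" "k < n" "orbit_diff k t B = 0" for k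
    proof -
      define p where "p = (LEAST k. 0 < k \<and> orbit_diff k t B = 0)"
      have p: "0 < p" "orbit_diff p t B = 0" and "p \<le> k"
        using LeastI[of "\<lambda>k. 0 < k \<and> orbit_diff k t B = 0" k] k
          Least_le[of "\<lambda>k. 0 < k \<and> orbit_diff k t B = 0" k] unfolding p_def by auto
      have "p dvd n"
      proof (rule orbit_zero_multiple[OF t p _ n0])
        show "orbit_diff k t B \<noteq> 0" if "0 < k" "k < p" for k
          using not_less_Least[of k "\<lambda>k. 0 < k \<and> orbit_diff k t B = 0"] that unfolding p_def by auto
      qed
      then have "p \<in> K" using p k \<open>p \<le> k\<close> by (simp add: K_def)
      moreover have "orbit_sum p t B \<noteq> 0" using orbit_nonzero[OF t] p by blast
      ultimately show False using z R0[of p t B] p by force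
    qed
    then show "(t, B) \<in> marked_per n" using t n0 by (auto simp: marked_per_def)
  qed
  \<comment> \<open>Suitable powers bring the cofactors to a common degree D and weight 0. The mixed
    products g_j(B) g_k(-B) then have the balanced bidegree (2 D, D).\<close>
  define D where "D = (\<Prod>k\<in>K. 2 ^ n - 2 ^ k :: nat)"
  define e where "e = (\<lambda>k. D div (2 ^ n - 2 ^ k))"
  have "(2::nat) ^ k < 2 ^ n" if "k \<in> K" for k using that by (simp add: K_def)
  then have "D > 0" unfolding D_def by (intro prod_pos) auto
  have e: "(2 ^ n - 2 ^ k) * e k = D" if "k \<in> K" for k
    unfolding e_def D_def using \<open>finite K\<close> that by (intro dvd_mult_div_cancel dvd_prodI)
  have e0: "e k > 0" if "k \<in> K" for k using e[OF that] \<open>D > 0\<close> by (metis gr0I mult_0_right less_numeral_extra(3))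
  define g where "g = (\<lambda>k t B. R k t B ^ e k)"
  have g: "bigraded D 0 (g k)" if "k \<in> K" for k
    using bigraded_power[OF R[OF that], of "e k"] e[OF that] unfolding g_def by simp
  have g0: "g k t B = 0 \<longleftrightarrow> R k t B = 0" if "k \<in> K" for k t B
    unfolding g_def using e0[OF that] by simp
  have "\<forall>p\<in>K \<times> K. \<exists>h. rat_polyfun2 h \<and> (\<forall>t B. t \<noteq> 0 \<longrightarrow>
    g (fst p) t B * g (snd p) t (- B) + g (fst p) t (- B) * g (snd p) t B =
      (8 * t) ^ D * h (coord_x t B) (coord_y t B))"
  proof clarify
    fix j k assume "j \<in> K" "k \<in> K"
    then have "bigraded (D + D) (0 + (int D - 0)) (\<lambda>t B. g j t B * g k t (- B))"
      by (intro bigraded_mult bigraded_swap g)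
    from bigraded_invariant[OF this, of D]
    show "\<exists>h. rat_polyfun2 h \<and> (\<forall>t B. t \<noteq> 0 \<longrightarrow>
      g (fst (j, k)) t B * g (snd (j, k)) t (- B) + g (fst (j, k)) t (- B) * g (snd (j, k)) t B =
      (8 * t) ^ D * h (coord_x t B) (coord_y t B))" by simp
  qed
  then obtain h where h: "\<And>p. p \<in> K \<times> K \<Longrightarrow> rat_polyfun2 (h p)"
    and heq: "\<And>p t B. p \<in> K \<times> K \<Longrightarrow> t \<noteq> 0 \<Longrightarrow>
      g (fst p) t B * g (snd p) t (- B) + g (fst p) t (- B) * g (snd p) t B =
      (8 * t) ^ D * h p (coord_x t B) (coord_y t B)"
    by metis
  show ?thesis
  proof (rule that[of "h ` (K \<times> K)"])
    show "rat_polyfun2 f" if "f \<in> h ` (K \<times> K)" for f using that h by blast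
    fix x y
    obtain t B where t: "t \<noteq> 0" and xy: "coord_x t B = x" "coord_y t B = y" using coords_surj by blast
    have hz: "h (j, k) x y = 0 \<longleftrightarrow> g j t B * g k t (- B) + g j t (- B) * g k t B = 0"
      if "j \<in> K" "k \<in> K" for j k
      using heq[of "(j, k)" t B] that t xy by simp
    show "(x, y) \<in> plane_per n \<longleftrightarrow> (\<forall>f\<in>h ` (K \<times> K). f x y = 0)"
    proof
      assume "(x, y) \<in> plane_per n"
      then obtain t' B' where tB: "(t', B') \<in> marked_per n" "coord_x t' B' = x" "coord_y t' B' = y"
        by (auto simp: plane_per_def)
      then have "t' \<noteq> 0" by (simp add: marked_per_def)
      then have "g k t' B' = 0" if "k \<in> K" for k using marked tB that g0 by blast
      then have "h p x y = 0" if "p \<in> K \<times> K" for p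
        using heq[OF that \<open>t' \<noteq> 0\<close>, of B'] that tB \<open>t' \<noteq> 0\<close> by auto
      then show "\<forall>f\<in>h ` (K \<times> K). f x y = 0" by blast
    next
      assume z: "\<forall>f\<in>h ` (K \<times> K). f x y = 0"
      \<comment> \<open>The products with j = k say that each g_k vanishes at B or at - B; the mixed
        ones prevent the choice of sign from depending on k.\<close>
      have "(\<forall>k\<in>K. g k t B = 0) \<or> (\<forall>k\<in>K. g k t (- B) = 0)"
      proof (rule ccontr)
        assume "\<not> ?thesis"
        then obtain j k where jk: "j \<in> K" "k \<in> K" "g j t B \<noteq> 0" "g k t (- B) \<noteq> 0" by blast
        have "g j t B * g j t (- B) = 0" "g k t B * g k t (- B) = 0"
          using hz[OF jk(1) jk(1)] hz[OF jk(2) jk(2)] z jk(1,2) by (auto simp: mult.commute)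
        then have "g j t (- B) = 0" using jk by simp
        moreover have "g j t B * g k t (- B) + g j t (- B) * g k t B = 0"
          using hz[OF jk(1) jk(2)] z jk(1,2) by blast
        ultimately show False using jk by simp
      qed
      then have "(t, B) \<in> marked_per n \<or> (t, - B) \<in> marked_per n" using marked[OF t] g0 by blast
      then show "(x, y) \<in> plane_per n"
        unfolding plane_per_def using xy coord_uminus[of t B] by (auto intro: rev_image_eqI)
    qed
  qed
qed

lemma orbit_norm:
  assumes "n > 0"
  obtains h where "rat_polyfun2 h"
    "\<And>t B. t \<noteq> 0 \<Longrightarrow> orbit_diff n t B * orbit_diff n t (- B) = (8 * t) ^ (2 ^ n - 1) * h (coord_x t B) (coord_y t B)"
proof -
  let ?d = "2 ^ n - 1 :: nat"
  have "bigraded (?d + ?d) (-1 + (int ?d - -1)) (\<lambda>t B. orbit_diff n t B * orbit_diff n t (- B))"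
    using assms by (intro bigraded_mult bigraded_swap bigraded_orbit_diff)
  from bigraded_invariant[OF this, of ?d] obtain h where h: "rat_polyfun2 h"
    "\<And>t B. t \<noteq> 0 \<Longrightarrow> orbit_diff n t B * orbit_diff n t (- B) + orbit_diff n t (- B) * orbit_diff n t (- (- B)) =
      (8 * t) ^ ?d * h (coord_x t B) (coord_y t B)" unfolding mult_2 by auto
  have "rat_polyfun2 (\<lambda>x y. 1 / 2 * h x y)" by (intro polyfun_intros h) auto
  moreover have "orbit_diff n t B * orbit_diff n t (- B) = (8 * t) ^ ?d * (1 / 2 * h (coord_x t B) (coord_y t B))"
    if "t \<noteq> 0" for t B using h(2)[OF that, of B] by (simp add: field_simps)
  ultimately show ?thesis using that by blast
qed

subsection \<open>The curve has no isolated points\<close>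

text \<open>Hurwitz' theorem: along parameters tending to a0 without zeros near b0 the functions
  would converge locally uniformly to \<open>p a0\<close>, which is not constant and vanishes at
  b0.\<close>

lemma zeros_persist:
  fixes p :: "complex \<Rightarrow> complex \<Rightarrow> complex"
  assumes cont: "continuous_on UNIV (\<lambda>z. p (fst z) (snd z))"
    and hol: "\<And>a. p a holomorphic_on UNIV"
    and z: "p a0 b0 = 0" and nz: "p a0 b1 \<noteq> 0" and "e > 0"
  obtains d where "d > 0" "\<And>a. dist a a0 < d \<Longrightarrow> \<exists>b. dist b b0 < e \<and> p a b = 0"
proof (rule ccontr)
  assume "\<not> thesis"
  then have "\<forall>k. \<exists>a. dist a a0 < inverse (real (Suc k)) \<and> (\<forall>b. dist b b0 < e \<longrightarrow> p a b \<noteq> 0)"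
    using that by (metis inverse_positive_iff_positive of_nat_0_less_iff zero_less_Suc)
  then obtain A where A: "\<And>k. dist (A k) a0 < inverse (real (Suc k))"
    and Anz: "\<And>k b. dist b b0 < e \<Longrightarrow> p (A k) b \<noteq> 0" by metis
  have Alim: "A \<longlonglongrightarrow> a0"
  proof (rule metric_LIMSEQ_I)
    fix r :: real assume "r > 0"
    then obtain N where N: "inverse (real (Suc N)) < r" using reals_Archimedean by blast
    have "dist (A k) a0 < r" if "k \<ge> N" for k
    proof -
      have "inverse (real (Suc k)) \<le> inverse (real (Suc N))"
        using that by (intro le_imp_inverse_le) auto
      then show ?thesis using A[of k] N by linarith
    qed
    then show "\<exists>N. \<forall>k\<ge>N. dist (A k) a0 < r" by blast
  qed
  have "p a0 b0 \<noteq> 0"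
  proof (rule Hurwitz_no_zeros[of "ball b0 e" "\<lambda>k. p (A k)" "p a0"])
    show "p (A k) holomorphic_on ball b0 e" for k using hol holomorphic_on_subset by blast
    show "p a0 holomorphic_on ball b0 e" using hol holomorphic_on_subset by blast
    show "p (A k) w \<noteq> 0" if "w \<in> ball b0 e" for k w using Anz that by (simp add: dist_commute)
    show "\<not> p a0 constant_on ball b0 e"
    proof
      assume "p a0 constant_on ball b0 e"
      then have c: "p a0 w = 0" if "w \<in> ball b0 e" for w
        using that z \<open>e > 0\<close> unfolding constant_on_def by (metis centre_in_ball)
      have "p a0 b1 = 0"
      proof (rule analytic_continuation_open[of "ball b0 e" UNIV "p a0" "\<lambda>_. 0"])
        show "p a0 z = 0" if "z \<in> ball b0 e" for z by (rule c[OF that])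
      qed (use \<open>e > 0\<close> hol in auto)
      then show False using nz by simp
    qed
    fix K assume K: "compact K" "K \<subseteq> ball b0 e"
    show "uniform_limit K (\<lambda>k. p (A k)) (p a0) sequentially"
      unfolding uniform_limit_iff
    proof (intro allI impI)
      fix r :: real assume "r > 0"
      have "uniformly_continuous_on (cball a0 1 \<times> K) (\<lambda>z. p (fst z) (snd z))"
        using K by (intro compact_uniformly_continuous continuous_on_subset[OF cont] compact_Times) auto
      then obtain d where d: "d > 0" and *: "\<And>z w. z \<in> cball a0 1 \<times> K \<Longrightarrow> w \<in> cball a0 1 \<times> K \<Longrightarrow>
          dist w z < d \<Longrightarrow> dist (p (fst w) (snd w)) (p (fst z) (snd z)) < r"
        using \<open>r > 0\<close> unfolding uniformly_continuous_on_def by metis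
      have "eventually (\<lambda>k. dist (A k) a0 < min d 1) sequentially"
        using Alim d by (intro tendstoD) auto
      then show "\<forall>\<^sub>F k in sequentially. \<forall>b\<in>K. dist (p (A k) b) (p a0 b) < r"
      proof (rule eventually_mono, intro ballI)
        fix k b assume k: "dist (A k) a0 < min d 1" and b: "b \<in> K"
        have "dist (A k, b) (a0, b) < d" using k by (simp add: dist_Pair_Pair)
        then show "dist (p (A k) b) (p a0 b) < r"
          using *[of "(a0, b)" "(A k, b)"] k b by (simp add: dist_commute)
      qed
    qed
  qed (use \<open>e > 0\<close> in auto)
  then show False using z by simp
qed

lemma continuous_orbit:
  "continuous_on UNIV (\<lambda>z. orbit_diff k (fst z) (snd z)) \<and> continuous_on UNIV (\<lambda>z. orbit_sum k (fst z) (snd z))"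
proof (induction k)
  case (Suc k)
  then show ?case unfolding orbit_diff_Suc orbit_sum_Suc coeff_defs
    by (auto intro!: continuous_intros)
qed simp

lemma holomorphic_orbit:
  "orbit_diff k t holomorphic_on UNIV \<and> orbit_sum k t holomorphic_on UNIV"
proof (induction k)
  case 0
  have "orbit_diff 0 t = (\<lambda>_. 0)" "orbit_sum 0 t = (\<lambda>_. 2)" by auto
  then show ?case by simp
next
  case (Suc k)
  have "orbit_diff (Suc k) t = (\<lambda>B. (alpha t B * (orbit_diff k t B)\<^sup>2 + beta t B * (orbit_sum k t B)\<^sup>2) / 4)"
    "orbit_sum (Suc k) t = (\<lambda>B. (gamma t B * (orbit_diff k t B)\<^sup>2 + delta t B * (orbit_sum k t B)\<^sup>2) / 4)"
    by (auto simp: orbit_diff_Suc orbit_sum_Suc)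
  then show ?case using Suc unfolding coeff_defs
    by (auto intro!: holomorphic_intros)
qed

text \<open>Where the smaller periods are excluded, an open condition, the set is given by one
  holomorphic equation in two variables and so has no isolated points. This will exclude components
  of dimension 0.\<close>

lemma marked_per_islimpt:
  assumes "n > 0" and m: "(t0, B0) \<in> marked_per n"
  shows "(t0, B0) islimpt marked_per n"
proof -
  have t0: "t0 \<noteq> 0" and z: "orbit_diff n t0 B0 = 0"
    and nz: "\<And>k. 0 < k \<Longrightarrow> k < n \<Longrightarrow> orbit_diff k t0 B0 \<noteq> 0"
    using m by (auto simp: marked_per_def)
  define W where "W = {z. fst z \<noteq> 0} \<inter> (\<Inter>k\<in>{0<..<n}. {z. orbit_diff k (fst z) (snd z) \<noteq> 0})"
  have "open W" unfolding W_def
    using continuous_orbit by (intro open_Int open_INT ballI open_Collect_neq) (auto intro!: continuous_intros)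
  moreover have "(t0, B0) \<in> W" using t0 nz by (auto simp: W_def)
  ultimately obtain r where r: "r > 0" "ball (t0, B0) r \<subseteq> W" by (meson open_contains_ball)
  show ?thesis unfolding islimpt_approachable
  proof (intro allI impI)
    fix e :: real assume "e > 0"
    define q where "q = min e r / 2"
    have q: "q > 0" "q + q \<le> e" "q + q \<le> r" using \<open>e > 0\<close> r by (auto simp: q_def)
    have "\<exists>t B. orbit_diff n t B = 0 \<and> (t, B) \<noteq> (t0, B0) \<and> dist t t0 < q \<and> dist B B0 < q"
    \<comment> \<open>If the equation is not identically zero on the line t = t0, its zero survives
      a small change of t; otherwise one moves along that line.\<close>
    proof (cases "\<exists>b. orbit_diff n t0 b \<noteq> 0")
      case True
      then obtain b where b: "orbit_diff n t0 b \<noteq> 0" by blast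
      obtain d where d: "d > 0" "\<And>a. dist a t0 < d \<Longrightarrow> \<exists>b. dist b B0 < q \<and> orbit_diff n a b = 0"
        using zeros_persist[of "orbit_diff n", OF _ _ z b q(1)] continuous_orbit holomorphic_orbit by blast
      let ?a = "t0 + complex_of_real (min d q / 2)"
      have pos: "min d q > 0" using d(1) q(1) by simp
      then have "min d q \<noteq> 0" "\<bar>min d q\<bar> = min d q" by linarith+
      then have "dist ?a t0 = min d q / 2" "?a \<noteq> t0" by (simp_all add: dist_norm)
      then have a: "dist ?a t0 < d" "dist ?a t0 < q" "?a \<noteq> t0" using pos by linarith+
      then obtain b where "dist b B0 < q" "orbit_diff n ?a b = 0" using d(2) by blast
      then show ?thesis using a by (intro exI[of _ ?a] exI[of _ b]) simp
    next
      case False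
      have "dist (B0 + complex_of_real (q / 2)) B0 < q" "B0 + complex_of_real (q / 2) \<noteq> B0"
        using q(1) by (simp_all add: dist_norm)
      then show ?thesis using False q(1)
        by (intro exI[of _ t0] exI[of _ "B0 + complex_of_real (q / 2)"]) simp
    qed
    then obtain t B where tB: "orbit_diff n t B = 0" "(t, B) \<noteq> (t0, B0)" "dist t t0 < q" "dist B B0 < q" by blast
    have "dist (t, B) (t0, B0) \<le> dist t t0 + dist B B0"
      unfolding dist_Pair_Pair by (rule sqrt_sum_squares_le_sum) auto
    then have dist: "dist (t, B) (t0, B0) < q + q" using tB by linarith
    then have "(t, B) \<in> W" using r q by (auto simp: dist_commute)
    then have "(t, B) \<in> marked_per n" using tB by (auto simp: W_def marked_per_def)
    then show "\<exists>x'\<in>marked_per n. x' \<noteq> (t0, B0) \<and> dist x' (t0, B0) < e"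
      using tB dist q by (intro bexI[of _ "(t, B)"]) auto
  qed
qed

text \<open>The possible t are the roots of the cubic of \<open>coords_surj\<close>. Finiteness
  ensures that points accumulating in (t, B) do not collapse to one point of the plane.\<close>

lemma finite_coord_fibre: "finite {(t, B). t \<noteq> 0 \<and> coord_x t B = x \<and> coord_y t B = y}"
proof -
  let ?p = "[:-1, x - 2, 2 * x - 1 - y, x - 4:]"
  have "finite {t. poly ?p t = 0}" by (rule poly_roots_finite) simp
  moreover have "finite {B. B\<^sup>2 = c}" for c :: complex
  proof -
    have "finite {B. poly [:-c, 0, 1:] B = 0}" by (rule poly_roots_finite) simp
    then show ?thesis by (simp add: power2_eq_square)
  qed
  ultimately have "finite (SIGMA t:{t. poly ?p t = 0}. {B. B\<^sup>2 = 1 + 4 * t\<^sup>2 - x * t})"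
    by (intro finite_SigmaI)
  moreover have "poly ?p t = 0" "B\<^sup>2 = 1 + 4 * t\<^sup>2 - x * t"
    if "t \<noteq> 0" "coord_x t B = x" "coord_y t B = y" for t B
  proof -
    have x: "x * t = 1 + 4 * t\<^sup>2 - B\<^sup>2" unfolding that(2)[symmetric] using that(1) by (simp add: coord_x_def)
    then show B: "B\<^sup>2 = 1 + 4 * t\<^sup>2 - x * t" by simp
    have "t\<^sup>2 * y = t\<^sup>2 * (- 4 * t) + (4 * t\<^sup>2 - B\<^sup>2) * (1 + t)\<^sup>2"
      using that(1,3) by (simp add: coord_y_def field_simps)
    then have "(x - 4) * t ^ 3 + (2 * x - 1 - y) * t\<^sup>2 + (x - 2) * t - 1 = 0"
      unfolding B by algebra
    then show "poly ?p t = 0" by (simp add: algebra_simps power2_eq_square power3_eq_cube)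
  qed
  ultimately show ?thesis by (elim finite_subset[rotated]) auto
qed

theorem plane_per_islimpt:
  assumes "n > 0" "(x, y) \<in> plane_per n"
  shows "(x, y) islimpt plane_per n"
proof (rule islimptI)
  fix T assume T: "(x, y) \<in> T" "open T"
  obtain t0 B0 where m: "(t0, B0) \<in> marked_per n" and xy: "x = coord_x t0 B0" "y = coord_y t0 B0"
    using assms(2) by (auto simp: plane_per_def)
  let ?f = "\<lambda>z. (coord_x (fst z) (snd z), coord_y (fst z) (snd z))"
  let ?D = "{z::complex \<times> complex. fst z \<noteq> 0}"
  have D: "open ?D" by (intro open_Collect_neq continuous_intros)
  have "continuous_on ?D ?f" unfolding coord_x_def coord_y_def by (intro continuous_intros) auto
  then have "open (?f -` T \<inter> ?D)"
    using continuous_on_open_vimage[OF D, of ?f] T(2) by simp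
  moreover have "(t0, B0) \<in> ?f -` T \<inter> ?D" using m xy T(1) by (simp add: marked_per_def)
  ultimately have "infinite ((?f -` T \<inter> ?D) \<inter> marked_per n)"
    by (intro marked_per_islimpt[OF assms(1) m, unfolded islimpt_eq_acc_point, rule_format])
  then have "\<not> (?f -` T \<inter> ?D) \<inter> marked_per n \<subseteq> {(t, B). t \<noteq> 0 \<and> coord_x t B = x \<and> coord_y t B = y}"
    using finite_subset[OF _ finite_coord_fibre[of x y]] by (rule contrapos_nn)
  then obtain z where "z \<in> (?f -` T \<inter> ?D) \<inter> marked_per n"
    "z \<notin> {(t, B). t \<noteq> 0 \<and> coord_x t B = x \<and> coord_y t B = y}" unfolding subset_eq Ball_def not_all not_imp by (elim exE conjE)
  then obtain t B where z: "(t, B) \<in> ?f -` T \<inter> ?D" "(t, B) \<in> marked_per n"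
    "(t, B) \<notin> {(t, B). t \<noteq> 0 \<and> coord_x t B = x \<and> coord_y t B = y}" by (cases z) auto
  have "(coord_x t B, coord_y t B) \<in> plane_per n"
    unfolding plane_per_def using z(2) by (rule rev_image_eqI) simp
  moreover have "(coord_x t B, coord_y t B) \<in> T" "(coord_x t B, coord_y t B) \<noteq> (x, y)"
    using z(1,3) by simp_all
  ultimately show "\<exists>w\<in>plane_per n. w \<in> T \<and> w \<noteq> (x, y)" by blast
qed

subsection \<open>A branch at infinity\<close>

text \<open>
  On the branch \<open>B = - 2 t + t ^ (n - 1) e\<close>, with \<open>t\<close> tending to \<open>0\<close>, the critical orbit passes from
  \<open>1\<close> to a neighbourhood of the pole \<open>0\<close> and from there to a neighbourhood of the fixed point at
  infinity, from which it returns with the multiplier \<open>t\<close> in the coordinate \<open>1 / w\<close>. The exponents of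
  \<open>t\<close> split off below are those predicted by this picture.
\<close>

definition star_B :: "nat \<Rightarrow> complex \<Rightarrow> complex \<Rightarrow> complex" where
  "star_B n t e = t ^ (n - 1) * e - 2 * t"

primrec star_orbit :: "nat \<Rightarrow> nat \<Rightarrow> complex \<Rightarrow> complex \<Rightarrow> complex \<times> complex" where
  "star_orbit n 0 t e = ((1 - t ^ (n - 1) * e)\<^sup>2 + t ^ (2 * n - 3) * e\<^sup>2, e)"
| "star_orbit n (Suc j) t e = (case star_orbit n j t e of (P, Q) \<Rightarrow>
     (P\<^sup>2 + (t ^ (n - 2) * e - 2) * t ^ (n - 2 - j) * P * Q + (t ^ (n - 2 - j))\<^sup>2 * Q\<^sup>2, P * Q))"

lemma star_orbit_at_0:
  assumes "n \<ge> 3" "j \<le> n - 2" shows "star_orbit n j 0 e = (1, e)"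
  using assms(2)
proof (induction j)
  case 0
  have z: "(0::complex) ^ (2 * n - 3) = 0" "(0::complex) ^ (n - 1) = 0"
    using assms(1) by (auto intro!: zero_power)
  show ?case unfolding star_orbit.simps z by simp
next
  case (Suc j)
  then have z: "(0::complex) ^ (n - 2 - j) = 0" by (intro zero_power) simp
  have "star_orbit n j 0 e = (1, e)" using Suc by simp
  then show ?case unfolding star_orbit.simps z by simp
qed

text \<open>The pair (P, Q) is what remains of [U : V] without its powers of t. After j + 2 steps
  the orbit is at P / (t^(n - 2 - j) Q), so each step brings it back by one power of t. After n
  steps the pole has disappeared, and for t = 0 the position is 1 / e; this is why the exponent in
  \<open>star_B\<close> is n - 1.\<close>

lemma orbit_eq_star_orbit:
  assumes "n \<ge> 3" "j \<le> n - 2"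
  shows "orbit t (star_B n t e) (Suc (Suc j)) =
    (t ^ (2 ^ Suc j - 1) * fst (star_orbit n j t e),
     t ^ (2 ^ Suc j - 1) * t ^ (n - 2 - j) * snd (star_orbit n j t e))"
  using assms(2)
proof (induction j)
  case 0
  obtain m where "n = 3 + m" using assms(1) le_Suc_ex by blast
  then have n: "n - 1 = Suc (Suc m)" "n - 2 = Suc m" "n - 2 - 0 = Suc m" "2 * n - 3 = m + m + 3" by auto
  show ?case unfolding star_B_def star_orbit.simps n power_add
    by (simp add: algebra_simps power2_eq_square power_add power3_eq_cube)
next
  case (Suc j)
  obtain P Q where PQ: "star_orbit n j t e = (P, Q)" by fastforce
  define a where "a = t ^ (2 ^ Suc j - 1)"
  define r where "r = t ^ (n - 2 - Suc j)"
  have r: "t ^ (n - 2 - j) = t * r" unfolding r_def using Suc.prems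
    by (metis Suc_diff_Suc less_eq_Suc_le power_Suc)
  have B: "star_B n t e = t * (t ^ (n - 2) * e - 2)"
  proof -
    have "n - 1 = Suc (n - 2)" using assms(1) by simp
    then show ?thesis unfolding star_B_def by (simp add: algebra_simps)
  qed
  have a: "t ^ (2 ^ Suc (Suc j) - 1) = t * a\<^sup>2"
  proof -
    have "1 \<le> (2::nat) ^ Suc j" by simp
    then have "2 ^ Suc (Suc j) - 1 = Suc ((2 ^ Suc j - 1) * 2 :: nat)"
      unfolding power_Suc[of _ "Suc j"] by linarith
    then show ?thesis unfolding a_def power_mult[symmetric] by simp
  qed
  have IH: "orbit t (star_B n t e) (Suc (Suc j)) = (a * P, a * (t * r) * Q)"
    using Suc unfolding PQ a_def r by simp
  show ?case
    unfolding orbit.simps(2)[of _ _ "Suc (Suc j)"] IH a star_orbit.simps PQ r r_def[symmetric] prod.case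
    unfolding B
    by (simp add: algebra_simps power2_eq_square)
qed

lemma continuous_star_orbit:
  "continuous_on UNIV (\<lambda>z. fst (star_orbit n j (fst z) (snd z))) \<and>
   continuous_on UNIV (\<lambda>z. snd (star_orbit n j (fst z) (snd z)))"
  by (induction j) (auto simp: split_beta intro!: continuous_intros)

lemma continuous_star_orbit_pair: "continuous_on UNIV (\<lambda>z. star_orbit n j (fst z) (snd z))"
proof -
  have "continuous_on UNIV (\<lambda>z. (fst (star_orbit n j (fst z) (snd z)), snd (star_orbit n j (fst z) (snd z))))"
    by (intro continuous_on_Pair continuous_star_orbit[THEN conjunct1] continuous_star_orbit[THEN conjunct2])
  then show ?thesis by simp
qed

lemma holomorphic_star_orbit:
  "(\<lambda>e. fst (star_orbit n j t e)) holomorphic_on UNIV \<and> (\<lambda>e. snd (star_orbit n j t e)) holomorphic_on UNIV"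
  by (induction j) (auto simp: split_beta intro!: holomorphic_intros)

lemma orbit_diff_star:
  assumes "n \<ge> 3" "2 \<le> k" "k \<le> n"
  shows "orbit_diff k t (star_B n t e) = t ^ (2 ^ (k - 1) - 1) *
    (fst (star_orbit n (k - 2) t e) - t ^ (n - k) * snd (star_orbit n (k - 2) t e))"
proof -
  have "Suc (Suc (k - 2)) = k" "Suc (k - 2) = k - 1" "n - 2 - (k - 2) = n - k" using assms by auto
  then show ?thesis using orbit_eq_star_orbit[OF assms(1), of "k - 2" t e] assms
    by (simp add: orbit_diff_def algebra_simps)
qed

text \<open>With powers of t removed, the equation of period n becomes 1 - e at t = 0, and its zero
  e = 1 persists. The expressions for smaller periods are nonzero at (0, 1), hence nearby.\<close>

lemma marked_near_star:
  assumes n: "n \<ge> 3" and "\<epsilon> > 0"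
  shows "\<exists>t e. t \<noteq> 0 \<and> norm t < \<epsilon> \<and> norm (e - 1) < \<epsilon> \<and> (t, star_B n t e) \<in> marked_per n"
proof -
  define p where "p = (\<lambda>t e. fst (star_orbit n (n - 2) t e) - snd (star_orbit n (n - 2) t e))"
  define q where "q = (\<lambda>k z. fst (star_orbit n (k - 2) (fst z) (snd z)) - (fst z) ^ (n - k) * snd (star_orbit n (k - 2) (fst z) (snd z)))"
  \<comment> \<open>The first condition excludes period 1, since \<open>orbit_diff 1\<close> is t^(n
    - 1) e - 1 on the branch; the factorisation in \<open>orbit_diff_star\<close> starts with k =
    2.\<close>
  define W where "W = {z. (fst z) ^ (n - 1) * snd z \<noteq> (1::complex)} \<inter> (\<Inter>k\<in>{2..<n}. {z. q k z \<noteq> 0})"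
  have "open W" unfolding W_def q_def using continuous_star_orbit_pair
    by (intro open_Int open_INT ballI open_Collect_neq) (auto intro!: continuous_intros)
  moreover have "(0, 1) \<in> W"
  proof -
    have "(0::complex) ^ (n - 1) = 0" using n by (intro zero_power) simp
    then have "(0::complex) ^ (n - 1) * 1 \<noteq> 1" by (simp only: mult_zero_left) simp
    moreover have "q k (0, 1) = 1" if "2 \<le> k" "k < n" for k
    proof -
      have z: "(0::complex) ^ (n - k) = 0" using that by (intro zero_power) simp
      show ?thesis using n that by (simp add: q_def star_orbit_at_0 z)
    qed
    ultimately show ?thesis unfolding W_def by fastforce
  qed
  ultimately obtain r where r: "r > 0" "ball (0, 1) r \<subseteq> W" by (meson open_contains_ball)
  define d where "d = min \<epsilon> r / 2"
  have d: "d > 0" "d < \<epsilon>" "d + d \<le> r" using \<open>\<epsilon> > 0\<close> r by (auto simp: d_def)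
  have cont: "continuous_on UNIV (\<lambda>z. p (fst z) (snd z))" unfolding p_def
    using continuous_star_orbit_pair by (intro continuous_intros) auto
  have hol: "p a holomorphic_on UNIV" for a unfolding p_def
    using holomorphic_star_orbit by (intro holomorphic_intros) auto
  have p0: "p 0 e = 1 - e" for e using n by (simp add: p_def star_orbit_at_0)
  have "p 0 1 = 0" "p 0 0 \<noteq> 0" by (simp_all add: p0)
  from zeros_persist[OF cont hol this d(1)]
  obtain d' where d': "d' > 0" "\<And>t. dist t 0 < d' \<Longrightarrow> \<exists>e. dist e 1 < d \<and> p t e = 0" by blast
  define t where "t = complex_of_real (min d d' / 2)"
  have t: "norm t < d'" "norm t < d" "t \<noteq> 0"
  proof -
    have m: "min d d' > 0" using d(1) d'(1) by simp
    then have "norm t = min d d' / 2" unfolding t_def norm_of_real by linarith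
    with m show "norm t < d'" "norm t < d" by linarith+
    show "t \<noteq> 0" using m unfolding t_def by (metis half_gt_zero less_irrefl of_real_eq_0_iff)
  qed
  then obtain e where e: "dist e 1 < d" "p t e = 0" using d'(2)[of t] by auto
  have "dist (t, e) (0, 1) \<le> dist t 0 + dist e 1"
    unfolding dist_Pair_Pair by (rule sqrt_sum_squares_le_sum) auto
  then have "(t, e) \<in> W" using r(2) t(2) e(1) d(3) by (auto simp: dist_commute)
  then have W: "t ^ (n - 1) * e \<noteq> 1" "\<And>k. 2 \<le> k \<Longrightarrow> k < n \<Longrightarrow> q k (t, e) \<noteq> 0"
    by (auto simp: W_def)
  have "orbit_diff k t (star_B n t e) \<noteq> 0" if k: "0 < k" "k < n" for k
  proof (cases "k = 1")
    case True
    then show ?thesis using W(1) by (simp add: orbit_diff_Suc beta_def star_B_def)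
  next
    case False
    then have "2 \<le> k" using k by simp
    then show ?thesis using W(2)[of k] k t(3) n by (simp add: orbit_diff_star q_def)
  qed
  moreover have "orbit_diff n t (star_B n t e) = 0"
    using e(2) n by (simp add: orbit_diff_star p_def)
  ultimately have "(t, star_B n t e) \<in> marked_per n" using t(3) by (simp add: marked_per_def)
  then show ?thesis using t e d by (intro exI[of _ t] exI[of _ e]) (auto simp: dist_norm)
qed

section \<open>Orders of vanishing of both periodicity equations along the branch\<close>

lemma orbit_diff_star_asymp:
  assumes n: "n \<ge> 3"
  shows "((\<lambda>t. orbit_diff n t (star_B n t e) / t ^ (2 ^ (n - 1) - 1)) \<longlongrightarrow> 1 - e) (at 0)"
proof -
  let ?p = "\<lambda>t. fst (star_orbit n (n - 2) t e) - snd (star_orbit n (n - 2) t e)"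
  have "continuous_on UNIV ?p"
    using continuous_on_compose2[OF continuous_star_orbit_pair[of n "n - 2"], of UNIV "\<lambda>t. (t, e)",
        OF continuous_on_Pair[OF continuous_on_id continuous_on_const]]
    by (auto intro!: continuous_intros)
  then have "(?p \<longlongrightarrow> ?p 0) (at 0)"
    using continuous_on_eq_continuous_at isCont_def by blast
  moreover have "?p 0 = 1 - e" using n by (simp add: star_orbit_at_0)
  ultimately have "(?p \<longlongrightarrow> 1 - e) (at 0)" by simp
  moreover have "\<forall>\<^sub>F t in at 0. ?p t = orbit_diff n t (star_B n t e) / t ^ (2 ^ (n - 1) - 1)"
    using n by (auto simp: eventually_at_filter orbit_diff_star)
  ultimately show ?thesis by (rule Lim_transform_eventually)
qed

text \<open>Up to w -> - w, the orbit of - 1 for B is the orbit of 1 for - B. For t -> 0 it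
  alternates between a limit P / Q strictly between 0 and 1 after an even number of steps and the
  pole 0 after an odd one. Positivity of the leading coefficients rules out cancellation, and P < Q
  keeps the leading term of U - V. The periodicity equation of the other critical point thus
  contributes only a power of t and a nonzero constant, independent of e.\<close>

lemma other_orbit_asymp:
  assumes n: "n \<ge> 3"
  shows "\<exists>a P Q. 0 < P \<and> P < Q \<and> (\<forall>e.
      ((\<lambda>t. fst (orbit t (- star_B n t e) (2 * m + 2)) / t ^ a) \<longlongrightarrow> complex_of_real P) (at 0) \<and>
      ((\<lambda>t. snd (orbit t (- star_B n t e) (2 * m + 2)) / t ^ a) \<longlongrightarrow> complex_of_real Q) (at 0))"
    (is "?even m")
  and "\<exists>a P Q. 0 < P \<and> 0 < Q \<and> (\<forall>e.
      ((\<lambda>t. fst (orbit t (- star_B n t e) (2 * m + 3)) / t ^ Suc a) \<longlongrightarrow> complex_of_real P) (at 0) \<and>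
      ((\<lambda>t. snd (orbit t (- star_B n t e) (2 * m + 3)) / t ^ a) \<longlongrightarrow> complex_of_real Q) (at 0))"
    (is "?odd m")
proof -
  define \<beta> where "\<beta> = (\<lambda>e t. 2 - t ^ (n - 2) * e :: complex)"
  have B: "- star_B n t e = t * \<beta> e t" for t e
  proof -
    have "n - 1 = Suc (n - 2)" using n by simp
    then show ?thesis unfolding star_B_def \<beta>_def by (simp add: algebra_simps)
  qed
  have \<beta>: "(\<beta> e \<longlongrightarrow> 2) (at 0)" for e
  proof -
    have "(\<beta> e \<longlongrightarrow> 2 - 0 ^ (n - 2) * e) (at 0)" unfolding \<beta>_def by (intro tendsto_intros)
    moreover have "(0::complex) ^ (n - 2) = 0" using n by (simp add: power_0_left)
    ultimately show ?thesis by simp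
  qed
  have t0: "((\<lambda>t. t) \<longlongrightarrow> (0::complex)) (at 0)" by (rule tendsto_ident_at)
  have nz: "\<forall>\<^sub>F t in at 0. t \<noteq> (0::complex)" by (simp add: eventually_at_filter)
  have even_odd: "?odd m \<and> ?even (Suc m)" if ev: "?even m" for m
  proof -
    obtain a P Q where PQ: "0 < P" "P < Q"
      and U: "\<And>e. ((\<lambda>t. fst (orbit t (- star_B n t e) (2 * m + 2)) / t ^ a) \<longlongrightarrow> complex_of_real P) (at 0)"
      and V: "\<And>e. ((\<lambda>t. snd (orbit t (- star_B n t e) (2 * m + 2)) / t ^ a) \<longlongrightarrow> complex_of_real Q) (at 0)"
      using ev by blast
    have U1: "((\<lambda>t. fst (orbit t (- star_B n t e) (2 * m + 3)) / t ^ Suc (2 * a)) \<longlongrightarrow> complex_of_real ((P + Q)\<^sup>2)) (at 0)" for e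
    proof -
      let ?u = "\<lambda>t. fst (orbit t (- star_B n t e) (2 * m + 2)) / t ^ a"
      let ?v = "\<lambda>t. snd (orbit t (- star_B n t e) (2 * m + 2)) / t ^ a"
      have "((\<lambda>t. (?u t)\<^sup>2 + \<beta> e t * ?u t * ?v t + (?v t)\<^sup>2) \<longlongrightarrow> of_real P ^ 2 + 2 * of_real P * of_real Q + of_real Q ^ 2) (at 0)"
        by (intro tendsto_intros U V \<beta>)
      also have "of_real P ^ 2 + 2 * of_real P * of_real Q + of_real Q ^ 2 = complex_of_real ((P + Q)\<^sup>2)"
        by (simp add: power2_eq_square algebra_simps)
      finally have "((\<lambda>t. (?u t)\<^sup>2 + \<beta> e t * ?u t * ?v t + (?v t)\<^sup>2) \<longlongrightarrow> complex_of_real ((P + Q)\<^sup>2)) (at 0)" .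
      moreover have "\<forall>\<^sub>F t in at 0. (?u t)\<^sup>2 + \<beta> e t * ?u t * ?v t + (?v t)\<^sup>2 =
          fst (orbit t (- star_B n t e) (2 * m + 3)) / t ^ Suc (2 * a)"
      proof (rule eventually_mono[OF nz])
        fix t :: complex assume "t \<noteq> 0"
        obtain U' V' where UV: "orbit t (- star_B n t e) (2 * m + 2) = (U', V')" by fastforce
        have "2 * m + 3 = Suc (2 * m + 2)" by simp
        then have o: "orbit t (- star_B n t e) (2 * m + 3) = (t * U'\<^sup>2 + (- star_B n t e) * U' * V' + t * V'\<^sup>2, U' * V')"
          by (simp only: orbit.simps UV prod.case)
        have b: "t ^ Suc (2 * a) = t * (t ^ a)\<^sup>2" by (simp add: power_mult[symmetric] mult.commute)
        show "(?u t)\<^sup>2 + \<beta> e t * ?u t * ?v t + (?v t)\<^sup>2 =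
          fst (orbit t (- star_B n t e) (2 * m + 3)) / t ^ Suc (2 * a)"
          unfolding o UV unfolding B b using \<open>t \<noteq> 0\<close>
          by (simp add: field_simps power2_eq_square)
      qed
      ultimately show ?thesis by (rule Lim_transform_eventually)
    qed
    have V1: "((\<lambda>t. snd (orbit t (- star_B n t e) (2 * m + 3)) / t ^ (2 * a)) \<longlongrightarrow> complex_of_real (P * Q)) (at 0)" for e
    proof -
      have "((\<lambda>t. fst (orbit t (- star_B n t e) (2 * m + 2)) / t ^ a * (snd (orbit t (- star_B n t e) (2 * m + 2)) / t ^ a))
        \<longlongrightarrow> of_real P * of_real Q) (at 0)" by (intro tendsto_intros U V)
      moreover have "fst (orbit t (- star_B n t e) (2 * m + 2)) / t ^ a * (snd (orbit t (- star_B n t e) (2 * m + 2)) / t ^ a) =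
        snd (orbit t (- star_B n t e) (2 * m + 3)) / t ^ (2 * a)" for t
        by (simp add: eval_nat_numeral split_beta mult_2 power_add)
      ultimately show ?thesis by simp
    qed
    let ?b = "Suc (4 * a)"
    have U2: "((\<lambda>t. fst (orbit t (- star_B n t e) (2 * Suc m + 2)) / t ^ ?b) \<longlongrightarrow> complex_of_real ((P * Q)\<^sup>2)) (at 0)" for e
    proof -
      let ?u = "\<lambda>t. fst (orbit t (- star_B n t e) (2 * m + 3)) / t ^ Suc (2 * a)"
      let ?v = "\<lambda>t. snd (orbit t (- star_B n t e) (2 * m + 3)) / t ^ (2 * a)"
      have "((\<lambda>t. t\<^sup>2 * (?u t)\<^sup>2 + \<beta> e t * t * ?u t * ?v t + (?v t)\<^sup>2) \<longlongrightarrow>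
          0\<^sup>2 * (complex_of_real ((P + Q)\<^sup>2))\<^sup>2 + 2 * 0 * complex_of_real ((P + Q)\<^sup>2) * complex_of_real (P * Q) + (complex_of_real (P * Q))\<^sup>2) (at 0)"
        by (intro tendsto_intros U1 V1 \<beta> t0)
      then have "((\<lambda>t. t\<^sup>2 * (?u t)\<^sup>2 + \<beta> e t * t * ?u t * ?v t + (?v t)\<^sup>2) \<longlongrightarrow> complex_of_real ((P * Q)\<^sup>2)) (at 0)"
        by simp
      moreover have "\<forall>\<^sub>F t in at 0. t\<^sup>2 * (?u t)\<^sup>2 + \<beta> e t * t * ?u t * ?v t + (?v t)\<^sup>2 =
          fst (orbit t (- star_B n t e) (2 * Suc m + 2)) / t ^ ?b"
      proof (rule eventually_mono[OF nz])
        fix t :: complex assume "t \<noteq> 0"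
        obtain U' V' where UV: "orbit t (- star_B n t e) (2 * m + 3) = (U', V')" by fastforce
        have "2 * Suc m + 2 = Suc (2 * m + 3)" by simp
        then have o: "orbit t (- star_B n t e) (2 * Suc m + 2) = (t * U'\<^sup>2 + (- star_B n t e) * U' * V' + t * V'\<^sup>2, U' * V')"
          by (simp only: orbit.simps UV prod.case)
        have b: "t ^ ?b = t * (t ^ (2 * a))\<^sup>2" by (simp add: power_mult[symmetric])
        show "t\<^sup>2 * (?u t)\<^sup>2 + \<beta> e t * t * ?u t * ?v t + (?v t)\<^sup>2 =
          fst (orbit t (- star_B n t e) (2 * Suc m + 2)) / t ^ ?b"
          unfolding o UV unfolding B b using \<open>t \<noteq> 0\<close>
          by (simp add: field_simps power2_eq_square)
      qed
      ultimately show ?thesis by (rule Lim_transform_eventually)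
    qed
    have V2: "((\<lambda>t. snd (orbit t (- star_B n t e) (2 * Suc m + 2)) / t ^ ?b) \<longlongrightarrow> complex_of_real ((P + Q)\<^sup>2 * (P * Q))) (at 0)" for e
    proof -
      let ?u = "\<lambda>t. fst (orbit t (- star_B n t e) (2 * m + 3)) / t ^ Suc (2 * a)"
      let ?v = "\<lambda>t. snd (orbit t (- star_B n t e) (2 * m + 3)) / t ^ (2 * a)"
      have "((\<lambda>t. ?u t * ?v t) \<longlongrightarrow> complex_of_real ((P + Q)\<^sup>2) * complex_of_real (P * Q)) (at 0)"
        by (intro tendsto_intros U1 V1)
      moreover have "?u t * ?v t = snd (orbit t (- star_B n t e) (2 * Suc m + 2)) / t ^ ?b" for t
      proof -
        have "2 * Suc m + 2 = Suc (2 * m + 3)" by simp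
        then have o: "snd (orbit t (- star_B n t e) (2 * Suc m + 2)) =
            fst (orbit t (- star_B n t e) (2 * m + 3)) * snd (orbit t (- star_B n t e) (2 * m + 3))"
          by (simp only: orbit.simps split_beta snd_conv)
        have b: "t ^ ?b = t ^ Suc (2 * a) * t ^ (2 * a)" by (simp add: power_add[symmetric])
        show ?thesis unfolding o b by simp
      qed
      ultimately show ?thesis by (simp only: of_real_mult)
    qed
    have pos: "0 < P * Q" "0 < (P + Q)\<^sup>2" "P * Q < (P + Q)\<^sup>2"
    proof -
      show "0 < P * Q" "0 < (P + Q)\<^sup>2" using PQ by simp_all
      have "(P + Q)\<^sup>2 - P * Q = P\<^sup>2 + Q\<^sup>2 + P * Q" by algebra
      moreover have "0 < P\<^sup>2 + Q\<^sup>2 + P * Q" using PQ by (intro add_pos_pos) auto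
      ultimately show "P * Q < (P + Q)\<^sup>2" by linarith
    qed
    \<comment> \<open>Two steps turn P / Q into P Q / (P + Q)^2, which is again below 1.\<close>
    have "(P * Q)\<^sup>2 < (P + Q)\<^sup>2 * (P * Q)"
      unfolding power2_eq_square[of "P * Q"] by (rule mult_strict_right_mono[OF pos(3) pos(1)])
    then have "?even (Suc m)" using U2 V2 pos
      by (intro exI[of _ ?b] exI[of _ "(P * Q)\<^sup>2"] exI[of _ "(P + Q)\<^sup>2 * (P * Q)"]) auto
    moreover have "?odd m" using U1 V1 pos
      by (intro exI[of _ "2 * a"] exI[of _ "(P + Q)\<^sup>2"] exI[of _ "P * Q"]) auto
    ultimately show ?thesis by blast
  qed
  have ev: "?even m"
  proof (induction m)
    case 0
    have o: "orbit t (- star_B n t e) 2 =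
        (t * ((2 + \<beta> e t) * t)\<^sup>2 + t * \<beta> e t * ((2 + \<beta> e t) * t) + t, (2 + \<beta> e t) * t)" for t e
      unfolding B by (simp add: eval_nat_numeral algebra_simps)
    have "((\<lambda>t. fst (orbit t (- star_B n t e) 2) / t ^ 1) \<longlongrightarrow> complex_of_real 1) (at 0)" for e
    proof -
      have "((\<lambda>t. ((2 + \<beta> e t) * t)\<^sup>2 + \<beta> e t * ((2 + \<beta> e t) * t) + 1) \<longlongrightarrow>
          ((2 + 2) * 0)\<^sup>2 + 2 * ((2 + 2) * 0) + 1) (at 0)"
        by (intro tendsto_intros \<beta> t0)
      then have "((\<lambda>t. ((2 + \<beta> e t) * t)\<^sup>2 + \<beta> e t * ((2 + \<beta> e t) * t) + 1) \<longlongrightarrow> complex_of_real 1) (at 0)"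
        by simp
      moreover have "\<forall>\<^sub>F t in at 0. ((2 + \<beta> e t) * t)\<^sup>2 + \<beta> e t * ((2 + \<beta> e t) * t) + 1 =
          fst (orbit t (- star_B n t e) 2) / t ^ 1"
        by (rule eventually_mono[OF nz]) (simp add: o field_simps)
      ultimately show ?thesis by (rule Lim_transform_eventually)
    qed
    moreover have "((\<lambda>t. snd (orbit t (- star_B n t e) 2) / t ^ 1) \<longlongrightarrow> complex_of_real 4) (at 0)" for e
    proof -
      have "((\<lambda>t. 2 + \<beta> e t) \<longlongrightarrow> 2 + 2) (at 0)" by (intro tendsto_intros \<beta>)
      then have "((\<lambda>t. 2 + \<beta> e t) \<longlongrightarrow> complex_of_real 4) (at 0)" by simp
      moreover have "\<forall>\<^sub>F t in at 0. 2 + \<beta> e t = snd (orbit t (- star_B n t e) 2) / t ^ 1"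
        by (rule eventually_mono[OF nz]) (simp add: o)
      ultimately show ?thesis by (rule Lim_transform_eventually)
    qed
    ultimately have "\<forall>e. ((\<lambda>t. fst (orbit t (- star_B n t e) (2 * 0 + 2)) / t ^ 1) \<longlongrightarrow> complex_of_real 1) (at 0) \<and>
        ((\<lambda>t. snd (orbit t (- star_B n t e) (2 * 0 + 2)) / t ^ 1) \<longlongrightarrow> complex_of_real 4) (at 0)"
      unfolding mult_0_right add_0_left by blast
    moreover have "0 < (1::real)" "1 < (4::real)" by simp_all
    ultimately show ?case by blast
  next
    case (Suc m)
    then show ?case using even_odd[of m] by blast
  qed
  then show "?even m" .
  show "?odd m" using even_odd[OF ev] by blast
qed

lemma orbit_diff_other_asymp:
  assumes n: "n \<ge> 3"
  obtains a c where "c \<noteq> 0" "\<And>e. ((\<lambda>t. orbit_diff n t (- star_B n t e) / t ^ a) \<longlongrightarrow> c) (at 0)"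
proof -
  consider m where "n = 2 * m + 2" | m where "n = 2 * m + 3"
  proof -
    have "n = 2 * ((n - 2) div 2) + 2 \<or> n = 2 * ((n - 2) div 2) + 3" using n by presburger
    then show ?thesis using that by blast
  qed
  then show ?thesis
  proof cases
    case 1
    obtain a P Q where "0 < P" "P < Q"
      and U: "\<And>e. ((\<lambda>t. fst (orbit t (- star_B n t e) (2 * m + 2)) / t ^ a) \<longlongrightarrow> complex_of_real P) (at 0)"
      and V: "\<And>e. ((\<lambda>t. snd (orbit t (- star_B n t e) (2 * m + 2)) / t ^ a) \<longlongrightarrow> complex_of_real Q) (at 0)"
      using other_orbit_asymp(1)[OF n, of m] by blast
    have "((\<lambda>t. orbit_diff n t (- star_B n t e) / t ^ a) \<longlongrightarrow> of_real P - of_real Q) (at 0)" for e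
      using tendsto_diff[OF U V] unfolding orbit_diff_def diff_divide_distrib 1 .
    then show ?thesis using that[of "of_real P - of_real Q" a] \<open>P < Q\<close> by simp
  next
    case 2
    obtain a P Q where "0 < P" "0 < Q"
      and U: "\<And>e. ((\<lambda>t. fst (orbit t (- star_B n t e) (2 * m + 3)) / t ^ Suc a) \<longlongrightarrow> complex_of_real P) (at 0)"
      and V: "\<And>e. ((\<lambda>t. snd (orbit t (- star_B n t e) (2 * m + 3)) / t ^ a) \<longlongrightarrow> complex_of_real Q) (at 0)"
      using other_orbit_asymp(2)[OF n, of m] by blast
    have "((\<lambda>t. orbit_diff n t (- star_B n t e) / t ^ a) \<longlongrightarrow> 0 * of_real P - of_real Q) (at 0)" for e
    proof (rule Lim_transform_eventually)
      show "((\<lambda>t. t * (fst (orbit t (- star_B n t e) (2 * m + 3)) / t ^ Suc a) -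
          snd (orbit t (- star_B n t e) (2 * m + 3)) / t ^ a) \<longlongrightarrow> 0 * of_real P - of_real Q) (at 0)"
        by (intro tendsto_intros U V)
      show "\<forall>\<^sub>F t in at 0. t * (fst (orbit t (- star_B n t e) (2 * m + 3)) / t ^ Suc a) -
          snd (orbit t (- star_B n t e) (2 * m + 3)) / t ^ a = orbit_diff n t (- star_B n t e) / t ^ a"
        by (auto simp: eventually_at_filter orbit_diff_def diff_divide_distrib 2)
    qed
    then show ?thesis using that[of "0 * of_real P - of_real Q" a] \<open>0 < Q\<close> by simp
  qed
qed

text \<open>On an arc of the branch with e /= 0 the factor x y + 4 vanishes to order n - 3 in t and
  x has a simple pole. The power of x compensates exactly and leaves the limit 4 e.\<close>

definition plane_h :: "nat \<Rightarrow> complex \<Rightarrow> complex \<Rightarrow> complex" where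
  "plane_h n x y = x ^ (n - 3) * (x * y + 4)"

text \<open>Multiplied by t^n this is 4 t^2 - B^2 on the branch, the quantity through which B enters
  both coordinates.\<close>

definition star_k :: "nat \<Rightarrow> complex \<Rightarrow> complex \<Rightarrow> complex" where
  "star_k n t e = (4 - t ^ (n - 2) * e) * e"

definition star_h :: "nat \<Rightarrow> complex \<Rightarrow> complex \<Rightarrow> complex" where
  "star_h n t e = (1 + t ^ n * star_k n t e) ^ (n - 3) * star_k n t e *
     ((1 + t ^ n * star_k n t e) * (1 + t)\<^sup>2 - 4 * t ^ 3)"

lemma coords_star:
  assumes "n \<ge> 3" "t \<noteq> 0"
  shows "coord_x t (star_B n t e) = (1 + t ^ n * star_k n t e) / t"
    and "plane_h n (coord_x t (star_B n t e)) (coord_y t (star_B n t e)) = star_h n t e"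
proof -
  define g where "g = 4 * t\<^sup>2 - (star_B n t e)\<^sup>2"
  have g: "g = t ^ n * star_k n t e"
  proof -
    obtain m where n: "n = 3 + m" using assms(1) le_Suc_ex by blast
    have "n - 1 = Suc (Suc m)" "n - 2 = Suc m" using n by auto
    then show ?thesis unfolding g_def star_B_def star_k_def unfolding n power_add
      by (simp add: algebra_simps power2_eq_square power3_eq_cube)
  qed
  have x: "coord_x t (star_B n t e) = (1 + g) / t" unfolding coord_x_def g_def by simp
  then show "coord_x t (star_B n t e) = (1 + t ^ n * star_k n t e) / t" unfolding g .
  have y: "coord_y t (star_B n t e) = - 4 * t + g * (1 + t)\<^sup>2 / t\<^sup>2" unfolding coord_y_def g_def by simp
  have "(1 + g) / t * (- 4 * t + g * (1 + t)\<^sup>2 / t\<^sup>2) + 4 = g / t ^ 3 * ((1 + g) * (1 + t)\<^sup>2 - 4 * t ^ 3)"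
    using assms(2) by (simp add: field_simps power2_eq_square power3_eq_cube)
  moreover have "g / t ^ 3 = t ^ (n - 3) * star_k n t e"
  proof -
    have "t ^ n = t ^ 3 * t ^ (n - 3)" using assms(1) unfolding power_add[symmetric] by simp
    then show ?thesis using assms(2) unfolding g by simp
  qed
  ultimately show "plane_h n (coord_x t (star_B n t e)) (coord_y t (star_B n t e)) = star_h n t e"
    unfolding plane_h_def x y star_h_def g[symmetric]
    using assms(2) by (simp add: power_divide)
qed

lemma tendsto_star:
  assumes "n \<ge> 3"
  shows "((\<lambda>t. t ^ n * star_k n t e) \<longlongrightarrow> 0) (at 0)" "((\<lambda>t. star_h n t e) \<longlongrightarrow> 4 * e) (at 0)"
proof -
  have z: "(0::complex) ^ n = 0" "(0::complex) ^ (n - 2) = 0" using assms by (auto intro!: zero_power)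
  have "((\<lambda>t. t ^ n * star_k n t e) \<longlongrightarrow> 0 ^ n * ((4 - 0 ^ (n - 2) * e) * e)) (at 0)"
    unfolding star_k_def by (intro tendsto_intros)
  then show "((\<lambda>t. t ^ n * star_k n t e) \<longlongrightarrow> 0) (at 0)" unfolding z by simp
  have "((\<lambda>t. star_h n t e) \<longlongrightarrow> (1 + 0 ^ n * ((4 - 0 ^ (n - 2) * e) * e)) ^ (n - 3) * ((4 - 0 ^ (n - 2) * e) * e) *
     ((1 + 0 ^ n * ((4 - 0 ^ (n - 2) * e) * e)) * (1 + 0)\<^sup>2 - 4 * 0 ^ 3)) (at 0)"
    unfolding star_h_def star_k_def by (intro tendsto_intros)
  then show "((\<lambda>t. star_h n t e) \<longlongrightarrow> 4 * e) (at 0)" unfolding z by simp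
qed

lemma power_asymp_unique:
  fixes A W :: "complex \<Rightarrow> complex"
  assumes eq: "\<forall>\<^sub>F t in at 0. t ^ k * A t = t ^ m * W t"
    and A: "(A \<longlongrightarrow> a) (at 0)" and W: "(W \<longlongrightarrow> w) (at 0)"
  shows "k < m \<Longrightarrow> a = 0" "k = m \<Longrightarrow> a = w"
proof -
  have main: "a = 0 ^ (m - k) * w" if "k \<le> m"
  proof -
    have "((\<lambda>t. t ^ (m - k) * W t) \<longlongrightarrow> 0 ^ (m - k) * w) (at 0)" by (intro tendsto_intros W)
    moreover have "\<forall>\<^sub>F t in at 0. t ^ (m - k) * W t = A t"
    proof (rule eventually_mono[OF eventually_conj[OF eq eventually_neq_at_within[of 0 0 UNIV]]])
      fix t :: complex assume t: "t ^ k * A t = t ^ m * W t \<and> t \<noteq> 0"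
      have "t ^ m = t ^ k * t ^ (m - k)" using that by (simp add: power_add[symmetric])
      then show "t ^ (m - k) * W t = A t" using t by auto
    qed
    ultimately have "(A \<longlongrightarrow> 0 ^ (m - k) * w) (at 0)" by (rule Lim_transform_eventually)
    then show ?thesis using A tendsto_unique[OF _ A] by (metis at_neq_bot)
  qed
  show "k < m \<Longrightarrow> a = 0" using main zero_power[of "m - k"] by simp
  show "k = m \<Longrightarrow> a = w" using main by simp
qed

lemma rpoly_eq_0_imp:
  assumes "\<And>x. rpoly p x = 0" shows "p = 0"
  using finite_rpoly_roots[of p] assms infinite_UNIV_char_0 by auto

lemma rpoly2_at_0: "rpoly2 P x 0 = rpoly (coeff P 0) x"
  by (cases P) simp

lemma tendsto_rpoly:
  assumes "(f \<longlongrightarrow> a) F" shows "((\<lambda>t. rpoly p (f t)) \<longlongrightarrow> rpoly p a) F"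
  using assms unfolding rpoly_def eval_hom_def by (rule tendsto_poly)

lemma tendsto_rpoly2:
  assumes "(f \<longlongrightarrow> a) F" "(g \<longlongrightarrow> b) F" shows "((\<lambda>t. rpoly2 P (f t) (g t)) \<longlongrightarrow> rpoly2 P a b) F"
proof (induction P)
  case (pCons p P)
  then show ?case using assms by (auto intro!: tendsto_intros tendsto_rpoly)
qed simp

text \<open>
  Coordinates near the point at infinity that turns out to be smooth are \<open>1 / x\<close>, vanishing there, and
  \<open>h\<close>, with the value \<open>4\<close>.
\<close>

theorem local_equation:
  assumes n: "n \<ge> 3"
  obtains G c where "c \<noteq> 0" "\<And>h. rpoly2 G h 0 = c * (4 - h)"
    "\<And>x y. (x, y) \<in> plane_per n \<Longrightarrow> x \<noteq> 0 \<Longrightarrow> rpoly2 G (plane_h n x y) (1 / x) = 0"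
    "\<exists>H. H \<noteq> 0 \<and> (\<forall>(x, y)\<in>plane_per n. rpoly2 H x y = 0)"
proof -
  obtain f where f: "rat_polyfun2 f" and norm: "\<And>t B. t \<noteq> 0 \<Longrightarrow>
      orbit_diff n t B * orbit_diff n t (- B) = (8 * t) ^ (2 ^ n - 1) * f (coord_x t B) (coord_y t B)"
    using orbit_norm[of n] n by auto
  then obtain H where H: "f = (\<lambda>x y. rpoly2 H x y)" unfolding rat_polyfun2_def by blast
  have H0: "rpoly2 H x y = 0" if "(x, y) \<in> plane_per n" for x y
  proof -
    obtain t B where "t \<noteq> 0" "orbit_diff n t B = 0" "x = coord_x t B" "y = coord_y t B"
      using \<open>(x, y) \<in> plane_per n\<close> by (auto simp: plane_per_def marked_per_def)
    then show ?thesis using norm[of t B] H by simp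
  qed
  \<comment> \<open>E bounds the degree of H in x, so that s^E clears the denominators of x = 1 / s.
    By the definition of h, the other coordinate is y = h s^(n - 2) - 4 s, a polynomial in h and
    s.\<close>
  define E where "E = Max (insert 0 ((\<lambda>j. degree (coeff H j)) ` {..degree H}))"
  have E: "degree (coeff H j) \<le> E" for j
  proof (cases "j \<le> degree H")
    case True
    then show ?thesis unfolding E_def by (intro Max_ge) auto
  qed (simp add: coeff_eq_0)
  have "rat_polyfun2 (\<lambda>h s. \<Sum>j\<le>degree H. \<Sum>i\<le>E.
      of_rat (coeff (coeff H j) i) * s ^ (E - i) * (h * s ^ (n - 2) - 4 * s) ^ j)"
    by (intro polyfun_intros) auto
  then obtain K where K: "\<And>h s. (\<Sum>j\<le>degree H. \<Sum>i\<le>E.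
      of_rat (coeff (coeff H j) i) * s ^ (E - i) * (h * s ^ (n - 2) - 4 * s) ^ j) = rpoly2 K h s"
    unfolding rat_polyfun2_def by blast
  have HK: "s ^ E * rpoly2 H (1 / s) (h * s ^ (n - 2) - 4 * s) = rpoly2 K h s" if "s \<noteq> 0" for h s
  proof -
    have "s ^ E * (of_rat (coeff (coeff H j) i) * (1 / s) ^ i * z) = of_rat (coeff (coeff H j) i) * s ^ (E - i) * z"
      if "i \<le> E" for i j z
      using \<open>s \<noteq> 0\<close> that by (simp add: power_diff field_simps)
    then show ?thesis unfolding rpoly2_eq_sum[OF order_refl E] K[symmetric] sum_distrib_left
      by (intro sum.cong refl) auto
  qed
  have hxy: "plane_h n x y * (1 / x) ^ (n - 2) - 4 * (1 / x) = y" if "x \<noteq> 0" for x y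
  proof -
    have m: "n - 2 = Suc (n - 3)" using n by simp
    have "x ^ k * z * (1 / x) ^ Suc k = z / x" for k z
      using that by (simp add: power_one_over)
    then have eq: "plane_h n x y * (1 / x) ^ (n - 2) = (x * y + 4) / x"
      unfolding plane_h_def m .
    show ?thesis unfolding eq using that by (simp add: add_divide_distrib)
  qed
  obtain a' c' where c': "c' \<noteq> 0" and other: "\<And>e. ((\<lambda>t. orbit_diff n t (- star_B n t e) / t ^ a') \<longlongrightarrow> c') (at 0)"
    using orbit_diff_other_asymp[OF n] by blast
  define a where "a = (2 ^ (n - 1) - 1 :: nat)"
  define D where "D = (2 ^ n - 1 :: nat)"
  define \<sigma> where "\<sigma> = (\<lambda>e t. 1 / (1 + t ^ n * star_k n t e))"
  have \<sigma>: "(\<sigma> e \<longlongrightarrow> 1) (at 0)" for e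
  proof -
    have "(\<sigma> e \<longlongrightarrow> 1 / (1 + 0)) (at 0)" unfolding \<sigma>_def by (intro tendsto_intros tendsto_star[OF n]) simp
    then show ?thesis by simp
  qed
  define W where "W = (\<lambda>e t. \<sigma> e t ^ E * (orbit_diff n t (star_B n t e) / t ^ a * (orbit_diff n t (- star_B n t e) / t ^ a')))"
  have W: "(W e \<longlongrightarrow> (1 - e) * c') (at 0)" for e
  proof -
    have "(W e \<longlongrightarrow> 1 ^ E * ((1 - e) * c')) (at 0)" unfolding W_def a_def
      by (intro tendsto_intros \<sigma> other orbit_diff_star_asymp[OF n])
    then show ?thesis by simp
  qed
  \<comment> \<open>Along the arc with fixed e, which in general leaves the curve, the norm is
    computed twice: as K in the coordinates h and s, and as a product of two critical expressions
    whose leading terms are known.\<close>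
  have star_eq: "\<forall>\<^sub>F t in at 0. t ^ D * (8 ^ D * rpoly2 K (star_h n t e) (t * \<sigma> e t)) = t ^ (E + a + a') * W e t" for e
  proof -
    have "\<forall>\<^sub>F t in at 0. \<sigma> e t \<noteq> 0" by (rule tendsto_imp_eventually_ne[OF \<sigma>]) simp
    then show ?thesis
    proof (rule eventually_mono[OF eventually_conj[OF eventually_neq_at_within[of 0 0 UNIV]]])
      fix t :: complex assume t: "t \<noteq> 0 \<and> \<sigma> e t \<noteq> 0"
      let ?B = "star_B n t e"
      have x: "coord_x t ?B = 1 / (t * \<sigma> e t)" using t coords_star(1)[OF n, of t e] by (simp add: \<sigma>_def)
      have "rpoly2 K (star_h n t e) (t * \<sigma> e t) = (t * \<sigma> e t) ^ E * rpoly2 H (coord_x t ?B) (coord_y t ?B)"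
      proof -
        have s: "t * \<sigma> e t = 1 / coord_x t ?B" and x0: "coord_x t ?B \<noteq> 0" using x t by auto
        show ?thesis unfolding s
          using HK[of "1 / coord_x t ?B" "star_h n t e"] x0 hxy[OF x0, of "coord_y t ?B"]
            coords_star(2)[OF n, of t e] t by simp
      qed
      moreover have "t ^ D * 8 ^ D * rpoly2 H (coord_x t ?B) (coord_y t ?B) =
          orbit_diff n t ?B * orbit_diff n t (- ?B)"
        using norm[of t ?B] t unfolding H D_def by (simp add: power_mult_distrib)
      ultimately have "t ^ D * (8 ^ D * rpoly2 K (star_h n t e) (t * \<sigma> e t)) =
          (t * \<sigma> e t) ^ E * (orbit_diff n t ?B * orbit_diff n t (- ?B))"
        by (metis mult.assoc mult.left_commute)
      also have "\<dots> = t ^ (E + a + a') * W e t"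
        unfolding W_def using t by (simp add: power_mult_distrib power_add)
      finally show "t ^ D * (8 ^ D * rpoly2 K (star_h n t e) (t * \<sigma> e t)) = t ^ (E + a + a') * W e t" .
    qed
  qed
  \<comment> \<open>On the arc e = 0 the right-hand side has the nonzero leading coefficient
    c'.\<close>
  have "K \<noteq> 0"
  proof
    assume "K = 0"
    then have "\<forall>\<^sub>F t in at 0. t ^ (E + a + a') * W 0 t = t ^ (E + a + a') * 0"
      using star_eq[of 0] by simp
    from power_asymp_unique(2)[OF this W tendsto_const] show False using c' by simp
  qed
  \<comment> \<open>The line s = 0 is removed from K with its full multiplicity, so that G does not
    vanish identically on it.\<close>
  then obtain G where G: "K = [:0, 1:] ^ order 0 K * G" and "\<not> [:0, 1:] dvd G"
    using order_decomp[of K 0] by auto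
  then have G0: "coeff G 0 \<noteq> 0" using poly_eq_0_iff_dvd[of G 0] by (simp add: poly_0_coeff_0)
  define k where "k = order 0 K"
  have KG: "rpoly2 K h s = s ^ k * rpoly2 G h s" for h s
    by (subst G) (simp add: k_def)
  have Glim: "((\<lambda>t. 8 ^ D * \<sigma> e t ^ k * rpoly2 G (star_h n t e) (t * \<sigma> e t)) \<longlongrightarrow> 8 ^ D * rpoly (coeff G 0) (4 * e)) (at 0)" for e
  proof -
    have "((\<lambda>t. 8 ^ D * \<sigma> e t ^ k * rpoly2 G (star_h n t e) (t * \<sigma> e t)) \<longlongrightarrow>
        8 ^ D * 1 ^ k * rpoly2 G (4 * e) (0 * 1)) (at 0)"
      by (intro tendsto_intros tendsto_rpoly2 \<sigma> tendsto_star[OF n])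
    then show ?thesis by (simp add: rpoly2_at_0)
  qed
  have Geq: "\<forall>\<^sub>F t in at 0. t ^ (D + k) * (8 ^ D * \<sigma> e t ^ k * rpoly2 G (star_h n t e) (t * \<sigma> e t)) = t ^ (E + a + a') * W e t" for e
    by (rule eventually_mono[OF star_eq[of e]]) (simp add: KG power_add power_mult_distrib algebra_simps)
  \<comment> \<open>The exponents of t on both sides must agree. A smaller one on the right
    contradicts c' /= 0 on the arc e = 0; a larger one would make G vanish identically on s =
    0.\<close>
  have "\<not> E + a + a' < D + k"
  proof
    assume less: "E + a + a' < D + k"
    have "\<forall>\<^sub>F t in at 0. t ^ (E + a + a') * W 0 t = t ^ (D + k) * (8 ^ D * \<sigma> 0 t ^ k * rpoly2 G (star_h n t 0) (t * \<sigma> 0 t))"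
      by (rule eventually_mono[OF Geq[of 0]]) simp
    from power_asymp_unique(1)[OF this W Glim less] show False using c' by simp
  qed
  moreover have "\<not> D + k < E + a + a'"
  proof
    assume less: "D + k < E + a + a'"
    have "rpoly (coeff G 0) (4 * e) = 0" for e
      using power_asymp_unique(1)[OF Geq[of e] Glim W less] by simp
    then have "rpoly (coeff G 0) x = 0" for x by (metis mult.commute nonzero_mult_div_cancel_left times_divide_eq_right zero_neq_numeral)
    then show False using rpoly_eq_0_imp G0 by blast
  qed
  ultimately have eq: "D + k = E + a + a'" by linarith
  \<comment> \<open>Comparing leading coefficients for every e, with limit h = 4 e, determines the
    restriction of G to s = 0 completely: it is linear in h.\<close>
  have L8: "8 ^ D * rpoly (coeff G 0) (4 * e) = (1 - e) * c'" for e
    using power_asymp_unique(2)[OF Geq[of e] Glim W eq] .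
  have r: "rpoly (coeff G 0) (4 * e) = (1 - e) * c' / 8 ^ D" for e
    unfolding L8[symmetric] by simp
  have G4: "rpoly2 G h 0 = c' / (4 * 8 ^ D) * (4 - h)" for h
    using r[of "h / 4"] unfolding rpoly2_at_0 by (simp add: field_simps)
  have "H \<noteq> 0"
  proof
    assume "H = 0"
    then have "rpoly2 K h s = 0" if "s \<noteq> 0" for h s using HK[OF that, of h] by simp
    then have "\<forall>\<^sub>F t in at 0. t ^ (E + a + a') * W 0 t = t ^ (E + a + a') * 0"
    proof -
      have "\<forall>\<^sub>F t in at 0. \<sigma> 0 t \<noteq> 0" by (rule tendsto_imp_eventually_ne[OF \<sigma>]) simp
      from eventually_conj[OF star_eq[of 0] eventually_conj[OF eventually_neq_at_within[of 0 0 UNIV] this]]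
      show ?thesis by (rule eventually_mono) (use \<open>\<And>s h. s \<noteq> 0 \<Longrightarrow> rpoly2 K h s = 0\<close> in auto)
    qed
    from power_asymp_unique(2)[OF this W tendsto_const] show False using c' by simp
  qed
  show ?thesis
  proof (rule that[of "c' / (4 * 8 ^ D)" G])
    show "c' / (4 * 8 ^ D) \<noteq> 0" using c' by simp
    show "rpoly2 G h 0 = c' / (4 * 8 ^ D) * (4 - h)" for h by (rule G4)
    show "rpoly2 G (plane_h n x y) (1 / x) = 0" if "(x, y) \<in> plane_per n" "x \<noteq> 0" for x y
    proof -
      have "rpoly2 K (plane_h n x y) (1 / x) = 0"
        using HK[of "1 / x" "plane_h n x y"] hxy[OF that(2), of y] H0[OF that(1)] that(2) by simp
      then show ?thesis using KG that(2) by simp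
    qed
    show "\<exists>H. H \<noteq> 0 \<and> (\<forall>(x, y)\<in>plane_per n. rpoly2 H x y = 0)" using \<open>H \<noteq> 0\<close> H0 by blast
  qed
qed

text \<open>This is what puts the point at infinity into the closure; \<open>local_equation\<close>
  only says that the equation G holds there.\<close>

lemma plane_per_near_star:
  assumes n: "n \<ge> 3" and "\<epsilon> > 0"
  obtains x y where "(x, y) \<in> plane_per n" "x \<noteq> 0" "norm (1 / x) < \<epsilon>" "norm (plane_h n x y - 4) < \<epsilon>"
proof -
  let ?s = "\<lambda>z. fst z / (1 + fst z ^ n * star_k n (fst z) (snd z))"
  let ?h = "\<lambda>z. star_h n (fst z) (snd z)"
  let ?d = "\<lambda>z. 1 + fst z ^ n * star_k n (fst z) (snd z)"
  have z: "(0::complex) ^ n = 0" "(0::complex) ^ (n - 2) = 0" using n by (auto intro!: zero_power)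
  have ident: "((\<lambda>z. fst z) \<longlongrightarrow> (0::complex)) (nhds (0 :: complex, 1 :: complex))" "((\<lambda>z. snd z) \<longlongrightarrow> (1::complex)) (nhds (0 :: complex, 1 :: complex))"
    using tendsto_fst[OF filterlim_ident[of "nhds (0::complex, 1::complex)"]]
      tendsto_snd[OF filterlim_ident[of "nhds (0::complex, 1::complex)"]] by simp_all
  have "(?d \<longlongrightarrow> 1 + 0 ^ n * ((4 - 0 ^ (n - 2) * 1) * 1)) (nhds (0 :: complex, 1 :: complex))"
    unfolding star_k_def by (intro tendsto_intros ident)
  then have d: "(?d \<longlongrightarrow> 1) (nhds (0 :: complex, 1 :: complex))" unfolding z by simp
  have "(?s \<longlongrightarrow> 0 / 1) (nhds (0 :: complex, 1 :: complex))" by (intro tendsto_intros ident d) simp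
  then have s: "\<forall>\<^sub>F z in nhds (0 :: complex, 1 :: complex). norm (?s z) < \<epsilon>"
    using \<open>\<epsilon> > 0\<close> by (auto dest!: tendstoD[of _ _ _ \<epsilon>])
  have "(?h \<longlongrightarrow> (1 + 0 ^ n * ((4 - 0 ^ (n - 2) * 1) * 1)) ^ (n - 3) * ((4 - 0 ^ (n - 2) * 1) * 1) *
     ((1 + 0 ^ n * ((4 - 0 ^ (n - 2) * 1) * 1)) * (1 + 0)\<^sup>2 - 4 * 0 ^ 3)) (nhds (0 :: complex, 1 :: complex))"
    unfolding star_h_def star_k_def by (intro tendsto_intros ident)
  then have "(?h \<longlongrightarrow> 4) (nhds (0 :: complex, 1 :: complex))" unfolding z by simp
  then have h: "\<forall>\<^sub>F z in nhds (0 :: complex, 1 :: complex). norm (?h z - 4) < \<epsilon>"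
    using \<open>\<epsilon> > 0\<close> by (auto dest!: tendstoD[of _ _ _ \<epsilon>] simp: dist_norm)
  have "\<forall>\<^sub>F z in nhds (0 :: complex, 1 :: complex). ?d z \<noteq> 0" by (rule tendsto_imp_eventually_ne[OF d]) simp
  from eventually_conj[OF this eventually_conj[OF s h]] obtain r where r: "r > 0"
    and rr: "\<And>z. dist z (0, 1) < r \<Longrightarrow> ?d z \<noteq> 0 \<and> norm (?s z) < \<epsilon> \<and> norm (?h z - 4) < \<epsilon>"
    unfolding eventually_nhds_metric by blast
  obtain t e where te: "t \<noteq> 0" "norm t < r / 2" "norm (e - 1) < r / 2" "(t, star_B n t e) \<in> marked_per n"
    using marked_near_star[OF n, of "r / 2"] r by auto
  have "dist (t, e) (0, 1) \<le> dist t 0 + dist e 1"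
    unfolding dist_Pair_Pair by (rule sqrt_sum_squares_le_sum) auto
  then have "dist (t, e) (0, 1) < r" using te by (simp add: dist_norm)
  note * = rr[OF this, unfolded fst_conv snd_conv]
  have x: "coord_x t (star_B n t e) = (1 + t ^ n * star_k n t e) / t" by (rule coords_star(1)[OF n te(1)])
  show ?thesis
  proof (rule that)
    show "(coord_x t (star_B n t e), coord_y t (star_B n t e)) \<in> plane_per n"
      unfolding plane_per_def using te(4) by (rule rev_image_eqI) simp
    show "coord_x t (star_B n t e) \<noteq> 0" unfolding x using * te(1) by simp
    show "norm (1 / coord_x t (star_B n t e)) < \<epsilon>" unfolding x using * by simp
    show "norm (plane_h n (coord_x t (star_B n t e)) (coord_y t (star_B n t e)) - 4) < \<epsilon>"
      unfolding coords_star(2)[OF n te(1)] using * by simp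
  qed
qed

section \<open>Algebraic dependence on a plane curve\<close>

lemma sum_fun_apply: "(\<Sum>i\<in>A. f i) z = (\<Sum>i\<in>A. f i z)"
  by (induction A rule: infinite_finite_induct) auto

definition rat_scale :: "rat \<Rightarrow> (complex \<times> complex \<Rightarrow> complex) \<Rightarrow> complex \<times> complex \<Rightarrow> complex" where
  "rat_scale c f = (\<lambda>z. of_rat c * f z)"

interpretation rat_fun: vector_space rat_scale
  by unfold_locales (auto simp: rat_scale_def fun_eq_iff algebra_simps of_rat_add of_rat_mult)

text \<open>Extension by 0 turns equality on Y into equality of functions, so that the linear
  algebra takes place in one fixed space over Q.\<close>

definition restr :: "(complex \<times> complex) set \<Rightarrow> (complex \<Rightarrow> complex \<Rightarrow> complex) \<Rightarrow> complex \<times> complex \<Rightarrow> complex" where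
  "restr Y f z = (if z \<in> Y then f (fst z) (snd z) else 0)"

definition mono_span :: "(complex \<times> complex) set \<Rightarrow> nat \<Rightarrow> (complex \<times> complex \<Rightarrow> complex) set" where
  "mono_span Y e = rat_fun.span ((\<lambda>(i, j). restr Y (\<lambda>x y. x ^ i * y ^ j)) ` {(i, j). i + j \<le> e})"

lemma mono_span_base: "i + j \<le> e \<Longrightarrow> restr Y (\<lambda>x y. x ^ i * y ^ j) \<in> mono_span Y e"
  unfolding mono_span_def by (intro rat_fun.span_base) auto

lemma mono_span_mult:
  assumes "f \<in> mono_span Y e" "g \<in> mono_span Y e'"
  shows "(\<lambda>z. f z * g z) \<in> mono_span Y (e + e')"
  using assms(1) unfolding mono_span_def[of Y e]
proof (induction rule: rat_fun.span_induct_alt)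
  case base
  have z: "(\<lambda>z. 0 z * g z) = 0" by auto
  show ?case unfolding z mono_span_def by (rule rat_fun.span_zero)
next
  case (step c m f)
  then obtain i j where m: "m = restr Y (\<lambda>x y. x ^ i * y ^ j)" and ij: "i + j \<le> e" by auto
  have "(\<lambda>z. m z * g z) \<in> mono_span Y (e + e')"
    using assms(2) unfolding mono_span_def[of Y e']
  proof (induction rule: rat_fun.span_induct_alt)
    case base
    have z: "(\<lambda>z. m z * 0 z) = 0" by auto
    show ?case unfolding z mono_span_def by (rule rat_fun.span_zero)
  next
    case (step c m' g)
    then obtain k l where m': "m' = restr Y (\<lambda>x y. x ^ k * y ^ l)" and kl: "k + l \<le> e'" by auto
    have "(\<lambda>z. m z * (rat_scale c m' + g) z) =
        rat_scale c (restr Y (\<lambda>x y. x ^ (i + k) * y ^ (j + l))) + (\<lambda>z. m z * g z)"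
      unfolding m m' by (auto simp: fun_eq_iff rat_scale_def restr_def power_add algebra_simps)
    also have "\<dots> \<in> mono_span Y (e + e')"
      using mono_span_base[of "i + k" "j + l" "e + e'" Y] ij kl step.IH unfolding mono_span_def
      by (intro rat_fun.span_add rat_fun.span_scale) auto
    finally show ?case .
  qed
  then have "rat_scale c (\<lambda>z. m z * g z) + (\<lambda>z. f z * g z) \<in> mono_span Y (e + e')"
    using step.IH unfolding mono_span_def by (intro rat_fun.span_add rat_fun.span_scale)
  moreover have "rat_scale c (\<lambda>z. m z * g z) + (\<lambda>z. f z * g z) = (\<lambda>z. (rat_scale c m + f) z * g z)"
    by (auto simp: fun_eq_iff rat_scale_def algebra_simps)
  ultimately show ?case by simp
qed

lemma mono_span_restr_mult:
  assumes "restr Y f \<in> mono_span Y e" "restr Y g \<in> mono_span Y e'"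
  shows "restr Y (\<lambda>x y. f x y * g x y) \<in> mono_span Y (e + e')"
proof -
  have "restr Y (\<lambda>x y. f x y * g x y) = (\<lambda>z. restr Y f z * restr Y g z)"
    by (auto simp: restr_def fun_eq_iff)
  then show ?thesis using mono_span_mult[OF assms] by simp
qed

lemma mono_span_restr_power:
  assumes "restr Y f \<in> mono_span Y e"
  shows "restr Y (\<lambda>x y. f x y ^ k) \<in> mono_span Y (e * k)"
proof (induction k)
  case 0
  then show ?case using mono_span_base[of 0 0 0 Y] by simp
next
  case (Suc k)
  then show ?case using mono_span_restr_mult[OF assms Suc] by simp
qed

lemma mono_span_mono: "e \<le> e' \<Longrightarrow> mono_span Y e \<subseteq> mono_span Y e'"
  unfolding mono_span_def by (intro rat_fun.span_mono image_mono) auto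

lemma mono_span_rpoly2:
  assumes "rat_polyfun2 f" shows "\<exists>e. restr Y f \<in> mono_span Y e"
proof -
  obtain P where P: "f = (\<lambda>x y. rpoly2 P x y)" using assms unfolding rat_polyfun2_def by blast
  define E where "E = Max (insert 0 ((\<lambda>j. degree (coeff P j)) ` {..degree P}))"
  have E: "degree (coeff P j) \<le> E" for j
  proof (cases "j \<le> degree P")
    case True
    then show ?thesis unfolding E_def by (intro Max_ge) auto
  qed (simp add: coeff_eq_0)
  have "restr Y f = (\<Sum>j\<le>degree P. \<Sum>i\<le>E. rat_scale (coeff (coeff P j) i) (restr Y (\<lambda>x y. x ^ i * y ^ j)))"
    unfolding P rpoly2_eq_sum[OF order_refl E] fun_eq_iff
    by (auto simp: restr_def rat_scale_def sum_fun_apply algebra_simps intro!: sum.cong)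
  also have "\<dots> \<in> mono_span Y (E + degree P)"
    unfolding mono_span_def
    by (intro rat_fun.span_sum rat_fun.span_scale rat_fun.span_base) auto
  finally show ?thesis by blast
qed

text \<open>
  Modulo the equation of the curve, a monomial divisible by the leading monomial \<open>x ^ p * y ^ q\<close> of that
  equation (ordered by total degree, then by the exponent of \<open>x\<close>) is a combination of smaller ones. The
  remaining monomials of degree at most \<open>E\<close> are linear in number.
\<close>

lemma mono_span_small:
  assumes H: "H \<noteq> 0" and Y: "\<And>x y. (x, y) \<in> Y \<Longrightarrow> rpoly2 H x y = 0"
  obtains s :: nat where "\<And>E. \<exists>T. finite T \<and> card T \<le> s * (E + 1) \<and> mono_span Y E \<subseteq> rat_fun.span T"
proof -
  define h where "h = (\<lambda>(i, j). coeff (coeff H j) i)"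
  define M where "M = Max (insert 0 ((\<lambda>j. degree (coeff H j)) ` {..degree H}))"
  have M: "degree (coeff H j) \<le> M" for j
  proof (cases "j \<le> degree H")
    case True
    then show ?thesis unfolding M_def by (intro Max_ge) auto
  qed (simp add: coeff_eq_0)
  define S where "S = {z \<in> {..M} \<times> {..degree H}. h z \<noteq> 0}"
  have "finite S" unfolding S_def by simp
  have "S \<noteq> {}"
  proof -
    have "lead_coeff (lead_coeff H) \<noteq> 0" using H by simp
    then have "(degree (lead_coeff H), degree H) \<in> S" using M by (auto simp: S_def h_def)
    then show ?thesis by blast
  qed
  define D where "D = Max ((\<lambda>(i, j). i + j) ` S)"
  have D: "i + j \<le> D" if "(i, j) \<in> S" for i j
    unfolding D_def using \<open>finite S\<close> that by (intro Max_ge) (auto intro: rev_image_eqI)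
  have "D \<in> (\<lambda>(i, j). i + j) ` S" unfolding D_def using \<open>finite S\<close> \<open>S \<noteq> {}\<close> by (intro Max_in) auto
  then obtain i j where "(i, j) \<in> S" "D = i + j" by auto
  then have "i \<in> {i. (i, D - i) \<in> S \<and> i \<le> D}" by simp
  then have ne: "{i. (i, D - i) \<in> S \<and> i \<le> D} \<noteq> {}" by blast
  define p where "p = Max {i. (i, D - i) \<in> S \<and> i \<le> D}"
  have fin: "finite {i. (i, D - i) \<in> S \<and> i \<le> D}" by (rule finite_subset[of _ "{..D}"]) auto
  have "p \<in> {i. (i, D - i) \<in> S \<and> i \<le> D}" unfolding p_def using fin ne by (rule Max_in)
  then have pS: "(p, D - p) \<in> S" "p \<le> D" by auto
  define q where "q = D - p"
  have lower: "i + j < D \<or> (i + j = D \<and> i < p)" if "(i, j) \<in> S - {(p, q)}" for i j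
  proof (cases "i + j = D")
    case True
    then have "i \<in> {i. (i, D - i) \<in> S \<and> i \<le> D}" using that by auto
    then have "i \<le> p" unfolding p_def using fin by simp
    moreover have "i \<noteq> p" using that True unfolding q_def by auto
    ultimately show ?thesis using True by simp
  qed (use D[of i j] that in auto)
  have hpq: "h (p, q) \<noteq> 0" using pS unfolding q_def S_def by simp
  have rel: "(\<Sum>(k, l)\<in>S. of_rat (h (k, l)) * (x ^ k * y ^ l)) = (0::complex)" if "(x, y) \<in> Y" for x y
  proof -
    have "(\<Sum>(k, l)\<in>S. of_rat (h (k, l)) * (x ^ k * y ^ l)) =
      (\<Sum>(k, l)\<in>{..M} \<times> {..degree H}. of_rat (h (k, l)) * (x ^ k * y ^ l))"
      by (intro sum.mono_neutral_left) (auto simp: S_def)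
    also have "\<dots> = rpoly2 H x y"
      unfolding rpoly2_eq_sum[OF order_refl M] sum.cartesian_product[symmetric]
      by (subst sum.swap) (simp add: h_def mult.assoc)
    finally show ?thesis using Y[OF that] by simp
  qed
  let ?m = "\<lambda>(i, j). restr Y (\<lambda>x y. x ^ i * y ^ j)"
  show ?thesis
  proof (rule that[of "p + q"])
    fix E
    define T where "T = ?m ` ({..<p} \<times> {..E} \<union> {..E} \<times> {..<q})"
    have "finite T" unfolding T_def by simp
    have "card T \<le> card ({..<p} \<times> {..E} \<union> {..E} \<times> {..<q})" unfolding T_def by (intro card_image_le) simp
    also have "\<dots> \<le> p * (E + 1) + (E + 1) * q"
      by (rule order_trans[OF card_Un_le]) (simp add: card_cartesian_product)
    finally have card: "card T \<le> (p + q) * (E + 1)" by (simp add: algebra_simps)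
    have "i + j \<le> E \<Longrightarrow> ?m (i, j) \<in> rat_fun.span T" for i j
    \<comment> \<open>The measure encodes the lexicographic order of (i + j, i), since i never
      exceeds E.\<close>
    proof (induction "(i + j) * (E + 1) + i" arbitrary: i j rule: less_induct)
      case less
      show ?case
      proof (cases "i < p \<or> j < q")
        case True
        then have "?m (i, j) \<in> T" unfolding T_def using less.prems by (intro imageI) auto
        then show ?thesis by (rule rat_fun.span_base)
      next
        case False
        then have ij: "p \<le> i" "q \<le> j" by auto
        have pq: "p + q = D" using pS(2) by (simp add: q_def)
        have eq: "?m (i, j) = (\<Sum>(k, l)\<in>S - {(p, q)}. rat_scale (- (h (k, l) / h (p, q))) (?m (i - p + k, j - q + l)))"
        proof
          fix z :: "complex \<times> complex"
          obtain x y where z: "z = (x, y)" by fastforce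
          show "?m (i, j) z = (\<Sum>(k, l)\<in>S - {(p, q)}. rat_scale (- (h (k, l) / h (p, q))) (?m (i - p + k, j - q + l))) z"
          proof (cases "z \<in> Y")
            case True
            have "(p, q) \<in> S" using pS by (simp add: q_def)
            then have "(\<Sum>(k, l)\<in>S - {(p, q)}. of_rat (h (k, l)) * (x ^ k * y ^ l)) = - of_rat (h (p, q)) * (x ^ p * y ^ q)"
              using rel[of x y] True \<open>finite S\<close> unfolding z by (subst sum_diff1) auto
            then have "x ^ (i - p) * y ^ (j - q) / of_rat (h (p, q)) *
                (\<Sum>(k, l)\<in>S - {(p, q)}. of_rat (h (k, l)) * (x ^ k * y ^ l)) = - (x ^ (i - p) * x ^ p * (y ^ (j - q) * y ^ q))"
              using hpq by simp
            moreover have "x ^ (i - p) * x ^ p = x ^ i" "y ^ (j - q) * y ^ q = y ^ j"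
              using ij by (simp_all add: power_add[symmetric])
            ultimately have "x ^ i * y ^ j = - (x ^ (i - p) * y ^ (j - q) / of_rat (h (p, q)) *
                (\<Sum>(k, l)\<in>S - {(p, q)}. of_rat (h (k, l)) * (x ^ k * y ^ l)))" by simp
            also have "\<dots> = (\<Sum>(k, l)\<in>S - {(p, q)}. of_rat (- (h (k, l) / h (p, q))) * (x ^ (i - p + k) * y ^ (j - q + l)))"
              unfolding sum_distrib_left sum_negf[symmetric]
              by (intro sum.cong refl) (auto simp: power_add of_rat_minus of_rat_divide)
            finally show ?thesis using True unfolding z
              by (simp add: restr_def rat_scale_def sum_fun_apply split_beta)
          next
            case False
            then show ?thesis by (simp add: restr_def rat_scale_def sum_fun_apply split_beta)
          qed
        qed
        show ?thesis unfolding eq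
        proof (rule rat_fun.span_sum)
          fix kl assume kl: "kl \<in> S - {(p, q)}"
          obtain k l where k: "kl = (k, l)" by fastforce
          then have cases: "k + l < D \<or> (k + l = D \<and> k < p)" using lower[of k l] kl by auto
          let ?i = "i - p + k" and ?j = "j - q + l"
          have s: "?i + ?j + D = i + j + (k + l)" using ij pq by linarith
          then have le: "?i + ?j \<le> i + j" using cases by linarith
          then have "?i + ?j \<le> E" using less.prems by linarith
          moreover have "(?i + ?j) * (E + 1) + ?i < (i + j) * (E + 1) + i"
          proof (cases "k + l = D")
            case True
            then have "?i + ?j = i + j" "?i < i" using s cases ij by linarith+
            then show ?thesis by simp
          next
            case False
            then have "?i + ?j + 1 \<le> i + j" using s cases by linarith
            then have "(?i + ?j + 1) * (E + 1) \<le> (i + j) * (E + 1)" by (rule mult_le_mono1)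
            moreover have "?i < E + 1" using \<open>?i + ?j \<le> E\<close> by linarith
            ultimately show ?thesis by simp
          qed
          ultimately have "?m (?i, ?j) \<in> rat_fun.span T" by (intro less.hyps)
          then show "(case kl of (k, l) \<Rightarrow> rat_scale (- (h (k, l) / h (p, q))) (?m (i - p + k, j - q + l))) \<in> rat_fun.span T"
            unfolding k prod.case by (rule rat_fun.span_scale)
        qed
      qed
    qed
    then have "mono_span Y E \<subseteq> rat_fun.span T"
      unfolding mono_span_def by (intro rat_fun.span_minimal) (auto simp: rat_fun.subspace_span)
    then show "\<exists>T. finite T \<and> card T \<le> (p + q) * (E + 1) \<and> mono_span Y E \<subseteq> rat_fun.span T"
      using \<open>finite T\<close> card by blast
  qed
qed

text \<open>A dimension count: the (K + 1)^2 products with exponents a, b up to K lie in a space of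
  dimension at most s (2 e K + 1). The padding with powers of f0 makes the relation homogeneous of
  degree 2 K, so that it becomes a relation between forms on projective space.\<close>

theorem algebraic_dependence:
  assumes H: "H \<noteq> 0" and Y: "\<And>x y. (x, y) \<in> Y \<Longrightarrow> rpoly2 H x y = 0"
    and f: "rat_polyfun2 f0" "rat_polyfun2 f1" "rat_polyfun2 f2"
  obtains K r where "\<exists>a\<le>K. \<exists>b\<le>K. r a b \<noteq> (0::rat)"
    "\<And>x y. (x, y) \<in> Y \<Longrightarrow>
      (\<Sum>a\<le>K. \<Sum>b\<le>K. of_rat (r a b) * f0 x y ^ (2 * K - a - b) * f1 x y ^ a * f2 x y ^ b) = 0"
proof -
  obtain s :: nat where s: "\<And>E. \<exists>T. finite T \<and> card T \<le> s * (E + 1) \<and> mono_span Y E \<subseteq> rat_fun.span T"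
    using mono_span_small[of H Y, OF H Y] by metis
  obtain e0 e1 e2 where e': "restr Y f0 \<in> mono_span Y e0" "restr Y f1 \<in> mono_span Y e1" "restr Y f2 \<in> mono_span Y e2"
    using f mono_span_rpoly2 by metis
  define e where "e = e0 + e1 + e2"
  have e: "restr Y f0 \<in> mono_span Y e" "restr Y f1 \<in> mono_span Y e" "restr Y f2 \<in> mono_span Y e"
    using e' mono_span_mono[of e0 e Y] mono_span_mono[of e1 e Y] mono_span_mono[of e2 e Y] unfolding e_def by auto
  \<comment> \<open>Chosen such that s (2 e K + 2 K) = K^2.\<close>
  define K where "K = 2 * s * (e + 1)"
  define w where "w = (\<lambda>(a, b). restr Y (\<lambda>x y. f0 x y ^ (2 * K - a - b) * (f1 x y ^ a * f2 x y ^ b)))"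
  define I where "I = {..K} \<times> {..K}"
  obtain T where T: "finite T" "card T \<le> s * (e * (2 * K) + 1)" "mono_span Y (e * (2 * K)) \<subseteq> rat_fun.span T"
    using s by blast
  have wT: "w z \<in> rat_fun.span T" if "z \<in> I" for z
  proof -
    obtain a b where z: "z = (a, b)" "a \<le> K" "b \<le> K" using \<open>z \<in> I\<close> by (auto simp: I_def)
    have "w z \<in> mono_span Y (e * (2 * K - a - b) + (e * a + e * b))"
      unfolding w_def z prod.case by (intro mono_span_restr_mult mono_span_restr_power e)
    also have "e * (2 * K - a - b) + (e * a + e * b) = e * (2 * K)"
      unfolding distrib_left[symmetric] using z by simp
    finally show ?thesis using T by blast
  qed
  have cardlt: "card T < card I"
  proof -
    have "s * (e * (2 * K) + 1) \<le> K * K"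
    proof (cases "s = 0")
      case False
      then have "1 \<le> K" by (simp add: K_def)
      then have "s * (e * (2 * K) + 1) \<le> s * (e * (2 * K) + 2 * K)" by (intro mult_le_mono2 add_left_mono) simp
      also have "\<dots> = K * K" unfolding K_def by (simp add: algebra_simps)
      finally show ?thesis .
    qed simp
    also have "\<dots> < card I" by (simp add: I_def card_cartesian_product)
    finally show ?thesis using T(2) by linarith
  qed
  have "\<exists>r. (\<exists>z\<in>I. r z \<noteq> (0::rat)) \<and> (\<Sum>z\<in>I. rat_scale (r z) (w z)) = 0"
  \<comment> \<open>Linear dependence is a notion for sets of vectors, so different exponents with
    equal restrictions are treated separately.\<close>
  proof (cases "inj_on w I")
    case True
    have fin: "finite (w ` I)" by (simp add: I_def)
    have "rat_fun.dependent (w ` I)"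
    proof (rule ccontr)
      assume "\<not> rat_fun.dependent (w ` I)"
      then have "card (w ` I) \<le> card T"
        using rat_fun.independent_span_bound[OF T(1)] image_subsetI[of I w, OF wT] by blast
      then show False using cardlt card_image[OF True] by simp
    qed
    then obtain u where u: "\<exists>v\<in>w ` I. u v \<noteq> 0" "(\<Sum>v\<in>w ` I. rat_scale (u v) v) = 0"
      using rat_fun.dependent_finite[OF fin] by auto
    then show ?thesis by (intro exI[of _ "\<lambda>z. u (w z)"]) (auto simp: sum.reindex[OF True])
  next
    case False
    then obtain z1 z2 where z: "z1 \<in> I" "z2 \<in> I" "w z1 = w z2" "z1 \<noteq> z2" unfolding inj_on_def by blast
    let ?r = "\<lambda>z. if z = z1 then 1 else if z = z2 then - 1 else 0 :: rat"
    have "(\<Sum>z\<in>I. rat_scale (?r z) (w z)) = (\<Sum>z\<in>{z1, z2}. rat_scale (?r z) (w z))"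
      by (rule sum.mono_neutral_right) (use z in \<open>auto simp: I_def rat_scale_def\<close>)
    also have "\<dots> = 0" using z by (auto simp: rat_scale_def fun_eq_iff)
    finally show ?thesis using z(1) by (intro exI[of _ ?r]) auto
  qed
  then obtain r where r: "\<exists>z\<in>I. r z \<noteq> (0::rat)" "(\<Sum>z\<in>I. rat_scale (r z) (w z)) = 0" by blast
  show ?thesis
  proof (rule that[of K "\<lambda>a b. r (a, b)"])
    show "\<exists>a\<le>K. \<exists>b\<le>K. r (a, b) \<noteq> 0" using r(1) by (auto simp: I_def)
    fix x y assume xy: "(x, y) \<in> Y"
    have "(\<Sum>z\<in>I. rat_scale (r z) (w z)) (x, y) = 0" using r(2) by simp
    then show "(\<Sum>a\<le>K. \<Sum>b\<le>K. of_rat (r (a, b)) * f0 x y ^ (2 * K - a - b) * f1 x y ^ a * f2 x y ^ b) = 0"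
      unfolding sum_fun_apply I_def sum.cartesian_product[symmetric]
      using xy by (simp add: sum.cartesian_product split_beta rat_scale_def w_def restr_def mult.assoc)
  qed
qed

section \<open>Closed sets and dimension in projective space\<close>

text \<open>Forms are handled through their values. The degree is a parameter because the zero
  function is a form of every degree.\<close>

definition rat_form :: "nat \<Rightarrow> nat \<Rightarrow> ((nat \<Rightarrow> complex) \<Rightarrow> complex) \<Rightarrow> bool" where
  "rat_form N d F \<longleftrightarrow> (\<exists>p\<in>forms \<rat> N d. \<forall>v. form_eval p v = F v)"

lemma rat_form_const: "c \<in> \<rat> \<Longrightarrow> rat_form N 0 (\<lambda>v. c)"
  unfolding rat_form_def
  by (intro bexI[of _ "Poly_Mapping.single 0 c"]) (auto simp: form_eval_single monom_eval_def forms_def)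

lemma rat_form_var: "i \<le> N \<Longrightarrow> rat_form N 1 (\<lambda>v. v i)"
  unfolding rat_form_def
  by (intro bexI[of _ "Poly_Mapping.single (Poly_Mapping.single i 1) 1"])
    (auto simp: form_eval_single monom_eval_def forms_def)

lemma rat_form_mult: "rat_form N d F \<Longrightarrow> rat_form N e G \<Longrightarrow> rat_form N (d + e) (\<lambda>v. F v * G v)"
  unfolding rat_form_def using forms_mult form_eval_mult by metis

lemma rat_form_zero: "rat_form N d (\<lambda>v. 0)"
  unfolding rat_form_def by (intro bexI[of _ 0]) (auto simp: forms_def)

lemma rat_form_add:
  assumes "rat_form N d F" "rat_form N d G" shows "rat_form N d (\<lambda>v. F v + G v)"
proof -
  obtain p q where pq: "p \<in> forms \<rat> N d" "q \<in> forms \<rat> N d"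
    and eval: "\<And>v. form_eval p v = F v" "\<And>v. form_eval q v = G v"
    using assms unfolding rat_form_def by blast
  have rat: "Poly_Mapping.lookup p m \<in> \<rat>" "Poly_Mapping.lookup q m \<in> \<rat>" for m
    using pq by (cases "m \<in> Poly_Mapping.keys p"; cases "m \<in> Poly_Mapping.keys q"; auto simp: forms_def in_keys_iff)+
  have "p + q \<in> forms \<rat> N d"
    unfolding forms_def
  proof (intro CollectI ballI)
    fix m assume "m \<in> Poly_Mapping.keys (p + q)"
    then have "m \<in> Poly_Mapping.keys p \<or> m \<in> Poly_Mapping.keys q"
      using Poly_Mapping.keys_add[of p q] by blast
    then have "Poly_Mapping.keys m \<subseteq> {..N} \<and> (\<Sum>i\<in>Poly_Mapping.keys m. Poly_Mapping.lookup m i) = d"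
      using pq by (auto simp: forms_def)
    then show "Poly_Mapping.lookup (p + q) m \<in> \<rat> \<and> Poly_Mapping.keys m \<subseteq> {..N} \<and>
        (\<Sum>i\<in>Poly_Mapping.keys m. Poly_Mapping.lookup m i) = d"
      using rat by (simp add: lookup_add)
  qed
  then show ?thesis unfolding rat_form_def using eval
    by (intro bexI[of _ "p + q"]) (auto simp: form_eval_add)
qed

lemma rat_form_cmult: "c \<in> \<rat> \<Longrightarrow> rat_form N d F \<Longrightarrow> rat_form N d (\<lambda>v. c * F v)"
  using rat_form_mult[OF rat_form_const] by fastforce

lemma rat_form_diff: "rat_form N d F \<Longrightarrow> rat_form N d G \<Longrightarrow> rat_form N d (\<lambda>v. F v - G v)"
  using rat_form_add[of N d F "\<lambda>v. - 1 * G v"] rat_form_cmult[of "- 1" N d G] by simp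

lemma rat_form_sum: "(\<And>i. i \<in> A \<Longrightarrow> rat_form N d (F i)) \<Longrightarrow> rat_form N d (\<lambda>v. \<Sum>i\<in>A. F i v)"
  by (induction A rule: infinite_finite_induct) (auto intro!: rat_form_zero rat_form_add)

lemma rat_form_power: "rat_form N d F \<Longrightarrow> rat_form N (d * k) (\<lambda>v. F v ^ k)"
proof (induction k)
  case 0
  then show ?case using rat_form_const[of 1] by simp
next
  case (Suc k)
  then show ?case using rat_form_mult[of N d F] by simp
qed

lemma rat_form_degree: "rat_form N d F \<Longrightarrow> d = e \<Longrightarrow> rat_form N e F"
  by simp

lemma rat_form_scale: "rat_form N d F \<Longrightarrow> F (\<lambda>i. c * v i) = c ^ d * F v"
  unfolding rat_form_def using form_eval_scale by metis

section \<open>Points of projective space and zero sets of forms\<close>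

lemma proj_pt_scale: "v \<in> proj_pt w \<longleftrightarrow> (\<exists>c. c \<noteq> 0 \<and> v = (\<lambda>i. c * w i))"
  by (auto simp: proj_pt_def)

lemma self_in_proj_pt: "v \<in> proj_pt v"
  unfolding proj_pt_scale by (intro exI[of _ 1]) simp

lemma proj_pt_eq:
  assumes "c \<noteq> 0" shows "proj_pt (\<lambda>i. c * v i) = proj_pt v"
proof -
  have "w \<in> proj_pt (\<lambda>i. c * v i) \<longleftrightarrow> w \<in> proj_pt v" for w
  proof
    assume "w \<in> proj_pt (\<lambda>i. c * v i)"
    then obtain e where "e \<noteq> 0" "w = (\<lambda>i. e * (c * v i))" by (auto simp: proj_pt_scale)
    then show "w \<in> proj_pt v" unfolding proj_pt_scale using assms
      by (intro exI[of _ "e * c"]) (simp add: mult.assoc)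
  next
    assume "w \<in> proj_pt v"
    then obtain e where "e \<noteq> 0" "w = (\<lambda>i. e * v i)" by (auto simp: proj_pt_scale)
    then show "w \<in> proj_pt (\<lambda>i. c * v i)" unfolding proj_pt_scale using assms
      by (intro exI[of _ "e / c"]) simp
  qed
  then show ?thesis by blast
qed

lemma proj_pt_of_mem: "v \<in> proj_pt w \<Longrightarrow> proj_pt v = proj_pt w"
  using proj_pt_eq unfolding proj_pt_scale by blast

lemma proj_pt_in_space: "proj_pt v \<in> proj_space N \<longleftrightarrow> v \<in> vec_space N - {0}"
proof
  assume "proj_pt v \<in> proj_space N"
  then obtain w where w: "w \<in> vec_space N - {0}" "proj_pt v = proj_pt w" by (auto simp: proj_space_def)
  then have "v \<in> proj_pt w" using self_in_proj_pt by blast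
  then obtain c where "c \<noteq> 0" "v = (\<lambda>i. c * w i)" by (auto simp: proj_pt_scale)
  then show "v \<in> vec_space N - {0}" using w(1) by (auto simp: vec_space_def fun_eq_iff)
qed (simp add: proj_space_def)

lemma proj_spaceE:
  assumes "P \<in> proj_space N"
  obtains v where "v \<in> vec_space N" "v \<noteq> 0" "P = proj_pt v" "v \<in> P"
  using assms self_in_proj_pt by (auto simp: proj_space_def)

definition form_zeros :: "nat \<Rightarrow> ((nat \<Rightarrow> complex) \<Rightarrow> complex) \<Rightarrow> point set" where
  "form_zeros N F = {P \<in> proj_space N. \<forall>v\<in>P. F v = 0}"

lemma closedin_form_zeros: "rat_form N d F \<Longrightarrow> closedin (zariski N) (form_zeros N F)"
  unfolding closedin_zariski rat_form_def
proof (elim bexE)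
  fix p assume "p \<in> forms \<rat> N d" "\<forall>v. form_eval p v = F v"
  then show "\<exists>S\<subseteq>\<Union> (range (forms \<rat> N)). form_zeros N F = zero_locus N S"
    by (intro exI[of _ "{p}"]) (auto simp: form_zeros_def zero_locus_def)
qed

lemma form_zeros_iff:
  assumes "rat_form N d F" "v \<in> P" "P \<in> proj_space N"
  shows "P \<in> form_zeros N F \<longleftrightarrow> F v = 0"
proof -
  obtain w where w: "P = proj_pt w" using assms(3) by (auto simp: proj_space_def)
  then have P: "P = proj_pt v" using proj_pt_of_mem assms(2) by blast
  have "F u = 0" if "u \<in> P" "F v = 0" for u
  proof -
    have "u \<in> proj_pt v" using that(1) P by (rule subst[rotated])
    then obtain c where "c \<noteq> 0" "u = (\<lambda>i. c * v i)" by (auto simp: proj_pt_scale)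
    then show ?thesis using rat_form_scale[OF assms(1)] that by simp
  qed
  then show ?thesis using assms by (auto simp: form_zeros_def)
qed

lemma form_zeros_proj_pt:
  assumes "rat_form N d F" "v \<in> vec_space N - {0}"
  shows "proj_pt v \<in> form_zeros N F \<longleftrightarrow> F v = 0"
  using form_zeros_iff[OF assms(1) self_in_proj_pt] assms(2) by (simp add: proj_pt_in_space)

lemma not_in_closed:
  assumes "closedin (zariski N) A" "P \<notin> A" "P \<in> proj_space N"
  obtains d F where "rat_form N d F" "A \<subseteq> form_zeros N F" "P \<notin> form_zeros N F"
proof -
  obtain S where S: "S \<subseteq> (\<Union>d. forms \<rat> N d)" "A = zero_locus N S"
    using assms(1) unfolding closedin_zariski by blast
  then obtain p where p: "p \<in> S" "\<not> (\<forall>v\<in>P. form_eval p v = 0)"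
    using assms by (auto simp: zero_locus_def)
  then obtain d where "p \<in> forms \<rat> N d" using S by blast
  then have "rat_form N d (form_eval p)" unfolding rat_form_def by blast
  then show ?thesis
    by (rule that) (use S p in \<open>auto simp: zero_locus_def form_zeros_def\<close>)
qed

lemma closure_zariski:
  assumes "A \<subseteq> proj_space N"
  shows "zariski N closure_of A = zero_locus N (vanishing_forms N A)"
proof
  have "vanishing_forms N A \<subseteq> (\<Union>d. forms \<rat> N d)" by (auto simp: vanishing_forms_def)
  then have "closedin (zariski N) (zero_locus N (vanishing_forms N A))"
    unfolding closedin_zariski by blast
  moreover have "A \<subseteq> zero_locus N (vanishing_forms N A)"
    using assms by (auto simp: zero_locus_def vanishing_forms_def)
  ultimately show "zariski N closure_of A \<subseteq> zero_locus N (vanishing_forms N A)"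
    by (intro closure_of_minimal)
next
  show "zero_locus N (vanishing_forms N A) \<subseteq> zariski N closure_of A"
  proof
    fix P assume P: "P \<in> zero_locus N (vanishing_forms N A)"
    then have PN: "P \<in> proj_space N" by (simp add: zero_locus_def)
    have AC: "A \<subseteq> zariski N closure_of A"
      using assms by (intro closure_of_subset) (simp add: topspace_zariski)
    show "P \<in> zariski N closure_of A"
    proof (rule ccontr)
      assume "P \<notin> zariski N closure_of A"
      then obtain d F where F: "rat_form N d F" "zariski N closure_of A \<subseteq> form_zeros N F" "P \<notin> form_zeros N F"
        using not_in_closed[OF closedin_closure_of _ PN] by blast
      obtain p where p: "p \<in> forms \<rat> N d" "\<And>v. form_eval p v = F v" using F(1) unfolding rat_form_def by blast
      then have "p \<in> vanishing_forms N A"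
        using F(2) AC by (auto simp: vanishing_forms_def form_zeros_def)
      then have "P \<in> form_zeros N F" using P p by (auto simp: zero_locus_def form_zeros_def)
      then show False using F(3) by blast
    qed
  qed
qed

subsection \<open>Irreducible closed sets\<close>

lemma irreducible_closed_closure:
  assumes "S \<subseteq> topspace T" "S \<noteq> {}"
    and "\<And>A B. closedin T A \<Longrightarrow> closedin T B \<Longrightarrow> S \<subseteq> A \<union> B \<Longrightarrow> S \<subseteq> A \<or> S \<subseteq> B"
  shows "irreducible_closed T (T closure_of S)"
proof -
  have sub: "S \<subseteq> T closure_of S" using assms(1) by (rule closure_of_subset)
  show ?thesis unfolding irreducible_closed_def
  proof (intro conjI allI impI)
    show "T closure_of S \<noteq> {}" using sub assms(2) by blast
    fix A B assume AB: "closedin T A" "closedin T B" "T closure_of S \<subseteq> A \<union> B"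
    then have "S \<subseteq> A \<or> S \<subseteq> B" using assms(3) sub by blast
    then show "T closure_of S \<subseteq> A \<or> T closure_of S \<subseteq> B" using closure_of_minimal AB by metis
  qed simp
qed

lemma irreducible_closed_closure_point: "P \<in> topspace T \<Longrightarrow> irreducible_closed T (T closure_of {P})"
  by (rule irreducible_closed_closure) auto

lemma irreducible_closed_subset_UN:
  assumes Z: "irreducible_closed T Z" and "finite I" and "\<And>i. i \<in> I \<Longrightarrow> closedin T (F i)" and "Z \<subseteq> (\<Union>i\<in>I. F i)"
  shows "\<exists>i\<in>I. Z \<subseteq> F i"
  using assms(2-4)
proof (induction I rule: finite_induct)
  case empty
  then show ?case using Z by (auto simp: irreducible_closed_def)
next
  case (insert i I)
  have "closedin T (\<Union>i\<in>I. F i)" using insert by (intro closedin_Union) auto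
  moreover have "Z \<subseteq> F i \<union> (\<Union>i\<in>I. F i)" using insert.prems by auto
  ultimately have "Z \<subseteq> F i \<or> Z \<subseteq> (\<Union>i\<in>I. F i)"
    using Z insert.prems(1)[of i] unfolding irreducible_closed_def by blast
  then show ?case using insert by auto
qed

lemma irreducible_component_UN:
  assumes "finite I" and F: "\<And>i. i \<in> I \<Longrightarrow> irreducible_closed T (F i)"
    and Z: "irreducible_component T (\<Union>i\<in>I. F i) Z"
  shows "\<exists>i\<in>I. Z = F i"
proof -
  have "irreducible_closed T Z" "Z \<subseteq> (\<Union>i\<in>I. F i)"
    using Z unfolding irreducible_component_def by blast+
  moreover have "closedin T (F i)" if "i \<in> I" for i
    using F[OF that] unfolding irreducible_closed_def by blast
  ultimately have "\<exists>i\<in>I. Z \<subseteq> F i"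
    by (intro irreducible_closed_subset_UN[OF _ assms(1)])
  then obtain i where i: "i \<in> I" "Z \<subseteq> F i" by blast
  then have "F i = Z" using F[OF i(1)] Z unfolding irreducible_component_def by blast
  then show ?thesis using i by blast
qed

text \<open>
  Forms \<open>p\<close> and \<open>q\<close> separating the members of a chain \<open>C0 < C1 < C2\<close> satisfy a relation whose coefficients are
  powers of a form \<open>p0\<close> that does not vanish at a point of \<open>C0\<close>. Cancelling powers of \<open>q\<close> on \<open>C2\<close> and then
  powers of \<open>p\<close> on \<open>C1\<close> leaves a relation that fails at this point.
\<close>

lemma no_chain_of_length_2:
  assumes dep: "\<And>d p0 p q. rat_form N d p0 \<Longrightarrow> rat_form N d p \<Longrightarrow> rat_form N d q \<Longrightarrow>
      \<exists>K r. (\<exists>a\<le>K. \<exists>b\<le>K. r a b \<noteq> (0::rat)) \<and> X \<subseteq> form_zeros N (\<lambda>v. \<Sum>a\<le>K. \<Sum>b\<le>K.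
        of_rat (r a b) * p0 v ^ (2 * K - a - b) * p v ^ a * q v ^ b)"
  shows "\<not> irreducible_chain (zariski N) X 2"
proof
  assume "irreducible_chain (zariski N) X 2"
  then obtain C where C: "\<And>i. i \<le> 2 \<Longrightarrow> irreducible_closed (zariski N) (C i)" "\<And>i. i \<le> 2 \<Longrightarrow> C i \<subseteq> X"
    and lt: "\<And>i. i < 2 \<Longrightarrow> C i \<subset> C (Suc i)"
    unfolding irreducible_chain_def by blast
  have closed: "closedin (zariski N) (C i)" if "i \<le> 2" for i
    using C(1)[OF that] by (simp add: irreducible_closed_def)
  have CN: "C i \<subseteq> proj_space N" if "i \<le> 2" for i
    using closedin_subset[OF closed[OF that]] by (simp add: topspace_zariski)
  have irr: "C i \<subseteq> form_zeros N F \<or> C i \<subseteq> form_zeros N G"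
    if "i \<le> 2" "rat_form N d F" "rat_form N e G" "\<And>P v. P \<in> C i \<Longrightarrow> v \<in> P \<Longrightarrow> F v = 0 \<or> G v = 0" for i d e F G
  proof -
    have "C i \<subseteq> form_zeros N F \<union> form_zeros N G"
    proof
      fix P assume P: "P \<in> C i"
      then have PN: "P \<in> proj_space N" using CN that(1) by blast
      then obtain v where "v \<in> P" using proj_spaceE by blast
      then show "P \<in> form_zeros N F \<union> form_zeros N G"
        using that(4)[OF P] form_zeros_iff[OF that(2) _ PN] form_zeros_iff[OF that(3) _ PN] by blast
    qed
    moreover have "closedin (zariski N) (form_zeros N F)" "closedin (zariski N) (form_zeros N G)"
      using closedin_form_zeros that(2,3) by blast+
    ultimately show ?thesis
      using C(1)[OF that(1)] unfolding irreducible_closed_def by simp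
  qed
  obtain P where P: "P \<in> C 0" using C(1)[of 0] by (auto simp: irreducible_closed_def)
  then have PN: "P \<in> proj_space N" using CN by auto
  then obtain v where v: "v \<in> vec_space N" "v \<noteq> 0" "v \<in> P" using proj_spaceE by blast
  obtain i where i: "v i \<noteq> 0" using v(2) by (auto simp: fun_eq_iff)
  then have iN: "i \<le> N" using v(1) by (auto simp: vec_space_def intro: leI)
  have sep: "\<exists>d F. rat_form N d F \<and> C j \<subseteq> form_zeros N F \<and> \<not> C (Suc j) \<subseteq> form_zeros N F \<and> d > 0" if jl: "j < 2" for j
  proof -
    obtain Q where Q: "Q \<in> C (Suc j)" "Q \<notin> C j" using lt[OF jl] by blast
    then have QN: "Q \<in> proj_space N" using CN[of "Suc j"] jl by auto
    obtain d F where F: "rat_form N d F" "C j \<subseteq> form_zeros N F" "Q \<notin> form_zeros N F"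
      using not_in_closed[OF closed Q(2) QN] jl by auto
    \<comment> \<open>A form of degree 0 is constant, so vanishing on the nonempty
      \<open>C j\<close> it would vanish at Q as well. Positive degrees guarantee that the powers
      taken below have the same zeros as the forms themselves.\<close>
    have "d > 0"
    proof (rule ccontr)
      assume "\<not> d > 0"
      then have d: "d = 0" by simp
      have C0: "C j \<noteq> {}" using C(1)[of j] jl by (auto simp: irreducible_closed_def)
      have const: "F u = F (\<lambda>_. 0)" for u
        using rat_form_scale[OF F(1), of 0 u] d by simp
      obtain R where "R \<in> form_zeros N F" using C0 F(2) by blast
      then obtain u where "u \<in> R" "F u = 0" using proj_spaceE unfolding form_zeros_def by blast
      then have "F w = 0" for w using const by metis
      then show False using F(3) QN by (simp add: form_zeros_def)
    qed
    then show ?thesis using F Q by blast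
  qed
  obtain d1 p where p: "rat_form N d1 p" "C 0 \<subseteq> form_zeros N p" "\<not> C 1 \<subseteq> form_zeros N p" "d1 > 0"
    using sep[of 0] by auto
  obtain d2 q where q: "rat_form N d2 q" "C 1 \<subseteq> form_zeros N q" "\<not> C 2 \<subseteq> form_zeros N q" "d2 > 0"
    using sep[of 1] by (auto simp: numeral_2_eq_2)
  \<comment> \<open>Powers equalise the degrees of p, of q and of a coordinate that is nonzero at
    the chosen point of \<open>C 0\<close>.\<close>
  define D where "D = d1 * d2"
  define p' where "p' = (\<lambda>v. p v ^ d2)"
  define q' where "q' = (\<lambda>v. q v ^ d1)"
  define p0 where "p0 = (\<lambda>v::nat \<Rightarrow> complex. v i ^ D)"
  have forms: "rat_form N D p0" "rat_form N D p'" "rat_form N D q'"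
    using rat_form_power[OF rat_form_var[OF iN], of D] rat_form_power[OF p(1), of d2] rat_form_power[OF q(1), of d1]
    unfolding p0_def p'_def q'_def D_def by (simp_all add: mult.commute)
  have zp: "form_zeros N p' = form_zeros N p" and zq: "form_zeros N q' = form_zeros N q"
    using p(4) q(4) by (auto simp: form_zeros_def p'_def q'_def)
  obtain K r where r: "\<exists>a\<le>K. \<exists>b\<le>K. r a b \<noteq> (0::rat)"
    and rel: "X \<subseteq> form_zeros N (\<lambda>v. \<Sum>a\<le>K. \<Sum>b\<le>K. of_rat (r a b) * p0 v ^ (2 * K - a - b) * p' v ^ a * q' v ^ b)"
    using dep[OF forms] by blast
  \<comment> \<open>The lowest power of q that occurs in the relation; \<open>a0\<close> is then the
    lowest power of p among the terms containing it. These are the powers to be cancelled.\<close>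
  define b0 where "b0 = (LEAST b. \<exists>a\<le>K. r a b \<noteq> 0 \<and> b \<le> K)"
  have b0: "\<exists>a\<le>K. r a b0 \<noteq> 0 \<and> b0 \<le> K" and b0': "\<And>a b. b < b0 \<Longrightarrow> a \<le> K \<Longrightarrow> b \<le> K \<Longrightarrow> r a b = 0"
  proof -
    obtain a b where "a \<le> K" "b \<le> K" "r a b \<noteq> 0" using r by blast
    then show "\<exists>a\<le>K. r a b0 \<noteq> 0 \<and> b0 \<le> K"
      unfolding b0_def by (intro LeastI[of "\<lambda>b. \<exists>a\<le>K. r a b \<noteq> 0 \<and> b \<le> K" b]) blast
    show "\<And>a b. b < b0 \<Longrightarrow> a \<le> K \<Longrightarrow> b \<le> K \<Longrightarrow> r a b = 0"
      unfolding b0_def using not_less_Least by blast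
  qed
  define a0 where "a0 = (LEAST a. a \<le> K \<and> r a b0 \<noteq> 0)"
  have a0: "a0 \<le> K" "r a0 b0 \<noteq> 0"
    using LeastI_ex[of "\<lambda>a. a \<le> K \<and> r a b0 \<noteq> 0"] b0 unfolding a0_def by blast+
  have a0': "r a b0 = 0" if "a < a0" "a \<le> K" for a
    using not_less_Least that unfolding a0_def by blast
  define R1 where "R1 = (\<lambda>v. \<Sum>a\<le>K. \<Sum>b\<in>{b0..K}. of_rat (r a b) * p0 v ^ (2 * K - a - b) * p' v ^ a * q' v ^ (b - b0))"
  define R2 where "R2 = (\<lambda>v. \<Sum>a\<in>{a0..K}. of_rat (r a b0) * p0 v ^ (2 * K - a - b0) * p' v ^ (a - a0))"
  have fR1: "rat_form N (D * (2 * K - b0)) R1"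
    unfolding R1_def
  proof (intro rat_form_sum)
    fix a b assume ab: "a \<in> {..K}" "b \<in> {b0..K}"
    have "rat_form N (0 + D * (2 * K - a - b) + D * a + D * (b - b0)) (\<lambda>v.
        of_rat (r a b) * p0 v ^ (2 * K - a - b) * p' v ^ a * q' v ^ (b - b0))"
      by (intro rat_form_mult rat_form_const rat_form_power forms) simp
    moreover have "0 + D * (2 * K - a - b) + D * a + D * (b - b0) = D * (2 * K - b0)"
      using ab unfolding add_0_left distrib_left[symmetric] by simp
    ultimately show "rat_form N (D * (2 * K - b0)) (\<lambda>v.
        of_rat (r a b) * p0 v ^ (2 * K - a - b) * p' v ^ a * q' v ^ (b - b0))" by simp
  qed
  have fR2: "rat_form N (D * (2 * K - b0 - a0)) R2"
    unfolding R2_def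
  proof (intro rat_form_sum)
    fix a assume a: "a \<in> {a0..K}"
    have "rat_form N (0 + D * (2 * K - a - b0) + D * (a - a0)) (\<lambda>v.
        of_rat (r a b0) * p0 v ^ (2 * K - a - b0) * p' v ^ (a - a0))"
      by (intro rat_form_mult rat_form_const rat_form_power forms) simp
    moreover have "0 + D * (2 * K - a - b0) + D * (a - a0) = D * (2 * K - b0 - a0)"
      using a b0 unfolding add_0_left distrib_left[symmetric] by auto
    ultimately show "rat_form N (D * (2 * K - b0 - a0)) (\<lambda>v.
        of_rat (r a b0) * p0 v ^ (2 * K - a - b0) * p' v ^ (a - a0))" by simp
  qed
  have R1: "(\<Sum>a\<le>K. \<Sum>b\<le>K. of_rat (r a b) * p0 v ^ (2 * K - a - b) * p' v ^ a * q' v ^ b) = q' v ^ b0 * R1 v" for v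
  proof -
    have inner: "(\<Sum>b\<le>K. of_rat (r a b) * p0 v ^ (2 * K - a - b) * p' v ^ a * q' v ^ b) =
        (\<Sum>b\<in>{b0..K}. q' v ^ b0 * (of_rat (r a b) * p0 v ^ (2 * K - a - b) * p' v ^ a * q' v ^ (b - b0)))"
      if "a \<le> K" for a
    proof -
      have "(\<Sum>b\<le>K. of_rat (r a b) * p0 v ^ (2 * K - a - b) * p' v ^ a * q' v ^ b) =
        (\<Sum>b\<in>{b0..K}. of_rat (r a b) * p0 v ^ (2 * K - a - b) * p' v ^ a * q' v ^ b)"
        using b0' that by (intro sum.mono_neutral_right) auto
      also have "\<dots> = (\<Sum>b\<in>{b0..K}. q' v ^ b0 * (of_rat (r a b) * p0 v ^ (2 * K - a - b) * p' v ^ a * q' v ^ (b - b0)))"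
        by (intro sum.cong refl) (simp add: power_add[symmetric] algebra_simps)
      finally show ?thesis .
    qed
    show ?thesis unfolding R1_def sum_distrib_left by (rule sum.cong[OF refl], rule inner) simp
  qed
  have R2: "R1 v = p' v ^ a0 * R2 v" if "q' v = 0" for v
  proof -
    have "(\<Sum>b\<in>{b0..K}. of_rat (r a b) * p0 v ^ (2 * K - a - b) * p' v ^ a * q' v ^ (b - b0)) =
        of_rat (r a b0) * p0 v ^ (2 * K - a - b0) * p' v ^ a" for a
    proof -
      have "(\<Sum>b\<in>{b0..K}. of_rat (r a b) * p0 v ^ (2 * K - a - b) * p' v ^ a * q' v ^ (b - b0)) =
        (\<Sum>b\<in>{b0}. of_rat (r a b) * p0 v ^ (2 * K - a - b) * p' v ^ a * q' v ^ (b - b0))"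
        using b0 that by (intro sum.mono_neutral_right) auto
      then show ?thesis by simp
    qed
    then have "R1 v = (\<Sum>a\<le>K. of_rat (r a b0) * p0 v ^ (2 * K - a - b0) * p' v ^ a)" by (simp add: R1_def)
    also have "\<dots> = (\<Sum>a\<in>{a0..K}. of_rat (r a b0) * p0 v ^ (2 * K - a - b0) * p' v ^ a)"
      using a0' by (intro sum.mono_neutral_right) auto
    also have "\<dots> = p' v ^ a0 * R2 v"
      unfolding R2_def sum_distrib_left by (intro sum.cong refl) (simp add: power_add[symmetric] algebra_simps)
    finally show ?thesis .
  qed
  have "C 2 \<subseteq> form_zeros N q' \<or> C 2 \<subseteq> form_zeros N R1"
  proof (rule irr[OF _ forms(3) fR1])
    fix P v assume "P \<in> C 2" "v \<in> P"
    then have "q' v ^ b0 * R1 v = 0" using rel C(2)[of 2] unfolding R1 form_zeros_def by blast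
    then show "q' v = 0 \<or> R1 v = 0" by auto
  qed simp
  then have "C 2 \<subseteq> form_zeros N R1" using q(3) zq by simp
  then have C1: "C 1 \<subseteq> form_zeros N R1" using lt[of 1] by (auto simp: numeral_2_eq_2)
  have "C 1 \<subseteq> form_zeros N p' \<or> C 1 \<subseteq> form_zeros N R2"
  proof (rule irr[OF _ forms(2) fR2])
    fix P v assume *: "P \<in> C 1" "v \<in> P"
    then have "q' v = 0" using q(2) zq[symmetric] unfolding form_zeros_def[of N q'] by auto
    moreover have "R1 v = 0" using C1 * by (auto simp: form_zeros_def)
    ultimately show "p' v = 0 \<or> R2 v = 0" using R2 by auto
  qed simp
  then have "C 1 \<subseteq> form_zeros N R2" using p(3) zp by simp
  then have "C 0 \<subseteq> form_zeros N R2" using lt[of 0] by auto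
  then have "R2 v = 0" using P v(3) by (auto simp: form_zeros_def)
  moreover have "p' v = 0" using p(2) zp[symmetric] P v(3) unfolding form_zeros_def[of N p'] by auto
  then have "R2 v = (\<Sum>a\<in>{a0}. of_rat (r a b0) * p0 v ^ (2 * K - a - b0) * p' v ^ (a - a0))"
    unfolding R2_def using a0 by (intro sum.mono_neutral_right) auto
  ultimately show False using a0 i by (simp add: p0_def)
qed

section \<open>A completion of the curve\<close>

text \<open>The coordinates h and x h make h visible at infinity: dividing by x gives
  [1 / x : 1 : y / x : h / x : h], so in the chart v1 /= 0 the quotients v0 / v1 and v4 / v1 are the
  local coordinates 1 / x and h.\<close>

definition emb_vec :: "nat \<Rightarrow> complex \<Rightarrow> complex \<Rightarrow> nat \<Rightarrow> complex" where
  "emb_vec n x y = vec_of [1, x, y, plane_h n x y, x * plane_h n x y]"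

definition emb :: "nat \<Rightarrow> complex \<times> complex \<Rightarrow> point" where
  "emb n z = proj_pt (emb_vec n (fst z) (snd z))"

lemma emb_vec_coords:
  "emb_vec n x y 0 = 1" "emb_vec n x y 1 = x" "emb_vec n x y (Suc 0) = x" "emb_vec n x y 2 = y"
  "emb_vec n x y 3 = plane_h n x y" "emb_vec n x y 4 = x * plane_h n x y"
  "i > 4 \<Longrightarrow> emb_vec n x y i = 0"
  by (simp_all add: emb_vec_def vec_of_def eval_nat_numeral)

lemma emb_vec_cases: "i = 0 \<or> i = 1 \<or> i = 2 \<or> i = 3 \<or> i = 4 \<or> i > (4::nat)"
  by arith

lemma emb_vec_space: "emb_vec n x y \<in> vec_space 4 - {0}"
proof -
  have "emb_vec n x y \<noteq> 0" by (metis emb_vec_coords(1) zero_fun_apply zero_neq_one)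
  then show ?thesis by (auto simp: vec_space_def emb_vec_coords)
qed

lemma emb_in_space: "emb n z \<in> proj_space 4"
  unfolding emb_def proj_pt_in_space by (rule emb_vec_space)

lemma emb_in_form_zeros:
  "rat_form 4 d F \<Longrightarrow> emb n (x, y) \<in> form_zeros 4 F \<longleftrightarrow> F (emb_vec n x y) = 0"
  unfolding emb_def fst_conv snd_conv by (rule form_zeros_proj_pt[OF _ emb_vec_space])

lemma proj_pt_inj:
  assumes "proj_pt v = proj_pt w" "v i = 1" "w i = 1" shows "v = w"
proof -
  have "v \<in> proj_pt w" using self_in_proj_pt assms(1) by blast
  then obtain c where "v = (\<lambda>i. c * w i)" by (auto simp: proj_pt_scale)
  then show ?thesis using assms(2,3) by auto
qed

lemma emb_inj: "emb n z = emb n w \<Longrightarrow> z = w"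
proof -
  assume "emb n z = emb n w"
  then have "emb_vec n (fst z) (snd z) = emb_vec n (fst w) (snd w)"
    unfolding emb_def by (rule proj_pt_inj[of _ _ 0]) (simp_all add: emb_vec_coords)
  then show "z = w" using emb_vec_coords(2,4) by (metis prod_eq_iff)
qed

lemma rat_polyfun2_plane_h: "rat_polyfun2 (plane_h n)"
proof -
  have "rat_polyfun2 (\<lambda>x y. x ^ (n - 3) * (x * y + 4))" by (intro polyfun_intros) simp
  then show ?thesis by (rule back_subst[of rat_polyfun2]) (simp add: plane_h_def fun_eq_iff)
qed

lemma rat_polyfun2_emb_vec: "rat_polyfun2 (\<lambda>x y. emb_vec n x y i)"
proof -
  have h: "rat_polyfun2 (\<lambda>x y. plane_h n x y)" using rat_polyfun2_plane_h by simp
  show ?thesis using emb_vec_cases[of i]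
    by (elim disjE) (simp_all add: emb_vec_coords polyfun_intros h)
qed

lemma rat_polyfun2_pullback:
  assumes "rat_form N d F" shows "rat_polyfun2 (\<lambda>x y. F (emb_vec n x y))"
proof -
  obtain p where p: "p \<in> forms \<rat> N d" "\<And>v. form_eval p v = F v" using assms unfolding rat_form_def by blast
  then have "\<And>m. m \<in> Poly_Mapping.keys p \<Longrightarrow> Poly_Mapping.lookup p m \<in> \<rat>" by (auto simp: forms_def)
  then show ?thesis unfolding p(2)[symmetric] form_eval_def
    by (intro polyfun_intros rat_polyfun2_emb_vec) auto
qed

text \<open>The degree exceeds that of the polynomial, so that F contains a factor v i0 and vanishes
  on the excluded hyperplane. For the chart v1 /= 0 this covers the points of the curve with x = 0,
  where a local equation says nothing.\<close>

lemma homogenize: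
  assumes i: "i0 \<le> N" "i1 \<le> N" "i2 \<le> N"
  obtains d F where "rat_form N d F"
    "\<And>v. v i0 \<noteq> 0 \<Longrightarrow> F v = v i0 ^ d * rpoly2 P (v i1 / v i0) (v i2 / v i0)" "\<And>v. v i0 = 0 \<Longrightarrow> F v = 0"
proof -
  define E where "E = Max (insert 0 ((\<lambda>j. degree (coeff P j)) ` {..degree P}))"
  have E: "degree (coeff P j) \<le> E" for j
  proof (cases "j \<le> degree P")
    case True
    then show ?thesis unfolding E_def by (intro Max_ge) auto
  qed (simp add: coeff_eq_0)
  define d where "d = Suc (degree P + E)"
  define F where "F = (\<lambda>v::nat \<Rightarrow> complex. \<Sum>j\<le>degree P. \<Sum>i\<le>E.
      of_rat (coeff (coeff P j) i) * (v i0 ^ (d - i - j) * (v i1 ^ i * v i2 ^ j)))"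
  show ?thesis
  proof (rule that[of d F])
    show "rat_form N d F" unfolding F_def
    proof (intro rat_form_sum rat_form_cmult)
      fix j k assume jk: "j \<in> {..degree P}" "k \<in> {..E}"
      have "rat_form N (1 * (d - k - j) + (1 * k + 1 * j)) (\<lambda>v. v i0 ^ (d - k - j) * (v i1 ^ k * v i2 ^ j))"
        by (intro rat_form_mult rat_form_power rat_form_var i)
      then show "rat_form N d (\<lambda>v. v i0 ^ (d - k - j) * (v i1 ^ k * v i2 ^ j))"
        by (rule rat_form_degree) (use jk in \<open>auto simp: d_def\<close>)
    qed simp
    show "F v = v i0 ^ d * rpoly2 P (v i1 / v i0) (v i2 / v i0)" if "v i0 \<noteq> 0" for v
    proof -
      have "of_rat (coeff (coeff P j) i) * (v i0 ^ (d - i - j) * (v i1 ^ i * v i2 ^ j)) =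
          v i0 ^ d * (of_rat (coeff (coeff P j) i) * (v i1 / v i0) ^ i * (v i2 / v i0) ^ j)"
        if "j \<le> degree P" "i \<le> E" for i j
      proof -
        have "d = (d - i - j) + i + j" using that by (simp add: d_def)
        then have "v i0 ^ d = v i0 ^ (d - i - j) * v i0 ^ i * v i0 ^ j" by (metis power_add)
        then show ?thesis using \<open>v i0 \<noteq> 0\<close> by (simp add: power_divide)
      qed
      then show ?thesis unfolding F_def rpoly2_eq_sum[OF order_refl E] sum_distrib_left
        by (intro sum.cong refl) auto
    qed
    show "F v = 0" if "v i0 = 0" for v
      unfolding F_def using that by (intro sum.neutral ballI) (auto simp: d_def)
  qed
qed

subsection \<open>Irreducible components\<close>

definition plane_zeros :: "rat poly poly \<Rightarrow> (complex \<times> complex) set" where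
  "plane_zeros A = {(x, y). rpoly2 A x y = 0}"

text \<open>A prime factor of H whose zero set is not contained in the curve meets the curve in
  finitely many points. As the curve has no isolated points and the union of the remaining zero sets
  is closed, these points already belong to that union.\<close>

lemma plane_per_components:
  assumes n: "n \<ge> 3"
  obtains I where "finite I" "\<And>A. A \<in> I \<Longrightarrow> irreducible A" "plane_per n = (\<Union>A\<in>I. plane_zeros A)"
proof -
  obtain F where F: "\<And>f. f \<in> F \<Longrightarrow> rat_polyfun2 f"
    and per: "\<And>x y. (x, y) \<in> plane_per n \<longleftrightarrow> (\<forall>f\<in>F. f x y = 0)"
    using plane_per_closed[of n] n by auto
  obtain H where H: "H \<noteq> 0" and H0: "\<forall>(x, y)\<in>plane_per n. rpoly2 H x y = 0"
    using local_equation[OF n] by metis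
  define I where "I = {A \<in> prime_factors H. plane_zeros A \<subseteq> plane_per n}"
  have fin: "finite I" unfolding I_def by simp
  have irr: "irreducible A" if "A \<in> prime_factors H" for A
    using that by (auto simp: in_prime_factors_iff prime_elem_imp_irreducible)
  have fac: "\<exists>A\<in>prime_factors H. (x, y) \<in> plane_zeros A" if "(x, y) \<in> plane_per n" for x y
  proof -
    have "H dvd prod_mset (prime_factorization H)"
      using H by (metis dvd_normalize_iff dvd_refl prod_mset_prime_factorization_weak)
    then have "rpoly2 (prod_mset (prime_factorization H)) x y = 0"
      using H0 that rpoly2_dvd_zero by blast
    moreover have "rpoly2 (prod_mset M) x y = 0 \<Longrightarrow> \<exists>A\<in>#M. rpoly2 A x y = 0" for M
      by (induction M) auto
    ultimately show ?thesis by (auto simp: plane_zeros_def)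
  qed
  define S where "S = (\<Union>A\<in>prime_factors H - I. plane_zeros A \<inter> plane_per n)"
  have finS: "finite S" unfolding S_def
  proof (intro finite_UN_I)
    fix A assume A: "A \<in> prime_factors H - I"
    then obtain x y where xy: "(x, y) \<in> plane_zeros A" "(x, y) \<notin> plane_per n" by (auto simp: I_def)
    then obtain f where f: "f \<in> F" "f x y \<noteq> 0" using per by blast
    then obtain P where P: "\<And>x y. f x y = rpoly2 P x y" using F[OF f(1)] unfolding rat_polyfun2_def by blast
    have "\<not> A dvd P" using rpoly2_dvd_zero[of A P x y] xy(1) f(2) P by (auto simp: plane_zeros_def)
    moreover have "irreducible A" using A irr by blast
    ultimately have "finite {(x, y). rpoly2 A x y = 0 \<and> rpoly2 P x y = 0}" by (intro finite_common_zeros)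
    then show "finite (plane_zeros A \<inter> plane_per n)"
      by (rule finite_subset[rotated]) (use per f(1) P[symmetric] in \<open>auto simp: plane_zeros_def\<close>)
  qed simp
  \<comment> \<open>Closedness in the ordinary topology of the plane, in which the absence of
    isolated points was proved.\<close>
  have closed: "closed (\<Union>A\<in>I. plane_zeros A)"
  proof (rule closed_UN[OF fin], rule ballI)
    fix A :: "rat poly poly"
    have "continuous_on UNIV (\<lambda>z. rpoly2 A (fst z) (snd z))"
      unfolding continuous_on_def
      using tendsto_rpoly2[OF tendsto_fst[OF tendsto_ident_at] tendsto_snd[OF tendsto_ident_at]] by blast
    then have "closed {z. rpoly2 A (fst z) (snd z) = 0}" by (intro closed_Collect_eq continuous_intros)
    moreover have "{z. rpoly2 A (fst z) (snd z) = 0} = plane_zeros A" by (auto simp: plane_zeros_def)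
    ultimately show "closed (plane_zeros A)" by simp
  qed
  have "plane_per n \<subseteq> (\<Union>A\<in>I. plane_zeros A)"
  proof (rule ccontr)
    assume "\<not> ?thesis"
    then obtain x y where xy: "(x, y) \<in> plane_per n" "(x, y) \<in> - (\<Union>A\<in>I. plane_zeros A)" by auto
    have "(x, y) islimpt plane_per n" using plane_per_islimpt[OF _ xy(1)] n by simp
    then have inf: "infinite (- (\<Union>A\<in>I. plane_zeros A) \<inter> plane_per n)"
      unfolding islimpt_eq_acc_point by (elim allE impE) (use xy closed in \<open>auto simp: open_closed\<close>)
    have "- (\<Union>A\<in>I. plane_zeros A) \<inter> plane_per n \<subseteq> S"
    proof clarify
      fix x y assume *: "(x, y) \<notin> (\<Union>A\<in>I. plane_zeros A)" "(x, y) \<in> plane_per n"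
      then obtain A where "A \<in> prime_factors H" "(x, y) \<in> plane_zeros A" using fac by blast
      then show "(x, y) \<in> S" using * unfolding S_def by blast
    qed
    then show False using inf finS finite_subset by blast
  qed
  then have eq: "plane_per n = (\<Union>A\<in>I. plane_zeros A)" unfolding I_def by blast
  have "irreducible A" if "A \<in> I" for A using irr that unfolding I_def by blast
  then show ?thesis using that[OF fin _ eq] by blast
qed

lemma vanishing_iff_dvd:
  assumes "irreducible A" "\<And>x y. (x, y) \<in> plane_zeros A \<Longrightarrow> rpoly2 P x y = 0"
  shows "A dvd P"
proof (rule ccontr)
  assume "\<not> A dvd P"
  from finite_common_zeros[OF assms(1) this]
  have "finite {(x, y). rpoly2 A x y = 0}"
    by (rule finite_subset[rotated]) (use assms(2) in \<open>auto simp: plane_zeros_def\<close>)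
  then show False using infinite_zeros[OF assms(1)] by blast
qed

definition emb_closure :: "nat \<Rightarrow> (complex \<times> complex) set \<Rightarrow> point set" where
  "emb_closure n Y = zariski 4 closure_of (emb n ` Y)"

lemma emb_closure_subset: "emb n ` Y \<subseteq> emb_closure n Y"
  unfolding emb_closure_def by (intro closure_of_subset) (auto simp: topspace_zariski emb_in_space)

lemma emb_closure_subset_form_zeros:
  assumes "rat_form 4 d F" "\<And>x y. (x, y) \<in> Y \<Longrightarrow> F (emb_vec n x y) = 0"
  shows "emb_closure n Y \<subseteq> form_zeros 4 F"
  unfolding emb_closure_def
proof (rule closure_of_minimal)
  show "emb n ` Y \<subseteq> form_zeros 4 F" using emb_in_form_zeros[OF assms(1)] assms(2) by auto
qed (rule closedin_form_zeros[OF assms(1)])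

text \<open>Pulling forms back to the plane reduces the claim to primality of A in Q[x, y].\<close>

lemma irreducible_emb_closure:
  assumes A: "irreducible A"
  shows "irreducible_closed (zariski 4) (emb_closure n (plane_zeros A))"
  unfolding emb_closure_def
proof (rule irreducible_closed_closure)
  show "emb n ` plane_zeros A \<subseteq> topspace (zariski 4)" by (auto simp: topspace_zariski emb_in_space)
  show "emb n ` plane_zeros A \<noteq> {}"
    using infinite_zeros[OF A] unfolding plane_zeros_def by (metis finite.emptyI image_is_empty)
  fix B C assume BC: "closedin (zariski 4) B" "closedin (zariski 4) C" "emb n ` plane_zeros A \<subseteq> B \<union> C"
  show "emb n ` plane_zeros A \<subseteq> B \<or> emb n ` plane_zeros A \<subseteq> C"
  proof (rule ccontr)
    assume "\<not> ?thesis"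
    then obtain z w where z: "z \<in> plane_zeros A" "emb n z \<notin> B" and w: "w \<in> plane_zeros A" "emb n w \<notin> C" by blast
    obtain d F where F: "rat_form 4 d F" "B \<subseteq> form_zeros 4 F" "emb n z \<notin> form_zeros 4 F"
      using not_in_closed[OF BC(1) z(2) emb_in_space] by blast
    obtain e G where G: "rat_form 4 e G" "C \<subseteq> form_zeros 4 G" "emb n w \<notin> form_zeros 4 G"
      using not_in_closed[OF BC(2) w(2) emb_in_space] by blast
    obtain P Q where P: "\<And>x y. F (emb_vec n x y) = rpoly2 P x y" and Q: "\<And>x y. G (emb_vec n x y) = rpoly2 Q x y"
      using rat_polyfun2_pullback[OF F(1), of n] rat_polyfun2_pullback[OF G(1), of n] unfolding rat_polyfun2_def by blast
    have "A dvd P * Q"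
    proof (rule vanishing_iff_dvd[OF A])
      fix x y assume "(x, y) \<in> plane_zeros A"
      then have "emb n (x, y) \<in> form_zeros 4 F \<or> emb n (x, y) \<in> form_zeros 4 G" using BC(3) F(2) G(2) by blast
      then show "rpoly2 (P * Q) x y = 0"
        using emb_in_form_zeros[OF F(1)] emb_in_form_zeros[OF G(1)] P Q by auto
    qed
    then have "A dvd P \<or> A dvd Q" using A by (simp add: prime_elem_dvd_mult_iff irreducible_imp_prime_elem)
    moreover have "\<not> A dvd P"
    proof
      assume "A dvd P"
      then have "rpoly2 P (fst z) (snd z) = 0" using z(1) rpoly2_dvd_zero by (auto simp: plane_zeros_def)
      then show False using F(3) emb_in_form_zeros[OF F(1), of n "fst z" "snd z"] P by simp
    qed
    moreover have "\<not> A dvd Q"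
    proof
      assume "A dvd Q"
      then have "rpoly2 Q (fst w) (snd w) = 0" using w(1) rpoly2_dvd_zero by (auto simp: plane_zeros_def)
      then show False using G(3) emb_in_form_zeros[OF G(1), of n "fst w" "snd w"] Q by simp
    qed
    ultimately show False by blast
  qed
qed

text \<open>The closure of a point over Q can be the whole curve, namely when its coordinates are
  generic. Intersecting with a rational line, y = 0 or x = k, yields a point whose closure is
  strictly smaller and can serve as the bottom of a chain.\<close>

lemma exists_special_point:
  assumes A: "irreducible A"
  obtains B x y where "\<not> A dvd B" "(x, y) \<in> plane_zeros A" "rpoly2 B x y = 0"
proof (cases "degree A = 0")
  case True
  then obtain a where a: "A = [:a:]" by (meson degree_eq_zeroE)
  obtain x y where xy: "(x, y) \<in> plane_zeros A"
    using infinite_zeros[OF A] unfolding plane_zeros_def by (metis ex_in_conv finite.emptyI prod.exhaust)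
  then have "(x, 0) \<in> plane_zeros A" by (simp add: a plane_zeros_def)
  moreover have "rpoly2 [:0, 1:] x 0 = 0" by simp
  moreover have "\<not> A dvd [:0, 1:]"
  proof
    assume "A dvd [:0, 1:]"
    then have "a dvd content [:0, 1 :: rat poly:]" unfolding a const_poly_dvd_iff_dvd_content .
    then have "is_unit A" unfolding a by (simp add: content_def cCons_def is_unit_const_poly_iff)
    then show False using A by (simp add: irreducible_def)
  qed
  ultimately show ?thesis using that by blast
next
  case False
  have "finite {x. rpoly (lead_coeff A) x = 0}" by (rule finite_rpoly_roots) (use False in auto)
  then have "\<not> range complex_of_nat \<subseteq> {x. rpoly (lead_coeff A) x = 0}"
    using finite_subset infinite_UNIV_char_0[where ?'a = nat] finite_imageD[of complex_of_nat UNIV] inj_of_nat by blast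
  then obtain k :: nat where k: "rpoly (lead_coeff A) (of_nat k) \<noteq> 0" by blast
  then have "degree (map_poly (\<lambda>p. rpoly p (of_nat k)) A) = degree A"
    by (intro map_poly_degree_eq) auto
  then obtain y where "rpoly2 A (of_nat k) y = 0"
    using False fundamental_theorem_of_algebra[of "map_poly (\<lambda>p. rpoly p (of_nat k)) A"]
    unfolding rpoly2_eq_poly constant_degree by metis
  moreover have "\<not> A dvd [:[:- of_nat k, 1:]:]"
  proof
    assume "A dvd [:[:- of_nat k, 1:]:]"
    then have "degree A \<le> degree [:[:- of_nat k, 1 :: rat:]:]" by (rule dvd_imp_degree_le) simp
    then show False using False by simp
  qed
  moreover have "rpoly2 [:[:- of_nat k, 1:]:] (of_nat k) y = 0"
    by (simp add: of_rat_minus)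
  ultimately show ?thesis using that[of "[:[:- of_nat k, 1:]:]" "of_nat k" y] by (simp add: plane_zeros_def)
qed

lemma krull_dim_emb_closure:
  assumes A: "irreducible A"
  shows "has_krull_dim (zariski 4) (emb_closure n (plane_zeros A)) 1"
proof -
  let ?Z = "emb_closure n (plane_zeros A)"
  have "irreducible_chain (zariski 4) ?Z 1"
  proof -
    obtain B x y where B: "\<not> A dvd B" "(x, y) \<in> plane_zeros A" "rpoly2 B x y = 0"
      using exists_special_point[OF A] .
    obtain d F where F: "rat_form 4 d F"
      and Feq: "\<And>v. v 0 \<noteq> 0 \<Longrightarrow> F v = v 0 ^ d * rpoly2 B (v 1 / v 0) (v 2 / v 0)"
    proof (rule homogenize[of 0 4 1 2 B])
      fix d F assume "rat_form 4 d F" "\<And>v. v 0 \<noteq> 0 \<Longrightarrow> F v = v 0 ^ d * rpoly2 B (v 1 / v 0) (v 2 / v 0)"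
      then show ?thesis by (rule that)
    qed simp_all
    have FB: "F (emb_vec n x y) = rpoly2 B x y" for x y using Feq by (simp add: emb_vec_coords)
    let ?Q = "zariski 4 closure_of {emb n (x, y)}"
    have Q: "irreducible_closed (zariski 4) ?Q"
      by (rule irreducible_closed_closure_point) (simp add: topspace_zariski emb_in_space)
    have sub: "?Q \<subseteq> ?Z" unfolding emb_closure_def using B(2) by (intro closure_of_mono) auto
    have "?Q \<subseteq> form_zeros 4 F"
      using emb_in_form_zeros[OF F, of n x y] FB B(3) by (intro closure_of_minimal closedin_form_zeros[OF F]) auto
    moreover obtain x' y' where "(x', y') \<in> plane_zeros A" "rpoly2 B x' y' \<noteq> 0"
      using vanishing_iff_dvd[OF A, of B] B(1) by blast
    then have "emb n (x', y') \<in> ?Z" "emb n (x', y') \<notin> form_zeros 4 F"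
      using emb_closure_subset emb_in_form_zeros[OF F] FB by auto
    ultimately have "?Q \<subset> ?Z" using sub by blast
    then show ?thesis unfolding irreducible_chain_def
      using Q irreducible_emb_closure[OF A, of n]
      by (intro exI[of _ "\<lambda>i. if i = 0 then ?Q else ?Z"]) auto
  qed
  \<comment> \<open>For the upper bound, a relation between the pulled-back forms on the plane curve
    extends to the closure of its image.\<close>
  moreover have "\<not> irreducible_chain (zariski 4) ?Z 2"
  proof (rule no_chain_of_length_2)
    fix d p0 p q assume forms: "rat_form 4 d p0" "rat_form 4 d p" "rat_form 4 d q"
    have A0: "A \<noteq> 0" using A by auto
    obtain K r where r: "\<exists>a\<le>K. \<exists>b\<le>K. r a b \<noteq> (0::rat)"
      and rel: "\<And>x y. (x, y) \<in> plane_zeros A \<Longrightarrow> (\<Sum>a\<le>K. \<Sum>b\<le>K. of_rat (r a b) *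
        p0 (emb_vec n x y) ^ (2 * K - a - b) * p (emb_vec n x y) ^ a * q (emb_vec n x y) ^ b) = 0"
    proof (rule algebraic_dependence[OF A0 _ rat_polyfun2_pullback[OF forms(1), of n]
          rat_polyfun2_pullback[OF forms(2), of n] rat_polyfun2_pullback[OF forms(3), of n], of "plane_zeros A"])
      show "rpoly2 A x y = 0" if "(x, y) \<in> plane_zeros A" for x y using that by (simp add: plane_zeros_def)
      fix K r assume "\<exists>a\<le>K. \<exists>b\<le>K. r a b \<noteq> (0::rat)"
        "\<And>x y. (x, y) \<in> plane_zeros A \<Longrightarrow> (\<Sum>a\<le>K. \<Sum>b\<le>K. of_rat (r a b) *
        p0 (emb_vec n x y) ^ (2 * K - a - b) * p (emb_vec n x y) ^ a * q (emb_vec n x y) ^ b) = 0"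
      then show ?thesis by (rule that)
    qed
    have "rat_form 4 (d * (2 * K)) (\<lambda>v. \<Sum>a\<le>K. \<Sum>b\<le>K. of_rat (r a b) * p0 v ^ (2 * K - a - b) * p v ^ a * q v ^ b)"
    proof (intro rat_form_sum)
      fix a b assume "a \<in> {..K}" "b \<in> {..K}"
      then have deg: "0 + d * (2 * K - a - b) + d * a + d * b = d * (2 * K)"
        unfolding add_0_left distrib_left[symmetric] by simp
      have "rat_form 4 (0 + d * (2 * K - a - b) + d * a + d * b) (\<lambda>v.
          of_rat (r a b) * p0 v ^ (2 * K - a - b) * p v ^ a * q v ^ b)"
        by (intro rat_form_mult rat_form_const rat_form_power forms) simp
      then show "rat_form 4 (d * (2 * K)) (\<lambda>v. of_rat (r a b) * p0 v ^ (2 * K - a - b) * p v ^ a * q v ^ b)"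
        unfolding deg .
    qed
    then have "?Z \<subseteq> form_zeros 4 (\<lambda>v. \<Sum>a\<le>K. \<Sum>b\<le>K. of_rat (r a b) * p0 v ^ (2 * K - a - b) * p v ^ a * q v ^ b)"
      using rel by (rule emb_closure_subset_form_zeros)
    then show "\<exists>K r. (\<exists>a\<le>K. \<exists>b\<le>K. r a b \<noteq> (0::rat)) \<and> ?Z \<subseteq> form_zeros 4 (\<lambda>v. \<Sum>a\<le>K. \<Sum>b\<le>K.
        of_rat (r a b) * p0 v ^ (2 * K - a - b) * p v ^ a * q v ^ b)"
      using r by blast
  qed
  ultimately show ?thesis unfolding has_krull_dim_def by (simp add: numeral_2_eq_2)
qed

lemma projective_curve_emb_closure:
  assumes "n \<ge> 3" shows "projective_curve 4 (emb_closure n (plane_per n))"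
proof -
  obtain I where I: "finite I" "\<And>A. A \<in> I \<Longrightarrow> irreducible A" "plane_per n = (\<Union>A\<in>I. plane_zeros A)"
    using plane_per_components[OF assms] by blast
  have "emb n ` plane_per n = \<Union> ((\<lambda>A. emb n ` plane_zeros A) ` I)" unfolding I(3) by blast
  then have "emb_closure n (plane_per n) = (\<Union>A\<in>I. emb_closure n (plane_zeros A))"
    unfolding emb_closure_def using closure_of_Union[of "(\<lambda>A. emb n ` plane_zeros A) ` I" "zariski 4"] I(1)
    by simp
  then have "has_krull_dim (zariski 4) Z 1" if "irreducible_component (zariski 4) (emb_closure n (plane_per n)) Z" for Z
    using irreducible_component_UN[OF I(1), of "zariski 4" "\<lambda>A. emb_closure n (plane_zeros A)" Z, OF irreducible_emb_closure[OF I(2)]] that krull_dim_emb_closure[OF I(2)]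
    by auto
  moreover have "closedin (zariski 4) (emb_closure n (plane_per n))"
    unfolding emb_closure_def by (rule closedin_closure_of)
  ultimately show ?thesis unfolding projective_curve_def by blast
qed

subsection \<open>The affine part\<close>

text \<open>The relation v4 = x h, the definition of h and the equations of
  \<open>plane_per n\<close> become forms that vanish on the closure; where v0 /= 0 they lead back
  to the embedded curve. This uses the full system of \<open>plane_per_closed\<close>: the norm
  equation also admits periods properly dividing n.\<close>

lemma emb_closure_affine:
  assumes n: "n \<ge> 3" and P: "P \<in> emb_closure n (plane_per n)" "v \<in> P" "v 0 \<noteq> 0"
  shows "P \<in> emb n ` plane_per n"
proof -
  have sub: "P \<in> form_zeros 4 F" if "rat_form 4 d F" "\<And>x y. (x, y) \<in> plane_per n \<Longrightarrow> F (emb_vec n x y) = 0" for d F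
    using emb_closure_subset_form_zeros[OF that] P(1) by blast
  have PN: "P \<in> proj_space 4"
    using P(1) closure_of_subset_topspace[of "zariski 4"] unfolding emb_closure_def topspace_zariski by blast
  then have Pv: "P = proj_pt v" using proj_pt_of_mem P(2) by (auto simp: proj_space_def)
  then have v: "v \<in> vec_space 4" using PN by (simp add: proj_pt_in_space)
  define w where "w = (\<lambda>i. 1 / v 0 * v i)"
  have Pw: "P = proj_pt w" unfolding w_def using Pv P(3) by (simp only: proj_pt_eq divide_eq_0_iff one_neq_zero if_False simp_thms)
  have wP: "w \<in> P" unfolding Pw by (rule self_in_proj_pt)
  have w0: "w 0 = 1" using P(3) by (simp add: w_def)
  have wi: "w i = 0" if "i > 4" for i using v that by (simp add: w_def vec_space_def)
  let ?x = "w 1" and ?y = "w 2"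
  have f1: "rat_form 4 (1 + 1) (\<lambda>v. v 0 * v 4 - v 1 * v 3)"
    by (intro rat_form_diff rat_form_mult rat_form_var) auto
  have "P \<in> form_zeros 4 (\<lambda>v. v 0 * v 4 - v 1 * v 3)"
    by (rule sub[OF f1]) (simp add: emb_vec_coords)
  then have "w 0 * w 4 - w 1 * w 3 = 0" using wP unfolding form_zeros_def by blast
  then have w4: "w 4 = ?x * w 3" using w0 by simp
  have f2: "rat_form 4 (n - 1) (\<lambda>v. v 1 ^ (n - 2) * v 2 + 4 * (v 1 ^ (n - 3) * v 0 ^ 2) - v 3 * v 0 ^ (n - 2))"
  proof (intro rat_form_diff rat_form_add rat_form_cmult)
    show "rat_form 4 (n - 1) (\<lambda>v. v 1 ^ (n - 2) * v 2)"
      by (rule rat_form_degree[OF rat_form_mult[OF rat_form_power[OF rat_form_var] rat_form_var]]) (use n in auto)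
    show "rat_form 4 (n - 1) (\<lambda>v. v 1 ^ (n - 3) * v 0 ^ 2)"
      by (rule rat_form_degree[OF rat_form_mult[OF rat_form_power[OF rat_form_var] rat_form_power[OF rat_form_var]]])
        (use n in auto)
    show "rat_form 4 (n - 1) (\<lambda>v. v 3 * v 0 ^ (n - 2))"
      by (rule rat_form_degree[OF rat_form_mult[OF rat_form_var rat_form_power[OF rat_form_var]]]) (use n in auto)
  qed simp
  have hn: "plane_h n x y = x ^ (n - 2) * y + 4 * x ^ (n - 3)" for x y
  proof -
    have "n - 2 = Suc (n - 3)" using n by simp
    then show ?thesis by (simp only: plane_h_def power_Suc) (simp add: algebra_simps)
  qed
  have "P \<in> form_zeros 4 (\<lambda>v. v 1 ^ (n - 2) * v 2 + 4 * (v 1 ^ (n - 3) * v 0 ^ 2) - v 3 * v 0 ^ (n - 2))"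
    by (rule sub[OF f2]) (simp only: emb_vec_coords hn power_one mult_1_right, simp)
  then have "w 1 ^ (n - 2) * w 2 + 4 * (w 1 ^ (n - 3) * w 0 ^ 2) - w 3 * w 0 ^ (n - 2) = 0"
    using wP unfolding form_zeros_def by blast
  then have w3: "w 3 = plane_h n ?x ?y" using w0 by (simp add: hn)
  have "w = emb_vec n ?x ?y"
  proof
    fix i show "w i = emb_vec n ?x ?y i"
      using emb_vec_cases[of i] by (elim disjE) (auto simp: emb_vec_coords w0 w3 w4 wi)
  qed
  then have Pemb: "P = emb n (?x, ?y)" by (simp add: Pw emb_def)
  obtain F where F: "\<And>f. f \<in> F \<Longrightarrow> rat_polyfun2 f"
    and per: "\<And>x y. (x, y) \<in> plane_per n \<longleftrightarrow> (\<forall>f\<in>F. f x y = 0)"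
    using plane_per_closed[of n] n by auto
  have "f ?x ?y = 0" if fF: "f \<in> F" for f
  proof -
    obtain Q where Q: "\<And>x y. f x y = rpoly2 Q x y" using F[OF fF] unfolding rat_polyfun2_def by blast
    show ?thesis
    proof (rule homogenize[of 0 4 1 2 Q])
      fix d G assume G: "rat_form 4 d G" "\<And>v. v 0 \<noteq> 0 \<Longrightarrow> G v = v 0 ^ d * rpoly2 Q (v 1 / v 0) (v 2 / v 0)"
      have "P \<in> form_zeros 4 G"
        by (rule sub[OF G(1)]) (use per fF in \<open>simp add: G(2) emb_vec_coords flip: Q\<close>)
      then have "G w = 0" using wP by (simp add: form_zeros_def)
      then show ?thesis using G(2)[of w] w0 Q by simp
    qed simp_all
  qed
  then have "(?x, ?y) \<in> plane_per n" using per by blast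
  then show ?thesis using Pemb by blast
qed

lemma emb_affine_part:
  assumes "n \<ge> 3"
  shows "emb n ` plane_per n = emb_closure n (plane_per n) - form_zeros 4 (\<lambda>v. v 0)"
proof -
  have f: "rat_form 4 1 (\<lambda>v. v 0)" by (rule rat_form_var) simp
  show ?thesis
  proof (intro equalityI subsetI)
    fix P assume P: "P \<in> emb n ` plane_per n"
    then show "P \<in> emb_closure n (plane_per n) - form_zeros 4 (\<lambda>v. v 0)"
      using emb_closure_subset emb_in_form_zeros[OF f, of n] by (auto simp: emb_vec_coords)
  next
    fix P assume P: "P \<in> emb_closure n (plane_per n) - form_zeros 4 (\<lambda>v. v 0)"
    then have "P \<in> proj_space 4"
      using closure_of_subset_topspace[of "zariski 4"] unfolding emb_closure_def topspace_zariski by blast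
    then obtain v where "v \<in> P" "v 0 \<noteq> 0" using P by (auto simp: form_zeros_def)
    then show "P \<in> emb n ` plane_per n" using emb_closure_affine[OF assms] P by blast
  qed
qed

subsection \<open>The embedding is an isomorphism onto its image\<close>

text \<open>The entries are 1, sigma1, sigma2 in terms of the shifted coordinates x, y.\<close>

definition plane_vec :: "complex \<Rightarrow> complex \<Rightarrow> nat \<Rightarrow> complex" where
  "plane_vec x y = vec_of [1, x - 2, y - 2 * x + 1]"

definition plane_pt :: "complex \<times> complex \<Rightarrow> point" where
  "plane_pt z = proj_pt (plane_vec (fst z) (snd z))"

lemma plane_vec_coords:
  "plane_vec x y 0 = 1" "plane_vec x y 1 = x - 2" "plane_vec x y (Suc 0) = x - 2" "plane_vec x y 2 = y - 2 * x + 1"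
  by (simp_all add: plane_vec_def vec_of_def eval_nat_numeral)

lemma plane_pt_inj: "plane_pt z = plane_pt w \<Longrightarrow> z = w"
proof -
  assume "plane_pt z = plane_pt w"
  then have eq: "plane_vec (fst z) (snd z) = plane_vec (fst w) (snd w)"
    unfolding plane_pt_def by (rule proj_pt_inj[of _ _ 0]) (simp_all add: plane_vec_coords)
  have "fst z = fst w" using arg_cong[OF eq, of "\<lambda>f. f 1"] by (simp add: plane_vec_coords)
  moreover have "snd z = snd w"
    using arg_cong[OF eq, of "\<lambda>f. f 2"] \<open>fst z = fst w\<close> by (simp add: plane_vec_coords)
  ultimately show "z = w" by (rule prod_eqI)
qed

lemma rat_forms_list:
  assumes "\<And>G. G \<in> set Gs \<Longrightarrow> rat_form N d G"
  obtains F where "length F = length Gs" "set F \<subseteq> forms \<rat> N d" "\<And>v. forms_eval F v = vec_of (map (\<lambda>G. G v) Gs)"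
proof -
  define q where "q = (\<lambda>G. SOME p. p \<in> forms \<rat> N d \<and> (\<forall>v. form_eval p v = G v))"
  have q: "q G \<in> forms \<rat> N d" "\<And>v. form_eval (q G) v = G v" if "G \<in> set Gs" for G
  proof -
    have "\<exists>p. p \<in> forms \<rat> N d \<and> (\<forall>v. form_eval p v = G v)"
      using assms[OF that] unfolding rat_form_def by blast
    from someI_ex[OF this] show "q G \<in> forms \<rat> N d" "\<And>v. form_eval (q G) v = G v"
      unfolding q_def by blast+
  qed
  show ?thesis
  proof (rule that[of "map q Gs"])
    show "forms_eval (map q Gs) v = vec_of (map (\<lambda>G. G v) Gs)" for v
      unfolding forms_eval_def map_map by (rule arg_cong[where f = vec_of]) (auto simp: q(2))
  qed (use q(1) in auto)
qed

lemma regular_map_global: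
  assumes "f \<in> Y \<rightarrow> Z" "length Gs = Suc M" "\<And>G. G \<in> set Gs \<Longrightarrow> rat_form N d G"
    and "\<And>P v. P \<in> Y \<Longrightarrow> v \<in> P \<Longrightarrow> vec_of (map (\<lambda>G. G v) Gs) \<noteq> 0 \<and> f P = proj_pt (vec_of (map (\<lambda>G. G v) Gs))"
  shows "regular_map N Y M Z f"
proof -
  obtain F where F: "length F = length Gs" "set F \<subseteq> forms \<rat> N d" "\<And>v. forms_eval F v = vec_of (map (\<lambda>G. G v) Gs)"
    using rat_forms_list[of Gs N d] assms(3) by metis
  show ?thesis unfolding regular_map_def
    by (intro conjI assms(1) ballI exI[of _ d] exI[of _ F]) (use F assms(2,4) in auto)
qed

lemma vec_of_scale: "vec_of (map (\<lambda>a. c * a) xs) = (\<lambda>i. c * vec_of xs i)"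
  by (auto simp: vec_of_def fun_eq_iff)

lemma plane_ptE:
  assumes "v \<in> plane_pt (x, y)"
  obtains c where "c \<noteq> 0" "v 0 = c" "v 1 = c * (x - 2)" "v 2 = c * (y - 2 * x + 1)"
proof -
  obtain c where "c \<noteq> 0" "v = (\<lambda>i. c * plane_vec x y i)"
    using assms unfolding plane_pt_def proj_pt_scale by auto
  then show ?thesis using that[of c] by (simp add: plane_vec_coords)
qed

lemma embE:
  assumes "v \<in> emb n (x, y)"
  obtains c where "c \<noteq> 0" "v = (\<lambda>i. c * emb_vec n x y i)"
  using assms unfolding emb_def proj_pt_scale by auto

text \<open>Each direction is given by a single tuple of forms. Since x, y are affine in sigma1,
  sigma2, the inverse is linear; the embedding has degree n, the degree of x h.\<close>

lemma isomorphism_emb: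
  assumes n: "n \<ge> 3"
  obtains \<iota> where "\<And>z. \<iota> (plane_pt z) = emb n z" "isomorphism 2 (plane_pt ` Y) 4 (emb n ` Y) \<iota>"
proof -
  define \<iota> where "\<iota> = (\<lambda>P. emb n (THE z. P = plane_pt z))"
  define g where "g = (\<lambda>Q. plane_pt (THE z. Q = emb n z))"
  have \<iota>: "\<iota> (plane_pt z) = emb n z" for z
    unfolding \<iota>_def by (rule arg_cong[where f = "emb n"], rule the_equality) (auto dest: plane_pt_inj)
  have g: "g (emb n z) = plane_pt z" for z
    unfolding g_def by (rule arg_cong[where f = plane_pt], rule the_equality) (auto dest: emb_inj)
  have "regular_map 2 (plane_pt ` Y) 4 (emb n ` Y) \<iota>"
  proof -
    let ?X = "\<lambda>v::nat \<Rightarrow> complex. v 1 + 2 * v 0" and ?Y = "\<lambda>v::nat \<Rightarrow> complex. v 2 + 2 * v 1 + 3 * v 0"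
    let ?H = "\<lambda>v. ?X v ^ (n - 3) * (?X v * ?Y v + 4 * v 0 ^ 2)"
    let ?Gs = "[\<lambda>v. v 0 ^ n, \<lambda>v. ?X v * v 0 ^ (n - 1), \<lambda>v. ?Y v * v 0 ^ (n - 1), \<lambda>v. ?H v * v 0, \<lambda>v. ?X v * ?H v]"
    have fX: "rat_form 2 1 ?X" by (intro rat_form_add rat_form_cmult rat_form_var) auto
    have fY: "rat_form 2 1 ?Y" by (intro rat_form_add rat_form_cmult rat_form_var) auto
    have f0: "rat_form 2 1 (\<lambda>v. v 0)" by (rule rat_form_var) simp
    have "rat_form 2 2 (\<lambda>v. ?X v * ?Y v)" using rat_form_mult[OF fX fY] by (simp add: numeral_2_eq_2)
    moreover have "rat_form 2 2 (\<lambda>v. v 0 ^ 2)" using rat_form_power[OF f0, of 2] by simp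
    ultimately have "rat_form 2 2 (\<lambda>v. ?X v * ?Y v + 4 * v 0 ^ 2)" by (intro rat_form_add rat_form_cmult) auto
    then have fH: "rat_form 2 (n - 1) ?H"
      by (rule rat_form_degree[OF rat_form_mult[OF rat_form_power[OF fX]]]) (use n in simp)
    have forms: "rat_form 2 n G" if "G \<in> set ?Gs" for G
    proof -
      have "rat_form 2 n (\<lambda>v. v 0 ^ n)" by (rule rat_form_degree[OF rat_form_power[OF f0]]) simp
      moreover have "rat_form 2 n (\<lambda>v. ?X v * v 0 ^ (n - 1))"
        by (rule rat_form_degree[OF rat_form_mult[OF fX rat_form_power[OF f0]]]) (use n in simp)
      moreover have "rat_form 2 n (\<lambda>v. ?Y v * v 0 ^ (n - 1))"
        by (rule rat_form_degree[OF rat_form_mult[OF fY rat_form_power[OF f0]]]) (use n in simp)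
      moreover have "rat_form 2 n (\<lambda>v. ?H v * v 0)"
        by (rule rat_form_degree[OF rat_form_mult[OF fH f0]]) (use n in simp)
      moreover have "rat_form 2 n (\<lambda>v. ?X v * ?H v)"
        by (rule rat_form_degree[OF rat_form_mult[OF fX fH]]) (use n in simp)
      ultimately show ?thesis using that by auto
    qed
    have eval: "\<exists>c. c \<noteq> 0 \<and> vec_of (map (\<lambda>G. G v) ?Gs) = (\<lambda>i. c * emb_vec n x y i)" if v: "v \<in> plane_pt (x, y)" for x y v
    proof -
      obtain c where c: "c \<noteq> 0" "v 0 = c" "v 1 = c * (x - 2)" "v 2 = c * (y - 2 * x + 1)" using v by (rule plane_ptE)
      have X: "?X v = c * x" and Y: "?Y v = c * y" unfolding c(2-4) by algebra+
      obtain m where m: "n = m + 3" using n by (metis add.commute le_Suc_ex)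
      have h: "(c * x) ^ (n - 3) * (c * x * (c * y) + 4 * c\<^sup>2) = c ^ (n - 1) * plane_h n x y"
        unfolding m plane_h_def by (simp add: power_mult_distrib algebra_simps power2_eq_square)
      have cn: "c ^ n = c * c ^ (n - 1)" using n by (simp add: power_eq_if)
      have "map (\<lambda>G. G v) ?Gs = map (\<lambda>a. c ^ n * a) [1, x, y, plane_h n x y, x * plane_h n x y]"
        unfolding list.map X Y unfolding c(2) h cn by simp
      then have "vec_of (map (\<lambda>G. G v) ?Gs) = (\<lambda>i. c ^ n * emb_vec n x y i)"
        unfolding emb_vec_def by (simp only: vec_of_scale)
      then show ?thesis using c(1) by (intro exI[of _ "c ^ n"]) simp
    qed
    show ?thesis
    proof (rule regular_map_global[of _ _ _ ?Gs])
      show "\<iota> \<in> plane_pt ` Y \<rightarrow> emb n ` Y" using \<iota> by auto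
      fix P v assume "P \<in> plane_pt ` Y" "v \<in> P"
      then obtain x y where xy: "P = plane_pt (x, y)" "v \<in> plane_pt (x, y)" by auto
      obtain c where c: "c \<noteq> 0" and eq: "vec_of (map (\<lambda>G. G v) ?Gs) = (\<lambda>i. c * emb_vec n x y i)" using eval[OF xy(2)] by blast
      have "(\<lambda>i. c * emb_vec n x y i) 0 \<noteq> 0" using c by (simp add: emb_vec_coords)
      then have "(\<lambda>i. c * emb_vec n x y i) \<noteq> 0" by (metis zero_fun_apply)
      moreover have "\<iota> P = proj_pt (\<lambda>i. c * emb_vec n x y i)"
        unfolding xy(1) \<iota> proj_pt_eq[OF c] by (simp add: emb_def)
      ultimately show "vec_of (map (\<lambda>G. G v) ?Gs) \<noteq> 0 \<and> \<iota> P = proj_pt (vec_of (map (\<lambda>G. G v) ?Gs))"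
        unfolding eq by blast
    qed (use forms in auto)
  qed
  moreover have "regular_map 4 (emb n ` Y) 2 (plane_pt ` Y) g"
  proof -
    let ?Gs = "[\<lambda>v::nat \<Rightarrow> complex. v 0, \<lambda>v. v 1 - 2 * v 0, \<lambda>v. v 2 - 2 * v 1 + 1 * v 0]"
    have forms: "rat_form 4 1 G" if "G \<in> set ?Gs" for G
    proof -
      have "rat_form 4 1 (\<lambda>v. v 0)" by (rule rat_form_var) simp
      moreover have "rat_form 4 1 (\<lambda>v. v 1 - 2 * v 0)"
        by (intro rat_form_diff rat_form_cmult rat_form_var) auto
      moreover have "rat_form 4 1 (\<lambda>v. v 2 - 2 * v 1 + 1 * v 0)"
        by (intro rat_form_add rat_form_diff rat_form_cmult rat_form_var) auto
      ultimately show ?thesis using that by auto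
    qed
    show ?thesis
    proof (rule regular_map_global[of _ _ _ ?Gs])
      show "g \<in> emb n ` Y \<rightarrow> plane_pt ` Y" using g by auto
      fix P v assume "P \<in> emb n ` Y" "v \<in> P"
      then obtain x y where xy: "P = emb n (x, y)" "v \<in> emb n (x, y)" by auto
      obtain c where c: "c \<noteq> 0" "v = (\<lambda>i. c * emb_vec n x y i)" using xy(2) by (rule embE)
      have "map (\<lambda>G. G v) ?Gs = map (\<lambda>a. c * a) [1, x - 2, y - 2 * x + 1]"
        unfolding c(2) by (simp add: emb_vec_coords algebra_simps)
      then have eq: "vec_of (map (\<lambda>G. G v) ?Gs) = (\<lambda>i. c * plane_vec x y i)"
        unfolding plane_vec_def by (simp only: vec_of_scale)
      have "(\<lambda>i. c * plane_vec x y i) 0 \<noteq> 0" using c by (simp add: plane_vec_coords)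
      then have "(\<lambda>i. c * plane_vec x y i) \<noteq> 0" by (metis zero_fun_apply)
      moreover have "g P = proj_pt (\<lambda>i. c * plane_vec x y i)"
        unfolding xy(1) g proj_pt_eq[OF c(1)] by (simp add: plane_pt_def)
      ultimately show "vec_of (map (\<lambda>G. G v) ?Gs) \<noteq> 0 \<and> g P = proj_pt (vec_of (map (\<lambda>G. G v) ?Gs))"
        unfolding eq by blast
    qed (use forms in auto)
  qed
  ultimately have "isomorphism 2 (plane_pt ` Y) 4 (emb n ` Y) \<iota>"
    unfolding isomorphism_def using \<iota> g by (intro conjI exI[of _ g]) auto
  then show ?thesis using that \<iota> by blast
qed

theorem completion_plane_per:
  assumes n: "n \<ge> 3"
  obtains \<iota> where "projective_completion 2 (plane_pt ` plane_per n) 4 (emb_closure n (plane_per n)) \<iota>"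
proof -
  obtain \<iota> where \<iota>: "\<And>z. \<iota> (plane_pt z) = emb n z" "isomorphism 2 (plane_pt ` plane_per n) 4 (emb n ` plane_per n) \<iota>"
    using isomorphism_emb[OF n] by blast
  let ?X = "emb_closure n (plane_per n)"
  have im: "\<iota> ` plane_pt ` plane_per n = emb n ` plane_per n" using \<iota>(1) by (auto simp: image_image)
  have f: "rat_form 4 1 (\<lambda>v. v 0)" by (rule rat_form_var) simp
  have "openin (subtopology (zariski 4) ?X) (emb n ` plane_per n)"
  proof -
    have "openin (zariski 4) (topspace (zariski 4) - form_zeros 4 (\<lambda>v. v 0))"
      using closedin_form_zeros[OF f] by (intro openin_diff) auto
    moreover have "emb n ` plane_per n = (topspace (zariski 4) - form_zeros 4 (\<lambda>v. v 0)) \<inter> ?X"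
      using emb_affine_part[OF n] closure_of_subset_topspace[of "zariski 4" "emb n ` plane_per n"]
      unfolding emb_closure_def by blast
    ultimately show ?thesis unfolding openin_subtopology by blast
  qed
  moreover have "subtopology (zariski 4) ?X closure_of (emb n ` plane_per n) = ?X"
  proof -
    have "?X \<inter> emb n ` plane_per n = emb n ` plane_per n" using emb_closure_subset by blast
    then show ?thesis unfolding closure_of_subtopology by (simp add: emb_closure_def)
  qed
  ultimately have "projective_completion 2 (plane_pt ` plane_per n) 4 ?X \<iota>"
    unfolding projective_completion_def im
    using projective_curve_emb_closure[OF n] \<iota>(2) by blast
  then show ?thesis by (rule that)
qed

section \<open>The smooth rational point\<close>

text \<open>The directions W may vary with s. Constant W gives the derivative along a line, as in
  the definition of the tangent space; varying W covers secants of the curve, so that a limit of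
  secants is seen to be tangent.\<close>

definition dir_deriv :: "((nat \<Rightarrow> complex) \<Rightarrow> complex) \<Rightarrow> (nat \<Rightarrow> complex) \<Rightarrow> ((nat \<Rightarrow> complex) \<Rightarrow> complex) \<Rightarrow> bool" where
  "dir_deriv f v L \<longleftrightarrow> (\<forall>s W \<omega>. (\<forall>k. s k \<noteq> 0) \<longrightarrow> s \<longlonglongrightarrow> 0 \<longrightarrow> (\<forall>i. (\<lambda>k. W k i) \<longlonglongrightarrow> \<omega> i) \<longrightarrow>
     (\<lambda>k::nat. (f (\<lambda>i. v i + s k * W k i) - f v) / s k) \<longlonglongrightarrow> L \<omega>)"

lemma dir_derivI:
  fixes v :: "nat \<Rightarrow> complex"
  assumes "\<And>(s :: nat \<Rightarrow> complex) (W :: nat \<Rightarrow> nat \<Rightarrow> complex) \<omega>. (\<And>k. s k \<noteq> 0) \<Longrightarrow> s \<longlonglongrightarrow> 0 \<Longrightarrow> (\<And>i. (\<lambda>k. W k i) \<longlonglongrightarrow> \<omega> i) \<Longrightarrow>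
     (\<lambda>k::nat. (f (\<lambda>i. v i + s k * W k i) - f v) / s k) \<longlonglongrightarrow> L \<omega>"
  shows "dir_deriv f v L"
  using assms unfolding dir_deriv_def by simp

lemma dir_derivD:
  fixes s :: "nat \<Rightarrow> complex" and W :: "nat \<Rightarrow> nat \<Rightarrow> complex"
  assumes "dir_deriv f v L" "\<And>k. s k \<noteq> 0" "s \<longlonglongrightarrow> 0" "\<And>i. (\<lambda>k. W k i) \<longlonglongrightarrow> \<omega> i"
  shows "(\<lambda>k::nat. (f (\<lambda>i. v i + s k * W k i) - f v) / s k) \<longlonglongrightarrow> L \<omega>"
  using assms unfolding dir_deriv_def by simp

lemma dir_deriv_continuous:
  fixes s :: "nat \<Rightarrow> complex" and W :: "nat \<Rightarrow> nat \<Rightarrow> complex"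
  assumes "dir_deriv f v L" "\<And>k. s k \<noteq> 0" "s \<longlonglongrightarrow> 0" "\<And>i. (\<lambda>k. W k i) \<longlonglongrightarrow> \<omega> i"
  shows "(\<lambda>k::nat. f (\<lambda>i. v i + s k * W k i)) \<longlonglongrightarrow> f v"
proof -
  have "(\<lambda>k. f v + s k * ((f (\<lambda>i. v i + s k * W k i) - f v) / s k)) \<longlonglongrightarrow> f v + 0 * L \<omega>"
    by (intro tendsto_intros assms(3) dir_derivD[OF assms])
  then show ?thesis using assms(2) by simp
qed

lemma dir_deriv_const: "dir_deriv (\<lambda>v. c) v (\<lambda>w. 0)"
  by (rule dir_derivI) simp

lemma dir_deriv_coord: "dir_deriv (\<lambda>v. v i) v (\<lambda>w. w i)"
  by (rule dir_derivI) simp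

lemma dir_deriv_add:
  assumes "dir_deriv f v L" "dir_deriv g v M" shows "dir_deriv (\<lambda>v. f v + g v) v (\<lambda>w. L w + M w)"
proof (rule dir_derivI)
  fix s :: "nat \<Rightarrow> complex" and W :: "nat \<Rightarrow> nat \<Rightarrow> complex" and \<omega> assume *: "\<And>k. s k \<noteq> 0" "s \<longlonglongrightarrow> 0" "\<And>i. (\<lambda>k. W k i) \<longlonglongrightarrow> \<omega> i"
  from tendsto_add[OF dir_derivD[OF assms(1) *] dir_derivD[OF assms(2) *]]
  show "(\<lambda>k. (f (\<lambda>i. v i + s k * W k i) + g (\<lambda>i. v i + s k * W k i) - (f v + g v)) / s k) \<longlonglongrightarrow> L \<omega> + M \<omega>"
    by (simp add: add_divide_distrib[symmetric] algebra_simps)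
qed

lemma dir_deriv_mult:
  assumes "dir_deriv f v L" "dir_deriv g v M" shows "dir_deriv (\<lambda>v. f v * g v) v (\<lambda>w. L w * g v + f v * M w)"
proof (rule dir_derivI)
  fix s :: "nat \<Rightarrow> complex" and W :: "nat \<Rightarrow> nat \<Rightarrow> complex" and \<omega> assume *: "\<And>k. s k \<noteq> 0" "s \<longlonglongrightarrow> 0" "\<And>i. (\<lambda>k. W k i) \<longlonglongrightarrow> \<omega> i"
  let ?f = "\<lambda>k. f (\<lambda>i. v i + s k * W k i)" and ?g = "\<lambda>k. g (\<lambda>i. v i + s k * W k i)"
  have "(\<lambda>k. (?f k - f v) / s k * ?g k + f v * ((?g k - g v) / s k)) \<longlonglongrightarrow> L \<omega> * g v + f v * M \<omega>"
    by (intro tendsto_intros dir_derivD[OF assms(1) *] dir_derivD[OF assms(2) *] dir_deriv_continuous[OF assms(2) *])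
  moreover have "(?f k - f v) / s k * ?g k + f v * ((?g k - g v) / s k) = (?f k * ?g k - f v * g v) / s k" for k
    using *(1)[of k] by (simp add: field_simps)
  ultimately show "(\<lambda>k. (?f k * ?g k - f v * g v) / s k) \<longlonglongrightarrow> L \<omega> * g v + f v * M \<omega>" by simp
qed

lemma dir_deriv_power: "\<exists>L. dir_deriv f v L \<Longrightarrow> \<exists>L. dir_deriv (\<lambda>v. f v ^ k) v L"
proof (induction k)
  case 0
  then show ?case using dir_deriv_const[of 1] by auto
next
  case (Suc k)
  then obtain L M where "dir_deriv f v L" "dir_deriv (\<lambda>v. f v ^ k) v M" by blast
  from dir_deriv_mult[OF this] show ?case by auto
qed

lemma dir_deriv_prod: "(\<And>i. i \<in> A \<Longrightarrow> \<exists>L. dir_deriv (f i) v L) \<Longrightarrow> \<exists>L. dir_deriv (\<lambda>v. \<Prod>i\<in>A. f i v) v L"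
proof (induction A rule: infinite_finite_induct)
  case (insert i A)
  then obtain L M where "dir_deriv (f i) v L" "dir_deriv (\<lambda>v. \<Prod>i\<in>A. f i v) v M" by blast
  from dir_deriv_mult[OF this] show ?case using insert.hyps by auto
qed (use dir_deriv_const[of 1] in auto)

lemma dir_deriv_sum: "(\<And>i. i \<in> A \<Longrightarrow> \<exists>L. dir_deriv (f i) v L) \<Longrightarrow> \<exists>L. dir_deriv (\<lambda>v. \<Sum>i\<in>A. f i v) v L"
proof (induction A rule: infinite_finite_induct)
  case (insert i A)
  then obtain L M where "dir_deriv (f i) v L" "dir_deriv (\<lambda>v. \<Sum>i\<in>A. f i v) v M" by blast
  from dir_deriv_add[OF this] show ?case using insert.hyps by auto
qed (use dir_deriv_const[of 0] in auto)

lemma dir_deriv_form_eval: "\<exists>L. dir_deriv (form_eval p) v L"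
proof -
  have "\<exists>L. dir_deriv (\<lambda>v. c * (\<Prod>i\<in>A. v i ^ e i)) v L" for c :: complex and A and e :: "nat \<Rightarrow> nat"
  proof -
    obtain L where "dir_deriv (\<lambda>v. \<Prod>i\<in>A. v i ^ e i) v L"
      using dir_deriv_prod[of A "\<lambda>i v. v i ^ e i" v] dir_deriv_power dir_deriv_coord by blast
    from dir_deriv_mult[OF dir_deriv_const this] show ?thesis by blast
  qed
  then have "\<exists>L. dir_deriv (\<lambda>v. form_eval p v) v L" unfolding form_eval_def by (intro dir_deriv_sum)
  then show ?thesis by simp
qed

lemma dir_deriv_DERIV:
  assumes "dir_deriv f v L" shows "((\<lambda>t. f (\<lambda>i. v i + t * w i)) has_field_derivative L w) (at 0)"
proof -
  have "((\<lambda>t. (f (\<lambda>i. v i + t * w i) - f v) / t) \<longlongrightarrow> L w) (at 0)"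
    unfolding tendsto_at_iff_sequentially
  proof (intro allI impI)
    fix X :: "nat \<Rightarrow> complex" assume X: "\<forall>i. X i \<in> UNIV - {0}" "X \<longlonglongrightarrow> 0"
    then have "(\<lambda>k. (f (\<lambda>i. v i + X k * w i) - f v) / X k) \<longlonglongrightarrow> L w"
      by (intro dir_derivD[OF assms, where W = "\<lambda>k. w"]) auto
    then show "((\<lambda>t. (f (\<lambda>i. v i + t * w i) - f v) / t) \<circ> X) \<longlonglongrightarrow> L w" by (simp add: comp_def)
  qed
  then show ?thesis unfolding DERIV_def by simp
qed

lemma tangent_cone_space_scale:
  assumes "c \<noteq> 0"
  shows "tangent_cone_space N X (\<lambda>i. c * v i) = tangent_cone_space N X v"
proof -
  have "deriv (\<lambda>t. form_eval p (\<lambda>i. c * v i + t * w i)) 0 = 0 \<longleftrightarrow> deriv (\<lambda>t. form_eval p (\<lambda>i. v i + t * w i)) 0 = 0"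
    if pX: "p \<in> vanishing_forms N X" for p w
  proof -
    obtain d where p: "p \<in> forms \<rat> N d" using pX by (auto simp: vanishing_forms_def)
    obtain L where "dir_deriv (form_eval p) v L" using dir_deriv_form_eval by blast
    from dir_deriv_DERIV[OF this] have D: "((\<lambda>t. form_eval p (\<lambda>i. v i + t * w i)) has_field_derivative L w) (at 0)" .
    then have D': "((\<lambda>t. form_eval p (\<lambda>i. v i + t * w i)) has_field_derivative L w) (at (0 / c))" by simp
    have "((\<lambda>t. t / c) has_field_derivative 1 / c) (at 0)"
      by (rule DERIV_cdivide) (rule DERIV_ident)
    from DERIV_chain[OF D' this]
    have "((\<lambda>t. form_eval p (\<lambda>i. v i + (t / c) * w i)) has_field_derivative L w * (1 / c)) (at 0)"
      by (simp add: comp_def)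
    from DERIV_cmult[OF this, of "c ^ d"]
    have "((\<lambda>t. c ^ d * form_eval p (\<lambda>i. v i + (t / c) * w i)) has_field_derivative c ^ d * (L w * (1 / c))) (at 0)" .
    moreover have "c ^ d * form_eval p (\<lambda>i. v i + (t / c) * w i) = form_eval p (\<lambda>i. c * v i + t * w i)" for t
      using form_eval_scale[OF p, of c "\<lambda>i. v i + (t / c) * w i"] assms by (simp add: algebra_simps)
    ultimately have "deriv (\<lambda>t. form_eval p (\<lambda>i. c * v i + t * w i)) 0 = c ^ d * (L w * (1 / c))"
      by (intro DERIV_imp_deriv) simp
    then show ?thesis using DERIV_imp_deriv[OF D] assms by simp
  qed
  then show ?thesis unfolding tangent_cone_space_def by blast
qed

lemma quotient_limit_deriv:
  assumes "((\<lambda>t. f t / t) \<longlongrightarrow> D) (at 0)" "f 0 = (0::complex)" shows "deriv f 0 = D"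
proof -
  have "(f has_field_derivative D) (at 0)" unfolding DERIV_def using assms by simp
  then show ?thesis by (rule DERIV_imp_deriv)
qed

section \<open>The point at infinity and its tangent space\<close>

definition star_vec :: "nat \<Rightarrow> complex" where
  "star_vec = vec_of [0, 1, 0, 0, 4]"

lemma star_vec_coords:
  "star_vec 0 = 0" "star_vec 1 = 1" "star_vec (Suc 0) = 1" "star_vec 2 = 0" "star_vec 3 = 0" "star_vec 4 = 4"
  "i > 4 \<Longrightarrow> star_vec i = 0"
  by (simp_all add: star_vec_def vec_of_def eval_nat_numeral)

lemma star_vec_space: "star_vec \<in> vec_space 4 - {0}"
proof -
  have "star_vec \<noteq> 0" by (metis star_vec_coords(2) zero_fun_apply zero_neq_one)
  then show ?thesis by (auto simp: vec_space_def star_vec_coords)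
qed

lemma vanishing_formsI:
  assumes "rat_form N d F" "X \<subseteq> form_zeros N F"
  obtains p where "p \<in> vanishing_forms N X" "\<And>v. form_eval p v = F v"
proof -
  obtain p where p: "p \<in> forms \<rat> N d" "\<And>v. form_eval p v = F v" using assms(1) unfolding rat_form_def by blast
  then have "p \<in> vanishing_forms N X" using assms(2) by (auto simp: vanishing_forms_def form_zeros_def)
  then show ?thesis using that p(2) by blast
qed

text \<open>The tangent space contains \<open>star_vec\<close> by homogeneity and \<open>b2\<close>
  as a limit of secants. It is no larger, because three forms vanishing on the curve have
  independent differentials there: v0 v4 - v1 v3, the equation defining h, and the homogenised G.
  The last one contributes because the zero of 4 - h is simple.\<close>

lemma smooth_star:
  assumes n: "n \<ge> 4"
  shows "smooth_point 4 (emb_closure n (plane_per n)) (proj_pt star_vec)"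
proof -
  let ?Y = "plane_per n" and ?X = "emb_closure n (plane_per n)"
  have n3: "n \<ge> 3" using n by simp
  obtain G c where c: "c \<noteq> 0" and G0: "\<And>h. rpoly2 G h 0 = c * (4 - h)"
    and GY: "\<And>x y. (x, y) \<in> ?Y \<Longrightarrow> x \<noteq> 0 \<Longrightarrow> rpoly2 G (plane_h n x y) (1 / x) = 0"
    using local_equation[OF n3] by metis
  obtain g G1 where G: "G = pCons g G1" by (cases G)
  have Gs: "rpoly2 G h s = c * (4 - h) + s * rpoly2 G1 h s" for h s
    using G0[of h] by (simp add: G)
  \<comment> \<open>The slope of h as a function of s = 1 / x at the point: on the curve c (h - 4) =
    s G1(h, s).\<close>
  define h1 where "h1 = rpoly2 G1 4 0 / c"
  define b2 where "b2 = vec_of [1, 0, 0, 4, h1]"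
  have b2: "b2 0 = 1" "b2 1 = 0" "b2 (Suc 0) = 0" "b2 2 = 0" "b2 3 = 4" "b2 4 = h1" "\<And>i. i > 4 \<Longrightarrow> b2 i = 0"
    by (simp_all add: b2_def vec_of_def eval_nat_numeral)
  \<comment> \<open>points of the curve tending to the star along \<open>b2\<close>\<close>
  have "\<forall>k. \<exists>x y. (x, y) \<in> ?Y \<and> x \<noteq> 0 \<and> norm (1 / x) < inverse (real (Suc k)) \<and>
      norm (plane_h n x y - 4) < inverse (real (Suc k))"
    using plane_per_near_star[OF n3] by (metis inverse_positive_iff_positive of_nat_0_less_iff zero_less_Suc)
  then obtain x y where xy: "\<And>k. (x k, y k) \<in> ?Y" "\<And>k. x k \<noteq> 0"
    and xlim: "\<And>k. norm (1 / x k) < inverse (real (Suc k))"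
    and hlim: "\<And>k. norm (plane_h n (x k) (y k) - 4) < inverse (real (Suc k))"
    by metis
  define s where "s = (\<lambda>k. 1 / x k)"
  define h where "h = (\<lambda>k. plane_h n (x k) (y k))"
  have s0: "s k \<noteq> 0" for k using xy(2) by (simp add: s_def)
  have s: "s \<longlonglongrightarrow> 0"
    by (rule Lim_null_comparison[OF _ LIMSEQ_inverse_real_of_nat])
      (use xlim in \<open>auto simp: s_def intro!: always_eventually less_imp_le\<close>)
  have h: "h \<longlonglongrightarrow> 4"
  proof -
    have "(\<lambda>k. h k - 4) \<longlonglongrightarrow> 0"
      by (rule Lim_null_comparison[OF _ LIMSEQ_inverse_real_of_nat])
        (use hlim in \<open>auto simp: h_def intro!: always_eventually less_imp_le\<close>)
    then show ?thesis by (simp add: LIM_zero_iff)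
  qed
  have y: "y k = h k * s k ^ (n - 2) - 4 * s k" for k
  proof -
    have m: "n - 2 = Suc (n - 3)" using n by simp
    have "X ^ k * z * (1 / X) ^ Suc k = z / X" if "X \<noteq> 0" for X z :: complex and k
      using that by (simp add: power_one_over)
    then have eq: "h k * s k ^ (n - 2) = (x k * y k + 4) / x k"
      unfolding plane_h_def h_def s_def m using xy(2) by blast
    show ?thesis unfolding eq unfolding s_def using xy(2)[of k] by (simp add: add_divide_distrib)
  qed
  \<comment> \<open>Since s x = 1, the rescaled embedding vector is [s, 1, s y, s h, h], which
    equals \<open>star_vec\<close> + s W.\<close>
  define W where "W = (\<lambda>k. vec_of [1, 0, y k, h k, (h k - 4) / s k])"
  have Wc: "W k 0 = 1" "W k 1 = 0" "W k (Suc 0) = 0" "W k 2 = y k" "W k 3 = h k" "W k 4 = (h k - 4) / s k" "\<And>i. i > 4 \<Longrightarrow> W k i = 0" for k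
    by (simp_all add: W_def vec_of_def eval_nat_numeral)
  have ylim: "y \<longlonglongrightarrow> 0"
  proof -
    have "(\<lambda>k. h k * s k ^ (n - 2) - 4 * s k) \<longlonglongrightarrow> 4 * 0 ^ (n - 2) - 4 * 0" by (intro tendsto_intros h s)
    moreover have "(0::complex) ^ (n - 2) = 0" using n by (intro zero_power) simp
    ultimately show ?thesis by (simp flip: y)
  qed
  have quot: "(\<lambda>k. (h k - 4) / s k) \<longlonglongrightarrow> h1"
  proof -
    have "(h k - 4) / s k = rpoly2 G1 (h k) (s k) / c" for k
    proof -
      have "c * (4 - h k) + s k * rpoly2 G1 (h k) (s k) = 0"
        using GY[OF xy(1) xy(2), of k] unfolding Gs s_def h_def .
      then have "c * (h k - 4) = s k * rpoly2 G1 (h k) (s k)" by (simp add: algebra_simps)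
      then show ?thesis using c s0[of k] by (simp add: frac_eq_eq mult.commute)
    qed
    moreover have "(\<lambda>k. rpoly2 G1 (h k) (s k) / c) \<longlonglongrightarrow> h1"
      unfolding h1_def by (intro tendsto_intros tendsto_rpoly2 h s c)
    ultimately show ?thesis by simp
  qed
  have W: "(\<lambda>k. W k i) \<longlonglongrightarrow> b2 i" for i
    using emb_vec_cases[of i] h ylim quot by (elim disjE) (simp_all add: Wc b2)
  have curve: "(\<lambda>i. star_vec i + s k * W k i) = (\<lambda>i. s k * emb_vec n (x k) (y k) i)" for k
  proof
    fix i
    have "s k * x k = 1" using xy(2) by (simp add: s_def)
    then have "s k * (x k * h k) = h k" by (simp add: mult.assoc[symmetric])
    moreover have "plane_h n (x k) (y k) = h k" by (simp add: h_def)
    ultimately show "star_vec i + s k * W k i = s k * emb_vec n (x k) (y k) i"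
      using emb_vec_cases[of i] s0[of k] \<open>s k * x k = 1\<close>
      by (elim disjE) (auto simp: star_vec_coords Wc emb_vec_coords)
  qed
  have vanish: "form_eval p (\<lambda>i. star_vec i + s k * W k i) = 0" if "p \<in> vanishing_forms 4 (emb n ` ?Y)" for p k
  proof -
    have "(\<lambda>i. s k * emb_vec n (x k) (y k) i) \<in> emb n (x k, y k)"
      unfolding emb_def proj_pt_scale using s0 by auto
    then show ?thesis unfolding curve using that xy(1)[of k] by (auto simp: vanishing_forms_def)
  qed
  have star0: "form_eval p star_vec = 0" if "p \<in> vanishing_forms 4 (emb n ` ?Y)" for p
  proof -
    obtain L where "dir_deriv (form_eval p) star_vec L" using dir_deriv_form_eval by blast
    then have "(\<lambda>k. form_eval p (\<lambda>i. star_vec i + s k * W k i)) \<longlonglongrightarrow> form_eval p star_vec"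
      by (rule dir_deriv_continuous[where \<omega> = b2]) (intro s0 s W)+
    then show ?thesis unfolding vanish[OF that] by (simp add: LIMSEQ_const_iff)
  qed
  have X: "?X = zero_locus 4 (vanishing_forms 4 (emb n ` ?Y))"
    unfolding emb_closure_def by (rule closure_zariski) (auto simp: emb_in_space)
  have sub: "vanishing_forms 4 ?X \<subseteq> vanishing_forms 4 (emb n ` ?Y)"
    unfolding vanishing_forms_def using emb_closure_subset[of n ?Y] by blast
  have starX: "proj_pt star_vec \<in> ?X"
    unfolding X zero_locus_def
  proof (intro CollectI conjI ballI)
    show P: "proj_pt star_vec \<in> proj_space 4" unfolding proj_pt_in_space by (rule star_vec_space)
    fix p v assume p: "p \<in> vanishing_forms 4 (emb n ` ?Y)" and v: "v \<in> proj_pt star_vec"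
    then obtain d where "p \<in> forms \<rat> 4 d" by (auto simp: vanishing_forms_def)
    from zero_on_point_iff[OF this P self_in_proj_pt] star0[OF p] v show "form_eval p v = 0" by blast
  qed
  let ?T = "tangent_cone_space 4 ?X star_vec"
  have b1T: "star_vec \<in> ?T"
    unfolding tangent_cone_space_def
  proof (intro CollectI conjI ballI)
    show "star_vec \<in> vec_space 4" using star_vec_space by blast
    fix p assume p: "p \<in> vanishing_forms 4 ?X"
    then obtain d where pd: "p \<in> forms \<rat> 4 d" by (auto simp: vanishing_forms_def)
    have "form_eval p (\<lambda>i. star_vec i + t * star_vec i) = 0" for t
      using form_eval_scale[OF pd, of "1 + t" star_vec] star0 p sub by (auto simp: algebra_simps)
    then show "deriv (\<lambda>t. form_eval p (\<lambda>i. star_vec i + t * star_vec i)) 0 = 0" by simp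
  qed
  have b2T: "b2 \<in> ?T"
    unfolding tangent_cone_space_def
  proof (intro CollectI conjI ballI)
    show "b2 \<in> vec_space 4" by (simp add: vec_space_def b2)
    fix p assume "p \<in> vanishing_forms 4 ?X"
    then have p: "p \<in> vanishing_forms 4 (emb n ` ?Y)" using sub by blast
    obtain L where L: "dir_deriv (form_eval p) star_vec L" using dir_deriv_form_eval by blast
    have "(\<lambda>k. (form_eval p (\<lambda>i. star_vec i + s k * W k i) - form_eval p star_vec) / s k) \<longlonglongrightarrow> L b2"
      by (rule dir_derivD[OF L]) (intro s0 s W)+
    then have "(\<lambda>k::nat. 0) \<longlonglongrightarrow> L b2" unfolding vanish[OF p] star0[OF p] by simp
    then have "L b2 = 0" by (simp add: LIMSEQ_const_iff)
    then show "deriv (\<lambda>t. form_eval p (\<lambda>i. star_vec i + t * b2 i)) 0 = 0"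
      using DERIV_imp_deriv[OF dir_deriv_DERIV[OF L, of b2]] by simp
  qed
  have T_eqs: "w 3 = 4 * w 0 \<and> w 2 = 0 \<and> w 4 = 4 * w 1 + h1 * w 0" if w: "w \<in> ?T" for w
  proof -
    have der: "D = 0" if F: "rat_form 4 d F" "\<And>x y. (x, y) \<in> ?Y \<Longrightarrow> F (emb_vec n x y) = 0"
      and D: "((\<lambda>t. F (\<lambda>i. star_vec i + t * w i) / t) \<longlongrightarrow> D) (at 0)" "F star_vec = 0" for d F D
    proof -
      obtain p where p: "p \<in> vanishing_forms 4 ?X" "\<And>v. form_eval p v = F v"
        using vanishing_formsI[OF F(1) emb_closure_subset_form_zeros[OF F]] by blast
      have "deriv (\<lambda>t. F (\<lambda>i. star_vec i + t * w i)) 0 = D"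
        by (rule quotient_limit_deriv) (use D in simp_all)
      moreover have "deriv (\<lambda>t. F (\<lambda>i. star_vec i + t * w i)) 0 = 0"
        using w p(1) unfolding tangent_cone_space_def p(2)[symmetric] by blast
      ultimately show ?thesis by simp
    qed
    have nz: "\<forall>\<^sub>F t in at 0. t \<noteq> (0::complex)" by (simp add: eventually_at_filter)
    have t0: "((\<lambda>t. t) \<longlongrightarrow> (0::complex)) (at 0)" by (rule tendsto_ident_at)
    have f1: "rat_form 4 (1 + 1) (\<lambda>v. v 0 * v 4 - v 1 * v 3)"
      by (intro rat_form_diff rat_form_mult rat_form_var) auto
    have "4 * w 0 - w 3 = 0"
    proof (rule der[OF f1])
      have "((\<lambda>t. w 0 * (4 + t * w 4) - (1 + t * w 1) * w 3) \<longlongrightarrow> w 0 * (4 + 0 * w 4) - (1 + 0 * w 1) * w 3) (at 0)"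
        by (intro tendsto_intros t0)
      then have "((\<lambda>t. w 0 * (4 + t * w 4) - (1 + t * w 1) * w 3) \<longlongrightarrow> 4 * w 0 - w 3) (at 0)"
        by (simp add: mult.commute)
      then show "((\<lambda>t. ((star_vec 0 + t * w 0) * (star_vec 4 + t * w 4) - (star_vec 1 + t * w 1) * (star_vec 3 + t * w 3)) / t)
          \<longlongrightarrow> 4 * w 0 - w 3) (at 0)"
        by (rule Lim_transform_eventually)
          (rule eventually_mono[OF nz], simp add: star_vec_coords field_simps)
    qed (simp_all add: emb_vec_coords star_vec_coords)
    moreover have "w 2 = 0"
    proof -
      \<comment> \<open>Only the term v1^(n - 2) v2 has a nonzero differential at the point; the two
        others vanish there to order at least 2.\<close>
      have f2: "rat_form 4 (n - 1) (\<lambda>v. v 1 ^ (n - 2) * v 2 + 4 * (v 1 ^ (n - 3) * v 0 ^ 2) - v 3 * v 0 ^ (n - 2))"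
      proof (intro rat_form_diff rat_form_add rat_form_cmult)
        show "rat_form 4 (n - 1) (\<lambda>v. v 1 ^ (n - 2) * v 2)"
          by (rule rat_form_degree[OF rat_form_mult[OF rat_form_power[OF rat_form_var] rat_form_var]]) (use n in auto)
        show "rat_form 4 (n - 1) (\<lambda>v. v 1 ^ (n - 3) * v 0 ^ 2)"
          by (rule rat_form_degree[OF rat_form_mult[OF rat_form_power[OF rat_form_var] rat_form_power[OF rat_form_var]]])
            (use n in auto)
        show "rat_form 4 (n - 1) (\<lambda>v. v 3 * v 0 ^ (n - 2))"
          by (rule rat_form_degree[OF rat_form_mult[OF rat_form_var rat_form_power[OF rat_form_var]]]) (use n in auto)
      qed simp
      have hn: "plane_h n x y = x ^ (n - 2) * y + 4 * x ^ (n - 3)" for x y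
      proof -
        have "n - 2 = Suc (n - 3)" using n by simp
        then show ?thesis by (simp only: plane_h_def power_Suc) (simp add: algebra_simps)
      qed
      have z: "(0::complex) ^ (n - 2) = 0" using n by (intro zero_power) simp
      show ?thesis
      proof (rule der[OF f2])
        have "((\<lambda>t. (1 + t * w 1) ^ (n - 2) * w 2 + 4 * ((1 + t * w 1) ^ (n - 3) * (t * w 0 ^ 2)) - w 3 * (t * w 0) ^ (n - 2))
            \<longlongrightarrow> (1 + 0 * w 1) ^ (n - 2) * w 2 + 4 * ((1 + 0 * w 1) ^ (n - 3) * (0 * w 0 ^ 2)) - w 3 * (0 * w 0) ^ (n - 2)) (at 0)"
          by (intro tendsto_intros t0)
        then have "((\<lambda>t. (1 + t * w 1) ^ (n - 2) * w 2 + 4 * ((1 + t * w 1) ^ (n - 3) * (t * w 0 ^ 2)) - w 3 * (t * w 0) ^ (n - 2))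
            \<longlongrightarrow> w 2) (at 0)" by (simp add: z)
        then show "((\<lambda>t. ((star_vec 1 + t * w 1) ^ (n - 2) * (star_vec 2 + t * w 2) +
            4 * ((star_vec 1 + t * w 1) ^ (n - 3) * (star_vec 0 + t * w 0) ^ 2) -
            (star_vec 3 + t * w 3) * (star_vec 0 + t * w 0) ^ (n - 2)) / t) \<longlongrightarrow> w 2) (at 0)"
          by (rule Lim_transform_eventually)
            (rule eventually_mono[OF nz], simp add: star_vec_coords add_divide_distrib diff_divide_distrib power2_eq_square)
        show "emb_vec n x y 1 ^ (n - 2) * emb_vec n x y 2 + 4 * (emb_vec n x y 1 ^ (n - 3) * emb_vec n x y 0 ^ 2) -
            emb_vec n x y 3 * emb_vec n x y 0 ^ (n - 2) = 0" for x y
          by (simp only: emb_vec_coords hn power_one mult_1_right, simp)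
        show "star_vec 1 ^ (n - 2) * star_vec 2 + 4 * (star_vec 1 ^ (n - 3) * star_vec 0 ^ 2) -
            star_vec 3 * star_vec 0 ^ (n - 2) = 0" by (simp add: star_vec_coords)
      qed
    qed
    moreover have "c * (4 * w 1 - w 4) + w 0 * rpoly2 G1 4 0 = 0"
    \<comment> \<open>Homogenisation in the chart v1 /= 0, where v4 / v1 = h and v0 / v1 = 1 /
      x.\<close>
    proof (rule homogenize[of 1 4 4 0 G])
      fix d F assume F: "rat_form 4 d F"
        and F1: "\<And>v. v 1 \<noteq> 0 \<Longrightarrow> F v = v 1 ^ d * rpoly2 G (v 4 / v 1) (v 0 / v 1)"
        and F0: "\<And>v. v 1 = 0 \<Longrightarrow> F v = 0"
      show ?thesis
      proof (rule der[OF F])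
        show "F (emb_vec n x y) = 0" if "(x, y) \<in> ?Y" for x y
        proof (cases "x = 0")
          case False
          then show ?thesis using F1[of "emb_vec n x y"] GY[OF that False] by (simp add: emb_vec_coords)
        qed (simp add: F0 emb_vec_coords)
        show "F star_vec = 0" using F1[of star_vec] G0[of 4] by (simp add: star_vec_coords)
        let ?a = "\<lambda>t. 1 + t * w 1"
        have a: "(?a \<longlongrightarrow> 1) (at 0)" using tendsto_add[OF tendsto_const[of 1] tendsto_mult[OF t0 tendsto_const[of "w 1"]]] by simp
        have H: "((\<lambda>t. (4 + t * w 4) / ?a t) \<longlongrightarrow> (4 + 0 * w 4) / 1) (at 0)" by (intro tendsto_intros t0 a) simp
        have S: "((\<lambda>t. (t * w 0) / ?a t) \<longlongrightarrow> (0 * w 0) / 1) (at 0)" by (intro tendsto_intros t0 a) simp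
        have "((\<lambda>t. ?a t ^ d * (c * ((4 * w 1 - w 4) / ?a t) + w 0 / ?a t * rpoly2 G1 ((4 + t * w 4) / ?a t) ((t * w 0) / ?a t)))
            \<longlongrightarrow> 1 ^ d * (c * ((4 * w 1 - w 4) / 1) + w 0 / 1 * rpoly2 G1 ((4 + 0 * w 4) / 1) ((0 * w 0) / 1))) (at 0)"
          by (intro tendsto_intros tendsto_rpoly2 a H S) simp_all
        then have lim: "((\<lambda>t. ?a t ^ d * (c * ((4 * w 1 - w 4) / ?a t) + w 0 / ?a t * rpoly2 G1 ((4 + t * w 4) / ?a t) ((t * w 0) / ?a t)))
            \<longlongrightarrow> c * (4 * w 1 - w 4) + w 0 * rpoly2 G1 4 0) (at 0)" by simp
        have "\<forall>\<^sub>F t in at 0. ?a t \<noteq> 0" by (rule tendsto_imp_eventually_ne[OF a]) simp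
        then have "\<forall>\<^sub>F t in at 0. ?a t ^ d * (c * ((4 * w 1 - w 4) / ?a t) + w 0 / ?a t * rpoly2 G1 ((4 + t * w 4) / ?a t) ((t * w 0) / ?a t)) =
            F (\<lambda>i. star_vec i + t * w i) / t"
        proof (rule eventually_mono[OF eventually_conj[OF nz]])
          fix t assume t: "t \<noteq> 0 \<and> ?a t \<noteq> 0"
          have e: "4 - (4 + t * w 4) / ?a t = t * ((4 * w 1 - w 4) / ?a t)"
            using t by (simp add: field_simps)
          have "c * (t * X) + (t * w 0) / Z * R = t * (c * X + w 0 / Z * R)" for X Z R
            by (simp add: distrib_left)
          then have "rpoly2 G ((4 + t * w 4) / ?a t) ((t * w 0) / ?a t) =
              t * (c * ((4 * w 1 - w 4) / ?a t) + w 0 / ?a t * rpoly2 G1 ((4 + t * w 4) / ?a t) ((t * w 0) / ?a t))"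
            unfolding Gs e .
          moreover have "F (\<lambda>i. star_vec i + t * w i) = ?a t ^ d * rpoly2 G ((4 + t * w 4) / ?a t) ((t * w 0) / ?a t)"
            using F1[of "\<lambda>i. star_vec i + t * w i"] t by (simp add: star_vec_coords)
          ultimately show "?a t ^ d * (c * ((4 * w 1 - w 4) / ?a t) + w 0 / ?a t * rpoly2 G1 ((4 + t * w 4) / ?a t) ((t * w 0) / ?a t)) =
            F (\<lambda>i. star_vec i + t * w i) / t" using t by simp
        qed
        then show "((\<lambda>t. F (\<lambda>i. star_vec i + t * w i) / t) \<longlongrightarrow> c * (4 * w 1 - w 4) + w 0 * rpoly2 G1 4 0) (at 0)"
          by (rule Lim_transform_eventually[OF lim])
      qed
    qed simp_all
    then have "w 4 = 4 * w 1 + h1 * w 0"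
      unfolding h1_def using c by (simp add: field_simps)
    ultimately show ?thesis by simp
  qed
  interpret cv: vector_space "\<lambda>(c::complex) (w::nat \<Rightarrow> complex) i. c * w i" by (rule vector_space_fun)
  have "cv.dim ?T = 2"
  proof (rule cv.dim_unique)
    show "{star_vec, b2} \<subseteq> ?T" using b1T b2T by blast
    show "?T \<subseteq> cv.span {star_vec, b2}"
    proof
      fix w assume w: "w \<in> ?T"
      then have "w \<in> vec_space 4" by (simp add: tangent_cone_space_def)
      have "w = (\<lambda>i. w 1 * star_vec i) + (\<lambda>i. w 0 * b2 i)"
      proof
        fix i show "w i = ((\<lambda>i. w 1 * star_vec i) + (\<lambda>i. w 0 * b2 i)) i"
          using T_eqs[OF w] \<open>w \<in> vec_space 4\<close> emb_vec_cases[of i]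
          by (elim disjE) (simp_all add: star_vec_coords b2 vec_space_def)
      qed
      moreover have "(\<lambda>i. w 1 * star_vec i) + (\<lambda>i. w 0 * b2 i) \<in> cv.span {star_vec, b2}"
        by (intro cv.span_add cv.span_scale cv.span_base) auto
      ultimately show "w \<in> cv.span {star_vec, b2}" by simp
    qed
    have ne: "star_vec \<noteq> b2" using star_vec_coords(1) b2(1) by (metis zero_neq_one)
    then show "card {star_vec, b2} = 2" by simp
    show "cv.independent {star_vec, b2}"
    proof
      assume "cv.dependent {star_vec, b2}"
      then obtain u where u: "\<exists>v\<in>{star_vec, b2}. u v \<noteq> 0" "(\<Sum>v\<in>{star_vec, b2}. (\<lambda>i. u v * v i)) = 0"
        using cv.dependent_finite[of "{star_vec, b2}"] by auto
      then have "u star_vec * star_vec i + u b2 * b2 i = 0" for i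
        using ne by (simp add: fun_eq_iff)
      from this[of 0] this[of 1] show False using u(1) by (simp add: star_vec_coords b2)
    qed
  qed
  then have "cv.dim (tangent_cone_space 4 ?X v) = 2" if "v \<in> proj_pt star_vec" for v
    using that unfolding proj_pt_scale by (auto simp: tangent_cone_space_scale)
  then show ?thesis using starX unfolding smooth_point_def by blast
qed

lemma rational_star: "rational_point (proj_pt star_vec)"
proof -
  have "star_vec i \<in> \<rat>" for i
    using emb_vec_cases[of i] by (elim disjE) (simp_all add: star_vec_coords)
  then show ?thesis unfolding rational_point_def using self_in_proj_pt by blast
qed

section \<open>The normal form of a quadratic rational map\<close>

definition pt :: "complex \<Rightarrow> complex \<Rightarrow> point" where
  "pt x y = proj_pt (vec_of [x, y])"

lemma vec2_coords: "vec_of [x, y] 0 = x" "vec_of [x, y] 1 = y" "vec_of [x, y] (Suc 0) = y" "i > 1 \<Longrightarrow> vec_of [x, y] i = 0"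
  by (simp_all add: vec_of_def)

lemma vec2_eta: "v \<in> vec_space 1 \<Longrightarrow> v = vec_of [v 0, v 1]"
  by (rule ext) (auto simp: vec_space_def vec_of_def less_Suc_eq)

lemma vec2_space: "vec_of [x, y] \<in> vec_space 1"
  by (simp add: vec_space_def vec2_coords)

lemma vec2_eq_0: "vec_of [x, y] = 0 \<longleftrightarrow> x = 0 \<and> y = 0"
proof
  assume "vec_of [x, y] = 0"
  then show "x = 0 \<and> y = 0" by (metis vec2_coords(1,2) zero_fun_apply)
next
  assume "x = 0 \<and> y = 0"
  then show "vec_of [x, y] = 0" by (auto simp: fun_eq_iff vec_of_def less_Suc_eq)
qed

lemma pt_in_space: "pt x y \<in> proj_space 1 \<longleftrightarrow> \<not> (x = 0 \<and> y = 0)"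
  unfolding pt_def proj_pt_in_space using vec2_space vec2_eq_0 by blast

lemma pt_cases:
  assumes "P \<in> proj_space 1"
  obtains x y where "P = pt x y" "\<not> (x = 0 \<and> y = 0)"
proof -
  obtain v where v: "v \<in> vec_space 1" "v \<noteq> 0" "P = proj_pt v" using assms by (rule proj_spaceE)
  then have "P = pt (v 0) (v 1)" unfolding pt_def using vec2_eta by metis
  then show ?thesis using that[of "v 0" "v 1"] assms pt_in_space by metis
qed

lemma vec2_scale: "(\<lambda>i. c * vec_of [x, y] i) = vec_of [c * x, c * y]"
  by (auto simp: fun_eq_iff vec_of_def less_Suc_eq)

lemma pt_scale: "c \<noteq> 0 \<Longrightarrow> pt (c * x) (c * y) = pt x y"
  unfolding pt_def vec2_scale[symmetric] by (rule proj_pt_eq)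

lemma pt_eq_iff:
  assumes "\<not> (x = 0 \<and> y = 0)" "\<not> (x' = 0 \<and> y' = 0)"
  shows "pt x y = pt x' y' \<longleftrightarrow> x * y' = y * x'"
proof
  assume "pt x y = pt x' y'"
  then have "vec_of [x, y] \<in> proj_pt (vec_of [x', y'])" unfolding pt_def using self_in_proj_pt by blast
  then obtain c where "vec_of [x, y] = vec_of [c * x', c * y']"
    unfolding proj_pt_scale vec2_scale by blast
  then have "x = c * x'" "y = c * y'" by (metis vec2_coords(1), metis vec2_coords(2))
  then show "x * y' = y * x'" by simp
next
  assume eq: "x * y' = y * x'"
  show "pt x y = pt x' y'"
  proof (cases "x' = 0")
    case True
    then have "y' \<noteq> 0" "x = 0" using assms eq by auto
    then show ?thesis using pt_scale[of "y / y'" x' y'] assms True by simp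
  next
    case False
    then have y: "y = x / x' * y'" using eq by (simp add: field_simps)
    have "x \<noteq> 0"
    proof
      assume "x = 0"
      then have "y = 0" using y by simp
      then show False using assms(1) \<open>x = 0\<close> by simp
    qed
    with y show ?thesis using pt_scale[of "x / x'" x' y'] False by simp
  qed
qed

section \<open>Pairs of binary quadratic forms and their derivatives\<close>

type_synonym quad_form = "complex \<times> complex \<times> complex"

definition quad :: "quad_form \<Rightarrow> complex \<Rightarrow> complex \<Rightarrow> complex" where
  "quad A x y = (case A of (a, b, c) \<Rightarrow> a * x\<^sup>2 + b * x * y + c * y\<^sup>2)"

text \<open>The Jacobian determinant of the pair (A, B), whose zeros are the critical points. Being
  a form, it transforms under changes of coordinates without reference to charts.\<close>

definition jac :: "quad_form \<Rightarrow> quad_form \<Rightarrow> complex \<Rightarrow> complex \<Rightarrow> complex" where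
  "jac A B x y = (case (A, B) of ((a, b, c), (d, e, f)) \<Rightarrow>
     (2 * a * x + b * y) * (e * x + 2 * f * y) - (b * x + 2 * c * y) * (2 * d * x + e * y))"

definition rep :: "(point \<Rightarrow> point) \<Rightarrow> quad_form \<Rightarrow> quad_form \<Rightarrow> bool" where
  "rep \<phi> A B \<longleftrightarrow> (\<forall>x y. \<not> (x = 0 \<and> y = 0) \<longrightarrow>
     \<not> (quad A x y = 0 \<and> quad B x y = 0) \<and> \<phi> (pt x y) = pt (quad A x y) (quad B x y))"

lemma monom_eval_2:
  assumes "Poly_Mapping.keys m \<subseteq> {..1}" "(\<Sum>i\<in>Poly_Mapping.keys m. Poly_Mapping.lookup m i) = d"
  shows "\<exists>i j. i + j = d \<and> (\<forall>v. monom_eval m v = v 0 ^ i * v (1::nat) ^ j)"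
proof -
  have sub: "Poly_Mapping.keys m \<subseteq> {0, 1}" using assms(1) by auto
  have "monom_eval m v = v 0 ^ Poly_Mapping.lookup m 0 * v 1 ^ Poly_Mapping.lookup m 1" for v
    using monom_eval_superset[OF _ sub, of v] by simp
  moreover have "Poly_Mapping.lookup m 0 + Poly_Mapping.lookup m 1 = d"
  proof -
    have "(\<Sum>i\<in>Poly_Mapping.keys m. Poly_Mapping.lookup m i) = (\<Sum>i\<in>{0, 1}. Poly_Mapping.lookup m i)"
      using sub by (intro sum.mono_neutral_left) (auto simp: in_keys_iff)
    then show ?thesis using assms(2) by simp
  qed
  ultimately show ?thesis by blast
qed

lemma form_eval_sum_monom: "form_eval p v = (\<Sum>m\<in>Poly_Mapping.keys p. Poly_Mapping.lookup p m * monom_eval m v)"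
  by (simp add: form_eval_def monom_eval_def)

lemma quad_form_eval:
  assumes "p \<in> forms UNIV 1 2" shows "\<exists>A. \<forall>v. form_eval p v = quad A (v 0) (v 1)"
proof -
  have "\<exists>A. \<forall>v. (\<Sum>m\<in>S. Poly_Mapping.lookup p m * monom_eval m v) = quad A (v 0) (v 1)"
    if "finite S" "S \<subseteq> Poly_Mapping.keys p" for S
    using that
  proof (induction S rule: finite_induct)
    case empty
    show ?case by (intro exI[of _ "(0, 0, 0)"]) (simp add: quad_def)
  next
    case (insert m S)
    then obtain A where A: "\<And>v. (\<Sum>m\<in>S. Poly_Mapping.lookup p m * monom_eval m v) = quad A (v 0) (v 1)" by auto
    obtain a b c where abc: "A = (a, b, c)" by (cases A)
    have "m \<in> Poly_Mapping.keys p" using insert.prems by simp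
    then obtain i j where ij: "i + j = 2" "\<And>v. monom_eval m v = v 0 ^ i * v 1 ^ j"
      using assms monom_eval_2[of m 2] unfolding forms_def by blast
    let ?l = "Poly_Mapping.lookup p m"
    consider "i = 2" "j = 0" | "i = 1" "j = 1" | "i = 0" "j = 2" using ij(1) by linarith
    then show ?case
    proof cases
      case 1
      then show ?thesis using insert.hyps A ij(2) abc
        by (intro exI[of _ "(a + ?l, b, c)"]) (auto simp: quad_def algebra_simps)
    next
      case 2
      then show ?thesis using insert.hyps A ij(2) abc
        by (intro exI[of _ "(a, b + ?l, c)"]) (auto simp: quad_def algebra_simps)
    next
      case 3
      then show ?thesis using insert.hyps A ij(2) abc
        by (intro exI[of _ "(a, b, c + ?l)"]) (auto simp: quad_def algebra_simps)
    qed
  qed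
  from this[OF finite_keys order_refl] show ?thesis unfolding form_eval_sum_monom .
qed

lemma linear_form_eval:
  assumes "p \<in> forms UNIV 1 1" shows "\<exists>a b. \<forall>v. form_eval p v = a * v 0 + b * v 1"
proof -
  have "\<exists>a b. \<forall>v. (\<Sum>m\<in>S. Poly_Mapping.lookup p m * monom_eval m v) = a * v 0 + b * v 1"
    if "finite S" "S \<subseteq> Poly_Mapping.keys p" for S
    using that
  proof (induction S rule: finite_induct)
    case empty
    show ?case by (intro exI[of _ 0]) simp
  next
    case (insert m S)
    then obtain a b where A: "\<And>v. (\<Sum>m\<in>S. Poly_Mapping.lookup p m * monom_eval m v) = a * v 0 + b * v 1" by auto
    have "m \<in> Poly_Mapping.keys p" using insert.prems by simp
    then obtain i j where ij: "i + j = 1" "\<And>v. monom_eval m v = v 0 ^ i * v 1 ^ j"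
      using assms monom_eval_2[of m 1] unfolding forms_def by blast
    let ?l = "Poly_Mapping.lookup p m"
    consider "i = 1" "j = 0" | "i = 0" "j = 1" using ij(1) by linarith
    then show ?case
    proof cases
      case 1
      then show ?thesis using insert.hyps A ij(2)
        by (intro exI[of _ "a + ?l"] exI[of _ b]) (auto simp: algebra_simps)
    next
      case 2
      then show ?thesis using insert.hyps A ij(2)
        by (intro exI[of _ a] exI[of _ "b + ?l"]) (auto simp: algebra_simps)
    qed
  qed
  from this[OF finite_keys order_refl] show ?thesis unfolding form_eval_sum_monom .
qed

lemma forms_UNIV_add: "p \<in> forms UNIV N d \<Longrightarrow> q \<in> forms UNIV N d \<Longrightarrow> p + q \<in> forms UNIV N d"
  using Poly_Mapping.keys_add[of p q] unfolding forms_def by blast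

lemma forms_UNIV_monom:
  "i \<le> N \<Longrightarrow> j \<le> N \<Longrightarrow> \<exists>p\<in>forms UNIV N 2. \<forall>v. form_eval p v = c * (v i * v j)"
proof (intro bexI[of _ "Poly_Mapping.single (Poly_Mapping.single i 1 + Poly_Mapping.single j 1) c"] allI)
  assume ij: "i \<le> N" "j \<le> N"
  let ?m = "Poly_Mapping.single i (1::nat) + Poly_Mapping.single j 1"
  have "Poly_Mapping.keys ?m \<subseteq> {..N}"
    using Poly_Mapping.keys_add[of "Poly_Mapping.single i (1::nat)" "Poly_Mapping.single j 1"] ij by auto
  moreover have "(\<Sum>k\<in>Poly_Mapping.keys ?m. Poly_Mapping.lookup ?m k) = 2"
    unfolding sum_lookup_add by simp
  ultimately show "Poly_Mapping.single ?m c \<in> forms UNIV N 2" by (auto simp: forms_def)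
  show "form_eval (Poly_Mapping.single ?m c) v = c * (v i * v j)" for v
    unfolding form_eval_single monom_eval_add by (simp add: monom_eval_def)
qed

lemma quad_is_form: "\<exists>p\<in>forms UNIV 1 2. \<forall>v. form_eval p v = quad A (v 0) (v 1)"
proof -
  obtain a b c where A: "A = (a, b, c)" by (cases A)
  obtain p where p: "p \<in> forms UNIV 1 2" "\<And>v. form_eval p v = a * (v 0 * v 0)" using forms_UNIV_monom[of 0 1 0 a] by auto
  obtain q where q: "q \<in> forms UNIV 1 2" "\<And>v. form_eval q v = b * (v 0 * v 1)" using forms_UNIV_monom[of 0 1 1 b] by auto
  obtain r where r: "r \<in> forms UNIV 1 2" "\<And>v. form_eval r v = c * (v 1 * v 1)" using forms_UNIV_monom[of 1 1 1 c] by auto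
  have "p + q + r \<in> forms UNIV 1 2" using p(1) q(1) r(1) by (intro forms_UNIV_add)
  then show ?thesis
    by (rule bexI[rotated]) (simp add: form_eval_add p(2) q(2) r(2) A quad_def power2_eq_square mult.assoc)
qed

lemma represents_rep:
  assumes "represents F 2 \<phi>"
  obtains A B where "rep \<phi> A B" "\<And>v. forms_eval F v = vec_of [quad A (v 0) (v 1), quad B (v 0) (v 1)]"
proof -
  obtain p q where F: "F = [p, q]" using assms by (auto simp: represents_def length_Suc_conv numeral_2_eq_2)
  then have "p \<in> forms UNIV 1 2" "q \<in> forms UNIV 1 2" using assms by (auto simp: represents_def)
  then obtain A B where AB: "\<And>v. form_eval p v = quad A (v 0) (v 1)" "\<And>v. form_eval q v = quad B (v 0) (v 1)"
    using quad_form_eval by metis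
  then have ev: "forms_eval F v = vec_of [quad A (v 0) (v 1), quad B (v 0) (v 1)]" for v
    by (simp add: forms_eval_def F)
  have "rep \<phi> A B" unfolding rep_def
  proof (intro allI impI)
    fix x y :: complex assume "\<not> (x = 0 \<and> y = 0)"
    then have "vec_of [x, y] \<in> vec_space 1 - {0}" using vec2_space vec2_eq_0 by blast
    then have *: "forms_eval F (vec_of [x, y]) \<noteq> 0" "\<phi> (pt x y) = proj_pt (forms_eval F (vec_of [x, y]))"
      using assms unfolding represents_def pt_def by blast+
    have "forms_eval F (vec_of [x, y]) = vec_of [quad A x y, quad B x y]" by (simp add: ev vec2_coords)
    then show "\<not> (quad A x y = 0 \<and> quad B x y = 0) \<and> \<phi> (pt x y) = pt (quad A x y) (quad B x y)"
      using * by (simp add: vec2_eq_0 pt_def)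
  qed
  then show ?thesis using that ev by blast
qed

lemma rep_represents:
  assumes "rep \<phi> A B"
  obtains F where "represents F 2 \<phi>" "\<And>v. forms_eval F v = vec_of [quad A (v 0) (v 1), quad B (v 0) (v 1)]"
proof -
  obtain p q where p: "p \<in> forms UNIV 1 2" "\<And>v. form_eval p v = quad A (v 0) (v 1)"
    and q: "q \<in> forms UNIV 1 2" "\<And>v. form_eval q v = quad B (v 0) (v 1)"
    using quad_is_form by metis
  have ev: "forms_eval [p, q] v = vec_of [quad A (v 0) (v 1), quad B (v 0) (v 1)]" for v
    by (simp add: forms_eval_def p q)
  have "represents [p, q] 2 \<phi>"
    unfolding represents_def
  proof (intro conjI ballI)
    fix v assume v: "v \<in> vec_space 1 - {0}"
    then have eta: "v = vec_of [v 0, v 1]" using vec2_eta by blast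
    then have ne: "\<not> (v 0 = 0 \<and> v 1 = 0)" using v vec2_eq_0 by (metis DiffE singletonI)
    then have *: "\<not> (quad A (v 0) (v 1) = 0 \<and> quad B (v 0) (v 1) = 0)"
      "\<phi> (pt (v 0) (v 1)) = pt (quad A (v 0) (v 1)) (quad B (v 0) (v 1))"
      using assms unfolding rep_def by blast+
    then show "forms_eval [p, q] v \<noteq> 0" unfolding ev vec2_eq_0 by blast
    show "\<phi> (proj_pt v) = proj_pt (forms_eval [p, q] v)"
      using *(2) eta unfolding ev pt_def by metis
  qed (use p q in auto)
  then show ?thesis using that ev by blast
qed

subsection \<open>Derivatives in charts\<close>

lemma chart_eq: "chart P z = (if P = pt 1 0 then pt 1 z else pt z 1)"
  by (simp add: chart_def pt_def)

lemma inv_chart_inf: "inv (chart (pt 1 0)) (pt 1 z) = z"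
proof -
  have "inj (chart (pt 1 0))" by (rule injI) (simp add: chart_eq pt_eq_iff)
  from inv_f_f[OF this, of z] show ?thesis by (simp add: chart_eq)
qed

lemma inv_chart_fin: "P \<noteq> pt 1 0 \<Longrightarrow> inv (chart P) (pt z 1) = z"
proof -
  assume P: "P \<noteq> pt 1 0"
  then have "inj (chart P)" by (intro injI) (simp add: chart_eq pt_eq_iff)
  from inv_f_f[OF this, of z] show ?thesis using P by (simp add: chart_eq)
qed

lemma pt_eq_inf: "\<not> (x = 0 \<and> y = 0) \<Longrightarrow> pt x y = pt 1 0 \<longleftrightarrow> y = 0"
  by (subst pt_eq_iff) auto

lemma nonzero_near:
  fixes f :: "complex \<Rightarrow> complex"
  assumes "(f has_field_derivative f') (at z0)" "f z0 \<noteq> 0"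
  shows "\<forall>\<^sub>F z in nhds z0. f z \<noteq> 0"
proof -
  have "f \<midarrow>z0\<rightarrow> f z0" using DERIV_isCont[OF assms(1)] by (simp add: isCont_def)
  then have "\<forall>\<^sub>F z in at z0. f z \<noteq> 0" using assms(2) by (rule tendsto_imp_eventually_ne)
  then show ?thesis unfolding eventually_at_filter
    by (rule eventually_mono) (use assms(2) in auto)
qed

lemma deriv_chart:
  assumes f: "(f has_field_derivative f') (at z0)" and g: "(g has_field_derivative g') (at z0)"
    and nz: "\<not> (f z0 = 0 \<and> g z0 = 0)"
  shows "deriv (\<lambda>z. inv (chart (pt (f z0) (g z0))) (pt (f z) (g z))) z0 =
    (if g z0 = 0 then (g' * f z0 - g z0 * f') / (f z0)\<^sup>2 else (f' * g z0 - f z0 * g') / (g z0)\<^sup>2)"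
proof (cases "g z0 = 0")
  case True
  then have f0: "f z0 \<noteq> 0" using nz by simp
  have ev: "\<forall>\<^sub>F z in nhds z0. f z \<noteq> 0"
    by (rule nonzero_near[OF f f0])
  have D: "((\<lambda>z. g z / f z) has_field_derivative (g' * f z0 - g z0 * f') / (f z0 * f z0)) (at z0)"
    by (rule DERIV_divide[OF g f f0])
  have E: "\<forall>\<^sub>F z in nhds z0. g z / f z = inv (chart (pt (f z0) (g z0))) (pt (f z) (g z))"
    using ev
  proof (rule eventually_mono)
    fix z assume "f z \<noteq> 0"
    then have "pt (f z) (g z) = pt 1 (g z / f z)" by (subst pt_eq_iff) auto
    moreover have "pt (f z0) (g z0) = pt 1 0" using True f0 by (simp add: pt_eq_inf)
    ultimately show "g z / f z = inv (chart (pt (f z0) (g z0))) (pt (f z) (g z))" by (simp add: inv_chart_inf)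
  qed
  have "((\<lambda>z. inv (chart (pt (f z0) (g z0))) (pt (f z) (g z))) has_field_derivative (g' * f z0 - g z0 * f') / (f z0 * f z0)) (at z0)"
    by (rule DERIV_cong_ev[OF refl E refl, THEN iffD1, OF D])
  then show ?thesis using True by (simp add: DERIV_imp_deriv power2_eq_square)
next
  case False
  have ev: "\<forall>\<^sub>F z in nhds z0. g z \<noteq> 0"
    by (rule nonzero_near[OF g False])
  have D: "((\<lambda>z. f z / g z) has_field_derivative (f' * g z0 - f z0 * g') / (g z0 * g z0)) (at z0)"
    by (rule DERIV_divide[OF f g False])
  have E: "\<forall>\<^sub>F z in nhds z0. f z / g z = inv (chart (pt (f z0) (g z0))) (pt (f z) (g z))"
    using ev
  proof (rule eventually_mono)
    fix z assume "g z \<noteq> 0"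
    then have "pt (f z) (g z) = pt (f z / g z) 1" by (subst pt_eq_iff) auto
    moreover have "pt (f z0) (g z0) \<noteq> pt 1 0" using False by (simp add: pt_eq_inf)
    ultimately show "f z / g z = inv (chart (pt (f z0) (g z0))) (pt (f z) (g z))" by (simp add: inv_chart_fin)
  qed
  have "((\<lambda>z. inv (chart (pt (f z0) (g z0))) (pt (f z) (g z))) has_field_derivative (f' * g z0 - f z0 * g') / (g z0 * g z0)) (at z0)"
    by (rule DERIV_cong_ev[OF refl E refl, THEN iffD1, OF D])
  then show ?thesis using False by (simp add: DERIV_imp_deriv power2_eq_square)
qed

lemma jac_scale: "jac A B (c * x) (c * y) = c\<^sup>2 * jac A B x y"
  by (cases A; cases B) (simp add: jac_def algebra_simps power2_eq_square)

lemma quad_scale: "quad A (c * x) (c * y) = c\<^sup>2 * quad A x y"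
  by (cases A) (simp add: quad_def algebra_simps power2_eq_square)

text \<open>By Euler's relation, f' g - f g' is half the Jacobian at y = 1. The sign records whether
  the point and its image use the same chart.\<close>

lemma local_deriv_fin:
  assumes "rep \<phi> A B"
  shows "local_deriv \<phi> (pt z 1) = (if quad B z 1 = 0 then - jac A B z 1 / (2 * (quad A z 1)\<^sup>2)
    else jac A B z 1 / (2 * (quad B z 1)\<^sup>2))"
proof -
  obtain a b c where A: "A = (a, b, c)" by (cases A)
  obtain d e f where B: "B = (d, e, f)" by (cases B)
  have r: "\<not> (quad A z 1 = 0 \<and> quad B z 1 = 0)" "\<phi> (pt z 1) = pt (quad A z 1) (quad B z 1)" for z
    using assms by (auto simp: rep_def)
  have fin: "pt z 1 \<noteq> pt 1 0" by (simp add: pt_eq_inf)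
  have "inv (chart (\<phi> (pt z 1))) \<circ> \<phi> \<circ> chart (pt z 1) =
      (\<lambda>w. inv (chart (pt (quad A z 1) (quad B z 1))) (pt (quad A w 1) (quad B w 1)))"
    using fin r by (auto simp: fun_eq_iff chart_eq)
  then have "local_deriv \<phi> (pt z 1) = deriv (\<lambda>w. inv (chart (pt (quad A z 1) (quad B z 1))) (pt (quad A w 1) (quad B w 1))) z"
    unfolding local_deriv_def inv_chart_fin[OF fin] by simp
  also have "\<dots> = (if quad B z 1 = 0 then ((2 * d * z + e) * quad A z 1 - quad B z 1 * (2 * a * z + b)) / (quad A z 1)\<^sup>2
     else ((2 * a * z + b) * quad B z 1 - quad A z 1 * (2 * d * z + e)) / (quad B z 1)\<^sup>2)"
  proof (rule deriv_chart[where f = "\<lambda>w. quad A w 1" and g = "\<lambda>w. quad B w 1"])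
    show "\<not> (quad A z 1 = 0 \<and> quad B z 1 = 0)" by (rule r(1))
    show "((\<lambda>w. quad A w 1) has_field_derivative 2 * a * z + b) (at z)"
      unfolding A quad_def prod.case by (auto intro!: derivative_eq_intros)
    show "((\<lambda>w. quad B w 1) has_field_derivative 2 * d * z + e) (at z)"
      unfolding B quad_def prod.case by (auto intro!: derivative_eq_intros)
  qed
  also have "(2 * a * z + b) * quad B z 1 - quad A z 1 * (2 * d * z + e) = jac A B z 1 / 2"
    unfolding A B quad_def jac_def prod.case by (simp add: field_simps power2_eq_square)
  also have "(2 * d * z + e) * quad A z 1 - quad B z 1 * (2 * a * z + b) = - jac A B z 1 / 2"
    unfolding A B quad_def jac_def prod.case by (simp add: field_simps power2_eq_square)
  finally show ?thesis by simp
qed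

lemma local_deriv_inf:
  assumes "rep \<phi> A B"
  shows "local_deriv \<phi> (pt 1 0) = (if quad B 1 0 = 0 then jac A B 1 0 / (2 * (quad A 1 0)\<^sup>2)
    else - jac A B 1 0 / (2 * (quad B 1 0)\<^sup>2))"
proof -
  obtain a b c where A: "A = (a, b, c)" by (cases A)
  obtain d e f where B: "B = (d, e, f)" by (cases B)
  have r: "\<not> (quad A 1 z = 0 \<and> quad B 1 z = 0)" "\<phi> (pt 1 z) = pt (quad A 1 z) (quad B 1 z)" for z
    using assms by (auto simp: rep_def)
  have "inv (chart (\<phi> (pt 1 0))) \<circ> \<phi> \<circ> chart (pt 1 0) =
      (\<lambda>w. inv (chart (pt (quad A 1 0) (quad B 1 0))) (pt (quad A 1 w) (quad B 1 w)))"
    using r by (auto simp: fun_eq_iff chart_eq)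
  then have "local_deriv \<phi> (pt 1 0) = deriv (\<lambda>w. inv (chart (pt (quad A 1 0) (quad B 1 0))) (pt (quad A 1 w) (quad B 1 w))) 0"
    unfolding local_deriv_def inv_chart_inf by simp
  also have "\<dots> = (if quad B 1 0 = 0 then (e * quad A 1 0 - quad B 1 0 * b) / (quad A 1 0)\<^sup>2
     else (b * quad B 1 0 - quad A 1 0 * e) / (quad B 1 0)\<^sup>2)"
  proof (rule deriv_chart[where f = "\<lambda>w. quad A 1 w" and g = "\<lambda>w. quad B 1 w"])
    show "\<not> (quad A 1 0 = 0 \<and> quad B 1 0 = 0)" by (rule r(1))
    show "((\<lambda>w. quad A 1 w) has_field_derivative b) (at 0)"
      unfolding A quad_def prod.case by (auto intro!: derivative_eq_intros)
    show "((\<lambda>w. quad B 1 w) has_field_derivative e) (at 0)"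
      unfolding B quad_def prod.case by (auto intro!: derivative_eq_intros)
  qed
  also have "b * quad B 1 0 - quad A 1 0 * e = - jac A B 1 0 / 2"
    unfolding A B quad_def jac_def prod.case by (simp add: field_simps)
  also have "e * quad A 1 0 - quad B 1 0 * b = jac A B 1 0 / 2"
    unfolding A B quad_def jac_def prod.case by (simp add: field_simps)
  finally show ?thesis by simp
qed

lemma local_deriv_eq_0_iff:
  assumes \<phi>: "rep \<phi> A B" and xy: "\<not> (x = 0 \<and> y = 0)"
  shows "local_deriv \<phi> (pt x y) = 0 \<longleftrightarrow> jac A B x y = 0"
proof (cases "y = 0")
  case True
  then have "x \<noteq> 0" using xy by simp
  then have "pt x y = pt 1 0" using True by (simp add: pt_eq_inf)
  moreover have "\<not> (quad A 1 0 = 0 \<and> quad B 1 0 = 0)" using \<phi> by (auto simp: rep_def)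
  ultimately have "local_deriv \<phi> (pt x y) = 0 \<longleftrightarrow> jac A B 1 0 = 0" using local_deriv_inf[OF \<phi>] by auto
  then show ?thesis using jac_scale[of A B x 1 0] True \<open>x \<noteq> 0\<close> by simp
next
  case False
  then have "pt x y = pt (x / y) 1" by (subst pt_eq_iff) auto
  moreover have "\<not> (quad A (x / y) 1 = 0 \<and> quad B (x / y) 1 = 0)" using \<phi> by (auto simp: rep_def)
  ultimately have "local_deriv \<phi> (pt x y) = 0 \<longleftrightarrow> jac A B (x / y) 1 = 0" using local_deriv_fin[OF \<phi>, of "x / y"] by auto
  then show ?thesis using jac_scale[of A B y "x / y" 1] False by simp
qed

text \<open>At a fixed point both charts coincide and the sign disappears. The quotient is
  independent of the chosen vector, since the Jacobian is quadratic and k linear in (x, y).\<close>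

lemma multiplier:
  assumes \<phi>: "rep \<phi> A B" and xy: "\<not> (x = 0 \<and> y = 0)" and fx: "quad A x y = k * x" "quad B x y = k * y"
  shows "k \<noteq> 0" "local_deriv \<phi> (pt x y) = jac A B x y / (2 * k\<^sup>2)"
proof -
  show k: "k \<noteq> 0" using \<phi> xy fx by (auto simp: rep_def)
  show "local_deriv \<phi> (pt x y) = jac A B x y / (2 * k\<^sup>2)"
  proof (cases "y = 0")
    case True
    then have x: "x \<noteq> 0" using xy by simp
    have "pt x y = pt 1 0" using True x by (simp add: pt_eq_inf)
    moreover have "quad A x y = x\<^sup>2 * quad A 1 0" "quad B x y = x\<^sup>2 * quad B 1 0" "jac A B x y = x\<^sup>2 * jac A B 1 0"
      using quad_scale[of A x 1 0] quad_scale[of B x 1 0] jac_scale[of A B x 1 0] True by simp_all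
    moreover from this fx True x have "quad B 1 0 = 0" "k = x * quad A 1 0" by (simp_all add: power2_eq_square)
    ultimately show ?thesis using local_deriv_inf[OF \<phi>] x by (simp add: power_mult_distrib)
  next
    case False
    then have "pt x y = pt (x / y) 1" by (subst pt_eq_iff) auto
    moreover have "quad B x y = y\<^sup>2 * quad B (x / y) 1" "jac A B x y = y\<^sup>2 * jac A B (x / y) 1"
      using quad_scale[of B y "x / y" 1] jac_scale[of A B y "x / y" 1] False by simp_all
    moreover from this fx False have "k = y * quad B (x / y) 1" by (simp add: power2_eq_square)
    ultimately show ?thesis using local_deriv_fin[OF \<phi>, of "x / y"] k False by (simp add: power_mult_distrib)
  qed
qed

subsection \<open>Conjugation by Moebius transformations\<close>

definition moebius :: "(point \<Rightarrow> point) \<Rightarrow> complex \<Rightarrow> complex \<Rightarrow> complex \<Rightarrow> complex \<Rightarrow> bool" where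
  "moebius \<mu> k l m n \<longleftrightarrow> k * n - l * m \<noteq> 0 \<and>
     (\<forall>x y. \<not> (x = 0 \<and> y = 0) \<longrightarrow> \<mu> (pt x y) = pt (k * x + l * y) (m * x + n * y))"

lemma moebius_nonzero:
  assumes "k * n - l * m \<noteq> (0::complex)" "\<not> (x = 0 \<and> y = 0)"
  shows "\<not> (k * x + l * y = 0 \<and> m * x + n * y = 0)"
proof
  assume "k * x + l * y = 0 \<and> m * x + n * y = 0"
  then have "(k * n - l * m) * x = 0" "(k * n - l * m) * y = 0" by algebra+
  then show False using assms by auto
qed

lemma moebius_space:
  assumes "moebius \<mu> k l m n" "P \<in> proj_space 1" shows "\<mu> P \<in> proj_space 1"
proof -
  obtain x y where "P = pt x y" "\<not> (x = 0 \<and> y = 0)" using assms(2) by (rule pt_cases)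
  then show ?thesis using assms(1) moebius_nonzero[of k n l m x y] using pt_in_space unfolding moebius_def by metis
qed

lemma moebius_inj:
  assumes \<mu>: "moebius \<mu> k l m n" shows "inj_on \<mu> (proj_space 1)"
proof (rule inj_onI)
  fix P Q assume PQ: "P \<in> proj_space 1" "Q \<in> proj_space 1" "\<mu> P = \<mu> Q"
  obtain x y where P: "P = pt x y" "\<not> (x = 0 \<and> y = 0)" using PQ(1) by (rule pt_cases)
  obtain x' y' where Q: "Q = pt x' y'" "\<not> (x' = 0 \<and> y' = 0)" using PQ(2) by (rule pt_cases)
  have det: "k * n - l * m \<noteq> 0" using \<mu> by (simp add: moebius_def)
  have "pt (k * x + l * y) (m * x + n * y) = pt (k * x' + l * y') (m * x' + n * y')"
    using PQ(3) P Q \<mu> by (simp add: moebius_def)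
  then have "(k * x + l * y) * (m * x' + n * y') = (m * x + n * y) * (k * x' + l * y')"
    by (subst (asm) pt_eq_iff[OF moebius_nonzero[OF det P(2)] moebius_nonzero[OF det Q(2)]])
  then have "(k * n - l * m) * (x * y' - y * x') = 0" by algebra
  then show "P = Q" using det unfolding P(1) Q(1) by (simp add: pt_eq_iff[OF P(2) Q(2)])
qed

lemma rational_map_1_moebius:
  assumes "\<mu> \<in> rational_maps 1" obtains k l m n where "moebius \<mu> k l m n"
proof -
  obtain F where F: "represents F 1 \<mu>" using assms by (auto simp: rational_maps_def)
  obtain p q where pq: "F = [p, q]" using F by (auto simp: represents_def length_Suc_conv numeral_2_eq_2)
  then have "p \<in> forms UNIV 1 1" "q \<in> forms UNIV 1 1" using F by (auto simp: represents_def)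
  then obtain k l m n where ev: "\<And>v. form_eval p v = k * v 0 + l * v 1" "\<And>v. form_eval q v = m * v 0 + n * v 1"
    using linear_form_eval by metis
  have val: "\<not> (k * x + l * y = 0 \<and> m * x + n * y = 0) \<and> \<mu> (pt x y) = pt (k * x + l * y) (m * x + n * y)"
    if "\<not> (x = 0 \<and> y = 0)" for x y
  proof -
    have "vec_of [x, y] \<in> vec_space 1 - {0}" using that vec2_space vec2_eq_0 by blast
    then have *: "forms_eval F (vec_of [x, y]) \<noteq> 0" "\<mu> (pt x y) = proj_pt (forms_eval F (vec_of [x, y]))"
      using F unfolding represents_def pt_def by blast+
    have "forms_eval F (vec_of [x, y]) = vec_of [k * x + l * y, m * x + n * y]"
      by (simp add: forms_eval_def pq ev vec2_coords)
    then show ?thesis using * vec2_eq_0 unfolding pt_def by metis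
  qed
  have "k * n - l * m \<noteq> 0"
  proof
    assume det: "k * n - l * m = 0"
    have "k * l + l * (- k) = 0" by algebra
    moreover have "m * l + n * (- k) = 0" using det by algebra
    moreover have "k * n + l * (- m) = 0" using det by algebra
    moreover have "m * n + n * (- m) = 0" by algebra
    ultimately have "l = 0 \<and> - k = 0" "n = 0 \<and> - m = 0" using val[of l "- k"] val[of n "- m"] by blast+
    then show False using val[of 1 0] by auto
  qed
  then show ?thesis using that val unfolding moebius_def by blast
qed

definition comp_quad :: "complex \<Rightarrow> complex \<Rightarrow> complex \<Rightarrow> complex \<Rightarrow> quad_form \<Rightarrow> quad_form" where
  "comp_quad k l m n A = (case A of (a, b, c) \<Rightarrow>
     (a * k\<^sup>2 + b * k * m + c * m\<^sup>2, 2 * a * k * l + b * (k * n + l * m) + 2 * c * m * n,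
      a * l\<^sup>2 + b * l * n + c * n\<^sup>2))"

definition lin_quad :: "complex \<Rightarrow> complex \<Rightarrow> quad_form \<Rightarrow> quad_form \<Rightarrow> quad_form" where
  "lin_quad s t A B = (case (A, B) of ((a, b, c), (d, e, f)) \<Rightarrow> (s * a + t * d, s * b + t * e, s * c + t * f))"

lemma quad_comp: "quad (comp_quad k l m n A) x y = quad A (k * x + l * y) (m * x + n * y)"
  by (cases A) (simp add: comp_quad_def quad_def algebra_simps power2_eq_square)

lemma quad_lin: "quad (lin_quad s t A B) x y = s * quad A x y + t * quad B x y"
  by (cases A; cases B) (simp add: lin_quad_def quad_def algebra_simps)

lemma jac_comp: "jac (comp_quad k l m n A) (comp_quad k l m n B) x y =
    (k * n - l * m) * jac A B (k * x + l * y) (m * x + n * y)"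
proof -
  obtain a b c where A: "A = (a, b, c)" by (cases A)
  obtain d e f where B: "B = (d, e, f)" by (cases B)
  show ?thesis unfolding A B jac_def comp_quad_def prod.case by algebra
qed

lemma jac_lin: "jac (lin_quad s t A B) (lin_quad s' t' A B) x y = (s * t' - t * s') * jac A B x y"
proof -
  obtain a b c where A: "A = (a, b, c)" by (cases A)
  obtain d e f where B: "B = (d, e, f)" by (cases B)
  show ?thesis unfolding A B jac_def lin_quad_def prod.case by algebra
qed

text \<open>Together with \<open>pull2\<close> this is conjugation by the matrix (k, l; m, n), with
  its inverse replaced by the adjugate in order to avoid denominators.\<close>

definition pull1 :: "complex \<Rightarrow> complex \<Rightarrow> complex \<Rightarrow> complex \<Rightarrow> quad_form \<Rightarrow> quad_form \<Rightarrow> quad_form" where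
  "pull1 k l m n A B = lin_quad n (- l) (comp_quad k l m n A) (comp_quad k l m n B)"

definition pull2 :: "complex \<Rightarrow> complex \<Rightarrow> complex \<Rightarrow> complex \<Rightarrow> quad_form \<Rightarrow> quad_form \<Rightarrow> quad_form" where
  "pull2 k l m n A B = lin_quad (- m) k (comp_quad k l m n A) (comp_quad k l m n B)"

lemma quad_pull:
  "quad (pull1 k l m n A B) x y = n * quad A (k * x + l * y) (m * x + n * y) - l * quad B (k * x + l * y) (m * x + n * y)"
  "quad (pull2 k l m n A B) x y = - m * quad A (k * x + l * y) (m * x + n * y) + k * quad B (k * x + l * y) (m * x + n * y)"
  by (simp_all add: pull1_def pull2_def quad_lin quad_comp)

lemma jac_pull:
  "jac (pull1 k l m n A B) (pull2 k l m n A B) x y = (k * n - l * m)\<^sup>2 * jac A B (k * x + l * y) (m * x + n * y)"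
  unfolding pull1_def pull2_def jac_lin jac_comp by (simp add: algebra_simps power2_eq_square)

lemma rep_space:
  assumes "rep \<phi> A B" "P \<in> proj_space 1" shows "\<phi> P \<in> proj_space 1"
proof -
  obtain x y where "P = pt x y" "\<not> (x = 0 \<and> y = 0)" using assms(2) by (rule pt_cases)
  then show ?thesis using assms(1) pt_in_space unfolding rep_def by metis
qed

lemma rep_pull:
  assumes \<mu>: "moebius \<mu> k l m n" and \<psi>: "rep \<psi> A B"
    and \<phi>: "\<And>P. P \<in> proj_space 1 \<Longrightarrow> \<phi> P \<in> proj_space 1"
    and conj: "\<And>P. P \<in> proj_space 1 \<Longrightarrow> \<psi> (\<mu> P) = \<mu> (\<phi> P)"
  shows "rep \<phi> (pull1 k l m n A B) (pull2 k l m n A B)"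
  unfolding rep_def
proof (intro allI impI)
  fix x y :: complex assume xy: "\<not> (x = 0 \<and> y = 0)"
  have det: "k * n - l * m \<noteq> 0" using \<mu> by (simp add: moebius_def)
  define X where "X = k * x + l * y"
  define Y where "Y = m * x + n * y"
  have XY: "\<not> (X = 0 \<and> Y = 0)" unfolding X_def Y_def using moebius_nonzero[OF det xy] .
  then have AB: "\<not> (quad A X Y = 0 \<and> quad B X Y = 0)" "\<psi> (pt X Y) = pt (quad A X Y) (quad B X Y)"
    using \<psi> by (auto simp: rep_def)
  have P: "pt x y \<in> proj_space 1" using xy unfolding pt_in_space .
  obtain u w where uw: "\<phi> (pt x y) = pt u w" "\<not> (u = 0 \<and> w = 0)" using \<phi>[OF P] by (rule pt_cases)
  have "pt (quad A X Y) (quad B X Y) = pt (k * u + l * w) (m * u + n * w)"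
    using conj[OF P] \<mu> xy uw AB(2) unfolding moebius_def X_def Y_def by simp
  then have "quad A X Y * (m * u + n * w) = quad B X Y * (k * u + l * w)"
    by (subst (asm) pt_eq_iff[OF AB(1) moebius_nonzero[OF det uw(2)]])
  then have cross: "u * (- m * quad A X Y + k * quad B X Y) = w * (n * quad A X Y - l * quad B X Y)" by algebra
  have nz: "\<not> (n * quad A X Y - l * quad B X Y = 0 \<and> - m * quad A X Y + k * quad B X Y = 0)"
    using moebius_nonzero[of n k "- l" "- m" "quad A X Y" "quad B X Y"] det AB(1) by (simp add: mult.commute)
  have "pt u w = pt (n * quad A X Y - l * quad B X Y) (- m * quad A X Y + k * quad B X Y)"
    unfolding pt_eq_iff[OF uw(2) nz] by (rule cross)
  then show "\<not> (quad (pull1 k l m n A B) x y = 0 \<and> quad (pull2 k l m n A B) x y = 0) \<and>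
      \<phi> (pt x y) = pt (quad (pull1 k l m n A B) x y) (quad (pull2 k l m n A B) x y)"
    unfolding quad_pull X_def[symmetric] Y_def[symmetric] uw(1) using nz by blast
qed

lemma exact_period_conj:
  assumes "\<And>P. P \<in> S \<Longrightarrow> \<phi> P \<in> S" "\<And>P. P \<in> S \<Longrightarrow> \<psi> (\<mu> P) = \<mu> (\<phi> P)" "inj_on \<mu> S" "P \<in> S"
  shows "exact_period \<psi> n (\<mu> P) \<longleftrightarrow> exact_period \<phi> n P"
proof -
  have it: "(\<phi> ^^ k) P \<in> S \<and> (\<psi> ^^ k) (\<mu> P) = \<mu> ((\<phi> ^^ k) P)" for k
    by (induction k) (use assms in auto)
  then have "(\<psi> ^^ k) (\<mu> P) = \<mu> P \<longleftrightarrow> (\<phi> ^^ k) P = P" for k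
    using assms(3,4) by (metis inj_on_eq_iff)
  then show ?thesis unfolding exact_period_def by simp
qed

lemma critical_conj:
  assumes \<mu>: "moebius \<mu> k l m n" and \<psi>: "rep \<psi> A B"
    and \<phi>: "\<And>P. P \<in> proj_space 1 \<Longrightarrow> \<phi> P \<in> proj_space 1"
    and conj: "\<And>P. P \<in> proj_space 1 \<Longrightarrow> \<psi> (\<mu> P) = \<mu> (\<phi> P)" and P: "P \<in> proj_space 1"
  shows "critical_point \<psi> (\<mu> P) \<longleftrightarrow> critical_point \<phi> P"
proof -
  obtain x y where xy: "P = pt x y" "\<not> (x = 0 \<and> y = 0)" using P by (rule pt_cases)
  have det: "k * n - l * m \<noteq> 0" using \<mu> by (simp add: moebius_def)
  have "\<mu> P = pt (k * x + l * y) (m * x + n * y)" using \<mu> xy by (simp add: moebius_def)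
  then show ?thesis
    using local_deriv_eq_0_iff[OF \<psi> moebius_nonzero[OF det xy(2)]]
      local_deriv_eq_0_iff[OF rep_pull[OF \<mu> \<psi> \<phi> conj] xy(2)] det moebius_space[OF \<mu> P] P
    unfolding critical_point_def xy(1) by (simp add: jac_pull)
qed

section \<open>Maps with a marked periodic critical point and marked fixed points\<close>

definition act :: "complex \<Rightarrow> complex \<Rightarrow> complex \<Rightarrow> complex \<Rightarrow> point \<Rightarrow> point" where
  "act k l m n P = (\<lambda>v. vec_of [k * v 0 + l * v 1, m * v 0 + n * v 1]) ` P"

lemma act_pt: "act k l m n (pt x y) = pt (k * x + l * y) (m * x + n * y)"
proof -
  have "vec_of [k * (c * x) + l * (c * y), m * (c * x) + n * (c * y)] =
      (\<lambda>i. c * vec_of [k * x + l * y, m * x + n * y] i)" for c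
    unfolding vec2_scale by (simp add: algebra_simps)
  then show ?thesis unfolding act_def pt_def proj_pt_def
    by (auto simp: image_iff vec2_coords set_eq_iff)
qed

text \<open>The marked points are kept as vectors, so that the factorisation of the fixed point form
  is an identity without an undetermined constant.\<close>

definition qdata :: "(point \<Rightarrow> point) \<Rightarrow> nat \<Rightarrow> quad_form \<Rightarrow> quad_form \<Rightarrow> complex \<times> complex \<Rightarrow>
    complex \<times> complex \<Rightarrow> complex \<times> complex \<Rightarrow> complex \<times> complex \<Rightarrow> bool" where
  "qdata \<phi> n A B v p q r \<longleftrightarrow> rep \<phi> A B \<and> v \<noteq> (0, 0) \<and> p \<noteq> (0, 0) \<and> q \<noteq> (0, 0) \<and> r \<noteq> (0, 0) \<and>
     (\<forall>x y. x * quad B x y - y * quad A x y =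
       (x * snd p - y * fst p) * (x * snd q - y * fst q) * (x * snd r - y * fst r)) \<and>
     jac A B (fst v) (snd v) = 0 \<and> exact_period \<phi> n (pt (fst v) (snd v))"

definition mult_at :: "(point \<Rightarrow> point) \<Rightarrow> complex \<times> complex \<Rightarrow> complex" where
  "mult_at \<phi> p = local_deriv \<phi> (pt (fst p) (snd p))"

text \<open>The determinant times the inverse image of p. With this multiple the linear form X p2 -
  Y p1 pulls back to the one belonging to the new vector without any extra factor, which preserves
  the identity in \<open>qdata\<close>.\<close>

definition adj :: "complex \<Rightarrow> complex \<Rightarrow> complex \<Rightarrow> complex \<Rightarrow> complex \<times> complex \<Rightarrow> complex \<times> complex" where
  "adj k l m n p = (n * fst p - l * snd p, - m * fst p + k * snd p)"

lemma pair_nonzero: "p \<noteq> (0, 0) \<longleftrightarrow> \<not> (fst p = 0 \<and> snd p = (0::complex))"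
  by (cases p) auto

lemma adj_nonzero: "k * n - l * m \<noteq> 0 \<Longrightarrow> p \<noteq> (0, 0) \<Longrightarrow> adj k l m n p \<noteq> (0, 0)"
  using moebius_nonzero[of n k "- l" "- m" "fst p" "snd p"]
  by (simp add: adj_def pair_nonzero mult.commute)

lemma fixed_of_cross:
  assumes "p \<noteq> (0, 0)" "fst p * b - snd p * a = (0::complex)"
  obtains t where "a = t * fst p" "b = t * snd p"
proof (cases "fst p = 0")
  case True
  then have "snd p \<noteq> 0" using assms(1) by (simp add: pair_nonzero)
  then show ?thesis using that[of "b / snd p"] assms(2) True by simp
next
  case False
  then show ?thesis using that[of "a / fst p"] assms(2) by (simp add: field_simps)
qed

lemma qdata_swap:
  "qdata \<phi> n A B v p q r \<Longrightarrow> qdata \<phi> n A B v q p r"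
  "qdata \<phi> n A B v p q r \<Longrightarrow> qdata \<phi> n A B v r q p"
  unfolding qdata_def by (auto simp: mult_ac)

lemma qdata_conj:
  assumes q: "qdata \<phi> n A B v p q r" and det: "k * m' - l * m \<noteq> 0"
  obtains \<phi>' where
    "qdata \<phi>' n (pull1 k l m m' A B) (pull2 k l m m' A B) (adj k l m m' v) (adj k l m m' p) (adj k l m m' q) (adj k l m m' r)"
    "mult_at \<phi>' (adj k l m m' p) = mult_at \<phi> p" "mult_at \<phi>' (adj k l m m' q) = mult_at \<phi> q"
    "mult_at \<phi>' (adj k l m m' r) = mult_at \<phi> r"
proof -
  let ?a = "adj k l m m'" and ?A = "pull1 k l m m' A B" and ?B = "pull2 k l m m' A B"
  define D where "D = k * m' - l * m"
  define \<mu> where "\<mu> = act k l m m'"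
  define \<nu> where "\<nu> = act m' (- l) (- m) k"
  define \<phi>' where "\<phi>' = \<nu> \<circ> \<phi> \<circ> \<mu>"
  have \<phi>: "rep \<phi> A B" using q by (simp add: qdata_def)
  have \<mu>: "moebius \<mu> k l m m'" using det by (simp add: moebius_def \<mu>_def act_pt)
  have \<nu>: "moebius \<nu> m' (- l) (- m) k" using det by (simp add: moebius_def \<nu>_def act_pt mult.commute)
  have \<mu>\<nu>: "\<mu> (\<nu> P) = P" if P: "P \<in> proj_space 1" for P
  proof -
    obtain x y where xy: "P = pt x y" "\<not> (x = 0 \<and> y = 0)" using P by (rule pt_cases)
    have "\<mu> (\<nu> P) = pt (D * x) (D * y)" unfolding \<mu>_def \<nu>_def xy act_pt D_def by (simp add: algebra_simps)
    then show ?thesis using det pt_scale[of D x y] xy by (simp add: D_def)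
  qed
  have sp: "\<phi>' P \<in> proj_space 1" if "P \<in> proj_space 1" for P
    unfolding \<phi>'_def comp_def using that by (intro moebius_space[OF \<nu>] rep_space[OF \<phi>] moebius_space[OF \<mu>])
  have conj: "\<phi> (\<mu> P) = \<mu> (\<phi>' P)" if "P \<in> proj_space 1" for P
    unfolding \<phi>'_def comp_def using \<mu>\<nu>[OF rep_space[OF \<phi> moebius_space[OF \<mu> that]]] by simp
  have \<phi>': "rep \<phi>' ?A ?B" by (rule rep_pull[OF \<mu> \<phi> sp conj])
  have adj: "k * fst (?a z) + l * snd (?a z) = D * fst z" "m * fst (?a z) + m' * snd (?a z) = D * snd z" for z
    unfolding adj_def D_def fst_conv snd_conv by algebra+
  have \<mu>adj: "\<mu> (pt (fst (?a z)) (snd (?a z))) = pt (fst z) (snd z)" for z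
    unfolding \<mu>_def act_pt adj using det by (simp add: pt_scale D_def)
  have cross: "x * quad B x y - y * quad A x y =
       (x * snd p - y * fst p) * (x * snd q - y * fst q) * (x * snd r - y * fst r)" for x y
    using q unfolding qdata_def by blast
  have cross': "x * quad ?B x y - y * quad ?A x y = (x * snd (?a p) - y * fst (?a p)) *
      (x * snd (?a q) - y * fst (?a q)) * (x * snd (?a r) - y * fst (?a r))" for x y
  proof -
    let ?X = "k * x + l * y" and ?Y = "m * x + m' * y"
    have lin: "?X * snd z - ?Y * fst z = x * snd (?a z) - y * fst (?a z)" for z
      unfolding adj_def fst_conv snd_conv by algebra
    have "x * quad ?B x y - y * quad ?A x y = ?X * quad B ?X ?Y - ?Y * quad A ?X ?Y"
      unfolding quad_pull by algebra
    also have "\<dots> = (?X * snd p - ?Y * fst p) * (?X * snd q - ?Y * fst q) * (?X * snd r - ?Y * fst r)" by (rule cross)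
    finally show ?thesis unfolding lin .
  qed
  have mult: "mult_at \<phi>' (?a z) = mult_at \<phi> z" if z: "z \<noteq> (0, 0)" "fst z * quad B (fst z) (snd z) - snd z * quad A (fst z) (snd z) = 0" for z
  proof -
    obtain t where t: "quad A (fst z) (snd z) = t * fst z" "quad B (fst z) (snd z) = t * snd z"
      using z by (rule fixed_of_cross)
    have z': "\<not> (fst z = 0 \<and> snd z = 0)" "\<not> (fst (?a z) = 0 \<and> snd (?a z) = 0)"
      using z(1) adj_nonzero[OF det z(1)] unfolding pair_nonzero by blast+
    have "quad ?A (fst (?a z)) (snd (?a z)) = D\<^sup>2 * t * fst (?a z)" "quad ?B (fst (?a z)) (snd (?a z)) = D\<^sup>2 * t * snd (?a z)"
      unfolding quad_pull adj quad_scale t by (simp_all add: adj_def algebra_simps)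
    from multiplier[OF \<phi>' z'(2) this] have "mult_at \<phi>' (?a z) = D\<^sup>2 * (D\<^sup>2 * jac A B (fst z) (snd z)) / (2 * (D\<^sup>2 * t)\<^sup>2)"
      unfolding mult_at_def jac_pull adj jac_scale D_def[symmetric] by simp
    moreover have "mult_at \<phi> z = jac A B (fst z) (snd z) / (2 * t\<^sup>2)"
      unfolding mult_at_def by (rule multiplier[OF \<phi> z'(1) t])
    ultimately show ?thesis using det by (simp add: D_def[symmetric] power2_eq_square)
  qed
  show ?thesis
  proof (rule that)
    have "exact_period \<phi>' n (pt (fst (?a v)) (snd (?a v)))"
    proof -
      have "?a v \<noteq> (0, 0)" using adj_nonzero[OF det] q by (simp add: qdata_def)
      then have "pt (fst (?a v)) (snd (?a v)) \<in> proj_space 1" unfolding pt_in_space pair_nonzero .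
      from exact_period_conj[where \<phi> = \<phi>' and \<psi> = \<phi> and \<mu> = \<mu> and S = "proj_space 1", OF sp conj moebius_inj[OF \<mu>] this] show ?thesis
        using q unfolding \<mu>adj qdata_def by simp
    qed
    moreover have "jac ?A ?B (fst (?a v)) (snd (?a v)) = 0"
      using q unfolding jac_pull adj jac_scale qdata_def by simp
    ultimately show "qdata \<phi>' n ?A ?B (?a v) (?a p) (?a q) (?a r)"
      using \<phi>' q cross' adj_nonzero[OF det] unfolding qdata_def by blast
    show "mult_at \<phi>' (?a p) = mult_at \<phi> p" "mult_at \<phi>' (?a q) = mult_at \<phi> q" "mult_at \<phi>' (?a r) = mult_at \<phi> r"
      using q by (intro mult; simp add: qdata_def cross mult.commute)+
  qed
qed

lemma qdata_fixed_at_infinity: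
  assumes q: "qdata \<phi> n A B v p q r"
  obtains \<phi>' A' B' v' q' r' where "qdata \<phi>' n A' B' v' (1, 0) q' r'"
    "mult_at \<phi>' (1, 0) = mult_at \<phi> p" "mult_at \<phi>' q' = mult_at \<phi> q" "mult_at \<phi>' r' = mult_at \<phi> r"
proof -
  have "p \<noteq> (0, 0)" using q by (simp add: qdata_def)
  then obtain l m' where det: "fst p * m' - l * snd p = 1"
  proof (cases "fst p = 0")
    case True
    then show ?thesis using that[of 0 "- 1 / snd p"] \<open>p \<noteq> (0, 0)\<close> by (simp add: pair_nonzero)
  next
    case False
    then show ?thesis using that[of "1 / fst p" 0] by simp
  qed
  then have "adj (fst p) l (snd p) m' p = (1, 0)" by (simp add: adj_def algebra_simps)
  then show ?thesis using qdata_conj[OF q, of "fst p" m' l "snd p"] det that by (metis zero_neq_one)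
qed

lemma quadratic_root:
  fixes a b c :: complex
  assumes "a \<noteq> 0" obtains x where "a * x\<^sup>2 + b * x + c = 0"
proof -
  let ?x = "(- b + csqrt (b\<^sup>2 - 4 * a * c)) / (2 * a)"
  have s: "(csqrt (b\<^sup>2 - 4 * a * c))\<^sup>2 = b\<^sup>2 - 4 * a * c" by simp
  have "4 * a * (a * ?x\<^sup>2 + b * ?x + c) = (2 * a * ?x + b)\<^sup>2 - (b\<^sup>2 - 4 * a * c)" by algebra
  also have "2 * a * ?x + b = csqrt (b\<^sup>2 - 4 * a * c)" using assms by simp
  finally have "a * ?x\<^sup>2 + b * ?x + c = 0" using assms s by simp
  then show ?thesis by (rule that)
qed

text \<open>If all three were critical, one could be put at infinity and the map would be a
  polynomial. Its only finite critical point would be both remaining fixed points; comparing with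
  their sum, read off from the fixed point form, gives f = 0, which is impossible.\<close>

lemma some_noncritical_fixed_point:
  assumes q0: "qdata \<phi> n A B v p q r"
  shows "mult_at \<phi> p \<noteq> 0 \<or> mult_at \<phi> q \<noteq> 0 \<or> mult_at \<phi> r \<noteq> 0"
proof (rule ccontr)
  assume "\<not> ?thesis"
  then obtain \<phi>' A' B' v' q' r' where qd: "qdata \<phi>' n A' B' v' (1, 0) q' r'"
    and m: "mult_at \<phi>' (1, 0) = 0" "mult_at \<phi>' q' = 0" "mult_at \<phi>' r' = 0"
    using qdata_fixed_at_infinity[OF q0] by metis
  obtain a b c where A: "A' = (a, b, c)" by (cases A')
  obtain d e f where B: "B' = (d, e, f)" by (cases B')
  have rp: "rep \<phi>' A' B'" and nz: "q' \<noteq> (0, 0)" "r' \<noteq> (0, 0)"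
    and cross: "\<And>x y. x * quad B' x y - y * quad A' x y = (- y) * (x * snd q' - y * fst q') * (x * snd r' - y * fst r')"
    using qd by (auto simp: qdata_def)
  have jac: "jac A' B' 1 0 = 0" "jac A' B' (fst q') (snd q') = 0" "jac A' B' (fst r') (snd r') = 0"
    using m nz local_deriv_eq_0_iff[OF rp] unfolding mult_at_def pair_nonzero by auto
  have "d = 0" using cross[of 1 0] by (simp add: B quad_def)
  moreover have "\<not> (quad A' 1 0 = 0 \<and> quad B' 1 0 = 0)" using rp by (auto simp: rep_def)
  ultimately have "a \<noteq> 0" by (auto simp: A B quad_def)
  then have "e = 0" using jac(1) \<open>d = 0\<close> by (simp add: A B jac_def)
  have f: "f \<noteq> 0"
  proof
    assume "f = 0"
    obtain x where "a * x\<^sup>2 + b * x + c = 0" using quadratic_root[OF \<open>a \<noteq> 0\<close>] by blast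
    moreover have "\<not> (quad A' x 1 = 0 \<and> quad B' x 1 = 0)" using rp unfolding rep_def by auto
    ultimately show False using \<open>f = 0\<close> \<open>d = 0\<close> \<open>e = 0\<close> by (simp add: A B quad_def)
  qed
  have c1: "f - a - b - c = - (snd q' - fst q') * (snd r' - fst r')"
    using cross[of 1 1] \<open>d = 0\<close> \<open>e = 0\<close> by (simp add: A B quad_def algebra_simps)
  have c2: "f + a - b + c = (snd q' + fst q') * (snd r' + fst r')"
    using cross[of 1 "- 1"] \<open>d = 0\<close> \<open>e = 0\<close> by (simp add: A B quad_def algebra_simps)
  have c3: "c = fst q' * fst r'"
    using cross[of 0 1] \<open>d = 0\<close> \<open>e = 0\<close> by (simp add: A B quad_def)
  have two: "2 * (f - b) = 2 * (fst q' * snd r' + snd q' * fst r')" using c1 c2 by algebra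
  have two': "2 * a = 2 * (snd q' * snd r')" using c1 c2 c3 by algebra
  have fb: "f - b = fst q' * snd r' + snd q' * fst r'" using two mult_left_cancel[OF zero_neq_numeral[symmetric]] by blast
  have aa: "a = snd q' * snd r'" using two' mult_left_cancel[OF zero_neq_numeral[symmetric]] by blast
  then have s: "snd q' \<noteq> 0" "snd r' \<noteq> 0" using \<open>a \<noteq> 0\<close> by auto
  have "(2 * a * fst q' + b * snd q') * (2 * f * snd q') = 0" "(2 * a * fst r' + b * snd r') * (2 * f * snd r') = 0"
    using jac(2,3) \<open>d = 0\<close> \<open>e = 0\<close> by (simp_all add: A B jac_def)
  then have "2 * a * fst q' + b * snd q' = 0" "2 * a * fst r' + b * snd r' = 0" using f s by simp_all
  then have "2 * a * (fst q' * snd r' + snd q' * fst r') + 2 * b * a = 0" using aa by algebra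
  then have "2 * a * f = 0" unfolding fb[symmetric] by (simp add: algebra_simps)
  then show False using f \<open>a \<noteq> 0\<close> by simp
qed

text \<open>The fixed point goes to infinity, its other preimage to 0 by a translation, and the
  periodic critical point to 1 by a scaling. The constant e remains because dividing both forms by
  it changes the fixed point form, while the vectors q', r' are kept.\<close>

lemma normal_form:
  assumes q0: "qdata \<phi> n A B v p q r" and crit: "mult_at \<phi> p \<noteq> 0"
  obtains \<phi>' t \<beta> e q' r' where "t \<noteq> 0" "e \<noteq> 0" "rep \<phi>' (t, \<beta>, t) (0, 1, 0)" "exact_period \<phi>' n (pt 1 1)"
    "\<And>x y. e * (x * (x * y) - y * (t * x\<^sup>2 + \<beta> * x * y + t * y\<^sup>2)) = (- y) * (x * snd q' - y * fst q') * (x * snd r' - y * fst r')"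
    "q' \<noteq> (0, 0)" "r' \<noteq> (0, 0)"
    "mult_at \<phi>' (1, 0) = mult_at \<phi> p" "mult_at \<phi>' q' = mult_at \<phi> q" "mult_at \<phi>' r' = mult_at \<phi> r"
proof -
  obtain \<phi>1 A1 B1 v1 q1 r1 where q1: "qdata \<phi>1 n A1 B1 v1 (1, 0) q1 r1"
    and m1: "mult_at \<phi>1 (1, 0) = mult_at \<phi> p" "mult_at \<phi>1 q1 = mult_at \<phi> q" "mult_at \<phi>1 r1 = mult_at \<phi> r"
    using qdata_fixed_at_infinity[OF q0] by metis
  obtain a b c where A1: "A1 = (a, b, c)" by (cases A1)
  obtain d e f where B1: "B1 = (d, e, f)" by (cases B1)
  have d: "d = 0" using q1[unfolded qdata_def, THEN conjunct2, THEN conjunct2, THEN conjunct2, THEN conjunct2, THEN conjunct2, THEN conjunct1, rule_format, of 1 0]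
    by (simp add: B1 quad_def)
  have rp1: "rep \<phi>1 A1 B1" using q1 by (simp add: qdata_def)
  \<comment> \<open>Noncriticality at infinity means that the denominator y (e x + f y) has a second
    zero, the finite pole - f / e.\<close>
  have "jac A1 B1 1 0 \<noteq> 0" using local_deriv_eq_0_iff[OF rp1, of 1 0] crit m1(1) by (simp add: mult_at_def)
  then have ae: "a \<noteq> 0" "e \<noteq> 0" by (auto simp: A1 B1 jac_def d)
  have "1 * 1 - (- f / e) * 0 \<noteq> (0::complex)" by simp
  from qdata_conj[OF q1 this] obtain \<phi>2 where
    q2: "qdata \<phi>2 n (pull1 1 (- f / e) 0 1 A1 B1) (pull2 1 (- f / e) 0 1 A1 B1) (adj 1 (- f / e) 0 1 v1)
      (adj 1 (- f / e) 0 1 (1, 0)) (adj 1 (- f / e) 0 1 q1) (adj 1 (- f / e) 0 1 r1)"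
    and m2: "mult_at \<phi>2 (adj 1 (- f / e) 0 1 (1, 0)) = mult_at \<phi>1 (1, 0)"
      "mult_at \<phi>2 (adj 1 (- f / e) 0 1 q1) = mult_at \<phi>1 q1" "mult_at \<phi>2 (adj 1 (- f / e) 0 1 r1) = mult_at \<phi>1 r1" .
  have p2: "adj 1 (- f / e) 0 1 (1, 0) = (1, 0)" by (simp add: adj_def)
  have B2: "pull2 1 (- f / e) 0 1 A1 B1 = (0, e, 0)"
    using ae by (simp add: pull2_def lin_quad_def comp_quad_def A1 B1 d)
  obtain a2 b2 c2 where A2: "pull1 1 (- f / e) 0 1 A1 B1 = (a2, b2, c2)" by (cases "pull1 1 (- f / e) 0 1 A1 B1")
  have "a2 = a" using A2 by (simp add: pull1_def lin_quad_def comp_quad_def A1 B1 d)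
  obtain v2 where v2: "adj 1 (- f / e) 0 1 v1 = v2" by blast
  obtain q2' where q2': "adj 1 (- f / e) 0 1 q1 = q2'" by blast
  obtain r2 where r2: "adj 1 (- f / e) 0 1 r1 = r2" by blast
  note q2 = q2[unfolded p2 B2 A2 v2 q2' r2] and m2 = m2[unfolded p2 q2' r2]
  have rp2: "rep \<phi>2 (a2, b2, c2) (0, e, 0)" using q2 by (simp add: qdata_def)
  have c2: "c2 \<noteq> 0" using rp2[unfolded rep_def, rule_format, of 0 1] by (simp add: quad_def)
  have "jac (a2, b2, c2) (0, e, 0) (fst v2) (snd v2) = 0" and vnz: "v2 \<noteq> (0, 0)" using q2 by (simp_all add: qdata_def)
  then have "2 * e * (a * (fst v2)\<^sup>2 - c2 * (snd v2)\<^sup>2) = 0"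
    by (simp add: jac_def \<open>a2 = a\<close> algebra_simps power2_eq_square)
  then have v: "a * (fst v2)\<^sup>2 = c2 * (snd v2)\<^sup>2" using ae by simp
  have v0: "fst v2 \<noteq> 0" "snd v2 \<noteq> 0"
    using v vnz ae c2 by (auto simp: pair_nonzero)
  \<comment> \<open>With the pole at 0 the critical points are the square roots of c2 / a; dividing
    by the periodic one moves it to 1.\<close>
  define k where "k = fst v2 / snd v2"
  have k: "k \<noteq> 0" "a * k\<^sup>2 = c2" using v0 v by (simp_all add: k_def power_divide field_simps)
  have "k * 1 - 0 * 0 \<noteq> (0::complex)" using k by simp
  from qdata_conj[OF q2 this] obtain \<phi>3 where
    q3: "qdata \<phi>3 n (pull1 k 0 0 1 (a2, b2, c2) (0, e, 0)) (pull2 k 0 0 1 (a2, b2, c2) (0, e, 0)) (adj k 0 0 1 v2)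
      (adj k 0 0 1 (1, 0)) (adj k 0 0 1 q2') (adj k 0 0 1 r2)"
    and m3: "mult_at \<phi>3 (adj k 0 0 1 (1, 0)) = mult_at \<phi>2 (1, 0)"
      "mult_at \<phi>3 (adj k 0 0 1 q2') = mult_at \<phi>2 q2'" "mult_at \<phi>3 (adj k 0 0 1 r2) = mult_at \<phi>2 r2" .
  have p3: "adj k 0 0 1 (1, 0) = (1, 0)" by (simp add: adj_def)
  have v3: "adj k 0 0 1 v2 = (fst v2, fst v2)" using v0 by (simp add: adj_def k_def)
  have A3: "pull1 k 0 0 1 (a2, b2, c2) (0, e, 0) = (c2, b2 * k, c2)"
    using k by (simp add: pull1_def lin_quad_def comp_quad_def \<open>a2 = a\<close>)
  have B3: "pull2 k 0 0 1 (a2, b2, c2) (0, e, 0) = (0, k\<^sup>2 * e, 0)"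
    by (simp add: pull2_def lin_quad_def comp_quad_def power2_eq_square)
  note q3 = q3[unfolded p3 v3 A3 B3] and m3 = m3[unfolded p3]
  define E where "E = k\<^sup>2 * e"
  have E: "E \<noteq> 0" using k ae by (simp add: E_def)
  have q: "quad (c2, b2 * k, c2) x y = E * quad (c2 / E, b2 * k / E, c2 / E) x y" "quad (0, E, 0) x y = E * quad (0, 1, 0) x y" for x y
    using E by (simp_all add: quad_def algebra_simps)
  show ?thesis
  proof (rule that[of "c2 / E" E \<phi>3 "b2 * k / E" "adj k 0 0 1 q2'" "adj k 0 0 1 r2"])
    show "c2 / E \<noteq> 0" "E \<noteq> 0" using E c2 by simp_all
    have "rep \<phi>3 (c2, b2 * k, c2) (0, E, 0)" using q3 by (simp add: qdata_def E_def)
    then show "rep \<phi>3 (c2 / E, b2 * k / E, c2 / E) (0, 1, 0)"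
      unfolding rep_def q using E pt_scale[OF E] by auto
    show "exact_period \<phi>3 n (pt 1 1)"
      using q3 pt_scale[OF v0(1), of 1 1] by (simp add: qdata_def)
    show "E * (x * (x * y) - y * (c2 / E * x\<^sup>2 + b2 * k / E * x * y + c2 / E * y\<^sup>2)) =
      - y * (x * snd (adj k 0 0 1 q2') - y * fst (adj k 0 0 1 q2')) * (x * snd (adj k 0 0 1 r2) - y * fst (adj k 0 0 1 r2))" for x y
    proof -
      have "x * quad (0, E, 0) x y - y * quad (c2, b2 * k, c2) x y =
        - y * (x * snd (adj k 0 0 1 q2') - y * fst (adj k 0 0 1 q2')) * (x * snd (adj k 0 0 1 r2) - y * fst (adj k 0 0 1 r2))"
        using q3 unfolding qdata_def E_def by simp
      then show ?thesis unfolding q by (simp add: quad_def algebra_simps)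
    qed
    show "adj k 0 0 1 q2' \<noteq> (0, 0)" "adj k 0 0 1 r2 \<noteq> (0, 0)" using q3 by (simp_all add: qdata_def)
  qed (use m1 m2 m3 in simp_all)
qed

subsection \<open>Moduli\<close>

text \<open>The computation uses the reciprocals u, w of the two other fixed points. They are always
  finite because 0 is a pole, whereas for t = 1 another fixed point coincides with infinity. They
  are the roots of t u^2 + \<beta> u + (t - 1), and the multipliers are t (1 - u^2) and t (1 -
  w^2).\<close>

lemma symmetric_multipliers:
  assumes \<phi>: "rep \<phi> (t, \<beta>, t) (0, 1, 0)" and t: "t \<noteq> 0" and e: "e \<noteq> 0"
    and cross: "\<And>x y. e * (x * (x * y) - y * (t * x\<^sup>2 + \<beta> * x * y + t * y\<^sup>2)) =
      (- y) * (x * snd q - y * fst q) * (x * snd r - y * fst r)"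
    and nz: "q \<noteq> (0, 0)" "r \<noteq> (0, 0)"
    and a: "a = mult_at \<phi> (1, 0)" and b: "b = mult_at \<phi> q" and c: "c = mult_at \<phi> r"
  shows "a + b + c = coord_x t \<beta> - 2" "a * b + b * c + c * a = coord_y t \<beta> - 2 * coord_x t \<beta> + 1"
proof -
  have c0: "fst q * fst r = e * t" using cross[of 0 1] by simp
  have c1: "e * (1 - (t + \<beta> + t)) = - ((snd q - fst q) * (snd r - fst r))" using cross[of 1 1] by (simp add: algebra_simps)
  have c2: "e * (- 1 - - (t - \<beta> + t)) = (snd q + fst q) * (snd r + fst r)" using cross[of 1 "- 1"] by simp
  have "2 * (snd q * snd r) = 2 * (e * (t - 1))" using c0 c1 c2 by algebra
  then have c3: "snd q * snd r = e * (t - 1)" by (subst (asm) mult_left_cancel) simp_all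
  have "2 * (snd q * fst r + fst q * snd r) = 2 * (- e * \<beta>)" using c0 c1 c2 by algebra
  then have c4: "snd q * fst r + fst q * snd r = - e * \<beta>" by (subst (asm) mult_left_cancel) simp_all
  have q0: "fst q \<noteq> 0" "fst r \<noteq> 0" using c0 e t by auto
  have val: "mult_at \<phi> z = t * (1 - (snd z / fst z)\<^sup>2)"
    if z: "fst z \<noteq> 0" and A: "e * (t * (fst z)\<^sup>2 + \<beta> * fst z * snd z + t * (snd z)\<^sup>2) = e * (fst z)\<^sup>2" for z
  proof -
    have "t * (fst z)\<^sup>2 + \<beta> * fst z * snd z + t * (snd z)\<^sup>2 = (fst z)\<^sup>2" using A e by (subst (asm) mult_left_cancel)
    then have "quad (t, \<beta>, t) (fst z) (snd z) = fst z * fst z" "quad (0, 1, 0) (fst z) (snd z) = fst z * snd z"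
      by (simp_all add: quad_def power2_eq_square)
    from multiplier(2)[OF \<phi> _ this] z
    have "mult_at \<phi> z = jac (t, \<beta>, t) (0, 1, 0) (fst z) (snd z) / (2 * (fst z)\<^sup>2)" by (simp add: mult_at_def)
    also have "jac (t, \<beta>, t) (0, 1, 0) (fst z) (snd z) = 2 * (t * ((fst z)\<^sup>2 - (snd z)\<^sup>2))"
      unfolding jac_def prod.case by algebra
    finally show ?thesis using z by (simp add: power_divide right_diff_distrib diff_divide_distrib)
  qed
  define u where "u = snd q / fst q"
  define w where "w = snd r / fst r"
  have u: "snd q = u * fst q" and w: "snd r = w * fst r" using q0 by (simp_all add: u_def w_def)
  have b: "b = t * (1 - u\<^sup>2)" unfolding b u_def
    by (rule val[OF q0(1)]) (use c0 c3 c4 in algebra)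
  have c: "c = t * (1 - w\<^sup>2)" unfolding c w_def
    by (rule val[OF q0(2)]) (use c0 c3 c4 in algebra)
  have "mult_at \<phi> (1, 0) = jac (t, \<beta>, t) (0, 1, 0) 1 0 / (2 * t\<^sup>2)"
    using multiplier(2)[OF \<phi>, of 1 0 t] by (simp add: mult_at_def quad_def)
  then have a: "t * a = 1" using t a by (simp add: jac_def power2_eq_square)
  have "e * (t * (u * w)) = e * (t - 1)" using c3[unfolded u w] c0 by algebra
  then have uw: "t * (u * w) = t - 1" using e by (subst (asm) mult_left_cancel)
  have "e * (t * (u + w)) = e * (- \<beta>)" using c4[unfolded u w] c0 by algebra
  then have us: "t * (u + w) = - \<beta>" using e by (subst (asm) mult_left_cancel)
  have x: "t * coord_x t \<beta> = 1 + 4 * t\<^sup>2 - \<beta>\<^sup>2" using t by (simp add: coord_x_def)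
  have y: "t\<^sup>2 * coord_y t \<beta> = - 4 * t * t\<^sup>2 + (4 * t\<^sup>2 - \<beta>\<^sup>2) * (1 + t)\<^sup>2"
    unfolding coord_y_def distrib_left using t by simp
  have bc: "t * (b + c) = 2 * t\<^sup>2 - \<beta>\<^sup>2 + 2 * t * (t - 1)"
  proof -
    have "t * (b + c) = 2 * t\<^sup>2 - (t * (u + w))\<^sup>2 + 2 * t * (t * (u * w))" unfolding b c by algebra
    then show ?thesis unfolding us uw by simp
  qed
  have bc': "t\<^sup>2 * (b * c) = t ^ 4 - t\<^sup>2 * (\<beta>\<^sup>2 - 2 * t * (t - 1)) + t\<^sup>2 * (t - 1)\<^sup>2"
  proof -
    have "t\<^sup>2 * (b * c) = t ^ 4 - t\<^sup>2 * ((t * (u + w))\<^sup>2 - 2 * t * (t * (u * w))) + t\<^sup>2 * (t * (u * w))\<^sup>2"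
      unfolding b c by algebra
    then show ?thesis unfolding us uw by simp
  qed
  have "t * (a + b + c) = t * a + t * (b + c)" by algebra
  also have "\<dots> = t * coord_x t \<beta> - 2 * t" unfolding a bc x by algebra
  also have "\<dots> = t * (coord_x t \<beta> - 2)" by algebra
  finally have "t * (a + b + c) = t * (coord_x t \<beta> - 2)" .
  then show "a + b + c = coord_x t \<beta> - 2" using t by (subst (asm) mult_left_cancel)
  have "t\<^sup>2 * (a * b + b * c + c * a) = (t * a) * (t * (b + c)) + t\<^sup>2 * (b * c)" by algebra
  also have "\<dots> = t\<^sup>2 * coord_y t \<beta> - 2 * t * (t * coord_x t \<beta>) + t\<^sup>2" unfolding a bc bc' x y by algebra
  also have "\<dots> = t\<^sup>2 * (coord_y t \<beta> - 2 * coord_x t \<beta> + 1)" by algebra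
  finally have "t\<^sup>2 * (a * b + b * c + c * a) = t\<^sup>2 * (coord_y t \<beta> - 2 * coord_x t \<beta> + 1)" .
  then show "a * b + b * c + c * a = coord_y t \<beta> - 2 * coord_x t \<beta> + 1"
    using t by (subst (asm) mult_left_cancel) simp_all
qed

lemma rep_orbit:
  assumes \<phi>: "rep \<phi> (t, \<beta>, t) (0, 1, 0)"
  shows "\<not> (fst (orbit t \<beta> k) = 0 \<and> snd (orbit t \<beta> k) = 0) \<and>
    (\<phi> ^^ k) (pt 1 1) = pt (fst (orbit t \<beta> k)) (snd (orbit t \<beta> k))"
proof (induction k)
  case (Suc k)
  obtain U V where UV: "orbit t \<beta> k = (U, V)" by (cases "orbit t \<beta> k")
  have "quad (t, \<beta>, t) U V = t * U\<^sup>2 + \<beta> * U * V + t * V\<^sup>2" "quad (0, 1, 0) U V = U * V" by (simp_all add: quad_def)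
  then show ?case using Suc \<phi>[unfolded rep_def, rule_format, of U V] by (simp add: UV)
qed simp

lemma exact_period_iff_marked:
  assumes \<phi>: "rep \<phi> (t, \<beta>, t) (0, 1, 0)" and t: "t \<noteq> 0" and n: "n > 0"
  shows "exact_period \<phi> n (pt 1 1) \<longleftrightarrow> (t, \<beta>) \<in> marked_per n"
proof -
  have "(\<phi> ^^ k) (pt 1 1) = pt 1 1 \<longleftrightarrow> orbit_diff k t \<beta> = 0" for k
  proof -
    have o: "\<not> (fst (orbit t \<beta> k) = 0 \<and> snd (orbit t \<beta> k) = 0)"
      "(\<phi> ^^ k) (pt 1 1) = pt (fst (orbit t \<beta> k)) (snd (orbit t \<beta> k))" using rep_orbit[OF \<phi>] by blast+
    show ?thesis unfolding o(2) orbit_diff_def by (subst pt_eq_iff[OF o(1)]) auto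
  qed
  then show ?thesis using t n unfolding exact_period_def marked_per_def by auto
qed

lemma moebius_surj:
  assumes \<mu>: "moebius \<mu> k l m n" and Q: "Q \<in> proj_space 1"
  obtains P where "P \<in> proj_space 1" "\<mu> P = Q"
proof -
  have det: "k * n - l * m \<noteq> 0" using \<mu> by (simp add: moebius_def)
  obtain x y where xy: "Q = pt x y" "\<not> (x = 0 \<and> y = 0)" using Q by (rule pt_cases)
  have nz: "\<not> (n * x - l * y = 0 \<and> - m * x + k * y = 0)"
    using moebius_nonzero[of n k "- l" "- m" x y] det xy(2) by (simp add: mult.commute)
  have "\<mu> (pt (n * x - l * y) (- m * x + k * y)) = pt ((k * n - l * m) * x) ((k * n - l * m) * y)"
    using \<mu> nz unfolding moebius_def by (simp add: algebra_simps)
  then have "\<mu> (pt (n * x - l * y) (- m * x + k * y)) = Q" unfolding xy(1) pt_scale[OF det] .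
  moreover have "pt (n * x - l * y) (- m * x + k * y) \<in> proj_space 1" unfolding pt_in_space by (rule nz)
  ultimately show ?thesis using that by blast
qed

lemma rational_maps_2_rep:
  assumes "\<phi> \<in> rational_maps 2" obtains A B where "rep \<phi> A B"
  using assms represents_rep unfolding rational_maps_def by blast

text \<open>In \<open>Per0_variety\<close> the member of the class with a periodic critical point
  and the member whose multipliers give the coordinates may be different; this transfers the
  critical cycle.\<close>

lemma conjugacy_periodic_critical:
  assumes "(\<phi>, \<psi>) \<in> conjugacy"
  shows "(\<exists>P. critical_point \<phi> P \<and> exact_period \<phi> n P) \<longleftrightarrow> (\<exists>P. critical_point \<psi> P \<and> exact_period \<psi> n P)"
proof -
  obtain \<mu> where \<mu>1: "\<mu> \<in> rational_maps 1" and conj: "\<And>P. P \<in> proj_space 1 \<Longrightarrow> \<psi> (\<mu> P) = \<mu> (\<phi> P)"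
    and "\<phi> \<in> rational_maps 2" "\<psi> \<in> rational_maps 2"
    using assms unfolding conjugacy_def by blast
  then obtain A B A' B' where rep: "rep \<phi> A B" "rep \<psi> A' B'" by (metis rational_maps_2_rep)
  obtain k l m m' where \<mu>: "moebius \<mu> k l m m'" using \<mu>1 by (rule rational_map_1_moebius)
  have "critical_point \<psi> (\<mu> P) \<longleftrightarrow> critical_point \<phi> P" "exact_period \<psi> n (\<mu> P) \<longleftrightarrow> exact_period \<phi> n P"
    if P: "P \<in> proj_space 1" for P
  proof -
    show "critical_point \<psi> (\<mu> P) \<longleftrightarrow> critical_point \<phi> P"
      by (rule critical_conj[OF \<mu> rep(2) rep_space[OF rep(1)] conj P])
    show "exact_period \<psi> n (\<mu> P) \<longleftrightarrow> exact_period \<phi> n P"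
      by (rule exact_period_conj[where \<phi> = \<phi> and \<psi> = \<psi> and \<mu> = \<mu> and S = "proj_space 1", OF rep_space[OF rep(1)] conj moebius_inj[OF \<mu>] P])
  qed
  moreover have "\<exists>P\<in>proj_space 1. \<mu> P = Q" if "Q \<in> proj_space 1" for Q
    using moebius_surj[OF \<mu> that] by blast
  moreover have "P \<in> proj_space 1" if "critical_point f P" for f P using that by (simp add: critical_point_def)
  ultimately show ?thesis by metis
qed

lemma point_member:
  assumes "P \<in> proj_space 1" "p \<in> P"
  shows "P = pt (p 0) (p 1)" "(p 0, p 1) \<noteq> (0, 0)"
proof -
  obtain x y where xy: "P = pt x y" "\<not> (x = 0 \<and> y = 0)" using assms(1) by (rule pt_cases)
  have "p \<in> proj_pt (vec_of [x, y])" using assms(2) unfolding xy(1) pt_def .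
  then obtain c where c: "c \<noteq> 0" "p = vec_of [c * x, c * y]"
    unfolding proj_pt_scale vec2_scale by blast
  show "P = pt (p 0) (p 1)" unfolding c(2) vec2_coords pt_scale[OF c(1)] by (rule xy(1))
  show "(p 0, p 1) \<noteq> (0, 0)" using xy(2) c(1) unfolding c(2) vec2_coords by simp
qed

text \<open>The normal form wants a noncritical fixed point in the first place, and the symmetric
  functions do not notice the reordering.\<close>

lemma qdata_coords:
  assumes q0: "qdata \<phi> n A B v p q r"
    and a: "a = mult_at \<phi> p" and b: "b = mult_at \<phi> q" and c: "c = mult_at \<phi> r"
  shows "\<exists>(t, \<beta>)\<in>marked_per n. a + b + c = coord_x t \<beta> - 2 \<and> a * b + b * c + c * a = coord_y t \<beta> - 2 * coord_x t \<beta> + 1"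
proof -
  have *: "\<exists>(t, \<beta>)\<in>marked_per n. mult_at \<phi> p + mult_at \<phi> q + mult_at \<phi> r = coord_x t \<beta> - 2 \<and>
      mult_at \<phi> p * mult_at \<phi> q + mult_at \<phi> q * mult_at \<phi> r + mult_at \<phi> r * mult_at \<phi> p = coord_y t \<beta> - 2 * coord_x t \<beta> + 1"
    if qd: "qdata \<phi> n A B v p q r" and nz: "mult_at \<phi> p \<noteq> 0" for p q r
    using qd nz
  proof (rule normal_form)
    fix \<phi>' t \<beta> e q' r'
    assume t: "t \<noteq> 0" and e: "e \<noteq> 0" and \<phi>': "rep \<phi>' (t, \<beta>, t) (0, 1, 0)" and per: "exact_period \<phi>' n (pt 1 1)"
      and cross: "\<And>x y. e * (x * (x * y) - y * (t * x\<^sup>2 + \<beta> * x * y + t * y\<^sup>2)) = (- y) * (x * snd q' - y * fst q') * (x * snd r' - y * fst r')"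
      and nz: "q' \<noteq> (0, 0)" "r' \<noteq> (0, 0)"
      and m: "mult_at \<phi>' (1, 0) = mult_at \<phi> p" "mult_at \<phi>' q' = mult_at \<phi> q" "mult_at \<phi>' r' = mult_at \<phi> r"
    have "n > 0" using per by (simp add: exact_period_def)
    then have "(t, \<beta>) \<in> marked_per n" using per exact_period_iff_marked[OF \<phi>' t] by blast
    then show ?thesis using symmetric_multipliers[OF \<phi>' t e cross nz m[symmetric]] by blast
  qed
  consider "a \<noteq> 0" | "b \<noteq> 0" | "c \<noteq> 0" using some_noncritical_fixed_point[OF q0] unfolding a b c by blast
  then show ?thesis
  proof cases
    case 1
    then show ?thesis using *[OF q0] unfolding a b c by blast
  next
    case 2
    then show ?thesis using *[OF qdata_swap(1)[OF q0]] unfolding a b c by (simp add: ac_simps)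
  next
    case 3
    then show ?thesis using *[OF qdata_swap(2)[OF q0]] unfolding a b c by (simp add: ac_simps)
  qed
qed

lemma plane_pt_coords: "plane_pt (x, y) = proj_pt (vec_of [1, x - 2, y - 2 * x + 1])"
  by (simp add: plane_pt_def plane_vec_def)

lemma Per0_variety_subset: "Per0_variety n \<subseteq> plane_pt ` plane_per n"
proof
  fix s assume "s \<in> Per0_variety n"
  then obtain C \<phi>1 P where C: "C \<in> M2" "M2_coords C s" and \<phi>1: "\<phi>1 \<in> C" "critical_point \<phi>1 P" "exact_period \<phi>1 n P"
    unfolding Per0_variety_def Per0_def by blast
  obtain \<phi>0 where "C = conjugacy `` {\<phi>0}" using C(1) unfolding M2_def by (rule quotientE)
  obtain \<phi> P1 P2 P3 where \<phi>: "\<phi> \<in> C" and fp: "fixed_points \<phi> P1 P2 P3"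
    and s: "s = (let a = local_deriv \<phi> P1; b = local_deriv \<phi> P2; c = local_deriv \<phi> P3
      in proj_pt (vec_of [1, a + b + c, a * b + b * c + c * a]))"
    using C(2) unfolding M2_coords_def Let_def by blast
  have "(\<phi>0, \<phi>1) \<in> conjugacy" "(\<phi>0, \<phi>) \<in> conjugacy"
    using \<phi>1(1) \<phi> \<open>C = conjugacy `` {\<phi>0}\<close> by blast+
  then obtain V where V: "critical_point \<phi> V" "exact_period \<phi> n V"
    using conjugacy_periodic_critical \<phi>1(2,3) by meson
  then have "V \<in> proj_space 1" by (simp add: critical_point_def)
  then obtain x0 y0 where v: "V = pt x0 y0" "\<not> (x0 = 0 \<and> y0 = 0)" by (rule pt_cases)
  obtain F p q r where F: "represents F 2 \<phi>" and pqr: "p \<in> P1" "q \<in> P2" "r \<in> P3"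
    and sp: "P1 \<in> proj_space 1" "P2 \<in> proj_space 1" "P3 \<in> proj_space 1"
    and cross: "\<And>x y. x * forms_eval F (vec_of [x, y]) 1 - y * forms_eval F (vec_of [x, y]) 0 =
        (x * p 1 - y * p 0) * (x * q 1 - y * q 0) * (x * r 1 - y * r 0)"
    using fp unfolding fixed_points_def by blast
  obtain A B where rp: "rep \<phi> A B" and ev: "\<And>v. forms_eval F v = vec_of [quad A (v 0) (v 1), quad B (v 0) (v 1)]"
    using F by (rule represents_rep) blast
  have qd: "qdata \<phi> n A B (x0, y0) (p 0, p 1) (q 0, q 1) (r 0, r 1)"
    unfolding qdata_def fst_conv snd_conv
  proof (intro conjI allI)
    show "x * quad B x y - y * quad A x y = (x * p 1 - y * p 0) * (x * q 1 - y * q 0) * (x * r 1 - y * r 0)" for x y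
      using cross[of x y] unfolding ev vec2_coords .
    show "jac A B x0 y0 = 0"
      using V(1) local_deriv_eq_0_iff[OF rp v(2)] unfolding critical_point_def v(1) by blast
  qed (use rp v V(2) point_member(2) sp pqr in auto)
  obtain t \<beta> where tb: "(t, \<beta>) \<in> marked_per n"
    and sums: "local_deriv \<phi> P1 + local_deriv \<phi> P2 + local_deriv \<phi> P3 = coord_x t \<beta> - 2"
      "local_deriv \<phi> P1 * local_deriv \<phi> P2 + local_deriv \<phi> P2 * local_deriv \<phi> P3 + local_deriv \<phi> P3 * local_deriv \<phi> P1 =
        coord_y t \<beta> - 2 * coord_x t \<beta> + 1"
    using qdata_coords[OF qd, of "local_deriv \<phi> P1" "local_deriv \<phi> P2" "local_deriv \<phi> P3"]
      point_member(1)[OF sp(1) pqr(1)] point_member(1)[OF sp(2) pqr(2)] point_member(1)[OF sp(3) pqr(3)]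
    unfolding mult_at_def by auto
  have "s = plane_pt (coord_x t \<beta>, coord_y t \<beta>)" unfolding s Let_def sums plane_pt_coords ..
  then show "s \<in> plane_pt ` plane_per n" using tb unfolding plane_per_def by force
qed

section \<open>Realisation of every marked parameter by a rational map\<close>

lemma exists_rational_map:
  assumes nz: "\<And>x y. \<not> (x = 0 \<and> y = 0) \<Longrightarrow> \<not> (quad A x y = 0 \<and> quad B x y = 0)"
  obtains \<phi> where "\<phi> \<in> rational_maps 2" "rep \<phi> A B"
proof -
  define \<phi> where "\<phi> = restrict (\<lambda>P. let v = SOME v. v \<in> P in pt (quad A (v 0) (v 1)) (quad B (v 0) (v 1))) (proj_space 1)"
  have rp: "rep \<phi> A B"
    unfolding rep_def
  proof (intro allI impI conjI)
    fix x y :: complex assume xy: "\<not> (x = 0 \<and> y = 0)"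
    show "\<not> (quad A x y = 0 \<and> quad B x y = 0)" by (rule nz[OF xy])
    define v where "v = (SOME v. v \<in> pt x y)"
    have "v \<in> pt x y" unfolding v_def by (rule someI[of _ "vec_of [x, y]"]) (simp add: pt_def self_in_proj_pt)
    then obtain c where c: "c \<noteq> 0" "v = vec_of [c * x, c * y]"
      unfolding pt_def proj_pt_scale vec2_scale by blast
    have "\<phi> (pt x y) = pt (quad A (v 0) (v 1)) (quad B (v 0) (v 1))"
      using pt_in_space[of x y] xy unfolding \<phi>_def restrict_def Let_def v_def[symmetric] by argo
    also have "\<dots> = pt (c\<^sup>2 * quad A x y) (c\<^sup>2 * quad B x y)" unfolding c(2) vec2_coords quad_scale ..
    also have "\<dots> = pt (quad A x y) (quad B x y)" using c(1) by (intro pt_scale) simp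
    finally show "\<phi> (pt x y) = pt (quad A x y) (quad B x y)" .
  qed
  obtain F where "represents F 2 \<phi>" using rp by (rule rep_represents)
  moreover have "\<phi> \<in> extensional (proj_space 1)" unfolding \<phi>_def by simp
  ultimately have "\<phi> \<in> rational_maps 2" unfolding rational_maps_def by blast
  then show ?thesis using rp by (rule that)
qed

lemma conjugacy_refl:
  assumes "\<phi> \<in> rational_maps 2" shows "(\<phi>, \<phi>) \<in> conjugacy"
proof -
  let ?X = "\<lambda>i. Poly_Mapping.single (Poly_Mapping.single i (1::nat)) (1::complex)"
  let ?\<mu> = "restrict (\<lambda>P. P) (proj_space 1)"
  have X: "?X i \<in> forms UNIV 1 1" if "i \<le> 1" for i using that by (auto simp: forms_def)
  have ev: "form_eval (?X i) v = v i" for i v by (simp add: form_eval_single monom_eval_def)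
  have "represents [?X 0, ?X 1] 1 ?\<mu>"
    unfolding represents_def
  proof (intro conjI ballI)
    fix v assume v: "v \<in> vec_space 1 - {0}"
    then have "forms_eval [?X 0, ?X 1] v = v"
      using vec2_eta[of v] unfolding forms_eval_def list.map ev by simp
    moreover have "proj_pt v \<in> proj_space 1" using v unfolding proj_pt_in_space .
    ultimately show "forms_eval [?X 0, ?X 1] v \<noteq> 0" "?\<mu> (proj_pt v) = proj_pt (forms_eval [?X 0, ?X 1] v)"
      using v by (simp_all add: restrict_def)
  qed (use X[of 0] X[of 1] in auto)
  then have \<mu>: "?\<mu> \<in> rational_maps 1" unfolding rational_maps_def by blast
  obtain A B where "rep \<phi> A B" using assms by (rule rational_maps_2_rep)
  then have "\<phi> (?\<mu> P) = ?\<mu> (\<phi> P)" if "P \<in> proj_space 1" for P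
    using rep_space[OF _ that] that unfolding restrict_def by metis
  then show ?thesis using assms \<mu> unfolding conjugacy_def by blast
qed

lemma Per0_variety_supset:
  assumes n: "n > 0" shows "plane_pt ` plane_per n \<subseteq> Per0_variety n"
proof
  fix s assume "s \<in> plane_pt ` plane_per n"
  then obtain t \<beta> where tb: "(t, \<beta>) \<in> marked_per n" and s: "s = plane_pt (coord_x t \<beta>, coord_y t \<beta>)"
    unfolding plane_per_def by auto
  have t: "t \<noteq> 0" using tb by (simp add: marked_per_def)
  obtain \<phi> where \<phi>: "\<phi> \<in> rational_maps 2" and rp: "rep \<phi> (t, \<beta>, t) (0, 1, 0)"
    by (rule exists_rational_map[of "(t, \<beta>, t)" "(0, 1, 0)"]) (use t in \<open>auto simp: quad_def\<close>)
  let ?C = "conjugacy `` {\<phi>}"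
  have C: "\<phi> \<in> ?C" using conjugacy_refl[OF \<phi>] by blast
  have "?C \<in> M2" unfolding M2_def using \<phi> by (rule quotientI)
  moreover have "critical_point \<phi> (pt 1 1)"
    unfolding critical_point_def using local_deriv_eq_0_iff[OF rp, of 1 1] pt_in_space[of 1 1] by (simp add: jac_def)
  moreover have "exact_period \<phi> n (pt 1 1)" using tb exact_period_iff_marked[OF rp t n] by blast
  ultimately have Per: "?C \<in> Per0 n" unfolding Per0_def using C by blast
  obtain u where u: "t * u\<^sup>2 + \<beta> * u + (t - 1) = 0" using quadratic_root[OF t] by blast
  \<comment> \<open>The reciprocals of the other two fixed points are u and w / t; representing the
    second by (t, w) makes the constant in front of the fixed point form equal to 1.\<close>
  define w where "w = - \<beta> - t * u"
  have cross: "1 * (x * (x * y) - y * (t * x\<^sup>2 + \<beta> * x * y + t * y\<^sup>2)) =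
      (- y) * (x * snd (1, u) - y * fst (1, u)) * (x * snd (t, w) - y * fst (t, w))" for x y
    using u unfolding fst_conv snd_conv w_def by algebra
  have nz: "(1 :: complex, u) \<noteq> (0, 0)" "(t, w) \<noteq> (0, 0)" using t by simp_all
  obtain F where F: "represents F 2 \<phi>"
    and ev: "\<And>v. forms_eval F v = vec_of [quad (t, \<beta>, t) (v 0) (v 1), quad (0, 1, 0) (v 0) (v 1)]"
    using rp by (rule rep_represents) blast
  have "fixed_points \<phi> (pt 1 0) (pt 1 u) (pt t w)"
    unfolding fixed_points_def
  proof (intro exI bexI conjI allI)
    show "represents F 2 \<phi>" by (rule F)
    show "pt 1 0 \<in> proj_space 1" "pt 1 u \<in> proj_space 1" "pt t w \<in> proj_space 1"
      unfolding pt_in_space using t by simp_all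
    show "vec_of [1, 0] \<in> pt 1 0" "vec_of [1, u] \<in> pt 1 u" "vec_of [t, w] \<in> pt t w"
      unfolding pt_def by (rule self_in_proj_pt)+
    show "x * forms_eval F (vec_of [x, y]) 1 - y * forms_eval F (vec_of [x, y]) 0 =
      (x * vec_of [1, 0] 1 - y * vec_of [1, 0] 0) * (x * vec_of [1, u] 1 - y * vec_of [1, u] 0) *
      (x * vec_of [t, w] 1 - y * vec_of [t, w] 0)" for x y
      using cross[of x y] unfolding ev vec2_coords quad_def by simp
  qed
  moreover have "s = proj_pt (vec_of [1, mult_at \<phi> (1, 0) + mult_at \<phi> (1, u) + mult_at \<phi> (t, w),
      mult_at \<phi> (1, 0) * mult_at \<phi> (1, u) + mult_at \<phi> (1, u) * mult_at \<phi> (t, w) + mult_at \<phi> (t, w) * mult_at \<phi> (1, 0)])"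
    unfolding symmetric_multipliers[OF rp t one_neq_zero cross nz refl refl refl] s plane_pt_coords ..
  ultimately have "M2_coords ?C s"
    unfolding M2_coords_def Let_def mult_at_def fst_conv snd_conv using C by blast
  then show "s \<in> Per0_variety n" using Per unfolding Per0_variety_def by blast
qed

lemma Per0_variety_eq: "n > 0 \<Longrightarrow> Per0_variety n = plane_pt ` plane_per n"
  using Per0_variety_subset Per0_variety_supset by blast

theorem theorem1p3:
  fixes n :: nat
  assumes "n \<ge> 4"
  shows "\<exists>N X \<iota>. projective_completion 2 (Per0_variety n) N X \<iota> \<and>
    (\<exists>f. smooth_point N X f \<and> rational_point f)"
proof -
  have "n \<ge> 3" "n > 0" using assms by simp_all
  obtain \<iota> where "projective_completion 2 (plane_pt ` plane_per n) 4 (emb_closure n (plane_per n)) \<iota>"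
    using \<open>n \<ge> 3\<close> by (rule completion_plane_per)
  then have "projective_completion 2 (Per0_variety n) 4 (emb_closure n (plane_per n)) \<iota>"
    unfolding Per0_variety_eq[OF \<open>n > 0\<close>] .
  then show ?thesis using smooth_star[OF assms] rational_star by blast
qed

end
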